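(* Let $p,p'\geq 2$ be integers and let $q,q'>1$ be real numbers. The following are equivalent. (A1) Either $\log(p)/\log(q)<\log(p')/\log(q')$; or $\log(p)/\log(q)=\log(p')/\log(q')$ and $p,p'$ are powers of a common integer. (A2) The integer sequence $\mathcal{X}(p,q,p',q')$ is bounded. (A3) There exists a rough isometric embedding $R(p,q)\to R(p',q')$ between the regular rooted trees. (A4) There exists a bilipschitz embedding $\mathbb{Z}(p,q)\to\mathbb{Z}(p',q')$ between the symbolic Cantor sets. (A5) There exists a quasiisometric embedding $HT(p,q)\to HT(p',q')$ between the treebolic spaces.
   Context: Maps. Let $X,Y$ be metric spaces, $K\ge 1$, $C\ge 0$. A $(K,C)$-quasiisometric embedding is a map $f:X\to Y$ (not necessarily continuous) with $\frac1K d(x,x')-C\le d(f(x),f(x'))\le K d(x,x')+C$ for all $x,x'\in X$. A quasiisometric embedding is a $(K,C)$-quasiisometric embedding for some $K\geq 1,C\geq 0$; a bilipschitz embedding is a $(K,0)$-quasiisometric embedding for some $K\ge 1$; a rough isometric embedding is a $(1,C)$-quasiisometric embedding for some $C\ge 0$. Powers of a common integer. $p,p'$ are powers of a common integer if there are positive integers $r,s,t$ with $p=r^s$ and $p'=r^t$. Regular rooted trees. $R(p,q)$ is the rooted metric tree with all edges of length $\log(q)$ and with valency $p+1$ at every vertex except the basepoint (root), which has valency $p$. Symbolic Cantor sets. $\mathbb{Z}(p,q)=\{0,1,\dots,p-1\}^{\mathbb{N}}$ (sequences indexed by $n\ge 1$), with the metric $\rho((a_n),(b_n))=q^{-N}$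 for distinct sequences, where $a_n=b_n$ for $n\le N$ and $a_{N+1}\ne b_{N+1}$. Treebolic spaces. $T(p,q)$ is the metric tree with all edges of length $\log(q)$ and valency $p+1$ at every vertex. Fix a geodesic ray $\gamma:[0,\infty)\to T(p,q)$ based at a vertex $b$ and define the height function $h(x)=d(b,x)-2\,\mathrm{length}(\gamma_x\cap\gamma)$ on $T(p,q)$, where $\gamma_x$ is the geodesic segment from $b$ to $x$. On the upper half plane $\mathbb{H}^2=\{(x,y):x\in\mathbb{R},y>0\}$ with metric $ds^2=(dx^2+dy^2)/y^2$ put the height function $h(x,y)=\log(y)$. As a set, $HT(p,q)=T(p,q)\times\mathbb{R}$. For each edge $e=[v,w]$ of $T(p,q)$ with $h(v)<h(w)$, metrize $e\times\mathbb{R}$ by identifying it, in a height-preserving manner (the point $(t,x)\in e\times \mathbb{R}$ corresponds to $(x,e^{h(t)})$), with the horostrip $\{(x,y)\in\mathbb{H}^2: h(x,y)\in[h(v),h(w)]\}$; then $HT(p,q)$ carries the resulting shortest path metric. The sequence $\mathcal{X}(p,q,p',q')$. Let $\mathcal{H}_1=\{a\log(q):a\in\mathbb{Z}_{\ge0}\}$, $\mathcal{H}_2=\{b\log(q'):b\in\mathbb{Z}_{\ge0}\}$, and enumerate $\mathcal{H}_1\cup\mathcal{H}_2=\{h_0<h_1<h_2<\cdots\}$. Set $\mathcal{X}_0=1$ and, for $n\ge0$, $\mathcal{X}_{n+1}=p\,\mathcal{X}_n$ if $h_n\in\mathcal{H}_1\setminus\mathcal{H}_2$; $\mathcal{X}_{n+1}=\lceil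 \mathcal{X}_n/p'\rceil$ if $h_n\in\mathcal{H}_2\setminus\mathcal{H}_1$; $\mathcal{X}_{n+1}=\lceil p\,\mathcal{X}_n/p'\rceil$ if $h_n\in\mathcal{H}_1\cap\mathcal{H}_2$. *)

theory Defs
  imports "HOL-Analysis.Analysis" "HOL-Library.Sublist"
begin

section \<open>Classes of maps\<close>

definition qi_embedding ::
  "real \<Rightarrow> real \<Rightarrow> 'a set \<Rightarrow> ('a \<Rightarrow> 'a \<Rightarrow> real) \<Rightarrow> 'b set \<Rightarrow> ('b \<Rightarrow> 'b \<Rightarrow> real) \<Rightarrow> ('a \<Rightarrow> 'b) \<Rightarrow> bool"
  where "qi_embedding K C X dX Y dY f \<longleftrightarrow>
    f ` X \<subseteq> Y \<and>
    (\<forall>x\<in>X. \<forall>x'\<in>X. 1 / K * dX x x' - C \<le> dY (f x) (f x') \<and> dY (f x) (f x') \<le> K * dX x x' + C)"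

definition quasiisometric_embedding ::
  "'a set \<Rightarrow> ('a \<Rightarrow> 'a \<Rightarrow> real) \<Rightarrow> 'b set \<Rightarrow> ('b \<Rightarrow> 'b \<Rightarrow> real) \<Rightarrow> ('a \<Rightarrow> 'b) \<Rightarrow> bool"
  where "quasiisometric_embedding X dX Y dY f \<longleftrightarrow>
    (\<exists>K\<ge>1. \<exists>C\<ge>0. qi_embedding K C X dX Y dY f)"

definition bilipschitz_embedding ::
  "'a set \<Rightarrow> ('a \<Rightarrow> 'a \<Rightarrow> real) \<Rightarrow> 'b set \<Rightarrow> ('b \<Rightarrow> 'b \<Rightarrow> real) \<Rightarrow> ('a \<Rightarrow> 'b) \<Rightarrow> bool"
  where "bilipschitz_embedding X dX Y dY f \<longleftrightarrow> (\<exists>K\<ge>1. qi_embedding K 0 X dX Y dY f)"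

definition rough_isometric_embedding ::
  "'a set \<Rightarrow> ('a \<Rightarrow> 'a \<Rightarrow> real) \<Rightarrow> 'b set \<Rightarrow> ('b \<Rightarrow> 'b \<Rightarrow> real) \<Rightarrow> ('a \<Rightarrow> 'b) \<Rightarrow> bool"
  where "rough_isometric_embedding X dX Y dY f \<longleftrightarrow> (\<exists>C\<ge>0. qi_embedding 1 C X dX Y dY f)"

section \<open>Powers of a common integer\<close>

definition powers_of_common_integer :: "nat \<Rightarrow> nat \<Rightarrow> bool"
  where "powers_of_common_integer p p' \<longleftrightarrow>
    (\<exists>r s t. r > 0 \<and> s > 0 \<and> t > 0 \<and> p = r ^ s \<and> p' = r ^ t)"

section \<open>Metric trees\<close>

text \<open>
  The vertices of a tree are the words of a prefix-closed set \<open>W\<close>, with an edge of length \<open>l\<close>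
  between each nonempty word and the word obtained by deleting its last letter.  The pair
  \<open>(w, s)\<close> is the point at distance \<open>s\<close> from the vertex \<open>w\<close> on the edge from \<open>w\<close> towards the
  empty word.  Taking \<open>0 \<le> s < l\<close>, and \<open>s = 0\<close> for the empty word, gives every point of the
  metric tree (vertices and interior points of edges) exactly once.
\<close>

type_synonym point = "nat list \<times> real"

definition tree_points :: "real \<Rightarrow> nat list set \<Rightarrow> point set"
  where "tree_points l W = {(w, s). w \<in> W \<and> 0 \<le> s \<and> s < l \<and> (w = [] \<longrightarrow> s = 0)}"

definition tree_vertices :: "nat list set \<Rightarrow> point set"
  where "tree_vertices W = {(w, 0) | w. w \<in> W}"

definition depth :: "real \<Rightarrow> point \<Rightarrow> real"
  where "depth l x = real (length (fst x)) * l - snd x"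

text \<open>
  The geodesics from \<open>([], 0)\<close> to \<open>x\<close> and to \<open>y\<close> separate at depth \<open>branch_depth l x y\<close>; it is
  smaller than \<open>l\<close> times the length of the common prefix only when one of the two points lies on
  the geodesic from \<open>([], 0)\<close> to the other.
\<close>

definition branch_depth :: "real \<Rightarrow> point \<Rightarrow> point \<Rightarrow> real"
  where "branch_depth l x y = min (min (depth l x) (depth l y))
    (real (length (longest_common_prefix (fst x) (fst y))) * l)"

definition tree_dist :: "real \<Rightarrow> point \<Rightarrow> point \<Rightarrow> real"
  where "tree_dist l x y = depth l x + depth l y - 2 * branch_depth l x y"

subsection \<open>The rooted tree \<open>R(p,q)\<close>\<close>

definition R_words :: "nat \<Rightarrow> nat list set"
  where "R_words p = {w. set w \<subseteq> {..<p}}"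

definition R_tree :: "nat \<Rightarrow> real \<Rightarrow> point set"
  where "R_tree p q = tree_points (ln q) (R_words p)"

definition R_dist :: "nat \<Rightarrow> real \<Rightarrow> point \<Rightarrow> point \<Rightarrow> real"
  where "R_dist p q = tree_dist (ln q)"

subsection \<open>The regular tree \<open>T(p,q)\<close>\<close>

text \<open>The first letter has \<open>p + 1\<close> possible values, so that the empty word has valency \<open>p + 1\<close> too.\<close>

definition T_words :: "nat \<Rightarrow> nat list set"
  where "T_words p = {w. (w \<noteq> [] \<longrightarrow> hd w < p + 1) \<and> set (tl w) \<subseteq> {..<p}}"

definition T_tree :: "nat \<Rightarrow> real \<Rightarrow> point set"
  where "T_tree p q = tree_points (ln q) (T_words p)"

definition T_vertices :: "nat \<Rightarrow> real \<Rightarrow> point set"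
  where "T_vertices p q = tree_vertices (T_words p)"

definition T_dist :: "nat \<Rightarrow> real \<Rightarrow> point \<Rightarrow> point \<Rightarrow> real"
  where "T_dist p q = tree_dist (ln q)"

text \<open>In a tree, the geodesic segment is the set of points metrically between its endpoints.\<close>

definition T_segment :: "nat \<Rightarrow> real \<Rightarrow> point \<Rightarrow> point \<Rightarrow> point set"
  where "T_segment p q x y = {z \<in> T_tree p q. T_dist p q x z + T_dist p q z y = T_dist p q x y}"

text \<open>Only the values of \<open>\<gamma>\<close> on \<open>[0,\<infinity>)\<close> matter, here and below; the base vertex is \<open>\<gamma> 0\<close>.\<close>

definition geodesic_ray :: "nat \<Rightarrow> real \<Rightarrow> (real \<Rightarrow> point) \<Rightarrow> bool"
  where "geodesic_ray p q \<gamma> \<longleftrightarrow>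
    \<gamma> 0 \<in> T_vertices p q \<and> \<gamma> ` {0..} \<subseteq> T_tree p q \<and>
    (\<forall>s\<ge>0. \<forall>t\<ge>0. T_dist p q (\<gamma> s) (\<gamma> t) = \<bar>s - t\<bar>)"

text \<open>
  As \<open>\<gamma>\<close> has unit speed, the length of \<open>\<gamma>\<^sub>x \<inter> \<gamma>\<close> is the Lebesgue measure of the set of times at
  which \<open>\<gamma>\<close> lies on the segment \<open>\<gamma>\<^sub>x\<close> from the base vertex to \<open>x\<close>.
\<close>

definition height :: "nat \<Rightarrow> real \<Rightarrow> (real \<Rightarrow> point) \<Rightarrow> point \<Rightarrow> real"
  where "height p q \<gamma> x =
    T_dist p q (\<gamma> 0) x - 2 * measure lborel {t. 0 \<le> t \<and> \<gamma> t \<in> T_segment p q (\<gamma> 0) x}"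

section \<open>Symbolic Cantor sets\<close>

text \<open>
  Sequences are indexed from \<open>0\<close>, so the first index at which two of them differ is the number
  of initial terms on which they agree.
\<close>

definition cantor_set :: "nat \<Rightarrow> (nat \<Rightarrow> nat) set"
  where "cantor_set p = {a. \<forall>n. a n < p}"

definition cantor_dist :: "real \<Rightarrow> (nat \<Rightarrow> nat) \<Rightarrow> (nat \<Rightarrow> nat) \<Rightarrow> real"
  where "cantor_dist q a b = (if a = b then 0 else 1 / q ^ (LEAST n. a n \<noteq> b n))"

section \<open>Treebolic spaces\<close>

definition HT_space :: "nat \<Rightarrow> real \<Rightarrow> (point \<times> real) set"
  where "HT_space p q = T_tree p q \<times> UNIV"

text \<open>The upper half plane is the set of complex numbers with positive imaginary part.\<close>

definition horostrip :: "real \<Rightarrow> real \<Rightarrow> complex set"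
  where "horostrip a b = {z. 0 < Im z \<and> ln (Im z) \<in> {a..b}}"

definition horostrip_coord :: "nat \<Rightarrow> real \<Rightarrow> (real \<Rightarrow> point) \<Rightarrow> point \<times> real \<Rightarrow> complex"
  where "horostrip_coord p q \<gamma> u = Complex (snd u) (exp (height p q \<gamma> (fst u)))"

text \<open>
  Two vertices are adjacent iff their distance is \<open>ln q\<close>.  The relation says that
  \<open>u\<close> and \<open>u'\<close> lie over a common edge and that the corresponding points of the horostrip are
  joined, inside this horostrip, by a piecewise continuously differentiable path of hyperbolic
  length \<open>L\<close>.  The integral is required to exist because \<^const>\<open>valid_path\<close> does not bound the
  derivative near the break points.
\<close>

definition strip_path :: "nat \<Rightarrow> real \<Rightarrow> (real \<Rightarrow> point) \<Rightarrow> point \<times> real \<Rightarrow> point \<times> real \<Rightarrow> real \<Rightarrow> bool"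
  where "strip_path p q \<gamma> u u' L \<longleftrightarrow>
    (\<exists>v\<in>T_vertices p q. \<exists>w\<in>T_vertices p q.
      T_dist p q v w = ln q \<and> height p q \<gamma> v < height p q \<gamma> w \<and>
      fst u \<in> T_segment p q v w \<and> fst u' \<in> T_segment p q v w \<and>
      (\<exists>g. valid_path g \<and> pathstart g = horostrip_coord p q \<gamma> u \<and>
        pathfinish g = horostrip_coord p q \<gamma> u' \<and>
        path_image g \<subseteq> horostrip (height p q \<gamma> v) (height p q \<gamma> w) \<and>
        ((\<lambda>t. norm (vector_derivative g (at t)) / Im (g t)) has_integral L) {0..1}))"

text \<open>Finite concatenations of paths in horostrips, with their total length.\<close>

inductive HT_path :: "nat \<Rightarrow> real \<Rightarrow> (real \<Rightarrow> point) \<Rightarrow> point \<times> real \<Rightarrow> point \<times> real \<Rightarrow> real \<Rightarrow> bool"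
  for p q \<gamma> where
  HT_path_refl: "u \<in> HT_space p q \<Longrightarrow> HT_path p q \<gamma> u u 0"
| HT_path_step: "HT_path p q \<gamma> u v L \<Longrightarrow> strip_path p q \<gamma> v w L' \<Longrightarrow> HT_path p q \<gamma> u w (L + L')"

definition HT_dist :: "nat \<Rightarrow> real \<Rightarrow> (real \<Rightarrow> point) \<Rightarrow> point \<times> real \<Rightarrow> point \<times> real \<Rightarrow> real"
  where "HT_dist p q \<gamma> u u' = Inf {L. HT_path p q \<gamma> u u' L}"

section \<open>The sequence \<open>\<X>(p,q,p',q')\<close>\<close>

definition log_multiples :: "real \<Rightarrow> real set"
  where "log_multiples q = {real a * ln q | a. True}"

text \<open>The increasing enumeration \<open>h\<^sub>0 < h\<^sub>1 < \<dots>\<close> of the union of the two sets of multiples.\<close>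

primrec level :: "real \<Rightarrow> real \<Rightarrow> nat \<Rightarrow> real" where
  "level q q' 0 = (LEAST h. h \<in> log_multiples q \<union> log_multiples q')"
| "level q q' (Suc n) =
    (LEAST h. h \<in> log_multiples q \<union> log_multiples q' \<and> level q q' n < h)"

primrec \<X> :: "nat \<Rightarrow> real \<Rightarrow> nat \<Rightarrow> real \<Rightarrow> nat \<Rightarrow> int" where
  "\<X> p q p' q' 0 = 1"
| "\<X> p q p' q' (Suc n) =
    (if level q q' n \<in> log_multiples q - log_multiples q' then int p * \<X> p q p' q' n
     else if level q q' n \<in> log_multiples q' - log_multiples q
       then \<lceil>real_of_int (\<X> p q p' q' n) / real p'\<rceil>
     else \<lceil>real p * real_of_int (\<X> p q p' q' n) / real p'\<rceil>)"

section \<open>The trees have the required metric and valencies\<close>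

lemma lcp_commute: "longest_common_prefix xs ys = longest_common_prefix ys xs"
  by (induction xs ys rule: longest_common_prefix.induct) auto

lemma lcp_ultrametric:
  "min (length (longest_common_prefix xs ys)) (length (longest_common_prefix ys zs))
    \<le> length (longest_common_prefix xs zs)"
proof (induction xs ys arbitrary: zs rule: longest_common_prefix.induct)
  case (1 x xs y ys)
  then show ?case by (cases zs) auto
qed auto

lemma branch_depth_ultrametric:
  assumes "l > 0"
  shows "min (branch_depth l x y) (branch_depth l y z) \<le> branch_depth l x z"
proof -
  have "real (min (length (longest_common_prefix (fst x) (fst y)))
      (length (longest_common_prefix (fst y) (fst z)))) * l
    \<le> real (length (longest_common_prefix (fst x) (fst z))) * l"
    using lcp_ultrametric[of "fst x" "fst y" "fst z"] assms
    by (intro mult_right_mono) (auto simp: min_le_iff_disj)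
  then show ?thesis
    unfolding branch_depth_def by (auto simp: min_def split: if_splits)
qed

lemma lcp_full:
  assumes "length xs \<le> length (longest_common_prefix xs ys)"
    and "length ys \<le> length (longest_common_prefix xs ys)"
  shows "xs = ys"
  using assms by (induction xs ys rule: longest_common_prefix.induct) (auto split: if_splits)

lemma Metric_space_tree:
  assumes "l > 0"
  shows "Metric_space (tree_points l W) (tree_dist l)"
proof
  fix x y
  show "0 \<le> tree_dist l x y"
    by (auto simp: tree_dist_def branch_depth_def)
  show "tree_dist l x y = tree_dist l y x"
    by (simp add: tree_dist_def branch_depth_def lcp_commute min.commute)
  assume x: "x \<in> tree_points l W" and y: "y \<in> tree_points l W"
  show "tree_dist l x y = 0 \<longleftrightarrow> x = y"
  proof
    let ?n = "length (longest_common_prefix (fst x) (fst y))"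
    assume "tree_dist l x y = 0"
    then have *: "depth l x = depth l y" "depth l x \<le> real ?n * l"
      unfolding tree_dist_def branch_depth_def by linarith+
    have le: "m \<le> ?n" if "real m * l - s \<le> real ?n * l" "s < l" for m s
    proof -
      have "real m * l < real (Suc ?n) * l" using that by (simp add: algebra_simps)
      then have "m < Suc ?n" using assms by (simp only: mult_less_cancel_right_pos of_nat_less_iff)
      then show ?thesis by simp
    qed
    have "length (fst x) \<le> ?n" "length (fst y) \<le> ?n"
      using x y * le[of "length (fst x)" "snd x"] le[of "length (fst y)" "snd y"]
      by (simp_all add: tree_points_def depth_def case_prod_beta)
    then have "fst x = fst y" by (rule lcp_full)
    moreover from this * have "snd x = snd y" by (simp add: depth_def)
    ultimately show "x = y" by (simp add: prod_eq_iff)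
  next
    have [simp]: "longest_common_prefix xs xs = xs" for xs :: "nat list" by (induction xs) auto
    assume "x = y"
    then show "tree_dist l x y = 0"
      using x by (auto simp: tree_dist_def branch_depth_def depth_def tree_points_def)
  qed
  fix z
  have "branch_depth l x y \<le> depth l y" "branch_depth l y z \<le> depth l y"
    by (auto simp: branch_depth_def)
  with branch_depth_ultrametric[OF assms, of x y z]
  show "tree_dist l x z \<le> tree_dist l x y + tree_dist l y z"
    unfolding tree_dist_def by linarith
qed

lemma dist_vertices:
  "tree_dist l (v, 0) (w, 0) =
    real (length v + length w - 2 * length (longest_common_prefix v w)) * l" if "l > 0"
proof -
  have 1: "length (longest_common_prefix v w) \<le> length v" "length (longest_common_prefix v w) \<le> length w"
    by (auto intro: prefix_length_le longest_common_prefix_prefix1 longest_common_prefix_prefix2)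
  then have "branch_depth l (v,0) (w,0) = real (length (longest_common_prefix v w)) * l"
    using that by (auto simp: branch_depth_def depth_def)
  then show ?thesis using 1 by (simp add: tree_dist_def depth_def algebra_simps of_nat_diff)
qed

lemma adjacent_vertices:
  assumes "l > 0"
  shows "tree_dist l (v, 0) (w, 0) = l \<longleftrightarrow> (\<exists>a. w = v @ [a] \<or> v = w @ [a])"
proof -
  let ?c = "longest_common_prefix v w"
  have [simp]: "longest_common_prefix (xs @ ys) xs = xs" "longest_common_prefix xs (xs @ ys) = xs"
    for xs ys :: "nat list" by (induction xs) auto
  have "tree_dist l (v, 0) (w, 0) = l \<longleftrightarrow> length v + length w - 2 * length ?c = 1"
    unfolding dist_vertices[OF assms] using assms
    by (simp only: mult_cancel_right2) (simp only: of_nat_eq_1_iff, simp)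
  also have "\<dots> \<longleftrightarrow> (\<exists>a. w = v @ [a] \<or> v = w @ [a])"
  proof
    assume *: "length v + length w - 2 * length ?c = 1"
    obtain v' where v: "v = ?c @ v'"
      using longest_common_prefix_prefix1[of v w] by (rule prefixE)
    obtain w' where w: "w = ?c @ w'"
      using longest_common_prefix_prefix2[of v w] by (rule prefixE)
    have "length v = length ?c + length v'" "length w = length ?c + length w'"
      using arg_cong[OF v, of length] arg_cong[OF w, of length] by simp_all
    with * have "length v' + length w' = 1" by simp
    then have "(v' = [] \<and> (\<exists>a. w' = [a])) \<or> (w' = [] \<and> (\<exists>a. v' = [a]))"
      by (cases v'; cases w') auto
    then show "\<exists>a. w = v @ [a] \<or> v = w @ [a]" 
    proof
      assume "v' = [] \<and> (\<exists>a. w' = [a])"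
      then have "v = ?c" "\<exists>a. w = ?c @ [a]" using v w by auto
      then show ?thesis by metis
    next
      assume "w' = [] \<and> (\<exists>a. v' = [a])"
      then have "w = ?c" "\<exists>a. v = ?c @ [a]" using v w by auto
      then show ?thesis by metis
    qed
  qed auto
  finally show ?thesis .
qed

lemma inj_snoc: "card ((\<lambda>a. (v @ [a], 0::real)) ` {..<n}) = n"
  by (subst card_image) (auto simp: inj_on_def)

lemma valency_R:
  assumes "q > 1" "w \<in> R_words p"
  shows "card {v \<in> tree_vertices (R_words p). R_dist p q (w, 0) v = ln q} = (if w = [] then p else p + 1)"
proof -
  have l: "ln q > 0" using assms by simp
  show ?thesis
  proof (cases w rule: rev_cases)
    case Nil
    then have "{v \<in> tree_vertices (R_words p). R_dist p q (w, 0) v = ln q} = (\<lambda>a. (w @ [a], 0)) ` {..<p}"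
      by (auto simp: tree_vertices_def R_dist_def adjacent_vertices[OF l] R_words_def)
    then show ?thesis using Nil by (simp only: inj_snoc) simp
  next
    case (snoc u b)
    have "{v \<in> tree_vertices (R_words p). R_dist p q (w, 0) v = ln q} =
        insert (u, 0) ((\<lambda>a. (w @ [a], 0)) ` {..<p})"
      using assms(2) snoc
      by (auto simp: tree_vertices_def R_dist_def adjacent_vertices[OF l] R_words_def)
    moreover have "(u, 0::real) \<notin> (\<lambda>a. (w @ [a], 0)) ` {..<p}" using snoc by auto
    moreover have "card ((\<lambda>a. (w @ [a], 0::real)) ` {..<p}) = p" by (rule inj_snoc)
    ultimately show ?thesis using snoc by simp
  qed
qed

lemma valency_T:
  assumes "q > 1" "v \<in> T_vertices p q"
  shows "card {w \<in> T_vertices p q. T_dist p q v w = ln q} = p + 1"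
proof -
  have l: "ln q > 0" using assms by simp
  obtain u where u: "v = (u, 0)" "u \<in> T_words p" using assms by (auto simp: T_vertices_def tree_vertices_def)
  show ?thesis
  proof (cases u rule: rev_cases)
    case Nil
    then have "{w \<in> T_vertices p q. T_dist p q v w = ln q} = (\<lambda>a. ([] @ [a], 0)) ` {..<p+1}"
      unfolding u by (auto simp: T_vertices_def tree_vertices_def T_dist_def adjacent_vertices[OF l] T_words_def)
    then show ?thesis by (simp only: inj_snoc)
  next
    case (snoc u' b)
    have "{w \<in> T_vertices p q. T_dist p q v w = ln q} = insert (u', 0) ((\<lambda>a. (u @ [a], 0)) ` {..<p})"
      using u(2) snoc unfolding u(1)
      by (cases u') (auto simp: T_vertices_def tree_vertices_def T_dist_def adjacent_vertices[OF l] T_words_def)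
    moreover have "(u', 0::real) \<notin> (\<lambda>a. (u @ [a], 0)) ` {..<p}" using snoc by auto
    ultimately show ?thesis by (simp add: inj_snoc)
  qed
qed

text \<open>Fixing a geodesic ray is no restriction.\<close>

lemma geodesic_ray_exists:
  assumes "p \<ge> 1" "q > 1"
  shows "\<exists>\<gamma>. geodesic_ray p q \<gamma>"
proof -
  define l where "l = ln q"
  have l: "l > 0" using assms by (simp add: l_def)
  define n where "n t = nat \<lceil>t / l\<rceil>" for t
  define g where "g t = (replicate (n t) (0::nat), real (n t) * l - t)" for t
  have n: "real (n t) * l \<ge> t" "real (n t) * l < t + l" "n t = 0 \<Longrightarrow> t = 0" if "t \<ge> 0" for t
  proof -
    have 0: "t / l \<ge> 0" using that l by simp
    have "real (n t) \<ge> t / l" "real (n t) < t / l + 1"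
      using 0 unfolding n_def by linarith+
    then show 1: "real (n t) * l \<ge> t" "real (n t) * l < t + l"
      using l by (simp_all add: field_simps)
    show "n t = 0 \<Longrightarrow> t = 0" using 1 that by simp
  qed
  have lcp: "longest_common_prefix (replicate i (0::nat)) (replicate j 0) = replicate (min i j) 0" for i j
  proof (induction i arbitrary: j)
    case (Suc i) then show ?case by (cases j) auto
  qed simp
  have d: "depth l (g t) = t" for t by (simp add: depth_def g_def)
  have "tree_dist l (g s) (g t) = \<bar>s - t\<bar>" if "s \<ge> 0" "t \<ge> 0" for s t
  proof -
    have "real (min (n s) (n t)) * l \<ge> min s t"
      using n(1)[of s] n(1)[of t] that by (auto simp: min_def)
    then have "branch_depth l (g s) (g t) = min s t"
      unfolding branch_depth_def d by (simp add: g_def lcp)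
    then show ?thesis unfolding tree_dist_def d by auto
  qed
  moreover have "g 0 = ([], 0)" by (simp add: g_def n_def)
  moreover have "set (tl (replicate k (0::nat))) \<subseteq> {..<p}" for k
    using assms by (cases k) auto
  then have "g t \<in> T_tree p q" if "t \<ge> 0" for t
    using n[OF that] assms by (cases "n t") (auto simp: T_tree_def tree_points_def T_words_def g_def l_def)
  ultimately have "geodesic_ray p q g"
    unfolding geodesic_ray_def T_dist_def l_def[symmetric]
    by (auto simp: T_vertices_def tree_vertices_def T_words_def)
  then show ?thesis by blast
qed

end

theory Submission
  imports Defs "HOL-Library.Groups_Big_Fun"
begin

text \<open>
  Each of the three kinds of embeddings induces a map from words of length \<open>n\<close> over \<open>p\<close> letters
  to sequences over \<open>p'\<close> letters that respects branch heights up to a bounded error.  Counting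
  words by pigeonhole along the levels shows that such a map forces \<open>\<X>\<close> to be bounded.
  If \<open>\<X>\<close> is bounded, then so is the nondecreasing sequence obtained by rescaling it with the
  powers of \<open>p\<close> and \<open>p'\<close> used so far; as only finitely many roundings can be proper, the
  exponential growth rates are ordered, and equality of the rates forces an integral relation
  between powers of \<open>p\<close> and \<open>p'\<close>.  Conversely, under the arithmetic condition some block
  length \<open>N\<close> admits injections from \<open>p ^ N\<close> blocks into the blocks of target letters that fit
  the same height interval, uniformly in the position, and recoding blocks yields all three
  embeddings.

  The hard step is the rigidity of quasi-isometric embeddings between treebolic spaces.  A
  vertical line of the tree spans a hyperbolic plane.  Its image has a degree over each point of the
  target, computed from winding numbers of discrete chains; at each vertex of the
  target tree it is the sum of the degrees at the children.  In hyperbolic planes a closed walk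
  stays logarithmically close to the points it winds around, whereas two branches of the support
  of the degree would carry a loop winding around a point far away; therefore the support is
  again a vertical line.  A discrete Poincare lemma dualizes degrees and shows that lines
  branching at a given height are mapped to lines branching at a controlled height, and comparison
  of horizontal distances shows that heights are preserved up to an additive constant.
\<close>

text \<open>A quasi-isometric embedding need not be continuous, so topology enters through integer
  functions of pairs of lattice points: such a function plays the part of a closed form when on
  every bounded set away from one centre it is a difference \<open>s b - s a\<close>. A bounded
  perturbation of a map alters only finitely many cells up to such differences, and sums over all
  cells of the plane do not notice it.

  Both treebolic spaces are replaced by lattices whose levels lie at multiples of
  \<open>ln 2\<close>, whatever the edge lengths are. Source and target become instances of one
  structure, and every distance estimate becomes a relation \<open>near A\<close> with a natural
  number \<open>A\<close>.

  The obstacle is that the embedding is far from surjective, so that a coarse inverse exists only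
  near the image. Duality is therefore formulated one vertex at a time: integer weights near the
  image of a vertex recover from the degrees whether a line passes through that vertex.

  On the symbolic side all three embeddings are reduced to one notion of a map from words to digit
  sequences, so that counting is done only once.\<close>

definition dy :: "int \<Rightarrow> real" where "dy n = 2 powr real_of_int n"

lemma dy_pos [simp]: "0 < dy n" and dy_nonneg [simp]: "0 \<le> dy n" and dy_nz [simp]: "dy n \<noteq> 0"
  by (simp_all add: dy_def)

lemma dy_mono: "m \<le> n \<Longrightarrow> dy m \<le> dy n" by (simp add: dy_def)
lemma dy_le_iff [simp]: "dy m \<le> dy n \<longleftrightarrow> m \<le> n" by (simp add: dy_def)
lemma dy_less_iff [simp]: "dy m < dy n \<longleftrightarrow> m < n" by (simp add: dy_def)
lemma dy_add: "dy (m + n) = dy m * dy n" by (simp add: dy_def powr_add)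
lemma dy_Suc: "dy (n + 1) = 2 * dy n" by (simp add: dy_add) (simp add: dy_def)
lemma dy_pred: "2 * dy (n - 1) = dy n" using dy_Suc[of "n - 1"] by simp
lemma dy_0 [simp]: "dy 0 = 1" by (simp add: dy_def)
lemma dy_nat: "dy (int n) = 2 ^ n" by (simp add: dy_def powr_realpow)
lemma dy_add_le: "m \<le> k \<Longrightarrow> n \<le> k \<Longrightarrow> dy m + dy n \<le> dy (k + 1)"
  unfolding dy_Suc using dy_mono[of m k] dy_mono[of n k] by linarith
lemma dy_unbounded: "\<exists>n::nat. B \<le> dy (int n)"
proof -
  obtain n where "B < 2 ^ n" using real_arch_pow[of 2 B] by auto
  then show ?thesis by (intro exI[of _ n]) (simp add: dy_nat)
qed

subsection \<open>Signed chains of edges\<close>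

text \<open>An edge is any ordered pair of points, adjacent or not, with an integer coefficient; the
  functions \<open>J\<close> of two points below are the cochains that \<open>ev\<close>
  integrates.\<close>

type_synonym 'x chain = "(int \<times> 'x \<times> 'x) list"

definition ev :: "'x chain \<Rightarrow> ('x \<Rightarrow> 'x \<Rightarrow> int) \<Rightarrow> int" where
  "ev z J = (\<Sum>(s,a,b)\<leftarrow>z. s * J a b)"

text \<open>Zero boundary expressed by duality: every coboundary integrates to zero. In this form
  local primitives can be discarded at once.\<close>

definition cyc :: "'x chain \<Rightarrow> bool" where
  "cyc z \<longleftrightarrow> (\<forall>S. ev z (\<lambda>a b. S b - S a) = 0)"

definition pts :: "'x chain \<Rightarrow> 'x set" where
  "pts z = (\<Union>(s,a,b)\<in>set z. {a,b})"

definition mapc :: "('x \<Rightarrow> 'y) \<Rightarrow> 'x chain \<Rightarrow> 'y chain" where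
  "mapc \<phi> z = map (\<lambda>(s,a,b). (s, \<phi> a, \<phi> b)) z"

lemma ev_Nil [simp]: "ev [] J = 0" and ev_Cons [simp]: "ev ((s,a,b) # z) J = s * J a b + ev z J"
  by (simp_all add: ev_def)

lemma ev_append [simp]: "ev (z @ z') J = ev z J + ev z' J"
  by (simp add: ev_def)

lemma ev_cong: "(\<And>s a b. (s,a,b) \<in> set z \<Longrightarrow> J a b = J' a b) \<Longrightarrow> ev z J = ev z J'"
  by (auto simp: ev_def intro!: arg_cong[of _ _ sum_list] map_cong)

lemma ev_add: "ev z (\<lambda>a b. J a b + J' a b) = ev z J + ev z J'"
  by (induction z) (auto simp: algebra_simps)
lemma ev_diff: "ev z (\<lambda>a b. J a b - J' a b) = ev z J - ev z J'"
  by (induction z) (auto simp: algebra_simps)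
lemma ev_cmult: "ev z (\<lambda>a b. c * J a b) = c * ev z J"
  by (induction z) (auto simp: algebra_simps)
lemma ev_zero [simp]: "ev z (\<lambda>a b. 0) = 0"
  by (induction z) auto
lemma ev_sum: "ev z (\<lambda>a b. \<Sum>i\<in>A. J i a b) = (\<Sum>i\<in>A. ev z (J i))"
  by (induction A rule: infinite_finite_induct) (auto simp: ev_add)

lemma ev_mapc [simp]: "ev (mapc \<phi> z) J = ev z (\<lambda>a b. J (\<phi> a) (\<phi> b))"
  by (induction z) (auto simp: mapc_def)

lemma pts_mapc [simp]: "pts (mapc \<phi> z) = \<phi> ` pts z"
  by (force simp: pts_def mapc_def split: prod.splits)

lemma finite_pts [simp]: "finite (pts z)"
  by (auto simp: pts_def)

lemma pts_set: "(s,a,b) \<in> set z \<Longrightarrow> a \<in> pts z \<and> b \<in> pts z"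
  by (force simp: pts_def)

lemma cyc_exact: "cyc z \<Longrightarrow> ev z (\<lambda>a b. S b - S a) = 0"
  by (auto simp: cyc_def)

lemma cyc_mapc: "cyc z \<Longrightarrow> cyc (mapc \<phi> z)"
  by (auto simp: cyc_def)

lemma cyc_exact_on:
  assumes "cyc z" "\<And>s a b. (s,a,b) \<in> set z \<Longrightarrow> J a b = S b - S a"
  shows "ev z J = 0"
  using ev_cong[of z J "\<lambda>a b. S b - S a"] assms cyc_exact by metis

lemma cyc_walk:
  fixes b :: "nat \<Rightarrow> 'x"
  assumes "b L = b 0"
  shows "cyc (map (\<lambda>i. (1, b i, b (Suc i))) [0..<L])"
proof -
  have "ev (map (\<lambda>i. (1, b i, b (Suc i))) [0..<L]) (\<lambda>a b. S b - S a) = S (b L) - S (b 0)" for S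
    by (induction L) auto
  then show ?thesis using assms by (simp add: cyc_def)
qed

lemma ev_walk: "ev (map (\<lambda>i. (1, b i, b (Suc i))) [0..<L]) J = (\<Sum>i<L. J (b i) (b (Suc i)))"
  by (induction L) auto

subsection \<open>Graded forests\<close>

text \<open>Levels increase upward, in the direction in which horizontal hyperbolic distances
  shrink, and the forest branches upward. The number of children of a vertex is not restricted, and
  several components are allowed.\<close>

locale horo =
  fixes par :: "'v \<Rightarrow> 'v" and lev :: "'v \<Rightarrow> int"
  assumes lev_par: "lev (par v) = lev v - 1"
begin

abbreviation anc :: "nat \<Rightarrow> 'v \<Rightarrow> 'v" where "anc i \<equiv> par ^^ i"

lemma lev_anc [simp]: "lev (anc i v) = lev v - int i"
  by (induction i) (auto simp: lev_par)

lemma anc_anc: "anc i (anc j v) = anc (i + j) v"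
  by (simp add: funpow_add)

definition up :: "'v \<Rightarrow> 'v \<Rightarrow> bool" where "up v t \<longleftrightarrow> (\<exists>i. anc i t = v)"

text \<open>The row of \<open>v\<close> has spacing \<open>2 ^ lev v\<close>, which at height
  \<open>lev v * ln 2\<close> is one unit of hyperbolic length.\<close>

definition xc :: "'v \<times> int \<Rightarrow> real" where "xc a = real_of_int (snd a) * dy (lev (fst a))"

text \<open>Replaces "hyperbolic distance at most a constant times \<open>A\<close>": the tree parts
  meet within \<open>A\<close> steps down on either side, and a horizontal gap of
  \<open>2 ^ A\<close> units closes in about \<open>A\<close> levels.\<close>

definition near :: "nat \<Rightarrow> 'v \<times> int \<Rightarrow> 'v \<times> int \<Rightarrow> bool" where
  "near A a b \<longleftrightarrow> (\<exists>i\<le>A. \<exists>j\<le>A. anc i (fst a) = anc j (fst b)) \<and>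
     \<bar>xc a - xc b\<bar> \<le> dy (int A + lev (fst a)) \<and> \<bar>xc a - xc b\<bar> \<le> dy (int A + lev (fst b))"

lemma nearI:
  "i \<le> A \<Longrightarrow> j \<le> A \<Longrightarrow> anc i (fst a) = anc j (fst b) \<Longrightarrow> \<bar>xc a - xc b\<bar> \<le> dy (int A + lev (fst a))
   \<Longrightarrow> \<bar>xc a - xc b\<bar> \<le> dy (int A + lev (fst b)) \<Longrightarrow> near A a b"
  by (auto simp: near_def)

lemma near_refl [simp]: "near A a a"
  by (auto simp: near_def intro!: exI[of _ 0])

lemma near_sym: "near A a b \<Longrightarrow> near A b a"
  unfolding near_def by (metis abs_minus_commute)

lemma near_mono: "near A a b \<Longrightarrow> A \<le> B \<Longrightarrow> near B a b"
  unfolding near_def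
  by (meson dy_mono add_right_mono of_nat_mono order_trans)

lemma near_lev: "near A a b \<Longrightarrow> \<bar>lev (fst a) - lev (fst b)\<bar> \<le> int A"
proof -
  assume "near A a b"
  then obtain i j where "i \<le> A" "j \<le> A" and e: "anc i (fst a) = anc j (fst b)" by (auto simp: near_def)
  moreover have "lev (fst a) - int i = lev (fst b) - int j" using arg_cong[OF e, of lev] by simp
  ultimately show ?thesis by auto
qed

lemma anc_meet_trans:
  assumes "anc i a = anc j b" "anc i' b = anc j' c" "i \<le> A" "j \<le> A" "i' \<le> B" "j' \<le> B"
  shows "\<exists>k\<le>A+B. \<exists>l\<le>A+B. anc k a = anc l c"
proof (cases "i' \<le> j")
  case True
  have "anc i a = anc (j - i') (anc i' b)" using assms(1) True by (simp add: anc_anc)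
  also have "\<dots> = anc (j - i' + j') c" by (simp add: assms(2) anc_anc)
  finally show ?thesis using assms True by (intro exI[of _ i] exI[of _ "j - i' + j'"] conjI) auto
next
  case False
  have "anc (i' - j + i) a = anc (i' - j) (anc j b)" using assms(1) by (simp add: funpow_add)
  also have "\<dots> = anc j' c" using False by (simp add: anc_anc assms(2))
  finally show ?thesis using assms False by (intro exI[of _ "i' - j + i"] exI[of _ j'] conjI) auto
qed

text \<open>The extra 1 pays for adding two powers of two, whose sum stays below the power after the
  larger exponent (\<open>dy_add_le\<close>).\<close>

lemma near_trans:
  assumes "near A a b" "near B b c" "A + B + 1 \<le> C" shows "near C a c"
proof -
  obtain i j i' j' where ij: "anc i (fst a) = anc j (fst b)" "anc i' (fst b) = anc j' (fst c)"
      "i \<le> A" "j \<le> A" "i' \<le> B" "j' \<le> B"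
    using assms(1,2) unfolding near_def by blast
  then obtain k l where kl: "k \<le> A + B" "l \<le> A + B" "anc k (fst a) = anc l (fst c)"
    using anc_meet_trans[OF ij] by blast
  have l1: "\<bar>lev (fst a) - lev (fst b)\<bar> \<le> int A" "\<bar>lev (fst b) - lev (fst c)\<bar> \<le> int B"
    using assms near_lev by blast+
  have x: "\<bar>xc a - xc b\<bar> \<le> dy (int A + lev (fst a))" "\<bar>xc a - xc b\<bar> \<le> dy (int A + lev (fst b))"
     "\<bar>xc b - xc c\<bar> \<le> dy (int B + lev (fst b))" "\<bar>xc b - xc c\<bar> \<le> dy (int B + lev (fst c))"
    using assms unfolding near_def by auto
  have "\<bar>xc a - xc c\<bar> \<le> dy (int A + lev (fst a)) + dy (int B + lev (fst b))" using x by linarith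
  also have "\<dots> \<le> dy (int A + int B + lev (fst a) + 1)" using l1 by (intro dy_add_le) auto
  also have "\<dots> \<le> dy (int C + lev (fst a))" using assms by (intro dy_mono) auto
  finally have 1: "\<bar>xc a - xc c\<bar> \<le> dy (int C + lev (fst a))" .
  have "\<bar>xc a - xc c\<bar> \<le> dy (int A + lev (fst b)) + dy (int B + lev (fst c))" using x by linarith
  also have "\<dots> \<le> dy (int A + int B + lev (fst c) + 1)" using l1 by (intro dy_add_le) auto
  also have "\<dots> \<le> dy (int C + lev (fst c))" using assms by (intro dy_mono) auto
  finally have 2: "\<bar>xc a - xc c\<bar> \<le> dy (int C + lev (fst c))" .
  show ?thesis using kl 1 2 assms(3) by (intro nearI[of k _ l]) auto
qed

definition chi :: "'v \<Rightarrow> 'v \<Rightarrow> int" where "chi v t = of_bool (up v t)"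
definition sg :: "real \<Rightarrow> 'v \<times> int \<Rightarrow> int" where "sg y a = of_bool (xc a < y)"

text \<open>The cup product of the indicator of the branch above \<open>v\<close> with the coboundary of the
  half line to the left of \<open>y\<close>; on cycles it measures the winding around \<open>(v, y)\<close>.\<close>

definition II :: "'v \<Rightarrow> real \<Rightarrow> 'v \<times> int \<Rightarrow> 'v \<times> int \<Rightarrow> int" where
  "II v y a b = chi v (fst a) * chi v (fst b) * (sg y b - sg y a)"

lemma up_refl [simp]: "up v v" unfolding up_def by (intro exI[of _ 0]) simp

lemma up_lev: "up v t \<Longrightarrow> lev v \<le> lev t"
  by (auto simp: up_def)

lemma up_iff: "up v t \<longleftrightarrow> lev v \<le> lev t \<and> anc (nat (lev t - lev v)) t = v"
  unfolding up_def by auto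

lemma up_par: "up v t \<Longrightarrow> up (par v) t"
  unfolding up_def by (metis funpow.simps(2) o_apply)

lemma up_trans: "up u v \<Longrightarrow> up v t \<Longrightarrow> up u t"
  unfolding up_def by (metis anc_anc)

text \<open>The tree path from \<open>a\<close> to \<open>b\<close> descends to the meet before it
  rises, and a branch is left only through its root; so \<open>v\<close> lies strictly above the
  meet.\<close>

lemma up_change:
  assumes "anc i a = anc j b" "i \<le> A" "up v a" "\<not> up v b"
  shows "\<exists>s<A. anc s a = v"
proof -
  obtain s where s: "anc s a = v" using assms(3) by (auto simp: up_def)
  have "s < i"
  proof (rule ccontr)
    assume "\<not> s < i"
    then have "v = anc (s - i) (anc i a)" using s by (simp add: anc_anc)
    also have "\<dots> = anc (s - i + j) b" by (simp add: assms(1) anc_anc)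
    finally show False using assms(4) by (auto simp: up_def)
  qed
  then show ?thesis using s assms(2) by (intro exI[of _ s]) auto
qed

definition inband :: "real \<Rightarrow> 'v \<times> int \<Rightarrow> bool" where
  "inband y a \<longleftrightarrow> \<bar>xc a - y\<bar> \<le> dy (lev (fst a))"

text \<open>A set of bounded diameter on which neither factor of the cup product is constant lies
  near the point in question.\<close>

lemma localize:
  assumes E: "\<And>a b. a \<in> E \<Longrightarrow> b \<in> E \<Longrightarrow> near A a b"
    and 1: "a \<in> E" "b \<in> E" "up v (fst a)" "\<not> up v (fst b)"
    and 2: "d \<in> E" "e \<in> E" "xc d < y" "\<not> xc e < y"
    and c: "c \<in> E" and y: "inband y (v,k)"
  shows "near (3*A+3) c (v,k)"
proof -
  obtain i j where ij: "anc i (fst a) = anc j (fst b)" "i \<le> A"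
    using E[OF 1(1,2)] by (auto simp: near_def)
  obtain s where s: "s < A" "anc s (fst a) = v" using up_change[OF ij 1(3,4)] by blast
  obtain i' j' where ij': "anc i' (fst c) = anc j' (fst a)" "i' \<le> A" "j' \<le> A"
    using E[OF c 1(1)] by (auto simp: near_def)
  have "\<exists>k\<le>A+A. \<exists>l\<le>A+A. anc k (fst c) = anc l v"
    using anc_meet_trans[of i' "fst c" j' "fst a" s 0 v] ij' s by auto
  then obtain m l where ml: "m \<le> A+A" "l \<le> A+A" "anc m (fst c) = anc l v" by blast
  have lv: "lev v = lev (fst a) - int s" using s(2) by auto
  have le: "\<bar>lev (fst c) - lev (fst a)\<bar> \<le> int A" "\<bar>lev (fst d) - lev (fst a)\<bar> \<le> int A"
     "\<bar>lev (fst c) - lev (fst d)\<bar> \<le> int A"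
    using E c 1 2 near_lev by blast+
  have b1: "\<bar>xc c - xc d\<bar> \<le> dy (int A + lev (fst c))" "\<bar>xc c - xc d\<bar> \<le> dy (int A + lev (fst d))"
    and b2: "\<bar>xc d - xc e\<bar> \<le> dy (int A + lev (fst d))"
    using E[OF c 2(1)] E[OF 2(1,2)] by (auto simp: near_def)
  have b3: "\<bar>xc (v,k) - y\<bar> \<le> dy (lev v)" using y by (simp add: inband_def)
  have "\<bar>xc c - xc (v,k)\<bar> \<le> \<bar>xc c - xc d\<bar> + \<bar>xc d - xc e\<bar> + dy (lev v)"
    using b3 2 by linarith
  then have main: "\<bar>xc c - xc (v,k)\<bar> \<le> 4 * dy r"
    if "int A + lev (fst d) \<le> r" "lev v \<le> r" for r
    using b1 b2 dy_mono[OF that(1)] dy_mono[OF that(2)] dy_pos[of r] by linarith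
  have "\<bar>xc c - xc (v,k)\<bar> \<le> dy (r + 1 + 1)"
    if "int A + lev (fst d) \<le> r" "lev v \<le> r" for r
    using main[OF that] by (simp only: dy_Suc)
  from this[of "int (2*A) + lev (fst c)"] this[of "int (3*A) + lev v"]
  have "\<bar>xc c - xc (v,k)\<bar> \<le> dy (int (2*A) + lev (fst c) + 1 + 1)"
    "\<bar>xc c - xc (v,k)\<bar> \<le> dy (int (3*A) + lev v + 1 + 1)" using le lv s(1) by auto
  note xx = this
  have x1: "\<bar>xc c - xc (v,k)\<bar> \<le> dy (int (3*A+3) + lev (fst c))"
    using le lv s(1) by (intro order_trans[OF xx(1)]) simp
  have x2: "\<bar>xc c - xc (v,k)\<bar> \<le> dy (int (3*A+3) + lev v)"
    using le lv s(1) by (intro order_trans[OF xx(2)]) simp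
  show ?thesis using ml x1 x2 by (intro nearI[of m _ l]) auto
qed

text \<open>A constant first factor makes \<open>chi * sg\<close> a primitive; a constant second
  factor makes the product vanish.\<close>

lemma II_const:
  assumes "(\<forall>a\<in>E. \<forall>b\<in>E. up v (fst a) = up v (fst b)) \<or> (\<forall>a\<in>E. \<forall>b\<in>E. xc a < y \<longleftrightarrow> xc b < y)"
  shows "\<exists>s. \<forall>a\<in>E. \<forall>b\<in>E. II v y a b = s b - s a"
  using assms
proof
  assume *: "\<forall>a\<in>E. \<forall>b\<in>E. up v (fst a) = up v (fst b)"
  have "II v y a b = chi v (fst b) * sg y b - chi v (fst a) * sg y a" if "a \<in> E" "b \<in> E" for a b
  proof -
    have "up v (fst a) = up v (fst b)" using * that by blast
    then show ?thesis by (cases "up v (fst b)") (simp_all add: II_def chi_def)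
  qed
  then show ?thesis by (intro exI[of _ "\<lambda>a. chi v (fst a) * sg y a"]) simp
next
  assume *: "\<forall>a\<in>E. \<forall>b\<in>E. xc a < y \<longleftrightarrow> xc b < y"
  have "II v y a b = 0" if "a \<in> E" "b \<in> E" for a b
  proof -
    have "xc a < y \<longleftrightarrow> xc b < y" using * that by blast
    then show ?thesis by (simp add: II_def sg_def)
  qed
  then show ?thesis by (intro exI[of _ "\<lambda>_. 0"]) simp
qed

text \<open>The coarse form of closedness: on sets of bounded diameter the cup product is a
  coboundary unless the set comes close to its centre \<open>(v, y)\<close>.\<close>

lemma II_local:
  assumes "\<And>a b. a \<in> E \<Longrightarrow> b \<in> E \<Longrightarrow> near A a b" "c \<in> E" "inband y (v,k)" "\<not> near (3*A+3) c (v,k)"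
  shows "\<exists>s. \<forall>a\<in>E. \<forall>b\<in>E. II v y a b = s b - s a"
proof (rule II_const, rule ccontr)
  assume "\<not> ((\<forall>a\<in>E. \<forall>b\<in>E. up v (fst a) = up v (fst b)) \<or> (\<forall>a\<in>E. \<forall>b\<in>E. (xc a < y) = (xc b < y)))"
  then obtain a b d e where "a \<in> E" "b \<in> E" "up v (fst a)" "\<not> up v (fst b)" "d \<in> E" "e \<in> E" "xc d < y" "\<not> xc e < y"
    by blast
  then have "near (3*A+3) c (v,k)" using localize[of E A a b v d e y c k] assms(1,2,3) by blast
  then show False using assms(4) by blast
qed

lemma ev_II_local:
  assumes "cyc z" "\<And>a b. a \<in> pts z \<Longrightarrow> b \<in> pts z \<Longrightarrow> near A a b" "c \<in> pts z" "inband y (v,k)" "ev z (II v y) \<noteq> 0"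
  shows "near (3*A+3) c (v,k)"
proof (rule ccontr)
  assume "\<not> ?thesis"
  then obtain s where "\<forall>a\<in>pts z. \<forall>b\<in>pts z. II v y a b = s b - s a"
    using II_local[of "pts z" A c y v k] assms by blast
  then have "ev z (II v y) = 0" using cyc_exact_on[OF assms(1)] pts_set by metis
  then show False using assms(5) by simp
qed

text \<open>Half-integer positions, so that no lattice point in the row of \<open>v\<close> lies on
  the vertical line and the line separates exactly one pair of neighbours there.\<close>

definition yy :: "'v \<Rightarrow> int \<Rightarrow> real" where "yy v i = (real_of_int i + 1/2) * dy (lev v)"

lemma inband_yy [simp]: "inband (yy v i) (v,i)"
  by (simp add: inband_def yy_def xc_def algebra_simps)

lemma inband_exists: "\<exists>k. inband y (v,k)"
proof -
  let ?k = "\<lfloor>y / dy (lev v)\<rfloor>"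
  have "\<bar>real_of_int ?k - y / dy (lev v)\<bar> \<le> 1" by linarith
  then have "\<bar>real_of_int ?k - y / dy (lev v)\<bar> * dy (lev v) \<le> 1 * dy (lev v)"
    by (rule mult_right_mono) simp
  also have "\<bar>real_of_int ?k - y / dy (lev v)\<bar> * dy (lev v) = \<bar>(real_of_int ?k - y / dy (lev v)) * dy (lev v)\<bar>"
    by (simp only: abs_mult) simp
  also have "(real_of_int ?k - y / dy (lev v)) * dy (lev v) = real_of_int ?k * dy (lev v) - y"
    by (simp add: field_simps)
  finally show ?thesis by (intro exI[of _ ?k]) (simp add: inband_def xc_def)
qed

text \<open>The boundary, counterclockwise, of the pentagon with upper left corner
  \<open>(v,k)\<close>. The row below has half the spacing, so \<open>(par v, 2*k)\<close> lies
  under \<open>(v,k)\<close> and the bottom side consists of two edges.\<close>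

definition cellc :: "'v \<times> int \<Rightarrow> ('v \<times> int) chain" where
  "cellc c = (case c of (v,k) \<Rightarrow> [(1,(par v,2*k),(par v,2*k+1)), (1,(par v,2*k+1),(par v,2*k+2)),
     (1,(par v,2*k+2),(v,k+1)), (-1,(v,k),(v,k+1)), (-1,(par v,2*k),(v,k))])"

lemma cyc_cellc: "cyc (cellc c)"
  by (auto simp: cyc_def cellc_def split: prod.splits)

lemma pts_cellc: "pts (cellc (v,k)) = {(par v,2*k),(par v,2*k+1),(par v,2*k+2),(v,k),(v,k+1)}"
  by (auto simp: pts_def cellc_def)

lemma cellc_self: "c \<in> pts (cellc c)"
  by (cases c) (auto simp: pts_cellc)

lemma ev_cellc: "ev (cellc (v,k)) J = J (par v,2*k) (par v,2*k+1) + J (par v,2*k+1) (par v,2*k+2) +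
   J (par v,2*k+2) (v,k+1) - J (v,k) (v,k+1) - J (par v,2*k) (v,k)"
  by (simp add: cellc_def)

lemma dy_lev_par: "dy (lev (par v)) = dy (lev v) / 2"
  using dy_pred[of "lev v"] by (simp add: lev_par)

lemma xc_par: "xc (par v, 2*k) = xc (v,k)"
  by (simp add: xc_def dy_lev_par)

lemma xc_anc: "xc (anc i v, 2^i*k) = xc (v,k)"
proof (induction i)
  case (Suc i)
  have "xc (anc (Suc i) v, 2^Suc i*k) = xc (par (anc i v), 2 * (2^i*k))" by (simp add: algebra_simps)
  then show ?case using Suc xc_par[of "anc i v" "2^i*k"] by simp
qed simp

lemma cellc_near: "a \<in> pts (cellc c) \<Longrightarrow> b \<in> pts (cellc c) \<Longrightarrow> near 1 a b"
proof -
  obtain v k where c: "c = (v,k)" by force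
  assume ab: "a \<in> pts (cellc c)" "b \<in> pts (cellc c)"
  have x: "\<bar>xc a - xc b\<bar> \<le> dy (lev v)"
    using ab unfolding c pts_cellc by (auto simp: xc_def dy_lev_par algebra_simps)
  have l: "lev (fst a) \<ge> lev v - 1" "lev (fst b) \<ge> lev v - 1" using ab unfolding c pts_cellc by (auto simp: lev_par)
  have "\<exists>i\<le>1. anc i (fst a) = par v" "\<exists>i\<le>1. anc i (fst b) = par v"
    using ab unfolding c pts_cellc
    by (auto intro: exI[of _ "0::nat"] exI[of _ "1::nat"])
  then obtain i j where "i \<le> 1" "j \<le> 1" "anc i (fst a) = anc j (fst b)" by metis
  then show ?thesis using l
    by (intro nearI[of i _ j] order_trans[OF x]) auto
qed

end

subsection \<open>The hyperbolic plane as a graded forest\<close>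

interpretation P: horo "\<lambda>n::int. n - 1" "\<lambda>n. n"
  by unfold_locales simp

lemma P_near: "P.near A a b \<longleftrightarrow> \<bar>fst a - fst b\<bar> \<le> int A \<and>
     \<bar>P.xc a - P.xc b\<bar> \<le> dy (int A + fst a) \<and> \<bar>P.xc a - P.xc b\<bar> \<le> dy (int A + fst b)"
proof -
  have "(\<exists>i\<le>A. \<exists>j\<le>A. fst a - int i = fst b - int j) \<longleftrightarrow> \<bar>fst a - fst b\<bar> \<le> int A"
  proof
    assume *: "\<bar>fst a - fst b\<bar> \<le> int A"
    show "\<exists>i\<le>A. \<exists>j\<le>A. fst a - int i = fst b - int j"
      using * by (intro exI[of _ "nat (fst a - fst b)"] exI[of _ "nat (fst b - fst a)"] conjI) auto
  qed auto
  then show ?thesis unfolding P.near_def by simp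
qed

lemma P_finite_ball: "finite {a. P.near A a b}"
proof -
  define M where "M = \<lceil>(\<bar>P.xc b\<bar> + dy (int A + fst b)) / dy (fst b - int A)\<rceil>"
  have "{a. P.near A a b} \<subseteq> {fst b - int A..fst b + int A} \<times> {-M..M}"
  proof
    fix a assume "a \<in> {a. P.near A a b}"
    then have l: "\<bar>fst a - fst b\<bar> \<le> int A" and x: "\<bar>P.xc a - P.xc b\<bar> \<le> dy (int A + fst b)"
      by (auto simp: P_near)
    have "\<bar>real_of_int (snd a)\<bar> * dy (fst b - int A) \<le> \<bar>real_of_int (snd a)\<bar> * dy (fst a)"
      using l by (intro mult_left_mono dy_mono) auto
    also have "\<dots> = \<bar>P.xc a\<bar>" by (simp add: P.xc_def abs_mult)
    also have "\<dots> \<le> \<bar>P.xc b\<bar> + dy (int A + fst b)" using x by linarith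
    finally have "\<bar>real_of_int (snd a)\<bar> \<le> (\<bar>P.xc b\<bar> + dy (int A + fst b)) / dy (fst b - int A)"
      by (simp add: field_simps)
    then have "\<bar>snd a\<bar> \<le> M" unfolding M_def by linarith
    then show "a \<in> {fst b - int A..fst b + int A} \<times> {-M..M}" using l by (cases a) auto
  qed
  then show ?thesis by (rule finite_subset) simp
qed

section \<open>Stokes' formula for cochains with finitely many nonzero edges\<close>

lemma Sum_any_diff:
  fixes g h :: "'a \<Rightarrow> int"
  assumes "finite {a. g a \<noteq> 0}" "finite {a. h a \<noteq> 0}"
  shows "(\<Sum>a. g a - h a) = Sum_any g - Sum_any h"
proof -
  have "Sum_any h = - (\<Sum>a. - h a)"
    unfolding Sum_any.expand_set by (simp add: sum_negf)
  moreover have "(\<Sum>a. g a + - h a) = Sum_any g + (\<Sum>a. - h a)"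
    using assms by (intro Sum_any.distrib) auto
  ultimately show ?thesis by simp
qed

text \<open>Every horizontal edge is the top side of one cell and half of the bottom side of
  another, every vertical edge the left side of one cell and the right side of its neighbour; the
  two contributions cancel.\<close>

lemma stokes:
  fixes D :: "int \<times> int \<Rightarrow> int \<times> int \<Rightarrow> int"
  assumes H: "finite {a. D a (fst a, snd a + 1) \<noteq> 0}" and W: "finite {a. D (fst a - 1, 2 * snd a) a \<noteq> 0}"
  shows "finite {c. ev (P.cellc c) D \<noteq> 0}" "(\<Sum>c. ev (P.cellc c) D) = 0"
proof -
  define h w e1 e2 w1 where "h a = D a (fst a, snd a + 1)" and "w a = D (fst a - 1, 2 * snd a) a"
    and "e1 a = h (fst a - 1, 2 * snd a)" and "e2 a = h (fst a - 1, 2 * snd a + 1)"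
    and "w1 a = w (fst a, snd a + 1)" for a
  have ev: "ev (P.cellc c) D = (e1 c + e2 c) + (w1 c - h c - w c)" for c
    by (cases c) (simp add: P.ev_cellc h_def w_def e1_def e2_def w1_def algebra_simps)
  have fh: "finite {a. h a \<noteq> 0}" and fw: "finite {a. w a \<noteq> 0}" using H W by (auto simp: h_def w_def)
  have "{a. e1 a \<noteq> 0} \<subseteq> (\<lambda>a. (fst a + 1, snd a div 2)) ` {a. h a \<noteq> 0}"
    unfolding e1_def by (force simp: image_iff)
  then have f1: "finite {a. e1 a \<noteq> 0}" using fh finite_surj by blast
  have "{a. e2 a \<noteq> 0} \<subseteq> (\<lambda>a. (fst a + 1, snd a div 2)) ` {a. h a \<noteq> 0}"
    unfolding e2_def by (force simp: image_iff)
  then have f2: "finite {a. e2 a \<noteq> 0}" using fh finite_surj by blast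
  have "{a. w1 a \<noteq> 0} \<subseteq> (\<lambda>a. (fst a, snd a - 1)) ` {a. w a \<noteq> 0}"
    unfolding w1_def by (force simp: image_iff)
  then have f3: "finite {a. w1 a \<noteq> 0}" using fw finite_surj by blast
  have f12: "finite {a. e1 a + e2 a \<noteq> 0}"
    by (rule finite_subset[of _ "{a. e1 a \<noteq> 0} \<union> {a. e2 a \<noteq> 0}"]) (use f1 f2 in auto)
  have f3h: "finite {a. w1 a - h a \<noteq> 0}"
    by (rule finite_subset[of _ "{a. w1 a \<noteq> 0} \<union> {a. h a \<noteq> 0}"]) (use f3 fh in auto)
  have f3hw: "finite {a. w1 a - h a - w a \<noteq> 0}"
    by (rule finite_subset[of _ "{a. w1 a - h a \<noteq> 0} \<union> {a. w a \<noteq> 0}"]) (use f3h fw in auto)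
  show "finite {c. ev (P.cellc c) D \<noteq> 0}" unfolding ev
    by (rule finite_subset[of _ "{a. e1 a + e2 a \<noteq> 0} \<union> {a. w1 a - h a - w a \<noteq> 0}"]) (use f12 f3hw in auto)
  \<comment> \<open>An edge of even index is the left half of the bottom side of its cell, an edge
    of odd index the right half.\<close>
  have s1: "Sum_any e1 = sum h {a. h a \<noteq> 0 \<and> even (snd a)}" unfolding Sum_any.expand_set
    by (rule sum.reindex_bij_witness[of _ "\<lambda>a. (fst a + 1, snd a div 2)" "\<lambda>c. (fst c - 1, 2 * snd c)"])
       (auto simp: e1_def)
  have s2: "Sum_any e2 = sum h {a. h a \<noteq> 0 \<and> odd (snd a)}" unfolding Sum_any.expand_set
    by (rule sum.reindex_bij_witness[of _ "\<lambda>a. (fst a + 1, snd a div 2)" "\<lambda>c. (fst c - 1, 2 * snd c + 1)"])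
       (auto simp: e2_def)
  have s3: "Sum_any w1 = Sum_any w" unfolding Sum_any.expand_set
    by (rule sum.reindex_bij_witness[of _ "\<lambda>a. (fst a, snd a - 1)" "\<lambda>c. (fst c, snd c + 1)"])
       (auto simp: w1_def)
  have "{a. h a \<noteq> 0} = {a. h a \<noteq> 0 \<and> even (snd a)} \<union> {a. h a \<noteq> 0 \<and> odd (snd a)}" by auto
  moreover have "sum h ({a. h a \<noteq> 0 \<and> even (snd a)} \<union> {a. h a \<noteq> 0 \<and> odd (snd a)}) =
      sum h {a. h a \<noteq> 0 \<and> even (snd a)} + sum h {a. h a \<noteq> 0 \<and> odd (snd a)}"
    by (rule sum.union_disjoint) (auto intro: finite_subset[OF _ fh])
  ultimately have "Sum_any h = Sum_any e1 + Sum_any e2"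
    by (simp only: s1 s2 Sum_any.expand_set[of h])
  moreover have "(\<Sum>c. ev (P.cellc c) D) = (\<Sum>c. e1 c + e2 c) + (\<Sum>c. w1 c - h c - w c)"
    unfolding ev by (rule Sum_any.distrib[OF f12 f3hw])
  moreover have "(\<Sum>c. e1 c + e2 c) = Sum_any e1 + Sum_any e2" by (rule Sum_any.distrib[OF f1 f2])
  moreover have "(\<Sum>c. w1 c - h c - w c) = Sum_any w1 - Sum_any h - Sum_any w"
    using Sum_any_diff[OF f3h fw] Sum_any_diff[OF f3 fh] by simp
  ultimately show "(\<Sum>c. ev (P.cellc c) D) = 0" using s3 by simp
qed

text \<open>Cells are cycles, so the coboundary of \<open>s\<close> contributes nothing to any of
  them, and what remains of the difference has finite support.\<close>

lemma stokes_eq: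
  fixes J J' :: "int \<times> int \<Rightarrow> int \<times> int \<Rightarrow> int"
  assumes "finite {c. ev (P.cellc c) J \<noteq> 0}" "finite {c. ev (P.cellc c) J' \<noteq> 0}"
    and fin: "finite F" and out: "\<And>a b. a \<notin> F \<Longrightarrow> P.near 1 a b \<Longrightarrow> J a b = J' a b + (s b - s a)"
  shows "(\<Sum>c. ev (P.cellc c) J) = (\<Sum>c. ev (P.cellc c) J')"
proof -
  define D where "D a b = J a b - J' a b - (s b - s a)" for a b
  have n1: "P.near 1 a (fst a, snd a + 1)" for a
    by (auto simp: P_near P.xc_def algebra_simps)
  have n2: "P.near 1 (fst a - 1, 2 * snd a) a" for a
    using P.xc_par[of "fst a" "snd a"] by (auto simp: P_near)
  have "{a. D a (fst a, snd a + 1) \<noteq> 0} \<subseteq> F" using out[OF _ n1] by (fastforce simp: D_def)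
  then have f1: "finite {a. D a (fst a, snd a + 1) \<noteq> 0}" using fin finite_subset by blast
  have "{a. D (fst a - 1, 2 * snd a) a \<noteq> 0} \<subseteq> (\<lambda>a. (fst a + 1, snd a div 2)) ` F"
  proof
    fix a assume "a \<in> {a. D (fst a - 1, 2 * snd a) a \<noteq> 0}"
    then have "(fst a - 1, 2 * snd a) \<in> F" using out[OF _ n2, of a] by (auto simp: D_def)
    then show "a \<in> (\<lambda>a. (fst a + 1, snd a div 2)) ` F" by (rule rev_image_eqI) simp
  qed
  then have f2: "finite {a. D (fst a - 1, 2 * snd a) a \<noteq> 0}" using fin finite_surj by blast
  have "ev (P.cellc c) D = ev (P.cellc c) J - ev (P.cellc c) J'" for c
  proof -
    have "ev (P.cellc c) D = ev (P.cellc c) (\<lambda>a b. J a b - J' a b) - ev (P.cellc c) (\<lambda>a b. s b - s a)"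
      unfolding D_def by (rule ev_diff)
    then show ?thesis using cyc_exact[OF P.cyc_cellc, of c s] by (simp only: ev_diff[of _ J J'])
  qed
  then have "(\<Sum>c. ev (P.cellc c) J) - (\<Sum>c. ev (P.cellc c) J') = 0"
    using stokes(2)[OF f1 f2] Sum_any_diff[OF assms(1,2)] by simp
  then show ?thesis by simp
qed

section \<open>The degree of a proper coarse map from the plane\<close>

context horo
begin

definition pmap :: "nat \<Rightarrow> (int \<times> int \<Rightarrow> 'v \<times> int) \<Rightarrow> bool" where
  "pmap A \<phi> \<longleftrightarrow> (\<forall>a b. P.near 1 a b \<longrightarrow> near A (\<phi> a) (\<phi> b)) \<and> (\<forall>B b. finite {a. near B (\<phi> a) b})"

lemma pmap_near: "pmap A \<phi> \<Longrightarrow> P.near 1 a b \<Longrightarrow> near A (\<phi> a) (\<phi> b)"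
  and pmap_finite: "pmap A \<phi> \<Longrightarrow> finite {a. near B (\<phi> a) x}"
  unfolding pmap_def by blast+

text \<open>Preimages of a point cannot be counted for a map that is not continuous; the winding
  numbers of the images of all cells are added instead. Properness leaves finitely many nonzero
  terms.\<close>

definition deg :: "(int \<times> int \<Rightarrow> 'v \<times> int) \<Rightarrow> 'v \<Rightarrow> real \<Rightarrow> int" where
  "deg \<phi> v y = (\<Sum>c. ev (P.cellc c) (\<lambda>a b. II v y (\<phi> a) (\<phi> b)))"

lemma cell_near:
  assumes "pmap A \<phi>" "inband y (v,k)" "ev (P.cellc c) (\<lambda>a b. II v y (\<phi> a) (\<phi> b)) \<noteq> 0" "a \<in> pts (P.cellc c)"
  shows "near (3*A+3) (\<phi> a) (v,k)"
proof (rule ev_II_local[of "mapc \<phi> (P.cellc c)"])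
  show "near A x z" if "x \<in> pts (mapc \<phi> (P.cellc c))" "z \<in> pts (mapc \<phi> (P.cellc c))" for x z
    using that pmap_near[OF assms(1) P.cellc_near] unfolding pts_mapc by blast
  show "cyc (mapc \<phi> (P.cellc c))" by (rule cyc_mapc[OF P.cyc_cellc])
qed (use assms in auto)

lemma cell_finite:
  assumes "pmap A \<phi>" shows "finite {c. ev (P.cellc c) (\<lambda>a b. II v y (\<phi> a) (\<phi> b)) \<noteq> 0}"
proof -
  obtain k where "inband y (v,k)" using inband_exists by blast
  then have "{c. ev (P.cellc c) (\<lambda>a b. II v y (\<phi> a) (\<phi> b)) \<noteq> 0} \<subseteq> {a. near (3*A+3) (\<phi> a) (v,k)}"
    using cell_near[OF assms _ _ P.cellc_self] by blast
  then show ?thesis using pmap_finite[OF assms] finite_subset by blast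
qed

lemma deg_nonzero:
  assumes "pmap A \<phi>" "deg \<phi> v y \<noteq> 0" "inband y (v,k)"
  shows "\<exists>a. near (3*A+3) (\<phi> a) (v,k)"
proof -
  obtain c where "ev (P.cellc c) (\<lambda>a b. II v y (\<phi> a) (\<phi> b)) \<noteq> 0"
    using assms(2) unfolding deg_def by (rule Sum_any.not_neutral_obtains_not_neutral)
  then show ?thesis using cell_near[OF assms(1,3) _ P.cellc_self] by blast
qed

text \<open>A prism argument: the two images of an edge and the tracks of its ends form a small
  quadrilateral, and away from the centre one primitive serves all four corners. The values on the
  tracks make up the correcting coboundary.\<close>

lemma deg_homotopic:
  assumes "pmap A \<phi>" "pmap A' \<psi>" "\<And>a. near B (\<phi> a) (\<psi> a)"
  shows "deg \<phi> v y = deg \<psi> v y"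
proof -
  define C where "C = A + A' + B + B + 2"
  obtain k where k: "inband y (v,k)" using inband_exists by blast
  let ?F = "{a. near (3*C+3) (\<phi> a) (v,k)}"
  have "II v y (\<phi> a) (\<phi> b) = II v y (\<psi> a) (\<psi> b) + (II v y (\<phi> a) (\<psi> a) - II v y (\<phi> b) (\<psi> b)) \<and>
    True" if a: "a \<notin> ?F" and ab: "P.near 1 a b" for a b
  proof -
    let ?E = "{\<phi> a, \<phi> b, \<psi> a, \<psi> b}"
    have n: "near A (\<phi> a) (\<phi> b)" "near A' (\<psi> a) (\<psi> b)" "near B (\<phi> a) (\<psi> a)" "near B (\<phi> b) (\<psi> b)"
      using pmap_near[OF assms(1) ab] pmap_near[OF assms(2) ab] assms(3) by auto
    have m: "near C (\<phi> a) (\<psi> b)" "near C (\<phi> b) (\<psi> a)"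
      using near_trans[OF n(3) n(2), of C] near_trans[OF n(4) near_sym[OF n(2)], of C] by (auto simp: C_def)
    have "near C x z" if "x \<in> ?E" "z \<in> ?E" for x z
      using that n[THEN near_mono, of C] m n[THEN near_sym, THEN near_mono, of C] m[THEN near_sym]
      by (auto simp: C_def)
    from II_local[OF this _ k, where c = "\<phi> a"] a
    obtain s where "\<forall>a\<in>?E. \<forall>b\<in>?E. II v y a b = s b - s a" by blast
    then show ?thesis by simp
  qed
  then have "(\<Sum>c. ev (P.cellc c) (\<lambda>a b. II v y (\<phi> a) (\<phi> b))) = (\<Sum>c. ev (P.cellc c) (\<lambda>a b. II v y (\<psi> a) (\<psi> b)))"
    using cell_finite[OF assms(1)] cell_finite[OF assms(2)] pmap_finite[OF assms(1)]
    by (intro stokes_eq[where F = ?F and s = "\<lambda>a. - II v y (\<phi> a) (\<psi> a)"]) auto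
  then show ?thesis by (simp add: deg_def)
qed

lemma II_sg_diff:
  "II v y a b - II v y' a b = chi v (fst a) * chi v (fst b) * ((sg y b - sg y' b) - (sg y a - sg y' a))"
  by (simp add: II_def algebra_simps)

text \<open>The difference of the two cup products is a coboundary except on edges that cross the
  boundary of the branch of \<open>v\<close>, and it involves only the strip between
  \<open>y\<close> and \<open>y'\<close>. Such edges stay near \<open>v\<close> in the tree and near
  the strip, so properness makes them finite in number.\<close>

lemma deg_y: assumes "pmap A \<phi>" shows "deg \<phi> v y = deg \<phi> v y'"
proof -
  let ?d = "\<lambda>a. sg y a - sg y' a"
  define s where "s a = chi v (fst (\<phi> a)) * ?d (\<phi> a)" for a
  obtain n where n: "\<bar>y\<bar> + \<bar>y'\<bar> \<le> dy (int n)" using dy_unbounded by blast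
  define C where "C = 3*A + n + nat \<bar>lev v\<bar> + 3"
  let ?F = "{a. near C (\<phi> a) (v,0)}"
  have "II v y (\<phi> a) (\<phi> b) = II v y' (\<phi> a) (\<phi> b) + (s b - s a)"
    if a: "a \<notin> ?F" and ab: "P.near 1 a b" for a b
  proof (rule ccontr)
    assume neq: "\<not> ?thesis"
    have n0: "near A (\<phi> a) (\<phi> b)" by (rule pmap_near[OF assms(1) ab])
    have d: "up v (fst (\<phi> a)) \<noteq> up v (fst (\<phi> b))"
      using neq II_sg_diff[of v y "\<phi> a" "\<phi> b" y'] by (auto simp: s_def chi_def)
    have "?d (\<phi> a) \<noteq> 0 \<or> ?d (\<phi> b) \<noteq> 0"
      using neq II_sg_diff[of v y "\<phi> a" "\<phi> b" y'] by (auto simp: s_def)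
    moreover have "\<bar>xc e\<bar> \<le> \<bar>y\<bar> + \<bar>y'\<bar>" if "?d e \<noteq> 0" for e
      using that by (cases "xc e < y"; cases "xc e < y'") (auto simp: sg_def)
    ultimately have "\<bar>xc (\<phi> a)\<bar> \<le> \<bar>y\<bar> + \<bar>y'\<bar> \<or> \<bar>xc (\<phi> b)\<bar> \<le> \<bar>y\<bar> + \<bar>y'\<bar>"
      by blast
    then have x: "\<bar>xc (\<phi> a)\<bar> \<le> dy (int n) + dy (int A + lev (fst (\<phi> a)))"
      using n n0 dy_nonneg[of "int A + lev (fst (\<phi> a))"] unfolding near_def by linarith
    obtain i j where ij: "anc i (fst (\<phi> a)) = anc j (fst (\<phi> b))" "i \<le> A" "j \<le> A"
      using n0 by (auto simp: near_def)
    have "\<exists>i'\<le>A+A. \<exists>j'\<le>A+A. anc i' (fst (\<phi> a)) = anc j' v"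
    proof (cases "up v (fst (\<phi> a))")
      case True
      then obtain s where "s < A" "anc s (fst (\<phi> a)) = v" using up_change[OF ij(1,2)] d by blast
      then show ?thesis by (intro exI[of _ s] conjI exI[of _ 0]) auto
    next
      case False
      then obtain s where "s < A" "anc s (fst (\<phi> b)) = v" using up_change[OF ij(1)[symmetric] ij(3)] d by blast
      then show ?thesis using anc_meet_trans[OF ij(1), of s 0 v A A] ij by auto
    qed
    then obtain i' j' where ij': "i' \<le> A+A" "j' \<le> A+A" "anc i' (fst (\<phi> a)) = anc j' v" by blast
    have lv: "lev (fst (\<phi> a)) - int i' = lev v - int j'" using arg_cong[OF ij'(3), of lev] by simp
    have "\<bar>xc (\<phi> a)\<bar> \<le> dy (int (C - 1) + lev v + 1)"
      using ij' lv by (intro order_trans[OF x] dy_add_le) (auto simp: C_def)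
    moreover have "\<bar>xc (\<phi> a)\<bar> \<le> dy (int (C - 1) + lev (fst (\<phi> a)) + 1)"
      using ij' lv by (intro order_trans[OF x] dy_add_le) (auto simp: C_def)
    ultimately have "near C (\<phi> a) (v,0)" using ij'
      by (intro nearI[of i' _ j']) (auto simp: C_def xc_def algebra_simps)
    then show False using a by simp
  qed
  then show ?thesis unfolding deg_def
    using cell_finite[OF assms(1)] pmap_finite[OF assms(1)]
    by (intro stokes_eq[where F = ?F and s = s]) auto
qed

end

lemma ev_cong_pts:
  assumes "\<And>a b. a \<in> pts z \<Longrightarrow> b \<in> pts z \<Longrightarrow> J a b = J' a b" shows "ev z J = ev z J'"
proof (rule ev_cong)
  fix s a b assume "(s,a,b) \<in> set z"
  from pts_set[OF this] show "J a b = J' a b" using assms by simp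
qed

context horo
begin

lemma finite_Un_nonzero: "finite {x. f x \<noteq> (0::int)} \<Longrightarrow> finite {x. g x \<noteq> 0} \<Longrightarrow> finite {x. f x + g x \<noteq> 0}"
  by (rule finite_subset[of _ "{x. f x \<noteq> 0} \<union> {x. g x \<noteq> 0}"]) auto

lemma up_child_unique:
  assumes "up u t" "up u' t" "par u = v" "par u' = v" shows "u = u'"
proof -
  have "lev u = lev u'" using assms(3,4) lev_par[of u] lev_par[of u'] by simp
  then show ?thesis using assms(1,2) by (simp add: up_iff)
qed

lemma up_child_exists:
  assumes "up v t" "t \<noteq> v" shows "\<exists>u. par u = v \<and> up u t"
proof -
  obtain i where i: "anc i t = v" using assms(1) by (auto simp: up_def)
  with assms(2) obtain j where "i = Suc j" by (cases i) auto
  then show ?thesis using i by (intro exI[of _ "anc j t"]) (auto simp: up_def)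
qed

text \<open>Kirchhoff's law. The branch of \<open>v\<close> splits into the branches of its
  children, except for edges that lie in no single one of them. Those which also cross
  \<open>y\<close> lie near \<open>(v, y)\<close>, so Stokes' formula removes them.\<close>

lemma deg_flow:
  assumes "pmap A \<phi>"
  obtains U where "finite U" "\<And>u. u \<in> U \<Longrightarrow> par u = v" "deg \<phi> v y = (\<Sum>u\<in>U. deg \<phi> u y)"
    "\<And>u. par u = v \<Longrightarrow> u \<notin> U \<Longrightarrow> deg \<phi> u y = 0"
proof -
  define e where "e v c = ev (P.cellc c) (\<lambda>a b. II v y (\<phi> a) (\<phi> b))" for v c
  obtain k where k: "inband y (v,k)" using inband_exists by blast
  define C where "C = 6*A+6"
  let ?F = "{a. near C (\<phi> a) (v,k)}"
  have F: "finite ?F" by (rule pmap_finite[OF assms])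
  \<comment> \<open>There may be infinitely many children; only those with an image point near
    \<open>(v,k)\<close> in their branch can have nonzero degree.\<close>
  define U where "U = {u. par u = v \<and> (\<exists>a\<in>?F. up u (fst (\<phi> a)))}"
  have U_sub: "U \<subseteq> (\<Union>a\<in>?F. {u. par u = v \<and> up u (fst (\<phi> a))})" by (auto simp: U_def)
  have finch: "finite {u. par u = v \<and> up u t}" for t
  proof (cases "\<exists>u. par u = v \<and> up u t")
    case True
    then obtain u where "par u = v" "up u t" by blast
    then have "{u. par u = v \<and> up u t} = {u}" using up_child_unique by blast
    then show ?thesis by simp
  next
    case False
    then have "{u. par u = v \<and> up u t} = {}" by blast
    then show ?thesis by (simp only: finite.emptyI)
  qed
  have U: "finite U" by (rule finite_subset[OF U_sub finite_UN_I[OF F finch]])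
  have e0: "e u c = 0" if u: "par u = v" "u \<notin> U" for u c
  proof (rule ccontr)
    assume ne: "e u c \<noteq> 0"
    obtain k' where k': "inband y (u,k')" using inband_exists by blast
    have near_u: "near (3*A+3) (\<phi> a) (u,k')" if "a \<in> pts (P.cellc c)" for a
      using cell_near[OF assms k' _ that] ne by (simp add: e_def)
    have "\<exists>a\<in>pts (P.cellc c). up u (fst (\<phi> a))"
    proof (rule ccontr)
      assume "\<not> ?thesis"
      then have no: "\<And>a. a \<in> pts (P.cellc c) \<Longrightarrow> chi u (fst (\<phi> a)) = 0" by (auto simp: chi_def)
      have "e u c = ev (P.cellc c) (\<lambda>a b. 0)" unfolding e_def
      proof (rule ev_cong)
        fix s a b assume "(s,a,b) \<in> set (P.cellc c)"
        from pts_set[OF this] have "a \<in> pts (P.cellc c)" by simp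
        then show "II u y (\<phi> a) (\<phi> b) = 0" using no by (simp add: II_def)
      qed
      then show False using ne by simp
    qed
    then obtain a where a: "a \<in> pts (P.cellc c)" "up u (fst (\<phi> a))" by blast
    have l: "lev u = lev v + 1" using lev_par[of u] u by simp
    have "\<bar>xc (u,k') - xc (v,k)\<bar> \<le> dy (lev v + 1 + 1)"
      using dy_add_le[of "lev v + 1" "lev v + 1" "lev v"] k k' l dy_add_le[of "lev u" "lev v + 1" "lev v"]
      unfolding inband_def by simp
    then have "near 2 (u,k') (v,k)" using u l
      by (intro nearI[of 1 _ 0]) (auto elim!: order_trans)
    then have "near C (\<phi> a) (v,k)" using near_trans[OF near_u[OF a(1)]] by (simp add: C_def)
    then have "u \<in> U" unfolding U_def using a(2) u(1) by blast
    then show False using u(2) by blast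
  qed
  \<comment> \<open>The correction cochain: both ends above \<open>v\<close>, but not above one and
    the same child.\<close>
  define D where "D a b = II v y (\<phi> a) (\<phi> b) * of_bool (\<not> (\<exists>u. par u = v \<and> up u (fst (\<phi> a)) \<and> up u (fst (\<phi> b))))" for a b
  have D0: "a \<in> ?F" if ab: "P.near 1 a b" and ne: "D a b \<noteq> 0" for a b
  proof -
    have n: "near A (\<phi> a) (\<phi> b)" by (rule pmap_near[OF assms ab])
    have ne: "II v y (\<phi> a) (\<phi> b) \<noteq> 0" and no: "\<not> (\<exists>u. par u = v \<and> up u (fst (\<phi> a)) \<and> up u (fst (\<phi> b)))"
      using ne by (auto simp: D_def)
    have up: "up v (fst (\<phi> a))" "up v (fst (\<phi> b))" and x: "(xc (\<phi> a) < y) \<noteq> (xc (\<phi> b) < y)"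
      using ne by (auto simp: II_def chi_def sg_def)
    have "\<exists>s\<le>A. anc s (fst (\<phi> a)) = v"
    proof (cases "fst (\<phi> a) = v")
      case True then show ?thesis by (intro exI[of _ 0]) auto
    next
      case False
      then obtain u where u: "par u = v" "up u (fst (\<phi> a))" using up up_child_exists by blast
      then have "\<not> up u (fst (\<phi> b))" using no by blast
      moreover obtain i j where "anc i (fst (\<phi> a)) = anc j (fst (\<phi> b))" "i \<le> A" using n by (auto simp: near_def)
      ultimately obtain s where "s < A" "anc s (fst (\<phi> a)) = u" using up_change u by blast
      then show ?thesis using u by (intro exI[of _ "Suc s"]) auto
    qed
    then obtain s where s: "s \<le> A" "anc s (fst (\<phi> a)) = v" by blast
    then have lv: "lev v = lev (fst (\<phi> a)) - int s" by auto
    have "\<bar>xc (\<phi> a) - xc (\<phi> b)\<bar> \<le> dy (int A + lev (fst (\<phi> a)))" using n by (auto simp: near_def)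
    then have "\<bar>xc (\<phi> a) - xc (v,k)\<bar> \<le> dy (int A + lev (fst (\<phi> a))) + dy (lev v)"
      using x k unfolding inband_def by fastforce
    also have "\<dots> \<le> dy (int A + lev (fst (\<phi> a)) + 1)" using lv by (intro dy_add_le) auto
    finally have *: "\<bar>xc (\<phi> a) - xc (v,k)\<bar> \<le> dy (int A + lev (fst (\<phi> a)) + 1)" .
    have "near (2*A+1) (\<phi> a) (v,k)" using s lv
      by (intro nearI[of s _ 0] order_trans[OF *]) auto
    then show ?thesis using near_mono by (simp add: C_def)
  qed
  have n1: "P.near 1 a (fst a, snd a + 1)" for a
    by (auto simp: P_near P.xc_def algebra_simps)
  have n2: "P.near 1 (fst a - 1, 2 * snd a) a" for a
    using P.xc_par[of "fst a" "snd a"] by (auto simp: P_near)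
  have "{a. D a (fst a, snd a + 1) \<noteq> 0} \<subseteq> ?F" using D0[OF n1] by blast
  then have f1: "finite {a. D a (fst a, snd a + 1) \<noteq> 0}" using F finite_subset by blast
  have "{a. D (fst a - 1, 2 * snd a) a \<noteq> 0} \<subseteq> (\<lambda>a. (fst a + 1, snd a div 2)) ` ?F"
  proof
    fix a assume "a \<in> {a. D (fst a - 1, 2 * snd a) a \<noteq> 0}"
    then have "(fst a - 1, 2 * snd a) \<in> ?F" using D0[OF n2] by blast
    then show "a \<in> (\<lambda>a. (fst a + 1, snd a div 2)) ` ?F" by (rule rev_image_eqI) simp
  qed
  then have f2: "finite {a. D (fst a - 1, 2 * snd a) a \<noteq> 0}" using F finite_surj by blast
  note st = stokes[of D, OF f1 f2]
  have cell: "e v c = (\<Sum>u\<in>U. e u c) + ev (P.cellc c) D" for c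
  proof -
    define Q where "Q = U \<union> {u. par u = v \<and> (\<exists>a\<in>pts (P.cellc c). up u (fst (\<phi> a)))}"
    have "{u. par u = v \<and> (\<exists>a\<in>pts (P.cellc c). up u (fst (\<phi> a)))} \<subseteq>
        (\<Union>a\<in>pts (P.cellc c). {u. par u = v \<and> up u (fst (\<phi> a))})" by auto
    moreover have "finite (\<Union>a\<in>pts (P.cellc c). {u. par u = v \<and> up u (fst (\<phi> a))})"
      using finch by (intro finite_UN_I) auto
    ultimately have Q: "finite Q" using U finite_subset unfolding Q_def by blast
    have Qv: "par u = v" if "u \<in> Q" for u using that by (auto simp: Q_def U_def)
    have "II v y (\<phi> a) (\<phi> b) = (\<Sum>u\<in>Q. II u y (\<phi> a) (\<phi> b)) + D a b"
      if ab: "a \<in> pts (P.cellc c)" "b \<in> pts (P.cellc c)" for a b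
    proof (cases "\<exists>u. par u = v \<and> up u (fst (\<phi> a)) \<and> up u (fst (\<phi> b))")
      case True
      then obtain u where u: "par u = v" "up u (fst (\<phi> a))" "up u (fst (\<phi> b))" by blast
      then have uQ: "u \<in> Q" using ab by (auto simp: Q_def)
      have "(\<Sum>u\<in>Q. II u y (\<phi> a) (\<phi> b)) = (\<Sum>u\<in>{u}. II u y (\<phi> a) (\<phi> b))"
        using Q uQ u Qv up_child_unique by (intro sum.mono_neutral_right) (auto simp: II_def chi_def)
      moreover have "up v (fst (\<phi> a))" "up v (fst (\<phi> b))" using u up_par by blast+
      ultimately show ?thesis using u True by (auto simp: D_def II_def chi_def)
    next
      case False
      then have "(\<Sum>u\<in>Q. II u y (\<phi> a) (\<phi> b)) = 0"
        using Qv by (intro sum.neutral) (auto simp: II_def chi_def)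
      then show ?thesis using False by (simp add: D_def)
    qed
    then have "e v c = ev (P.cellc c) (\<lambda>a b. (\<Sum>u\<in>Q. II u y (\<phi> a) (\<phi> b)) + D a b)"
      unfolding e_def by (rule ev_cong_pts)
    also have "\<dots> = (\<Sum>u\<in>Q. e u c) + ev (P.cellc c) D" by (simp add: ev_add ev_sum e_def)
    also have "(\<Sum>u\<in>Q. e u c) = (\<Sum>u\<in>U. e u c)"
    proof (rule sum.mono_neutral_right[OF Q])
      show "U \<subseteq> Q" unfolding Q_def by blast
      show "\<forall>u\<in>Q - U. e u c = 0" using Qv e0 by blast
    qed
    finally show ?thesis .
  qed
  have fe: "finite {c. e u c \<noteq> 0}" for u using cell_finite[OF assms] by (simp add: e_def)
  have fs: "finite W \<Longrightarrow> finite {c. (\<Sum>u\<in>W. e u c) \<noteq> 0} \<and> (\<Sum>c. \<Sum>u\<in>W. e u c) = (\<Sum>u\<in>W. \<Sum>c. e u c)" for W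
  proof (induction W rule: finite_induct)
    case (insert x W)
    have f2: "finite {c. (\<Sum>u\<in>W. e u c) \<noteq> 0}" using insert by blast
    have "(\<Sum>u\<in>insert x W. e u c) = e x c + (\<Sum>u\<in>W. e u c)" for c using insert(1,2) by simp
    then show ?case using finite_Un_nonzero[OF fe[of x] f2] Sum_any.distrib[OF fe[of x] f2] insert by simp
  qed auto
  have "deg \<phi> v y = (\<Sum>c. (\<Sum>u\<in>U. e u c) + ev (P.cellc c) D)"
    unfolding deg_def e_def[symmetric] cell ..
  also have "\<dots> = (\<Sum>c. \<Sum>u\<in>U. e u c) + (\<Sum>c. ev (P.cellc c) D)"
    using fs[OF U] st by (intro Sum_any.distrib) auto
  also have "\<dots> = (\<Sum>u\<in>U. deg \<phi> u y)" using fs[OF U] st by (simp add: deg_def e_def)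
  finally have 1: "deg \<phi> v y = (\<Sum>u\<in>U. deg \<phi> u y)" .
  have 2: "deg \<phi> u y = 0" if "par u = v" "u \<notin> U" for u
    using e0[OF that] by (simp add: deg_def e_def[symmetric])
  have 3: "par u = v" if "u \<in> U" for u using that by (simp add: U_def)
  show ?thesis by (rule that[OF U 3 1 2])
qed

subsection \<open>Lines\<close>

definition isline :: "(int \<Rightarrow> 'v) \<Rightarrow> bool" where
  "isline l \<longleftrightarrow> (\<forall>n. lev (l n) = n \<and> par (l (n + 1)) = l n)"

lemma isline_lev: "isline l \<Longrightarrow> lev (l n) = n" by (simp add: isline_def)

lemma isline_anc: "isline l \<Longrightarrow> anc i (l n) = l (n - int i)"
proof (induction i)
  case (Suc i)
  have "par (l (n - int (Suc i) + 1)) = l (n - int (Suc i))" using Suc(2) unfolding isline_def by blast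
  moreover have "n - int (Suc i) + 1 = n - int i" by simp
  ultimately show ?case using Suc by (simp only: funpow.simps o_apply)
qed simp

lemma isline_up: "isline l \<Longrightarrow> up v (l n) \<longleftrightarrow> lev v \<le> n \<and> v = l (lev v)"
  by (auto simp: up_iff isline_lev isline_anc)

definition emb :: "(int \<Rightarrow> 'v) \<Rightarrow> int \<times> int \<Rightarrow> 'v \<times> int" where
  "emb l a = (l (fst a), snd a)"

lemma xc_emb: "isline l \<Longrightarrow> xc (emb l a) = P.xc a"
  by (simp add: xc_def P.xc_def emb_def isline_lev)

lemma near_emb: assumes "isline l" shows "near A (emb l a) (emb l b) \<longleftrightarrow> P.near A a b"
proof -
  have "anc i (l n) = anc j (l m) \<longleftrightarrow> n - int i = m - int j" for i j n m
    using isline_lev[OF assms] unfolding isline_anc[OF assms] by metis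
  then show ?thesis unfolding near_def P.near_def xc_emb[OF assms]
    by (simp add: emb_def isline_lev[OF assms])
qed

text \<open>All points of the preimage lie near any chosen one of them, and balls of the plane are
  finite.\<close>

lemma finite_preball:
  assumes "\<And>B a b. near B (\<phi> a) (\<phi> b) \<Longrightarrow> P.near (g B) a b"
  shows "finite {a. near B (\<phi> a) x}"
proof (cases "\<exists>a. near B (\<phi> a) x")
  case True
  then obtain a0 where a0: "near B (\<phi> a0) x" by blast
  have "{a. near B (\<phi> a) x} \<subseteq> {a. P.near (g (2*B+1)) a a0}"
  proof
    fix a assume "a \<in> {a. near B (\<phi> a) x}"
    then have "near (2*B+1) (\<phi> a) (\<phi> a0)" using near_trans[OF _ near_sym[OF a0]] by simp
    then show "a \<in> {a. P.near (g (2*B+1)) a a0}" using assms by blast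
  qed
  then show ?thesis using P_finite_ball finite_subset by blast
next
  case False
  then have "{a. near B (\<phi> a) x} = {}" by blast
  then show ?thesis by (simp only: finite.emptyI)
qed

lemma pmap_emb: assumes "isline l" shows "pmap 1 (emb l)"
  unfolding pmap_def near_emb[OF assms] using finite_preball[of "emb l" "\<lambda>B. B"] near_emb[OF assms] by blast

text \<open>Normalization of the degree. If \<open>v\<close> is on the line, exactly one cell
  counts: the one whose top edge crosses \<open>yy v k\<close> in the row of \<open>v\<close>, while
  its bottom side lies outside the branch. In higher cells everything is in the branch and
  cancels.\<close>

lemma deg_emb:
  assumes "isline l" shows "deg (emb l) v (yy v k) = of_bool (v \<in> range l)"
proof (cases "v \<in> range l")
  case False
  have "chi v (fst (emb l a)) = 0" for a
    using False isline_up[OF assms, of v] by (auto simp: chi_def emb_def)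
  then show ?thesis using False by (simp add: deg_def II_def)
next
  case True
  then obtain n0 where n0: "v = l n0" by blast
  let ?J = "\<lambda>a b. II v (yy v k) (emb l a) (emb l b)"
  have chi: "chi v (fst (emb l a)) = of_bool (n0 \<le> fst a)" for a
    using isline_up[OF assms, of v "fst a"] n0 isline_lev[OF assms] by (simp add: chi_def emb_def)
  have J: "?J a b = of_bool (n0 \<le> fst a) * of_bool (n0 \<le> fst b) * (sg (yy v k) (emb l b) - sg (yy v k) (emb l a))" for a b
    unfolding II_def chi by simp
  have s: "sg (yy v k) (emb l (n0, j)) = of_bool (j \<le> k)" for j
  proof -
    have "xc (emb l (n0,j)) < yy v k \<longleftrightarrow> real_of_int j < real_of_int k + 1/2"
      unfolding xc_emb[OF assms] by (simp add: P.xc_def yy_def n0 isline_lev[OF assms] mult_less_cancel_right_pos)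
    also have "\<dots> \<longleftrightarrow> j \<le> k" by linarith
    finally show ?thesis by (simp add: sg_def)
  qed
  have "ev (P.cellc c) ?J = (if c = (n0,k) then 1 else 0)" for c
  proof -
    obtain n m where c: "c = (n,m)" by force
    consider "n < n0" | "n = n0" | "n > n0" by linarith
    then show ?thesis
    proof cases
      case 1 then show ?thesis by (simp add: c P.ev_cellc J)
    next
      case 2 then show ?thesis by (auto simp add: c P.ev_cellc J s)
    next
      case 3 then show ?thesis by (simp add: c P.ev_cellc J)
    qed
  qed
  then show ?thesis using True by (simp add: deg_def)
qed

subsection \<open>A discrete Poincare lemma\<close>

text \<open>The primitive of \<open>\<theta>\<close> along the row of \<open>t\<close>, normalized
  to vanish at index 0.\<close>

definition pot :: "('v \<times> int \<Rightarrow> 'v \<times> int \<Rightarrow> int) \<Rightarrow> 'v \<Rightarrow> int \<Rightarrow> int" where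
  "pot \<theta> t k = (if 0 \<le> k then \<Sum>j\<in>{0..<k}. \<theta> (t,j) (t,j+1) else - (\<Sum>j\<in>{k..<0}. \<theta> (t,j) (t,j+1)))"

lemma pot_step: "pot \<theta> t (k + 1) - pot \<theta> t k = \<theta> (t,k) (t,k+1)"
proof (cases "0 \<le> k")
  case True
  then have "{0..<k+1} = insert k {0..<k}" by auto
  then show ?thesis using True by (simp add: pot_def)
next
  case False
  then have "{k..<0} = insert k {k+1..<0}" by auto
  then show ?thesis using False by (auto simp: pot_def)
qed

text \<open>The deviation of \<open>\<theta>\<close> on the vertical edge below \<open>(v,k)\<close>
  from the two row potentials. By \<open>AA_step\<close> its increments in \<open>k\<close> are the
  values of \<open>\<theta>\<close> on cells, so it integrates the curvature of
  \<open>\<theta>\<close> along the row.\<close>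

definition AA :: "('v \<times> int \<Rightarrow> 'v \<times> int \<Rightarrow> int) \<Rightarrow> 'v \<Rightarrow> int \<Rightarrow> int" where
  "AA \<theta> v k = \<theta> (par v, 2*k) (v,k) - pot \<theta> v k + pot \<theta> (par v) (2*k)"

lemma AA_step: "AA \<theta> v (k + 1) - AA \<theta> v k = ev (cellc (v,k)) \<theta>"
  using pot_step[of \<theta> v k] pot_step[of \<theta> "par v" "2*k"] pot_step[of \<theta> "par v" "2*k+1"]
  by (simp add: AA_def ev_cellc algebra_simps)

text \<open>The index at which the vertical descent from \<open>b\<close> meets the row of
  \<open>v\<close>; each step down doubles the index.\<close>

definition pos :: "'v \<Rightarrow> 'v \<times> int \<Rightarrow> int" where "pos v b = 2 ^ nat (lev (fst b) - lev v) * snd b"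

definition DD :: "('v \<times> int \<Rightarrow> 'v \<times> int \<Rightarrow> int) \<Rightarrow> 'v \<Rightarrow> 'v \<times> int \<Rightarrow> int" where
  "DD \<theta> v b = AA \<theta> v (pos v b)"

definition Anc :: "'v \<times> int \<Rightarrow> 'v set" where "Anc b = {v. up v (fst b)}"

text \<open>The value of \<open>\<theta>\<close> along the edge path that descends from \<open>b\<close> to the meet, moves
  horizontally and ascends to \<open>b'\<close>, written in terms of potentials.\<close>

definition Th :: "('v \<times> int \<Rightarrow> 'v \<times> int \<Rightarrow> int) \<Rightarrow> 'v \<times> int \<Rightarrow> 'v \<times> int \<Rightarrow> int" where
  "Th \<theta> b b' = pot \<theta> (fst b') (snd b') - pot \<theta> (fst b) (snd b)
     + (\<Sum>v\<in>Anc b' - Anc b. DD \<theta> v b') - (\<Sum>v\<in>Anc b - Anc b'. DD \<theta> v b)"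

lemma int_telescope:
  fixes F :: "int \<Rightarrow> int"
  assumes "lo \<le> j" shows "(\<Sum>i\<in>{lo..<j}. F (i+1) - F i) = F j - F lo"
  using assms
proof (induction j rule: int_ge_induct)
  case (step j)
  then have "{lo..<j+1} = insert j {lo..<j}" by auto
  then show ?case using step by simp
qed simp

lemma int_step_sum:
  fixes F :: "int \<Rightarrow> int"
  assumes "lo \<le> j" "j \<le> hi"
  shows "F j = F lo + (\<Sum>i\<in>{lo..<hi}. (F (i+1) - F i) * of_bool (i < j))"
proof -
  have "(\<Sum>i\<in>{lo..<hi}. (F (i+1) - F i) * of_bool (i < j)) = (\<Sum>i\<in>{lo..<j}. F (i+1) - F i)"
    using assms by (intro sum.mono_neutral_cong_right) auto
  then show ?thesis using int_telescope[OF assms(1), of F] by simp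
qed

lemma sg_yy:
  assumes "up v (fst b)" shows "sg (yy v i) b = 1 - of_bool (i < pos v b)"
proof -
  let ?n = "nat (lev (fst b) - lev v)"
  have "anc ?n (fst b) = v" using assms by (simp add: up_iff)
  then have "xc b = xc (v, pos v b)" using xc_anc[of ?n "fst b" "snd b"] by (simp add: pos_def)
  then have "xc b < yy v i \<longleftrightarrow> real_of_int (pos v b) < real_of_int i + 1/2"
    by (simp add: xc_def yy_def mult_less_cancel_right_pos)
  also have "\<dots> \<longleftrightarrow> \<not> (i < pos v b)" by linarith
  finally show ?thesis by (simp add: sg_def)
qed

definition conn :: "'v \<times> int \<Rightarrow> 'v \<times> int \<Rightarrow> bool" where
  "conn a b \<longleftrightarrow> (\<exists>i j. anc i (fst a) = anc j (fst b))"

lemma near_conn: "near A a b \<Longrightarrow> conn a b"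
  by (auto simp: near_def conn_def)

lemma conn_finite:
  assumes "conn a b" shows "finite (Anc a - Anc b)" "finite (Anc b - Anc a)"
proof -
  obtain i j where ij: "anc i (fst a) = anc j (fst b)" using assms by (auto simp: conn_def)
  have "Anc a - Anc b \<subseteq> (\<lambda>s. anc s (fst a)) ` {..<i}"
    using up_change[OF ij order_refl] by (auto simp: Anc_def)
  then show "finite (Anc a - Anc b)" using finite_surj by blast
  have "Anc b - Anc a \<subseteq> (\<lambda>s. anc s (fst b)) ` {..<j}"
    using up_change[OF ij[symmetric] order_refl] by (auto simp: Anc_def)
  then show "finite (Anc b - Anc a)" using finite_surj by blast
qed

text \<open>A cycle is filled by cells, each taken as often as the cycle winds around it. Its edges
  may be long; \<open>Th \<theta>\<close> is designed so that integrating it over them amounts to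
  integrating \<open>\<theta>\<close> over the boundary of the filling.\<close>

lemma fill:
  assumes z: "cyc z" and conn: "\<And>s a b. (s,a,b) \<in> set z \<Longrightarrow> conn a b"
  shows "finite {vi. ev z (II (fst vi) (yy (fst vi) (snd vi))) \<noteq> 0}"
    and "ev z (Th \<theta>) = (\<Sum>vi. ev (cellc vi) \<theta> * ev z (II (fst vi) (yy (fst vi) (snd vi))))"
proof -
  \<comment> \<open>Only vertices in \<open>W\<close> separate the two ends of some edge; for all
    others the cup product is exact along \<open>z\<close>.\<close>
  define W where "W = (\<Union>(s,a,b)\<in>set z. (Anc a - Anc b) \<union> (Anc b - Anc a))"
  have W: "finite W" unfolding W_def using conn conn_finite by (intro finite_UN_I) auto
  define lo where "lo v = Min (insert 0 (pos v ` pts z))" for v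
  define hi where "hi v = Max (insert 0 (pos v ` pts z))" for v
  have lohi: "lo v \<le> pos v b \<and> pos v b \<le> hi v" if "b \<in> pts z" for v b
    using that by (auto simp: lo_def hi_def intro!: Min_le Max_ge)
  define Q where "Q = Sigma W (\<lambda>v. {lo v..<hi v})"
  have Q: "finite Q" using W by (auto simp: Q_def)
  have out: "ev z (II v (yy v i)) = 0" if "(v,i) \<notin> Q" for v i
  proof (cases "v \<in> W")
    case False
    show ?thesis
    proof (rule cyc_exact_on[OF z])
      fix s a b assume "(s,a,b) \<in> set z"
      then have "chi v (fst a) = chi v (fst b)" using False by (force simp: W_def Anc_def chi_def)
      then show "II v (yy v i) a b = chi v (fst b) * sg (yy v i) b - chi v (fst a) * sg (yy v i) a"
        by (auto simp: II_def chi_def)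
    qed
  next
    case True
    then have i: "i < lo v \<or> hi v \<le> i" using that by (auto simp: Q_def)
    have "ev z (II v (yy v i)) = ev z (\<lambda>a b. 0)"
    proof (rule ev_cong)
      fix s a b assume "(s,a,b) \<in> set z"
      then have ab: "a \<in> pts z" "b \<in> pts z" using pts_set[of s a b z] by auto
      show "II v (yy v i) a b = 0"
      proof (cases "up v (fst a) \<and> up v (fst b)")
        case True
        then show ?thesis using i lohi[OF ab(1), of v] lohi[OF ab(2), of v] by (auto simp: II_def sg_yy)
      qed (auto simp: II_def chi_def)
    qed
    then show ?thesis by simp
  qed
  then have sub: "{vi. ev z (II (fst vi) (yy (fst vi) (snd vi))) \<noteq> 0} \<subseteq> Q"
    by (metis (mono_tags, lifting) mem_Collect_eq prod.collapse subsetI)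
  then show "finite {vi. ev z (II (fst vi) (yy (fst vi) (snd vi))) \<noteq> 0}" using Q finite_subset by blast
  \<comment> \<open>The part of \<open>Th \<theta>\<close> that is a coboundary along
    \<open>z\<close>. What is left over sums the cell values between the positions of the two ends,
    which is where the cup product appears.\<close>
  define S where "S b = pot \<theta> (fst b) (snd b) + (\<Sum>v\<in>W. chi v (fst b) * DD \<theta> v b)" for b
  have "Th \<theta> a b = (S b - S a) + (\<Sum>vi\<in>Q. ev (cellc vi) \<theta> * II (fst vi) (yy (fst vi) (snd vi)) a b)"
    if ab: "(s,a,b) \<in> set z" for s a b
  proof -
    have p: "a \<in> pts z" "b \<in> pts z" using pts_set[OF ab] by auto
    have sub: "Anc b - Anc a \<subseteq> W" "Anc a - Anc b \<subseteq> W"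
      unfolding W_def by (rule subset_trans[OF _ UN_upper[OF ab]], simp)+
    have 1: "(\<Sum>v\<in>Anc b - Anc a. DD \<theta> v b) = (\<Sum>v\<in>W. (1 - chi v (fst a)) * chi v (fst b) * DD \<theta> v b)"
      using W sub by (intro sum.mono_neutral_cong_left) (auto simp: Anc_def chi_def)
    have 2: "(\<Sum>v\<in>Anc a - Anc b. DD \<theta> v a) = (\<Sum>v\<in>W. chi v (fst a) * (1 - chi v (fst b)) * DD \<theta> v a)"
      using W sub by (intro sum.mono_neutral_cong_left) (auto simp: Anc_def chi_def)
    have 3: "chi v (fst a) * chi v (fst b) * (DD \<theta> v a - DD \<theta> v b)
       = (\<Sum>i\<in>{lo v..<hi v}. ev (cellc (v,i)) \<theta> * II v (yy v i) a b)" for v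
    proof (cases "up v (fst a) \<and> up v (fst b)")
      case True
      have "DD \<theta> v a - DD \<theta> v b = (\<Sum>i\<in>{lo v..<hi v}. (AA \<theta> v (i+1) - AA \<theta> v i) * (of_bool (i < pos v a) - of_bool (i < pos v b)))"
        using int_step_sum[of "lo v" "pos v a" "hi v" "AA \<theta> v"] int_step_sum[of "lo v" "pos v b" "hi v" "AA \<theta> v"]
          lohi[OF p(1), of v] lohi[OF p(2), of v]
        by (simp add: DD_def right_diff_distrib sum_subtractf)
      then show ?thesis using True by (simp add: II_def AA_step sg_yy) (simp add: chi_def)
    qed (auto simp: chi_def II_def)
    have "(\<Sum>v\<in>W. (1 - chi v (fst a)) * chi v (fst b) * DD \<theta> v b) - (\<Sum>v\<in>W. chi v (fst a) * (1 - chi v (fst b)) * DD \<theta> v a)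
      = (\<Sum>v\<in>W. chi v (fst b) * DD \<theta> v b) - (\<Sum>v\<in>W. chi v (fst a) * DD \<theta> v a)
        + (\<Sum>v\<in>W. chi v (fst a) * chi v (fst b) * (DD \<theta> v a - DD \<theta> v b))"
      unfolding sum_subtractf[symmetric] sum.distrib[symmetric] by (intro sum.cong) (auto simp: algebra_simps)
    also have "(\<Sum>v\<in>W. chi v (fst a) * chi v (fst b) * (DD \<theta> v a - DD \<theta> v b)) =
      (\<Sum>vi\<in>Q. ev (cellc vi) \<theta> * II (fst vi) (yy (fst vi) (snd vi)) a b)"
      unfolding 3 Q_def using W by (subst sum.Sigma) (auto intro!: sum.cong)
    finally show ?thesis unfolding Th_def 1 2 S_def by simp
  qed
  then have "ev z (Th \<theta>) = ev z (\<lambda>a b. (S b - S a) + (\<Sum>vi\<in>Q. ev (cellc vi) \<theta> * II (fst vi) (yy (fst vi) (snd vi)) a b))"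
    by (intro ev_cong) blast
  also have "\<dots> = (\<Sum>vi\<in>Q. ev (cellc vi) \<theta> * ev z (II (fst vi) (yy (fst vi) (snd vi))))"
    unfolding ev_add ev_sum ev_cmult using cyc_exact[OF z, of S] by simp
  also have "\<dots> = (\<Sum>vi. ev (cellc vi) \<theta> * ev z (II (fst vi) (yy (fst vi) (snd vi))))"
    using Q sub by (intro Sum_any.expand_superset[symmetric]) auto
  finally show "ev z (Th \<theta>) = (\<Sum>vi. ev (cellc vi) \<theta> * ev z (II (fst vi) (yy (fst vi) (snd vi))))" .
qed

text \<open>The path behind \<open>Th\<close> goes down to the meet, across and up, and never leaves
  the ball of radius \<open>2*A+1\<close> about \<open>b\<close>; a primitive on that ball
  telescopes along it.\<close>

lemma Th_exact:
  assumes n: "near A b b'"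
    and ex: "\<And>e e'. near (2*A+1) b e \<Longrightarrow> near (2*A+1) b e' \<Longrightarrow> \<theta> e e' = s e' - s e"
  shows "Th \<theta> b b' = s b' - s b"
proof -
  obtain t k t' k' where b: "b = (t,k)" "b' = (t',k')" by force
  obtain i0 j0 where ij0: "i0 \<le> A" "j0 \<le> A" "anc i0 t = anc j0 t'"
    using n unfolding near_def b by auto
  \<comment> \<open>With the least such \<open>i\<close> the points \<open>anc l t\<close> with
    \<open>l < i\<close> are exactly the ancestors of \<open>t\<close> that are not ancestors of
    \<open>t'\<close>.\<close>
  define i where "i = (LEAST i. \<exists>j. anc i t = anc j t')"
  have "\<exists>j. anc i t = anc j t'" unfolding i_def by (rule LeastI) (use ij0 in blast)
  then obtain j where j: "anc i t = anc j t'" by blast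
  have min: "i \<le> l" if "anc l t = anc l' t'" for l l' unfolding i_def using that by (intro Least_le) blast
  have lev: "lev t - int i = lev t' - int j" using arg_cong[OF j, of lev] by simp
  have lev0: "lev t - int i0 = lev t' - int j0" using arg_cong[OF ij0(3), of lev] by simp
  have iA: "i \<le> A" using min[OF ij0(3)] ij0 by simp
  have jA: "j \<le> A" using min[OF ij0(3)] ij0 lev lev0 by linarith
  have 1: "Anc b - Anc b' = (\<lambda>l. anc l t) ` {..<i}"
  proof (intro set_eqI iffI)
    fix v assume "v \<in> Anc b - Anc b'"
    then obtain l where "v = anc l t" "\<not> up v t'" by (auto simp: Anc_def b up_def)
    moreover have "l < i"
    proof (rule ccontr)
      assume "\<not> l < i"
      then have "v = anc (l - i) (anc j t')" using \<open>v = anc l t\<close> by (simp add: anc_anc flip: j)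
      then show False using \<open>\<not> up v t'\<close> by (auto simp: up_def anc_anc)
    qed
    ultimately show "v \<in> (\<lambda>l. anc l t) ` {..<i}" by blast
  next
    fix v assume "v \<in> (\<lambda>l. anc l t) ` {..<i}"
    then obtain l where l: "v = anc l t" "l < i" by auto
    have "\<not> up v t'"
    proof
      assume "up v t'"
      then obtain l' where "anc l' t' = anc l t" using l by (auto simp: up_def)
      from min[OF this[symmetric]] show False using l(2) by simp
    qed
    then show "v \<in> Anc b - Anc b'" using l by (auto simp: Anc_def b up_def)
  qed
  have 2: "Anc b' - Anc b = (\<lambda>l. anc l t') ` {..<j}"
  proof (intro set_eqI iffI)
    fix v assume "v \<in> Anc b' - Anc b"
    then obtain l where "v = anc l t'" "\<not> up v t" by (auto simp: Anc_def b up_def)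
    moreover have "l < j"
    proof (rule ccontr)
      assume "\<not> l < j"
      then have "v = anc (l - j) (anc i t)" using \<open>v = anc l t'\<close> by (simp add: anc_anc j)
      then show False using \<open>\<not> up v t\<close> by (auto simp: up_def anc_anc)
    qed
    ultimately show "v \<in> (\<lambda>l. anc l t') ` {..<j}" by blast
  next
    fix v assume "v \<in> (\<lambda>l. anc l t') ` {..<j}"
    then obtain l where l: "v = anc l t'" "l < j" by auto
    have "\<not> up v t"
    proof
      assume "up v t"
      then obtain l'' where l'': "anc l'' t = anc l t'" using l by (auto simp: up_def)
      have "lev t - int l'' = lev t' - int l" using arg_cong[OF l'', of lev] by simp
      then show False using min[OF l''] lev l(2) by linarith
    qed
    then show "v \<in> Anc b' - Anc b" using l by (auto simp: Anc_def b up_def)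
  qed
  have inj: "inj_on (\<lambda>l. anc l u) B" for u B
  proof (rule inj_onI)
    fix l l' assume "anc l u = anc l' u"
    from arg_cong[OF this, of lev] show "l = l'" by simp
  qed
  define G where "G u q l = pot \<theta> (anc l u) (2^l * q) - s (anc l u, 2^l * q)" for u q l
  have tele: "(\<Sum>l<m. DD \<theta> (anc l u) (u,q)) = G u q m - G u q 0"
    if nr: "\<And>l. l \<le> m \<Longrightarrow> near (2*A+1) b (anc l u, 2^l * q)" for u q m
  proof -
    have "DD \<theta> (anc l u) (u,q) = G u q (Suc l) - G u q l" if "l < m" for l
    proof -
      have "\<theta> (anc (Suc l) u, 2^Suc l * q) (anc l u, 2^l*q) = s (anc l u, 2^l*q) - s (anc (Suc l) u, 2^Suc l * q)"
        using nr[of "Suc l"] nr[of l] that by (intro ex) auto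
      then show ?thesis unfolding DD_def AA_def G_def pos_def by (simp add: mult.assoc)
    qed
    then have "(\<Sum>l<m. DD \<theta> (anc l u) (u,q)) = (\<Sum>l<m. G u q (Suc l) - G u q l)" by simp
    also have "\<dots> = G u q m - G u q 0" by (rule sum_lessThan_telescope)
    finally show ?thesis .
  qed
  have nA: "near A (u,q) (anc l u, 2^l*q)" if "l \<le> A" for u q l
    using that xc_anc[of l u q] by (intro nearI[of l _ 0]) auto
  have t1: "(\<Sum>v\<in>Anc b - Anc b'. DD \<theta> v b) = G t k i - G t k 0"
  proof -
    have "near (2*A+1) b (anc l t, 2^l * k)" if "l \<le> i" for l
      using near_mono[OF nA[of l t k], of "2*A+1"] that iA by (simp add: b)
    from tele[OF this] show ?thesis by (simp only: 1 sum.reindex[OF inj] o_def) (simp only: b(1))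
  qed
  have t2: "(\<Sum>v\<in>Anc b' - Anc b. DD \<theta> v b') = G t' k' j - G t' k' 0"
  proof -
    have "near (2*A+1) b (anc l t', 2^l * k')" if "l \<le> j" for l
      using near_trans[OF n, of A "(anc l t', 2^l * k')" "2*A+1"] nA[of l t' k'] that jA by (simp add: b)
    from tele[OF this] show ?thesis by (simp only: 2 sum.reindex[OF inj] o_def) (simp only: b(2))
  qed
  define m where "m = anc i t"
  define x x' where "x = 2^i * k" and "x' = 2^j * k'"
  have xx: "xc (m,x) = xc b" "xc (m,x') = xc b'"
    using xc_anc[of i t k] xc_anc[of j t' k'] by (simp_all add: m_def x_def x'_def b j)
  have nb: "near (2*A+1) b (m,q)" if "min x x' \<le> q" "q \<le> max x x'" for q
  proof -
    have "\<bar>real_of_int x - real_of_int q\<bar> \<le> \<bar>real_of_int x - real_of_int x'\<bar>" using that by linarith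
    then have "\<bar>real_of_int x - real_of_int q\<bar> * dy (lev m) \<le> \<bar>real_of_int x - real_of_int x'\<bar> * dy (lev m)"
      by (rule mult_right_mono) simp
    then have "\<bar>xc (m,x) - xc (m,q)\<bar> \<le> \<bar>xc (m,x) - xc (m,x')\<bar>"
      by (simp add: xc_def abs_mult left_diff_distrib[symmetric])
    also have "\<dots> \<le> dy (int A + lev t)" using n by (simp add: xx near_def b)
    finally have *: "\<bar>xc b - xc (m,q)\<bar> \<le> dy (int A + lev t)" by (simp add: xx)
    show ?thesis using iA
      by (intro nearI[of i _ 0] order_trans[OF *]) (auto simp: b m_def)
  qed
  have const: "pot \<theta> m (max x x') - s (m, max x x') = pot \<theta> m (min x x') - s (m, min x x')"
  proof -
    have "(\<Sum>q\<in>{min x x'..<max x x'}. (pot \<theta> m (q+1) - s (m,q+1)) - (pot \<theta> m q - s (m,q))) = 0"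
    proof (rule sum.neutral, rule ballI)
      fix q assume q: "q \<in> {min x x'..<max x x'}"
      have "\<theta> (m,q) (m,q+1) = s (m,q+1) - s (m,q)" using nb[of q] nb[of "q+1"] q by (intro ex) auto
      then show "(pot \<theta> m (q+1) - s (m,q+1)) - (pot \<theta> m q - s (m,q)) = 0" using pot_step[of \<theta> m q] by simp
    qed
    then show ?thesis using int_telescope[of "min x x'" "max x x'" "\<lambda>q. pot \<theta> m q - s (m,q)"] by simp
  qed
  then have "G t k i = G t' k' j" unfolding G_def j[symmetric] m_def[symmetric] x_def[symmetric] x'_def[symmetric]
    by (cases "x \<le> x'") (auto simp: max_def min_def)
  then show ?thesis unfolding Th_def t1 t2 by (simp add: G_def b)
qed

end

section \<open>Degrees detect the vertices on a line\<close>

text \<open>The two bounds are stated over \<open>V\<close> because in the models \<open>par\<close>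
  is a total function on a type in which the genuine vertices form a proper subset.\<close>

locale rigid = X: horo par lev + Y: horo par' lev'
  for par :: "'v \<Rightarrow> 'v" and lev and par' :: "'w \<Rightarrow> 'w" and lev' +
  fixes V :: "'v set" and f :: "'v \<times> int \<Rightarrow> 'w \<times> int" and K :: nat
  assumes f_near: "fst a \<in> V \<Longrightarrow> fst b \<in> V \<Longrightarrow> X.near A a b \<Longrightarrow> Y.near (K*A+K) (f a) (f b)"
    and f_far: "fst a \<in> V \<Longrightarrow> fst b \<in> V \<Longrightarrow> Y.near A (f a) (f b) \<Longrightarrow> X.near (K*A+K) a b"
begin

definition inl :: "(int \<Rightarrow> 'v) \<Rightarrow> bool" where "inl l \<longleftrightarrow> X.isline l \<and> range l \<subseteq> V"

definition phi :: "(int \<Rightarrow> 'v) \<Rightarrow> int \<times> int \<Rightarrow> 'w \<times> int" where "phi l a = f (X.emb l a)"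

lemma inl_line: "inl l \<Longrightarrow> X.isline l" and inl_V: "inl l \<Longrightarrow> fst (X.emb l a) \<in> V"
  by (auto simp: inl_def X.emb_def)

lemma phi_near: "inl l \<Longrightarrow> P.near A a b \<Longrightarrow> Y.near (K*A+K) (phi l a) (phi l b)"
  using f_near[OF inl_V inl_V, of l l A a b] X.near_emb[OF inl_line, of l A a b] by (simp add: phi_def)

lemma phi_far: "inl l \<Longrightarrow> Y.near A (phi l a) (phi l b) \<Longrightarrow> P.near (K*A+K) a b"
  using f_far[OF inl_V inl_V, of l l A a b] X.near_emb[OF inl_line, of l "K*A+K" a b] by (simp add: phi_def)

lemma pmap_phi: assumes "inl l" shows "Y.pmap (2*K) (phi l)"
proof -
  have "finite {a. Y.near B (phi l a) x}" for B x
    by (rule Y.finite_preball[where g = "\<lambda>A. K*A+K"]) (rule phi_far[OF assms])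
  moreover have "Y.near (2*K) (phi l a) (phi l b)" if "P.near 1 a b" for a b
    using phi_near[OF assms that] by (simp add: mult_2)
  ultimately show ?thesis by (simp add: Y.pmap_def)
qed

text \<open>\<open>rr\<close> bounds the region around an image point in which its edges are filled
  and the cells near it lie; \<open>MM\<close> and \<open>RR\<close> are what this region becomes
  after passing back through \<open>f\<close> and forward again.\<close>

definition rr :: nat where "rr = 6*K+8"
definition MM :: nat where "MM = K*(4*rr+3)+K"
definition RR :: nat where "RR = K*(3*MM+3)+K+6*K+4"

text \<open>The cup product at \<open>v0\<close> is pulled back to the target by a coarse inverse
  \<open>g\<close> of \<open>f\<close>. Over the image of a line its total is the degree of the
  inclusion at \<open>v0\<close>, because \<open>g\<close> after \<open>phi l\<close> is close to
  the inclusion. Filling every image cell rewrites the same total as a weighted sum of degrees, and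
  the weights, being values on target cells, do not depend on the line.\<close>

lemma degree_duality:
  assumes v0: "v0 \<in> V"
  shows "\<exists>\<alpha> :: 'w \<times> int \<Rightarrow> int. (\<forall>vi. \<alpha> vi \<noteq> 0 \<longrightarrow> Y.near RR (f (v0,k0)) vi) \<and>
    (\<forall>l. inl l \<longrightarrow> of_bool (v0 \<in> range l) = (\<Sum>vi. \<alpha> vi * Y.deg (phi l) (fst vi) 0))"
proof -
  define y0 where "y0 = X.yy v0 k0"
  \<comment> \<open>Away from the image of \<open>f\<close> this choice is arbitrary, and nothing
    can be asserted about \<open>\<theta>\<close> there.\<close>
  define g where "g e = (SOME a. fst a \<in> V \<and> Y.near rr (f a) e)" for e
  define \<theta> where "\<theta> e e' = X.II v0 y0 (g e) (g e')" for e e'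
  \<comment> \<open>The cut-off is harmless: a target cell that some image cell winds around lies
    near the image, and if it is far from \<open>f (v0,k0)\<close> as well, then
    \<open>\<theta>\<close> is exact around it.\<close>
  define \<alpha> where "\<alpha> vi = (if Y.near RR (f (v0,k0)) vi then ev (Y.cellc vi) \<theta> else 0)" for vi
  have gI: "fst (g e) \<in> V \<and> Y.near rr (f (g e)) e" if "fst a \<in> V" "Y.near rr (f a) e" for a e
    unfolding g_def by (rule someI[of _ a]) (use that in auto)
  have g_region: "X.near MM (g e) (g e')" "X.near MM (g e) (X.emb l a)"
    if l: "inl l" and e: "Y.near rr (phi l a) e" "Y.near rr (phi l a) e'" for l a e e'
  proof -
    note ge = gI[OF inl_V[OF l] e(1)[unfolded phi_def]] gI[OF inl_V[OF l] e(2)[unfolded phi_def]]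
    have 1: "Y.near (2*rr+1) (f (g e)) (phi l a)"
      using Y.near_trans[OF conjunct2[OF ge(1)] Y.near_sym[OF e(1)]] by simp
    have 2: "Y.near (2*rr+1) (f (g e')) (phi l a)"
      using Y.near_trans[OF conjunct2[OF ge(2)] Y.near_sym[OF e(2)]] by simp
    have "Y.near (4*rr+3) (f (g e)) (f (g e'))"
      using Y.near_trans[OF 1 Y.near_sym[OF 2]] by simp
    then show "X.near MM (g e) (g e')" using f_far[of "g e" "g e'"] ge by (simp add: MM_def)
    have "Y.near (4*rr+3) (f (g e)) (f (X.emb l a))" using Y.near_mono[OF 1] by (simp add: phi_def)
    then show "X.near MM (g e) (X.emb l a)" using f_far[of "g e" "X.emb l a"] ge inl_V[OF l] by (simp add: MM_def)
  qed
  have loc: "\<exists>s. \<forall>e e'. Y.near rr (phi l a) e \<longrightarrow> Y.near rr (phi l a) e' \<longrightarrow> \<theta> e e' = s e' - s e"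
    if l: "inl l" and far: "\<not> X.near (3*MM+3) (X.emb l a) (v0,k0)" for l a
  proof -
    let ?E = "insert (X.emb l a) (g ` {e. Y.near rr (phi l a) e})"
    have nn: "X.near MM x z" if "x \<in> ?E" "z \<in> ?E" for x z
    proof -
      have 1: "X.near MM (g e) (g e')" if "Y.near rr (phi l a) e" "Y.near rr (phi l a) e'" for e e'
        by (rule g_region(1)[OF l that])
      have 2: "X.near MM (g e) (X.emb l a)" "X.near MM (X.emb l a) (g e)" if "Y.near rr (phi l a) e" for e
        using g_region(2)[OF l that that] X.near_sym by auto
      show ?thesis using that 1 2 X.near_refl by blast
    qed
    have "X.inband y0 (v0,k0)" unfolding y0_def by (rule X.inband_yy)
    from X.II_local[OF nn insertI1 this far]
    obtain s where "\<forall>x\<in>?E. \<forall>z\<in>?E. X.II v0 y0 x z = s z - s x" by blast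
    then have "\<forall>e e'. Y.near rr (phi l a) e \<longrightarrow> Y.near rr (phi l a) e' \<longrightarrow> \<theta> e e' = s (g e') - s (g e)"
      unfolding \<theta>_def by blast
    then show ?thesis by (intro exI[of _ "\<lambda>e. s (g e)"])
  qed
  have main: "of_bool (v0 \<in> range l) = (\<Sum>vi. \<alpha> vi * Y.deg (phi l) (fst vi) 0)" if l: "inl l" for l
  proof -
    define e where "e c vi = ev (P.cellc c) (\<lambda>a b. Y.II (fst vi) (Y.yy (fst vi) (snd vi)) (phi l a) (phi l b))" for c vi
    define F where "F = {a. X.near (3*MM+3) (X.emb l a) (v0,k0)}"
    have line: "X.isline l" by (rule inl_line[OF l])
    have F: "finite F" unfolding F_def by (rule X.pmap_finite[OF X.pmap_emb[OF line]])
    note pm = pmap_phi[OF l]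
    have edge: "Y.near rr (phi l a) (phi l b)" if "P.near 1 a b" for a b
      using Y.near_mono[OF Y.pmap_near[OF pm that]] by (simp add: rr_def)
    have pg: "X.pmap MM (\<lambda>a. g (phi l a))"
      unfolding X.pmap_def
    proof (intro conjI allI impI)
      fix a b assume "P.near 1 a b"
      from g_region(1)[OF l Y.near_refl edge[OF this]] show "X.near MM (g (phi l a)) (g (phi l b))" .
    next
      fix B x
      have "{a. X.near B (g (phi l a)) x} \<subseteq> {a. X.near (MM+B+1) (X.emb l a) x}"
        using X.near_trans[OF X.near_sym[OF g_region(2)[OF l Y.near_refl Y.near_refl]]] by blast
      then show "finite {a. X.near B (g (phi l a)) x}"
        using X.pmap_finite[OF X.pmap_emb[OF line]] finite_subset by blast
    qed
    have "of_bool (v0 \<in> range l) = X.deg (X.emb l) v0 y0"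
      unfolding y0_def by (rule X.deg_emb[OF line, symmetric])
    also have "\<dots> = X.deg (\<lambda>a. g (phi l a)) v0 y0"
      by (rule X.deg_homotopic[OF X.pmap_emb[OF line] pg, where B = MM])
         (rule X.near_sym[OF g_region(2)[OF l Y.near_refl Y.near_refl]])
    also have "\<dots> = (\<Sum>c. ev (P.cellc c) (\<lambda>a b. \<theta> (phi l a) (phi l b)))"
      by (simp add: X.deg_def \<theta>_def)
    \<comment> \<open>Off the finite set \<open>F\<close> both cochains are differences of the same
      local primitive.\<close>
    also have "\<dots> = (\<Sum>c. ev (P.cellc c) (\<lambda>a b. Y.Th \<theta> (phi l a) (phi l b)))"
    proof (rule stokes_eq[where F = F and s = "\<lambda>_. 0"])
      show "finite {c. ev (P.cellc c) (\<lambda>a b. \<theta> (phi l a) (phi l b)) \<noteq> 0}"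
        unfolding \<theta>_def by (rule X.cell_finite[OF pg])
      have "ev (P.cellc c) (\<lambda>a b. Y.Th \<theta> (phi l a) (phi l b)) = 0" if c: "c \<notin> F" for c
      proof -
        obtain s where s: "\<forall>e e'. Y.near rr (phi l c) e \<longrightarrow> Y.near rr (phi l c) e' \<longrightarrow> \<theta> e e' = s e' - s e"
          using loc[OF l, of c] c by (auto simp: F_def)
        have "ev (P.cellc c) (\<lambda>a b. Y.Th \<theta> (phi l a) (phi l b)) = ev (P.cellc c) (\<lambda>a b. s (phi l b) - s (phi l a))"
        proof (rule ev_cong_pts)
          fix a b assume ab: "a \<in> pts (P.cellc c)" "b \<in> pts (P.cellc c)"
          have ca: "Y.near (2*K) (phi l c) (phi l a)"
            by (rule Y.pmap_near[OF pm P.cellc_near[OF P.cellc_self ab(1)]])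
          have 1: "Y.near rr (phi l c) e" if "Y.near (2*(2*K)+1) (phi l a) e" for e
            using Y.near_trans[OF ca that] by (simp add: rr_def)
          show "Y.Th \<theta> (phi l a) (phi l b) = s (phi l b) - s (phi l a)"
            by (rule Y.Th_exact[OF Y.pmap_near[OF pm P.cellc_near[OF ab]]]) (use s 1 in blast)
        qed
        also have "\<dots> = 0" using cyc_exact[OF P.cyc_cellc, of c "\<lambda>a. s (phi l a)"] by simp
        finally show ?thesis .
      qed
      then have "{c. ev (P.cellc c) (\<lambda>a b. Y.Th \<theta> (phi l a) (phi l b)) \<noteq> 0} \<subseteq> F" by blast
      then show "finite {c. ev (P.cellc c) (\<lambda>a b. Y.Th \<theta> (phi l a) (phi l b)) \<noteq> 0}"
        using F finite_subset by blast
      show "finite F" by (rule F)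
      fix a b assume a: "a \<notin> F" and ab: "P.near 1 a b"
      obtain s where s: "\<forall>e e'. Y.near rr (phi l a) e \<longrightarrow> Y.near rr (phi l a) e' \<longrightarrow> \<theta> e e' = s e' - s e"
        using loc[OF l, of a] a by (auto simp: F_def)
      have "Y.near rr (phi l a) e" if "Y.near (2*(2*K)+1) (phi l a) e" for e
        using Y.near_mono[OF that] by (simp add: rr_def)
      then have "Y.Th \<theta> (phi l a) (phi l b) = s (phi l b) - s (phi l a)"
        using s by (intro Y.Th_exact[OF Y.pmap_near[OF pm ab]]) blast
      moreover have "\<theta> (phi l a) (phi l b) = s (phi l b) - s (phi l a)" using s edge[OF ab] Y.near_refl by blast
      ultimately show "\<theta> (phi l a) (phi l b) = Y.Th \<theta> (phi l a) (phi l b) + (0 - 0)" by simp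
    qed
    also have "\<dots> = (\<Sum>c. \<Sum>vi. \<alpha> vi * e c vi)"
    proof -
      have *: "ev (P.cellc c) (\<lambda>a b. Y.Th \<theta> (phi l a) (phi l b)) = (\<Sum>vi. ev (Y.cellc vi) \<theta> * e c vi)" for c
      proof -
        have "Y.conn a b" if ab: "(s,a,b) \<in> set (mapc (phi l) (P.cellc c))" for s a b
        proof -
          obtain a' b' where "a = phi l a'" "b = phi l b'" "a' \<in> pts (P.cellc c)" "b' \<in> pts (P.cellc c)"
            using pts_set[OF ab] by auto
          then show ?thesis using Y.near_conn[OF Y.pmap_near[OF pm P.cellc_near]] by blast
        qed
        from Y.fill(2)[OF cyc_mapc[OF P.cyc_cellc] this, where \<theta> = \<theta>] show ?thesis by (simp add: e_def)
      qed
      have "ev (Y.cellc vi) \<theta> * e c vi = \<alpha> vi * e c vi" for c vi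
      proof (cases "e c vi = 0 \<or> Y.near RR (f (v0,k0)) vi")
        case False
        obtain v i where vi: "vi = (v,i)" by force
        have n: "Y.near (3*(2*K)+3) (phi l c) vi"
          using Y.cell_near[OF pm Y.inband_yy[of v i] _ P.cellc_self, of c] False unfolding vi e_def by simp
        have "\<not> X.near (3*MM+3) (X.emb l c) (v0,k0)"
        proof
          assume "X.near (3*MM+3) (X.emb l c) (v0,k0)"
          then have "X.near (3*MM+3) (v0,k0) (X.emb l c)" by (rule X.near_sym)
          then have "Y.near (K*(3*MM+3)+K) (f (v0,k0)) (phi l c)"
            using f_near[of "(v0,k0)" "X.emb l c"] inl_V[OF l] v0 by (simp add: phi_def)
          then have "Y.near RR (f (v0,k0)) vi" using Y.near_trans[OF _ n] by (simp add: RR_def)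
          then show False using False by blast
        qed
        from loc[OF l this] obtain s where
          s: "\<forall>e e'. Y.near rr (phi l c) e \<longrightarrow> Y.near rr (phi l c) e' \<longrightarrow> \<theta> e e' = s e' - s e" by blast
        have "Y.near rr (phi l c) e" if "e \<in> pts (Y.cellc vi)" for e
          using Y.near_trans[OF n Y.cellc_near[OF Y.cellc_self that]] by (simp add: rr_def)
        then have "ev (Y.cellc vi) \<theta> = ev (Y.cellc vi) (\<lambda>a b. s b - s a)" using s by (intro ev_cong_pts) blast
        then show ?thesis using cyc_exact[OF Y.cyc_cellc, of vi s] False by (simp add: \<alpha>_def)
      qed (auto simp: \<alpha>_def)
      then have "(\<lambda>c vi. ev (Y.cellc vi) \<theta> * e c vi) = (\<lambda>c vi. \<alpha> vi * e c vi)" by (intro ext)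
      then show ?thesis unfolding * by (rule arg_cong)
    qed
    also have "\<dots> = (\<Sum>vi. \<Sum>c. \<alpha> vi * e c vi)"
    proof -
      have fin: "finite {vi. e c vi \<noteq> 0}" for c
      proof -
        have "Y.conn a b" if ab: "(s,a,b) \<in> set (mapc (phi l) (P.cellc c))" for s a b
        proof -
          obtain a' b' where "a = phi l a'" "b = phi l b'" "a' \<in> pts (P.cellc c)" "b' \<in> pts (P.cellc c)"
            using pts_set[OF ab] by auto
          then show ?thesis using Y.near_conn[OF Y.pmap_near[OF pm P.cellc_near]] by blast
        qed
        from Y.fill(1)[OF cyc_mapc[OF P.cyc_cellc] this] show ?thesis by (simp add: e_def)
      qed
      \<comment> \<open>Only finitely many source cells wind around a target cell with nonzero
        weight, which permits the exchange of the sums.\<close>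
      define F' where "F' = {c. Y.near (6*K+4+RR) (phi l c) (f (v0,k0))}"
      have F': "finite F'" unfolding F'_def by (rule Y.pmap_finite[OF pm])
      have c: "c \<in> F'" if "\<alpha> vi * e c vi \<noteq> 0" for c vi
      proof -
        obtain v i where vi: "vi = (v,i)" by force
        have n: "Y.near (3*(2*K)+3) (phi l c) vi"
          using Y.cell_near[OF pm Y.inband_yy[of v i] _ P.cellc_self, of c] that unfolding vi e_def by simp
        have "Y.near RR (f (v0,k0)) vi" using that by (auto simp: \<alpha>_def split: if_splits)
        then show ?thesis using Y.near_trans[OF n Y.near_sym] by (simp add: F'_def)
      qed
      show ?thesis
      proof (rule Sum_any.swap)
        show "finite (F' \<times> (\<Union>c\<in>F'. {vi. e c vi \<noteq> 0}))" using F' fin by auto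
        show "{c. \<exists>vi. \<alpha> vi * e c vi \<noteq> 0} \<times> {vi. \<exists>c. \<alpha> vi * e c vi \<noteq> 0} \<subseteq> F' \<times> (\<Union>c\<in>F'. {vi. e c vi \<noteq> 0})"
        proof (rule Sigma_mono)
          show "{c. \<exists>vi. \<alpha> vi * e c vi \<noteq> 0} \<subseteq> F'" using c by blast
          show "{vi. \<exists>c. \<alpha> vi * e c vi \<noteq> 0} \<subseteq> (\<Union>c\<in>F'. {vi. e c vi \<noteq> 0})"
          proof
            fix vi assume "vi \<in> {vi. \<exists>c. \<alpha> vi * e c vi \<noteq> 0}"
            then obtain c' where c': "\<alpha> vi * e c' vi \<noteq> 0" by blast
            then have "e c' vi \<noteq> 0" by (metis mult_zero_right)
            then show "vi \<in> (\<Union>c\<in>F'. {vi. e c vi \<noteq> 0})" using c[OF c'] by blast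
          qed
        qed
      qed
    qed
    also have "\<dots> = (\<Sum>vi. \<alpha> vi * Y.deg (phi l) (fst vi) 0)"
    proof -
      have "(\<Sum>c. \<alpha> vi * e c vi) = \<alpha> vi * Y.deg (phi l) (fst vi) 0" for vi
        using Sum_any_right_distrib[OF Y.cell_finite[OF pm, of "fst vi" "Y.yy (fst vi) (snd vi)"], of "\<alpha> vi"]
          Y.deg_y[OF pm, of "fst vi" "Y.yy (fst vi) (snd vi)" 0] by (simp add: Y.deg_def e_def)
      then show ?thesis by simp
    qed
    finally show ?thesis .
  qed
  have "\<alpha> vi \<noteq> 0 \<longrightarrow> Y.near RR (f (v0,k0)) vi" for vi by (simp add: \<alpha>_def)
  then show ?thesis using main by blast
qed

text \<open>Duality at \<open>l n\<close> has left side 1, so some weight near the image meets a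
  nonzero degree.\<close>

lemma near_support:
  assumes "inl l"
  obtains w i where "Y.near RR (phi l (n,k)) (w,i)" "Y.deg (phi l) w 0 \<noteq> 0"
proof -
  have v: "l n \<in> V" using assms by (auto simp: inl_def)
  obtain \<alpha> :: "'w \<times> int \<Rightarrow> int" where \<alpha>1: "\<And>vi. \<alpha> vi \<noteq> 0 \<Longrightarrow> Y.near RR (f (l n,k)) vi"
    and \<alpha>2: "\<And>l'. inl l' \<Longrightarrow> of_bool (l n \<in> range l') = (\<Sum>vi. \<alpha> vi * Y.deg (phi l') (fst vi) 0)"
    using degree_duality[OF v, of k] by blast
  have "(\<Sum>vi. \<alpha> vi * Y.deg (phi l) (fst vi) 0) \<noteq> 0" unfolding \<alpha>2[OF assms, symmetric] by simp
  then obtain vi where "\<alpha> vi * Y.deg (phi l) (fst vi) 0 \<noteq> 0"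
    by (rule Sum_any.not_neutral_obtains_not_neutral)
  then have "\<alpha> vi \<noteq> 0" and 2: "Y.deg (phi l) (fst vi) 0 \<noteq> 0" by simp_all
  from \<alpha>1[OF this(1)] have "Y.near RR (phi l (n,k)) (fst vi, snd vi)" by (simp add: phi_def X.emb_def)
  then show ?thesis using that 2 by blast
qed

text \<open>The left side of the duality is 1 for \<open>l\<close> and 0 for \<open>l'\<close>, so
  the degrees disagree at a vertex that carries weight.\<close>

lemma near_support_diff:
  assumes "inl l" "inl l'" "l n \<notin> range l'"
  obtains w i where "Y.near RR (phi l (n,k)) (w,i)" "Y.deg (phi l) w 0 \<noteq> Y.deg (phi l') w 0"
proof -
  have v: "l n \<in> V" using assms by (auto simp: inl_def)
  obtain \<alpha> :: "'w \<times> int \<Rightarrow> int" where \<alpha>1: "\<And>vi. \<alpha> vi \<noteq> 0 \<Longrightarrow> Y.near RR (f (l n,k)) vi"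
    and \<alpha>2: "\<And>l'. inl l' \<Longrightarrow> of_bool (l n \<in> range l') = (\<Sum>vi. \<alpha> vi * Y.deg (phi l') (fst vi) 0)"
    using degree_duality[OF v, of k] by blast
  have ne: "(\<Sum>vi. \<alpha> vi * Y.deg (phi l) (fst vi) 0) \<noteq> (\<Sum>vi. \<alpha> vi * Y.deg (phi l') (fst vi) 0)"
    unfolding \<alpha>2[OF assms(1), symmetric] \<alpha>2[OF assms(2), symmetric] using assms(3) by simp
  have "\<exists>vi. \<alpha> vi * Y.deg (phi l) (fst vi) 0 \<noteq> \<alpha> vi * Y.deg (phi l') (fst vi) 0"
  proof (rule ccontr)
    assume "\<not> ?thesis"
    then have "(\<lambda>vi. \<alpha> vi * Y.deg (phi l) (fst vi) 0) = (\<lambda>vi. \<alpha> vi * Y.deg (phi l') (fst vi) 0)"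
      by (intro ext) blast
    from arg_cong[OF this, of Sum_any] show False using ne by contradiction
  qed
  then obtain vi where "\<alpha> vi * Y.deg (phi l) (fst vi) 0 \<noteq> \<alpha> vi * Y.deg (phi l') (fst vi) 0" by blast
  then have "\<alpha> vi \<noteq> 0" and 2: "Y.deg (phi l) (fst vi) 0 \<noteq> Y.deg (phi l') (fst vi) 0" by auto
  from \<alpha>1[OF this(1)] have "Y.near RR (phi l (n,k)) (fst vi, snd vi)" by (simp add: phi_def X.emb_def)
  then show ?thesis using that 2 by blast
qed

end

section \<open>Divergence of closed walks in the plane\<close>

lemma P_up [simp]: "P.up n t \<longleftrightarrow> n \<le> t"
  by (auto simp: P.up_iff)

text \<open>At the first index with level \<open>n\<close> or more, all earlier positions were below
  \<open>n\<close>, where a step moves horizontally by at most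
  \<open>dy (int A + n)\<close>.\<close>

lemma P_climb:
  fixes b :: "nat \<Rightarrow> int \<times> int"
  assumes step: "\<And>i. i < T \<Longrightarrow> P.near A (b i) (b (Suc i))" and low: "fst (b 0) < n" and high: "n \<le> fst (b T)"
  shows "\<exists>m\<le>T. n \<le> fst (b m) \<and> fst (b m) \<le> n + int A \<and> \<bar>P.xc (b m) - P.xc (b 0)\<bar> \<le> real T * dy (int A + n)"
proof -
  define m where "m = (LEAST m. n \<le> fst (b m))"
  have m1: "n \<le> fst (b m)" unfolding m_def using high by (rule LeastI)
  have mT: "m \<le> T" unfolding m_def using high by (rule Least_le)
  have m2: "fst (b i) < n" if "i < m" for i using not_less_Least[of i "\<lambda>m. n \<le> fst (b m)"] that by (auto simp: m_def)
  have "\<bar>P.xc (b i) - P.xc (b 0)\<bar> \<le> real i * dy (int A + n)" if "i \<le> m" for i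
    using that
  proof (induction i)
    case (Suc i)
    have "\<bar>P.xc (b i) - P.xc (b (Suc i))\<bar> \<le> dy (int A + fst (b i))" using step[of i] Suc mT by (simp add: P_near)
    also have "\<dots> \<le> dy (int A + n)" using m2[of i] Suc by simp
    finally show ?case using Suc by (simp add: algebra_simps)
  qed simp
  from this[of m] have "\<bar>P.xc (b m) - P.xc (b 0)\<bar> \<le> real m * dy (int A + n)" by simp
  also have "\<dots> \<le> real T * dy (int A + n)" using mT by (intro mult_right_mono) auto
  finally have x: "\<bar>P.xc (b m) - P.xc (b 0)\<bar> \<le> real T * dy (int A + n)" .
  have "m \<noteq> 0" using m1 low by (cases m) auto
  then obtain m' where m': "m = Suc m'" by (cases m) auto
  have "\<bar>fst (b m') - fst (b m)\<bar> \<le> int A" using step[of m'] mT m' by (simp add: P_near)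
  then have "fst (b m) \<le> n + int A" using m2[of m'] m' by simp
  then show ?thesis using m1 mT x by blast
qed

text \<open>Divergence in the hyperbolic plane: a closed walk comes logarithmically close to every
  point it winds around.\<close>

lemma P_walk:
  fixes b :: "nat \<Rightarrow> int \<times> int"
  assumes step: "\<And>i. i < L \<Longrightarrow> P.near A (b i) (b (Suc i))" and closed: "b L = b 0"
    and ne: "(\<Sum>i<L. P.II n y (b i) (b (Suc i))) \<noteq> 0"
  shows "\<exists>i\<le>L. n \<le> fst (b i) \<and> fst (b i) \<le> n + int A \<and> \<bar>P.xc (b i) - y\<bar> \<le> real (L + 1) * dy (int A + n)"
proof -
  have II: "P.II n y a c = of_bool (n \<le> fst a \<and> n \<le> fst c) * (P.sg y c - P.sg y a)" for a c
    by (auto simp: P.II_def P.chi_def)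
  obtain j where j: "j < L" "n \<le> fst (b j)"
    using sum.not_neutral_contains_not_neutral[OF ne] by (auto simp: II)
  \<comment> \<open>On a closed walk all crossings of \<open>y\<close> cancel. Those on edges
    entirely at level \<open>n\<close> or above do not, so some crossing happens on another
    edge.\<close>
  have "(\<Sum>i<L. (P.sg y (b (Suc i)) - P.sg y (b i)) - P.II n y (b i) (b (Suc i))) \<noteq> 0"
  proof -
    have "(\<Sum>i<L. (P.sg y (b (Suc i)) - P.sg y (b i)) - P.II n y (b i) (b (Suc i)))
      = (\<Sum>i<L. P.sg y (b (Suc i)) - P.sg y (b i)) - (\<Sum>i<L. P.II n y (b i) (b (Suc i)))"
      by (rule sum_subtractf)
    also have "(\<Sum>i<L. P.sg y (b (Suc i)) - P.sg y (b i)) = P.sg y (b L) - P.sg y (b 0)"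
      by (rule sum_lessThan_telescope)
    finally show ?thesis using ne closed by simp
  qed
  from sum.not_neutral_contains_not_neutral[OF this] obtain i where
    i: "i < L" "(P.sg y (b (Suc i)) - P.sg y (b i)) - P.II n y (b i) (b (Suc i)) \<noteq> 0" by auto
  then have d: "P.sg y (b (Suc i)) \<noteq> P.sg y (b i)" and lo: "\<not> (n \<le> fst (b i) \<and> n \<le> fst (b (Suc i)))"
    by (auto simp: II split: if_splits)
  have nr: "\<bar>P.xc (b i) - P.xc (b (Suc i))\<bar> \<le> dy (int A + fst (b i))"
    "\<bar>P.xc (b i) - P.xc (b (Suc i))\<bar> \<le> dy (int A + fst (b (Suc i)))" using step[OF i(1)] by (auto simp: P_near)
  have "\<exists>i0\<le>L. fst (b i0) < n \<and> \<bar>P.xc (b i0) - y\<bar> \<le> dy (int A + n)"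
  proof (cases "fst (b i) < n")
    case True
    have "\<bar>P.xc (b i) - y\<bar> \<le> \<bar>P.xc (b i) - P.xc (b (Suc i))\<bar>"
      using d by (cases "P.xc (b i) < y"; cases "P.xc (b (Suc i)) < y") (auto simp: P.sg_def)
    also have "\<dots> \<le> dy (int A + n)" using nr(1) True by (auto elim: order_trans)
    finally show ?thesis using True i by (intro exI[of _ i]) auto
  next
    case False
    have "\<bar>P.xc (b (Suc i)) - y\<bar> \<le> \<bar>P.xc (b i) - P.xc (b (Suc i))\<bar>"
      using d by (cases "P.xc (b i) < y"; cases "P.xc (b (Suc i)) < y") (auto simp: P.sg_def)
    also have "\<dots> \<le> dy (int A + n)" using nr(2) False lo by (auto elim: order_trans)
    finally show ?thesis using False lo i by (intro exI[of _ "Suc i"]) auto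
  qed
  then obtain i0 where i0: "i0 \<le> L" "fst (b i0) < n" "\<bar>P.xc (b i0) - y\<bar> \<le> dy (int A + n)" by blast
  have fin: ?thesis if "m \<le> L" "n \<le> fst (b m)" "fst (b m) \<le> n + int A"
      "\<bar>P.xc (b m) - P.xc (b i0)\<bar> \<le> real T * dy (int A + n)" "T \<le> L" for m T
  proof -
    have "real T * dy (int A + n) \<le> real L * dy (int A + n)" using that by (intro mult_right_mono) auto
    then have "\<bar>P.xc (b m) - y\<bar> \<le> real L * dy (int A + n) + dy (int A + n)" using that(4) i0(3) by linarith
    then have "\<bar>P.xc (b m) - y\<bar> \<le> real (L + 1) * dy (int A + n)" by (simp add: algebra_simps)
    then show ?thesis using that by blast
  qed
  show ?thesis
  \<comment> \<open>The walk is below level \<open>n\<close> close to \<open>y\<close> at index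
    \<open>i0\<close>, and at level \<open>n\<close> or above at index \<open>j\<close>. Climbing
    from the one to the other, forward or backward in time, passes near
    \<open>(n, y)\<close>.\<close>
  proof (cases "i0 < j")
    case True
    have "\<exists>m\<le>j - i0. n \<le> fst (b (i0 + m)) \<and> fst (b (i0 + m)) \<le> n + int A
      \<and> \<bar>P.xc (b (i0 + m)) - P.xc (b (i0 + 0))\<bar> \<le> real (j - i0) * dy (int A + n)"
      using step i0 j True by (intro P_climb[of "j - i0" A "\<lambda>m. b (i0 + m)" n]) auto
    then obtain m where m: "m \<le> j - i0" "n \<le> fst (b (i0 + m))" "fst (b (i0 + m)) \<le> n + int A"
      "\<bar>P.xc (b (i0 + m)) - P.xc (b i0)\<bar> \<le> real (j - i0) * dy (int A + n)" by auto
    show ?thesis by (rule fin[OF _ m(2-4)]) (use m(1) j True in auto)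
  next
    case False
    have "P.near A (b (i0 - m)) (b (i0 - Suc m))" if "m < i0 - j" for m
      using step[of "i0 - Suc m"] that i0 P.near_sym by (auto simp: Suc_diff_Suc)
    then have "\<exists>m\<le>i0 - j. n \<le> fst (b (i0 - m)) \<and> fst (b (i0 - m)) \<le> n + int A
      \<and> \<bar>P.xc (b (i0 - m)) - P.xc (b (i0 - 0))\<bar> \<le> real (i0 - j) * dy (int A + n)"
      using i0 j False by (intro P_climb[of "i0 - j" A "\<lambda>m. b (i0 - m)" n]) auto
    then obtain m where m: "m \<le> i0 - j" "n \<le> fst (b (i0 - m))" "fst (b (i0 - m)) \<le> n + int A"
      "\<bar>P.xc (b (i0 - m)) - P.xc (b i0)\<bar> \<le> real (i0 - j) * dy (int A + n)" by auto
    show ?thesis by (rule fin[OF _ m(2-4)]) (use m(1) i0 in auto)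
  qed
qed

lemma exp_beats_linear: "\<exists>E::nat. A * E + B < 2 ^ E"
proof -
  define m where "m = 2*A+B+1"
  have "A * (2*m) + B \<le> m * m"
  proof -
    have "m * m = (2*A+B+1) * m" by (simp only: m_def)
    then have "m * m = A * (2*m) + (B * m + m)" by (simp add: algebra_simps)
    moreover have "B \<le> B * m" by (simp add: m_def)
    ultimately show ?thesis by linarith
  qed
  also have "\<dots> < 2 ^ m * 2 ^ m" using less_exp[of m] by (intro mult_strict_mono) auto
  also have "\<dots> = 2 ^ (2*m)" by (simp add: mult_2 power_add)
  finally show ?thesis by blast
qed

context horo
begin

lemma near_edges: "near 1 (par w, 2*k) (w,k)" "near 1 (w,k) (w,k+1)"
  by (rule cellc_near[of _ "(w,k)"]; simp add: pts_cellc)+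

text \<open>A loop that runs up one ray, across and down, then up a second ray, across and down.\<close>

definition loop :: "(nat \<Rightarrow> 'v) \<Rightarrow> (nat \<Rightarrow> 'v) \<Rightarrow> nat \<Rightarrow> nat \<Rightarrow> 'v \<times> int" where
  "loop r1 r2 N i = (if i \<le> N then (r1 i, 0) else if i \<le> 2*N+1 then (r1 (2*N+1-i), 2^(i-(N+1)))
     else if i \<le> 3*N+1 then (r2 (i-(2*N+1)), 2^(3*N+1-i)) else (r2 (4*N+2-i), 0))"

context
  fixes r1 r2 :: "nat \<Rightarrow> 'v" and N :: nat and v :: 'v
  assumes r: "r1 0 = v" "r2 0 = v" "\<And>i. par (r1 (Suc i)) = r1 i" "\<And>i. par (r2 (Suc i)) = r2 i"
begin

lemma loop_closed: "loop r1 r2 N (4*N+2) = loop r1 r2 N 0"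
  using r by (simp add: loop_def)

lemma loop_range: "fst (loop r1 r2 N i) \<in> range r1 \<union> range r2"
  by (simp add: loop_def)

lemma loop_step:
  assumes "i < 4*N+2" "i \<noteq> N" "i \<noteq> 3*N+1"
  shows "near 1 (loop r1 r2 N i) (loop r1 r2 N (Suc i)) \<and> xc (loop r1 r2 N i) = xc (loop r1 r2 N (Suc i))"
proof -
  have V: "near 1 (par w, 2*k) (w,k) \<and> xc (par w, 2*k) = xc (w,k)"
    "near 1 (w,k) (par w, 2*k) \<and> xc (w,k) = xc (par w,2*k)" for w k
    using near_edges(1) near_sym xc_par by auto
  consider "i < N" | "N < i" "i < 2*N+1" | "2*N+1 \<le> i" "i < 3*N+1" | "3*N+1 < i" using assms by linarith
  then show ?thesis
  proof cases
    case 1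
    then show ?thesis using V(1)[of "r1 (Suc i)" 0] r(3)[of i] by (simp add: loop_def)
  next
    case 2
    define m where "m = 2*N - i"
    have "2*N+1-i = Suc m" "2*N+1 - Suc i = m" "Suc i - (N+1) = Suc (i-(N+1))" using 2 by (auto simp: m_def)
    then show ?thesis using 2 V(2)[of "r1 (Suc m)" "2^(i-(N+1))"] r(3)[of m] by (simp add: loop_def)
  next
    case 3
    define m where "m = i-(2*N+1)"
    have e: "Suc i - (2*N+1) = Suc m" "3*N+1-i = Suc (3*N+1-Suc i)" using 3 by (auto simp: m_def)
    have "loop r1 r2 N i = (r2 m, 2^(3*N+1-i))"
    proof (cases "i = 2*N+1")
      case True
      have "2*N+1 - (N+1) = N" "3*N+1 - (2*N+1) = N" by auto
      then show ?thesis using True r(1,2) by (simp add: loop_def m_def)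
    next
      case False
      then show ?thesis using 3 by (simp add: loop_def m_def)
    qed
    moreover have "loop r1 r2 N (Suc i) = (r2 (Suc m), 2^(3*N+1-Suc i))"
      using 3 e by (simp add: loop_def del: diff_Suc_Suc)
    ultimately show ?thesis using V(1)[of "r2 (Suc m)" "2^(3*N+1-Suc i)"] r(4)[of m] e(2)
      by (simp del: diff_Suc_Suc)
  next
    case 4
    define m where "m = 4*N+2-Suc i"
    have "4*N+2-i = Suc m" using 4 assms by (auto simp: m_def)
    then show ?thesis using 4 V(2)[of "r2 (Suc m)" 0] r(4)[of m] by (simp add: loop_def m_def del: diff_Suc_Suc)
  qed
qed

lemma loop_top:
  "loop r1 r2 N N = (r1 N, 0)" "loop r1 r2 N (Suc N) = (r1 N, 1)"
  "0 < N \<Longrightarrow> loop r1 r2 N (3*N+1) = (r2 N, 1)" "loop r1 r2 N (Suc (3*N+1)) = (r2 N, 0)"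
  by (auto simp: loop_def)

lemma loop_near: assumes "0 < N" "i < 4*N+2" shows "near 1 (loop r1 r2 N i) (loop r1 r2 N (Suc i))"
proof (cases "i = N \<or> i = 3*N+1")
  case False
  then show ?thesis using loop_step[OF assms(2)] by blast
next
  case True
  then show ?thesis using near_edges(2)[of "r1 N" 0] near_sym[OF near_edges(2)[of "r2 N" 0]] loop_top assms(1) by auto
qed

lemma lev_ray: "lev (r1 i) = lev v + int i" "lev (r2 i) = lev v + int i"
proof (induction i)
  case (Suc i)
  { case 1 then show ?case using Suc lev_par[of "r1 (Suc i)"] r(3)[of i] by simp }
  { case 2 then show ?case using Suc lev_par[of "r2 (Suc i)"] r(4)[of i] by simp }
qed (use r in auto)

text \<open>The vertical sides of the loop stand over the ends of one unit interval of the row at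
  level \<open>lev v + N\<close>: as the level drops the index doubles, so the position
  stays.\<close>

lemma loop_xc: assumes "i \<le> 4*N+2" shows "xc (loop r1 r2 N i) = 0 \<or> xc (loop r1 r2 N i) = dy (lev v + int N)"
proof -
  have p: "(2::real)^j * dy m = dy (m + int j)" for j m by (simp add: dy_add dy_nat)
  consider "i \<le> N" | "N < i" "i \<le> 2*N+1" | "2*N+1 < i" "i \<le> 3*N+1" | "3*N+1 < i" using assms by linarith
  then show ?thesis
  proof cases
    case 2
    then have "lev v + int (2*N+1-i) + int (i-(N+1)) = lev v + int N" by linarith
    then show ?thesis using 2 by (auto simp: loop_def xc_def lev_ray p)
  next
    case 3
    then have "lev v + int (i-(2*N+1)) + int (3*N+1-i) = lev v + int N" by linarith
    then show ?thesis using 3 by (auto simp: loop_def xc_def lev_ray p)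
  qed (auto simp: loop_def xc_def)
qed

lemma ray_up: "i \<le> j \<Longrightarrow> up (r1 i) (r1 j)" "i \<le> j \<Longrightarrow> up (r2 i) (r2 j)"
proof -
  have 1: "anc k (r1 (i + k)) = r1 i" "anc k (r2 (i + k)) = r2 i" for i k
    using r by (induction k arbitrary: i; simp add: funpow_swap1)+
  show "up (r1 i) (r1 j)" "up (r2 i) (r2 j)" if "i \<le> j"
    using 1[of "j-i" i] that unfolding up_def by (auto intro!: exI[of _ "j-i"])
qed

text \<open>The loop winds once around the middle of its first sheet.\<close>

lemma loop_winds:
  assumes "2 \<le> N" "r1 1 \<noteq> r2 1"
  shows "(\<Sum>i<4*N+2. II (r1 1) (yy (r1 1) (2^(N-2))) (loop r1 r2 N i) (loop r1 r2 N (Suc i))) = -1"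
proof -
  let ?y = "yy (r1 1) (2^(N-2))"
  let ?J = "\<lambda>i. II (r1 1) ?y (loop r1 r2 N i) (loop r1 r2 N (Suc i))"
  have y: "?y = (2^(N-2) + 1/2) * dy (lev v + 1)" by (simp add: yy_def lev_ray)
  have no: "\<not> up (r1 1) (r2 N)"
  proof
    assume "up (r1 1) (r2 N)"
    moreover have "up (r2 1) (r2 N)" using ray_up(2)[of 1 N] assms(1) by simp
    ultimately have "r1 1 = r2 1" using up_child_unique[of "r1 1" "r2 N" "r2 1" v] r(1,2) r(3,4)[of 0] by simp
    then show False using assms(2) by simp
  qed
  have "?J i = 0" if "i < 4*N+2" "i \<noteq> N" for i
  proof (cases "i = 3*N+1")
    case True
    then show ?thesis using loop_top assms no by (simp add: II_def chi_def)
  next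
    case False
    then show ?thesis using loop_step[OF that(1,2) False] by (simp add: II_def sg_def)
  qed
  then have "(\<Sum>i<4*N+2. ?J i) = (\<Sum>i\<in>{N}. ?J i)" by (intro sum.mono_neutral_right) auto
  also have "\<dots> = -1"
  proof -
    have "up (r1 1) (r1 N)" using ray_up(1)[of 1 N] assms(1) by simp
    moreover have "xc (r1 N, 0) < ?y" unfolding y by (simp add: xc_def add_pos_pos)
    moreover have "?y \<le> xc (r1 N, 1)"
    proof -
      obtain M where M: "N = Suc (Suc M)" using assms(1) by (metis add_2_eq_Suc le_iff_add)
      have "xc (r1 N, 1) = 2^(N-1) * dy (lev v + 1)"
      proof -
        have "xc (r1 N, 1) = dy (lev v + int N)" by (simp add: xc_def lev_ray)
        also have "\<dots> = dy (int (N-1) + (lev v + 1))" by (rule arg_cong[of _ _ dy]) (simp add: M)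
        finally show ?thesis by (simp only: dy_add[of "int (N-1)"] dy_nat)
      qed
      moreover have "(2::real)^(N-2) + 1/2 \<le> 2^(N-1)"
      proof -
        have "(1::real) \<le> 2 ^ M" by simp
        moreover have "(2::real)^(N-2) = 2^M" "(2::real)^(N-1) = 2 * 2^M" by (simp_all add: M)
        ultimately show ?thesis by linarith
      qed
      then have "(2^(N-2) + 1/2) * dy (lev v + 1) \<le> 2^(N-1) * dy (lev v + 1)"
        by (rule mult_right_mono) simp
      ultimately show ?thesis unfolding y by (simp only:)
    qed
    ultimately show ?thesis by (simp add: loop_top II_def chi_def sg_def)
  qed
  finally show ?thesis .
qed

text \<open>The centre is horizontally halfway between the vertical sides, at distance
  \<open>dy (lev v + int N - 1)\<close> from both, although its level is only one above that of
  \<open>v\<close>.\<close>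

lemma loop_far:
  assumes "2 \<le> N" "i \<le> 4*N+2" "near B (loop r1 r2 N i) (r1 1, 2^(N-2))"
  shows "N \<le> B + 2"
proof -
  obtain M where M: "N = Suc (Suc M)" using assms(1) by (metis add_2_eq_Suc le_iff_add)
  have x: "xc (r1 1, 2^(N-2)) = dy (lev v + 1 + int M)" by (simp add: xc_def lev_ray dy_add dy_nat M)
  have "dy (lev v + int N) = 2 * dy (lev v + 1 + int M)"
    using dy_Suc[of "lev v + 1 + int M"] by (simp add: M algebra_simps)
  then have "\<bar>xc (loop r1 r2 N i) - xc (r1 1, 2^(N-2))\<bar> = dy (lev v + 1 + int M)"
    using loop_xc[OF assms(2)] unfolding x by auto
  then have "dy (lev v + 1 + int M) \<le> dy (int B + lev (r1 1))" using assms(3) by (simp add: near_def)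
  then show ?thesis by (simp add: lev_ray M)
qed

end

end

section \<open>The support of the degree does not branch\<close>

context rigid
begin

lemma deg_child:
  assumes "inl l" "Y.deg (phi l) w 0 \<noteq> 0"
  shows "\<exists>u. par' u = w \<and> Y.deg (phi l) u 0 \<noteq> 0"
proof -
  obtain U where "\<And>u. u \<in> U \<Longrightarrow> par' u = w" "Y.deg (phi l) w 0 = (\<Sum>u\<in>U. Y.deg (phi l) u 0)"
    by (rule Y.deg_flow[OF pmap_phi[OF assms(1)], of w 0]) blast
  then show ?thesis using assms(2) sum.not_neutral_contains_not_neutral by metis
qed

text \<open>Conservation of the flow always leaves a child of nonzero degree, so the ray can be
  continued upward forever.\<close>

lemma deg_ray:
  assumes l: "inl l" and u: "Y.deg (phi l) u 0 \<noteq> 0" "par' u = v"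
  obtains r where "r 0 = v" "r 1 = u" "\<And>i. par' (r (Suc i)) = r i" "\<And>i. Y.deg (phi l) (r (Suc i)) 0 \<noteq> 0"
proof -
  define nx where "nx w = (SOME u. par' u = w \<and> Y.deg (phi l) u 0 \<noteq> 0)" for w
  have nx: "par' (nx w) = w \<and> Y.deg (phi l) (nx w) 0 \<noteq> 0" if "Y.deg (phi l) w 0 \<noteq> 0" for w
    unfolding nx_def by (rule someI_ex[OF deg_child[OF l that]])
  define r where "r i = (case i of 0 \<Rightarrow> v | Suc j \<Rightarrow> (nx ^^ j) u)" for i
  have d: "Y.deg (phi l) ((nx ^^ j) u) 0 \<noteq> 0" for j by (induction j) (use u nx in auto)
  have "par' (r (Suc i)) = r i" for i using nx[OF d] u by (cases i) (auto simp: r_def)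
  then show ?thesis using d by (intro that[of r]) (auto simp: r_def)
qed

text \<open>A loop through both branches has \<open>4*N+2\<close> steps and keeps a distance of
  about \<open>N\<close> from the point it winds around. All of it is near the image, so it pulls
  back to a closed walk of the same number of steps in the plane, which must come within about
  \<open>log N\<close> of some cell mapped around that point.\<close>

lemma support_no_branch:
  assumes l: "inl l" and u: "par' u1 = par' u2" "u1 \<noteq> u2"
    and d: "Y.deg (phi l) u1 0 \<noteq> 0" "Y.deg (phi l) u2 0 \<noteq> 0"
  shows False
proof -
  define v where "v = par' u1"
  define \<phi> where "\<phi> = phi l"
  note pm = pmap_phi[OF l, folded \<phi>_def]
  obtain r1 where r1: "r1 0 = v" "r1 1 = u1" "\<And>i. par' (r1 (Suc i)) = r1 i" "\<And>i. Y.deg \<phi> (r1 (Suc i)) 0 \<noteq> 0"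
    using deg_ray[OF l d(1), of v] by (auto simp: v_def \<phi>_def)
  obtain r2 where r2: "r2 0 = v" "r2 1 = u2" "\<And>i. par' (r2 (Suc i)) = r2 i" "\<And>i. Y.deg \<phi> (r2 (Suc i)) 0 \<noteq> 0"
    using deg_ray[OF l d(2), of v] u(1) by (auto simp: v_def \<phi>_def)
  note r = r1(1) r2(1) r1(3) r2(3)
  define r3 where "r3 = 6*K+5"
  have good0: "\<exists>a. Y.near (6*K+3) (\<phi> a) (w,k)" if "Y.deg \<phi> w 0 \<noteq> 0" for w k
    using Y.deg_nonzero[OF pm _ Y.inband_yy, of w k] that Y.deg_y[OF pm, of w 0 "Y.yy w k"] by simp
  \<comment> \<open>At \<open>v\<close> itself the degrees of the children may cancel, so its points
    are reached through the cell between \<open>v\<close> and \<open>u1\<close>.\<close>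
  have good: "\<exists>a. Y.near r3 (\<phi> a) (w,k)" if "w \<in> range r1 \<union> range r2" for w k
  proof (cases "w = v")
    case True
    obtain a where a: "Y.near (6*K+3) (\<phi> a) (u1,k div 2)" using good0 d(1) \<phi>_def by blast
    have "k = 2*(k div 2) \<or> k = 2*(k div 2)+1" by presburger
    then have "(v,k) \<in> pts (Y.cellc (u1,k div 2))" unfolding Y.pts_cellc v_def by auto
    from Y.near_trans[OF a Y.cellc_near[OF Y.cellc_self this], of r3] show ?thesis
      using True unfolding r3_def by (intro exI[of _ a]) simp
  next
    case False
    then have "Y.deg \<phi> w 0 \<noteq> 0" using that r1(1,4) r2(1,4)
      by (metis Un_iff imageE not0_implies_Suc)
    then obtain a where "Y.near (6*K+3) (\<phi> a) (w,k)" using good0 by blast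
    then have "Y.near r3 (\<phi> a) (w,k)" by (rule Y.near_mono) (simp add: r3_def)
    then show ?thesis by blast
  qed
  define g where "g b = (SOME a. Y.near r3 (\<phi> a) b)" for b
  define C1 A3 C2 where "C1 = 2*r3+3" and "A3 = K*C1+K" and "C2 = K*(4*A3+3)+K"
  \<comment> \<open>The final contradiction compares \<open>K * E\<close> plus constants with
    \<open>N = 2 ^ E\<close>, where \<open>E\<close> is the logarithm from the divergence
    estimate.\<close>
  obtain E where E: "K * E + (3*C1+3*C2 + K*(A3+4) + r3 + 6*K + 20) < 2 ^ E" using exp_beats_linear by blast
  define N :: nat where "N = 2 ^ E"
  have N: "3*C1+3*C2 + K*(E+3+A3)+K + r3 + 6*K + 20 < N" using E by (simp add: N_def algebra_simps)
  then have N2: "2 \<le> N" "0 < N" by linarith+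
  define L where "L = 4*N+2"
  define M where "M = Y.loop r1 r2 N"
  define b0 where "b0 = (u1, 2^(N-2) :: int)"
  define y where "y = Y.yy u1 (2^(N-2))"
  have inb: "Y.inband y (u1, 2^(N-2))" unfolding y_def by (rule Y.inband_yy)
  have far: "N \<le> B + 2" if "Y.near B (M i) b0" "i \<le> L" for B i
    using Y.loop_far[OF r N2(1)] that unfolding M_def b0_def L_def r1(2) by blast
  have Mg: "Y.near r3 (\<phi> (g (M i))) (M i)" for i
  proof -
    have "\<exists>a. Y.near r3 (\<phi> a) (M i)"
      using good[OF Y.loop_range[OF r, of N i], of "snd (M i)"] by (simp add: M_def)
    then show ?thesis unfolding g_def by (rule someI_ex)
  qed
  have Mstep: "Y.near 1 (M i) (M (Suc i))" if "i < L" for i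
    using Y.loop_near[OF r N2(2)] that by (simp add: M_def L_def)
  have closed: "M L = M 0" unfolding M_def L_def by (rule Y.loop_closed[OF r])
  define c where "c i = g (M i)" for i
  define J where "J a b = Y.II u1 y (\<phi> a) (\<phi> b)" for a b
  have quad: "Y.near C1 x z" if "i < L" "x \<in> {M i, M (Suc i), \<phi> (c i), \<phi> (c (Suc i))}"
    "z \<in> {M i, M (Suc i), \<phi> (c i), \<phi> (c (Suc i))}" for i x z
  proof -
    note n = Mg[of i, folded c_def] Mg[of "Suc i", folded c_def] Mstep[OF that(1)]
    have 1: "Y.near (r3+2) (\<phi> (c i)) (M (Suc i))" using Y.near_trans[OF n(1) n(3)] by simp
    have 2: "Y.near (r3+2) (\<phi> (c (Suc i))) (M i)" using Y.near_trans[OF n(2) Y.near_sym[OF n(3)]] by simp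
    have 3: "Y.near C1 (\<phi> (c i)) (\<phi> (c (Suc i)))" using Y.near_trans[OF 1 Y.near_sym[OF n(2)]] by (simp add: C1_def)
    have n': "Y.near C1 (\<phi> (c i)) (M i)" "Y.near C1 (\<phi> (c (Suc i))) (M (Suc i))" "Y.near C1 (M i) (M (Suc i))"
      "Y.near C1 (\<phi> (c i)) (M (Suc i))" "Y.near C1 (\<phi> (c (Suc i))) (M i)"
      using n[THEN Y.near_mono] 1[THEN Y.near_mono] 2[THEN Y.near_mono] by (auto simp: C1_def)
    show ?thesis using that(2,3) n' n'[THEN Y.near_sym] 3 3[THEN Y.near_sym] Y.near_refl by blast
  qed
  \<comment> \<open>The loop and the image of the pulled-back walk differ by small quadrilaterals
    far from the centre, so both have the same winding number.\<close>
  have "J (c i) (c (Suc i)) = Y.II u1 y (M i) (M (Suc i)) + (Y.II u1 y (M (Suc i)) (\<phi> (c (Suc i))) - Y.II u1 y (M i) (\<phi> (c i)))"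
    if i: "i < L" for i
  proof -
    let ?E = "{M i, M (Suc i), \<phi> (c i), \<phi> (c (Suc i))}"
    have "\<not> Y.near (3*C1+3) (M i) (u1, 2^(N-2))" using far[of "3*C1+3" i] i N by (auto simp: b0_def)
    from Y.II_local[of ?E C1 "M i" y u1 "2^(N-2)", OF quad[OF i] _ inb this]
    obtain s where "\<forall>x\<in>?E. \<forall>z\<in>?E. Y.II u1 y x z = s z - s x" by blast
    then show ?thesis by (simp add: J_def)
  qed
  then have "(\<Sum>i<L. J (c i) (c (Suc i))) = (\<Sum>i<L. Y.II u1 y (M i) (M (Suc i)) + (Y.II u1 y (M (Suc i)) (\<phi> (c (Suc i))) - Y.II u1 y (M i) (\<phi> (c i))))"
    by (intro sum.cong) auto
  also have "\<dots> = (\<Sum>i<L. Y.II u1 y (M i) (M (Suc i))) + (\<Sum>i<L. Y.II u1 y (M (Suc i)) (\<phi> (c (Suc i))) - Y.II u1 y (M i) (\<phi> (c i)))"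
    by (rule sum.distrib)
  also have "(\<Sum>i<L. Y.II u1 y (M (Suc i)) (\<phi> (c (Suc i))) - Y.II u1 y (M i) (\<phi> (c i))) = 0"
    using sum_lessThan_telescope[of "\<lambda>i. Y.II u1 y (M i) (\<phi> (c i))" L] closed by (simp add: c_def)
  also have "(\<Sum>i<L. Y.II u1 y (M i) (M (Suc i))) = -1"
    using Y.loop_winds[OF r N2(1)] u(2) r1(2) r2(2) by (simp add: M_def L_def y_def)
  finally have sumJ: "(\<Sum>i<L. J (c i) (c (Suc i))) \<noteq> 0" by simp
  define z :: "(int \<times> int) chain" where "z = map (\<lambda>i. (1, c i, c (Suc i))) [0..<L]"
  have cz: "cyc z" unfolding z_def using closed by (intro cyc_walk) (simp add: c_def)
  have cstep: "P.near A3 (c i) (c (Suc i))" if "i < L" for i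
    using phi_far[OF l, of C1 "c i" "c (Suc i)"] quad[OF that] by (simp add: A3_def \<phi>_def)
  have zset: "\<exists>i<L. a = c i \<and> b = c (Suc i) \<and> s = 1" if "(s,a,b) \<in> set z" for s a b
    using that by (auto simp: z_def)
  \<comment> \<open>The loop keeps away from the centre, so \<open>J\<close> is exact on a ball
    around every step of the walk and agrees there with its filled version.\<close>
  have ThJ: "P.Th J (c i) (c (Suc i)) = J (c i) (c (Suc i))" if i: "i < L" for i
  proof -
    let ?E = "\<phi> ` {e. P.near (2*A3+1) (c i) e}"
    have nn: "Y.near C2 x x'" if xx: "x \<in> ?E" "x' \<in> ?E" for x x'
    proof -
      from xx obtain e e' where e: "x = \<phi> e" "x' = \<phi> e'" "P.near (2*A3+1) (c i) e" "P.near (2*A3+1) (c i) e'" by blast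
      have "P.near (4*A3+3) e e'" using P.near_trans[OF P.near_sym[OF e(3)] e(4)] by simp
      from phi_near[OF l this] show ?thesis by (simp add: e C2_def \<phi>_def)
    qed
    have "\<not> Y.near (3*C2+3) (\<phi> (c i)) (u1, 2^(N-2))"
    proof
      assume "Y.near (3*C2+3) (\<phi> (c i)) (u1, 2^(N-2))"
      then have "Y.near (r3+(3*C2+3)+1) (M i) b0"
        using Y.near_trans[OF Y.near_sym[OF Mg[of i, folded c_def]]] by (simp add: b0_def)
      then show False using far i N by fastforce
    qed
    from Y.II_local[OF nn _ inb this] obtain s where "\<forall>x\<in>?E. \<forall>x'\<in>?E. Y.II u1 y x x' = s x' - s x"
      by (metis (mono_tags, lifting) P.near_refl imageI mem_Collect_eq)
    then have ex: "J e e' = s (\<phi> e') - s (\<phi> e)" if "P.near (2*A3+1) (c i) e" "P.near (2*A3+1) (c i) e'" for e e'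
      using that unfolding J_def by blast
    have "P.Th J (c i) (c (Suc i)) = s (\<phi> (c (Suc i))) - s (\<phi> (c i))"
      by (rule P.Th_exact[OF cstep[OF i] ex])
    moreover have "J (c i) (c (Suc i)) = s (\<phi> (c (Suc i))) - s (\<phi> (c i))"
      using P.near_mono[OF cstep[OF i], of "2*A3+1"] by (intro ex) auto
    ultimately show ?thesis by simp
  qed
  have "ev z (P.Th J) = ev z J"
  proof (rule ev_cong)
    fix s a b assume "(s,a,b) \<in> set z"
    from zset[OF this] show "P.Th J a b = J a b" using ThJ by blast
  qed
  also have "ev z J = (\<Sum>i<L. J (c i) (c (Suc i)))" unfolding z_def by (rule ev_walk)
  finally have "ev z (P.Th J) \<noteq> 0" using sumJ by simp
  moreover have "P.conn a b" if "(s,a,b) \<in> set z" for s a b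
    using zset[OF that] cstep P.near_conn by blast
  ultimately have "(\<Sum>vi. ev (P.cellc vi) J * ev z (P.II (fst vi) (P.yy (fst vi) (snd vi)))) \<noteq> 0"
    using P.fill(2)[OF cz, where \<theta> = J] by simp
  \<comment> \<open>One and the same cell of the plane is wound around by the walk and has an image
    winding around the centre.\<close>
  then obtain vi where "ev (P.cellc vi) J * ev z (P.II (fst vi) (P.yy (fst vi) (snd vi))) \<noteq> 0"
    by (rule Sum_any.not_neutral_obtains_not_neutral)
  moreover obtain n i where vi: "vi = (n,i)" by force
  ultimately have ne: "ev (P.cellc vi) J \<noteq> 0" "ev z (P.II n (P.yy n i)) \<noteq> 0" by auto
  have near1: "Y.near (6*K+3) (\<phi> vi) b0"
  proof -
    have "J = (\<lambda>a b. Y.II u1 y (\<phi> a) (\<phi> b))" by (intro ext) (rule J_def)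
    then show ?thesis using Y.cell_near[OF pm inb _ P.cellc_self, of vi] ne(1) by (simp add: b0_def)
  qed
  have "(\<Sum>i'<L. P.II n (P.yy n i) (c i') (c (Suc i'))) \<noteq> 0" using ne(2) by (simp add: z_def ev_walk)
  from P_walk[of L A3 c n "P.yy n i", OF cstep _ this] closed obtain t where
    t: "t \<le> L" "n \<le> fst (c t)" "fst (c t) \<le> n + int A3" "\<bar>P.xc (c t) - P.yy n i\<bar> \<le> real (L+1) * dy (int A3 + n)"
    by (auto simp: c_def)
  have x: "\<bar>P.xc (c t) - P.xc vi\<bar> \<le> dy (int (E+3+A3) + n)"
  proof -
    have "\<bar>P.xc vi - P.yy n i\<bar> \<le> dy n" using P.inband_yy[of n i] by (simp add: P.inband_def vi)
    also have "\<dots> \<le> dy (int A3 + n)" by simp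
    finally have "\<bar>P.xc (c t) - P.xc vi\<bar> \<le> real (L+1) * dy (int A3 + n) + dy (int A3 + n)" using t(4) by linarith
    also have "\<dots> = real (L+2) * dy (int A3 + n)" by (simp add: algebra_simps)
    also have "\<dots> \<le> 2^(E+3) * dy (int A3 + n)"
    proof (rule mult_right_mono)
      have "L + 2 \<le> 8 * N" using N2 by (simp add: L_def)
      also have "\<dots> = 2^(E+3)" by (simp add: N_def power_add)
      finally show "real (L+2) \<le> 2^(E+3)" by (metis of_nat_le_iff of_nat_numeral of_nat_power)
    qed simp
    also have "\<dots> = dy (int (E+3) + (int A3 + n))" unfolding dy_add[of "int (E+3)"] dy_nat by simp
    finally show ?thesis by (simp add: algebra_simps)
  qed
  have "P.near (E+3+A3) (c t) vi"
    unfolding P_near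
  proof (intro conjI)
    show "\<bar>fst (c t) - fst vi\<bar> \<le> int (E+3+A3)" using t by (simp add: vi)
    show "\<bar>P.xc (c t) - P.xc vi\<bar> \<le> dy (int (E+3+A3) + fst (c t))" using t by (intro order_trans[OF x]) simp
    show "\<bar>P.xc (c t) - P.xc vi\<bar> \<le> dy (int (E+3+A3) + fst vi)" using x by (simp add: vi)
  qed
  from phi_near[OF l this] have "Y.near (K*(E+3+A3)+K) (\<phi> (c t)) (\<phi> vi)" by (simp add: \<phi>_def)
  from Y.near_trans[OF Y.near_trans[OF Y.near_sym[OF Mg[of t, folded c_def]] this order_refl] near1 order_refl]
  show False using far t(1) N by fastforce
qed

end

section \<open>The support of the degree is a vertical line\<close>

lemma P_near_exists: "\<exists>A. P.near A a b"
proof -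
  obtain n where n: "\<bar>P.xc a - P.xc b\<bar> \<le> dy (int n)" using dy_unbounded by blast
  define A where "A = n + nat \<bar>fst a\<bar> + nat \<bar>fst b\<bar> + nat \<bar>fst a - fst b\<bar>"
  have "P.near A a b" unfolding P_near
    by (intro conjI order_trans[OF n]) (auto simp: A_def)
  then show ?thesis by blast
qed

lemma P_near_up: "P.near d (n,k) (n + int d, k div 2^d)"
proof -
  have "real_of_int k = real_of_int (k div 2^d) * 2^d + real_of_int (k mod 2^d)"
    using arg_cong[OF div_mult_mod_eq[of k "2^d"], of real_of_int] by simp
  then have "P.xc (n,k) - P.xc (n + int d, k div 2^d) = real_of_int (k mod 2^d) * dy n"
    by (simp add: P.xc_def dy_add dy_nat algebra_simps)
  moreover have "real_of_int (k mod 2^d) \<le> real_of_int (2^d)" "0 \<le> real_of_int (k mod 2^d)"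
    by (simp_all only: of_int_le_iff of_int_0_le_iff) (simp_all add: less_imp_le)
  then have "real_of_int (k mod 2^d) * dy n \<le> 2^d * dy n" "0 \<le> real_of_int (k mod 2^d) * dy n"
    by (auto intro!: mult_right_mono)
  ultimately have x: "\<bar>P.xc (n,k) - P.xc (n + int d, k div 2^d)\<bar> \<le> dy (int d + n)"
    by (simp add: dy_add dy_nat)
  have "\<bar>P.xc (n,k) - P.xc (n + int d, k div 2^d)\<bar> \<le> dy (int d + (n + int d))"
    by (rule order_trans[OF x]) simp
  then show ?thesis unfolding P_near using x by simp
qed

lemma (in horo) deg_up:
  assumes "deg \<phi> w y \<noteq> 0" shows "\<exists>a. up w (fst (\<phi> a))"
proof (rule ccontr)
  assume "\<not> ?thesis"
  then have "\<not> up w (fst (\<phi> a))" for a by blast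
  then have "II w y (\<phi> a) (\<phi> b) = 0" for a b by (simp add: II_def chi_def)
  then show False using assms by (simp add: deg_def)
qed

lemma (in horo) isline_agree: "isline l \<Longrightarrow> isline l' \<Longrightarrow> l n = l' n \<Longrightarrow> m \<le> n \<Longrightarrow> l m = l' m"
  using isline_anc[of l "nat (n - m)" n] isline_anc[of l' "nat (n - m)" n] by simp

lemma (in horo) isline_branch:
  assumes "isline l" "isline l'" "l j = l' j" "l e \<noteq> l' e"
  obtains m where "\<And>i. l i = l' i \<longleftrightarrow> i \<le> m"
proof -
  have je: "j < e" using isline_agree[OF assms(1,2), of j e] isline_agree[OF assms(1,2,3), of e] assms(4)
    by (metis linorder_not_less)
  define S where "S = {i \<in> {j..e}. l i = l' i}"
  have S: "finite S" by (rule finite_subset[of _ "{j..e}"]) (auto simp: S_def)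
  have S: "finite S" "S \<noteq> {}" using S assms(3) je by (auto simp: S_def intro!: exI[of _ j])
  have "l i = l' i \<longleftrightarrow> i \<le> Max S" for i
  proof
    assume i: "l i = l' i"
    show "i \<le> Max S"
    proof (cases "i < j")
      case True
      have "j \<le> Max S" using S assms(3) je by (intro Max_ge) (auto simp: S_def)
      then show ?thesis using True by simp
    next
      case False
      have "i \<le> e" using isline_agree[OF assms(1,2) i, of e] assms(4) by fastforce
      then show ?thesis using S False i by (intro Max_ge) (auto simp: S_def)
    qed
  next
    assume "i \<le> Max S"
    moreover have "l (Max S) = l' (Max S)" using Max_in[OF S] by (simp add: S_def)
    ultimately show "l i = l' i" using isline_agree[OF assms(1,2)] by blast
  qed
  then show ?thesis using that by blast
qed

context rigid
begin

definition supp :: "(int \<Rightarrow> 'v) \<Rightarrow> 'w set" where "supp l = {w. Y.deg (phi l) w 0 \<noteq> 0}"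

lemma supp_near:
  assumes "inl l" "w \<in> supp l" shows "\<exists>a. Y.near (6*K+3) (phi l a) (w,k)"
  using Y.deg_nonzero[OF pmap_phi[OF assms(1)] _ Y.inband_yy, of w k] assms
    Y.deg_y[OF pmap_phi[OF assms(1)], of w 0 "Y.yy w k"] by (simp add: supp_def)

text \<open>The support does not branch, so \<open>w\<close> is the only child of
  \<open>par' w\<close> with nonzero degree and the flow equation has a single term.\<close>

lemma supp_par:
  assumes "inl l" "w \<in> supp l" shows "par' w \<in> supp l" "Y.deg (phi l) (par' w) 0 = Y.deg (phi l) w 0"
proof -
  obtain U where U: "finite U" "\<And>u. u \<in> U \<Longrightarrow> par' u = par' w" "Y.deg (phi l) (par' w) 0 = (\<Sum>u\<in>U. Y.deg (phi l) u 0)"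
    "\<And>u. par' u = par' w \<Longrightarrow> u \<notin> U \<Longrightarrow> Y.deg (phi l) u 0 = 0"
    by (rule Y.deg_flow[OF pmap_phi[OF assms(1)], of "par' w" 0]) blast
  have w: "Y.deg (phi l) w 0 \<noteq> 0" using assms by (simp add: supp_def)
  have "w \<in> U" using U(4)[of w] w by blast
  moreover have "Y.deg (phi l) u 0 = 0" if "u \<in> U" "u \<noteq> w" for u
    using support_no_branch[OF assms(1), of u w] U(2)[OF that(1)] w that(2) by blast
  ultimately have "(\<Sum>u\<in>U. Y.deg (phi l) u 0) = (\<Sum>u\<in>{w}. Y.deg (phi l) u 0)"
    using U(1) by (intro sum.mono_neutral_right) auto
  then show "Y.deg (phi l) (par' w) 0 = Y.deg (phi l) w 0" using U(3) by simp
  then show "par' w \<in> supp l" using w by (simp add: supp_def)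
qed

lemma supp_anc: "inl l \<Longrightarrow> w \<in> supp l \<Longrightarrow> (par' ^^ i) w \<in> supp l"
  by (induction i) (auto intro: supp_par)

text \<open>Images of any two points of the plane are a finite distance apart, so two support
  vertices have a common ancestor; where their descents join, the support would branch.\<close>

lemma supp_level_unique:
  assumes l: "inl l" and w: "w \<in> supp l" "w' \<in> supp l" "lev' w = lev' w'"
  shows "w = w'"
proof (rule ccontr)
  assume ne: "w \<noteq> w'"
  obtain a where a: "Y.near (6*K+3) (phi l a) (w,0)" using supp_near[OF l w(1)] by blast
  obtain b where b: "Y.near (6*K+3) (phi l b) (w',0)" using supp_near[OF l w(2)] by blast
  obtain A where "P.near A a b" using P_near_exists by blast
  from phi_near[OF l this] have ab: "Y.near (K*A+K) (phi l a) (phi l b)" .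
  have "\<exists>B. Y.near B (w,0) (w',0)"
    using Y.near_trans[OF Y.near_trans[OF Y.near_sym[OF a] ab order_refl] b order_refl] by blast
  then obtain i j where ij: "(par' ^^ i) w = (par' ^^ j) w'" by (auto simp: Y.near_def)
  have "i = j" using arg_cong[OF ij, of lev'] w(3) by simp
  define n where "n = (LEAST n. (par' ^^ n) w = (par' ^^ n) w')"
  have n: "(par' ^^ n) w = (par' ^^ n) w'" unfolding n_def using ij \<open>i = j\<close> by (intro LeastI) auto
  have "n \<noteq> 0" using n ne by (cases n) auto
  then obtain m where m: "n = Suc m" by (cases n) auto
  have "(par' ^^ m) w \<noteq> (par' ^^ m) w'"
    using not_less_Least[of m "\<lambda>n. (par' ^^ n) w = (par' ^^ n) w'"] m by (simp add: n_def)
  then show False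
    using support_no_branch[OF l, of "(par' ^^ m) w" "(par' ^^ m) w'"] n m
      supp_anc[OF l w(1), of m] supp_anc[OF l w(2), of m] by (auto simp: supp_def)
qed

lemma supp_line: assumes l: "inl l" shows "\<exists>l'. Y.isline l' \<and> range l' = supp l"
proof -
  obtain w0 where w0: "w0 \<in> supp l"
    by (rule near_support[OF l, of 0 0]) (auto simp: supp_def)
  have "\<exists>w\<in>supp l. lev' w = lev' w0 + int k" for k
  proof (induction k)
    case (Suc k)
    then obtain w where w: "w \<in> supp l" "lev' w = lev' w0 + int k" by blast
    obtain u where u: "par' u = w" "u \<in> supp l" using deg_child[OF l, of w] w by (auto simp: supp_def)
    have "lev' u = lev' w0 + int (Suc k)" using Y.lev_par[of u] u w by simp
    then show ?case using u by blast
  qed (use w0 in auto)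
  moreover have "\<exists>w\<in>supp l. lev' w = lev' w0 - int k" for k
    by (intro bexI[OF _ supp_anc[OF l w0, of k]]) simp
  ultimately have "\<exists>w\<in>supp l. lev' w = n" for n
    using zero_le_imp_eq_int[of "n - lev' w0"] zero_le_imp_eq_int[of "lev' w0 - n"]
    by (metis add.commute diff_add_cancel diff_diff_eq2 diff_ge_0_iff_ge linorder_linear add_diff_cancel_left')
  then obtain l' where l': "\<And>n. l' n \<in> supp l" "\<And>n. lev' (l' n) = n" by metis
  have uniq: "w = l' (lev' w)" if "w \<in> supp l" for w
    using supp_level_unique[OF l that l'(1)] l'(2) by simp
  have "par' (l' (n+1)) = l' n" for n
    using uniq[OF supp_par(1)[OF l l'(1)], of "n+1"] Y.lev_par l'(2) by simp
  then have "Y.isline l'" using l'(2) by (simp add: Y.isline_def)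
  moreover have "range l' = supp l" using l'(1) uniq by blast
  ultimately show ?thesis by blast
qed

definition LL :: "(int \<Rightarrow> 'v) \<Rightarrow> int \<Rightarrow> 'w" where
  "LL l = (SOME l'. Y.isline l' \<and> range l' = supp l)"

lemma LL_line: "inl l \<Longrightarrow> Y.isline (LL l)" and LL_range: "inl l \<Longrightarrow> range (LL l) = supp l"
  unfolding LL_def using someI_ex[OF supp_line] by blast+

lemma LL_deg: assumes "inl l" shows "Y.deg (phi l) (LL l n) 0 = Y.deg (phi l) (LL l m) 0"
proof -
  have 1: "Y.deg (phi l) (LL l (n - int k)) 0 = Y.deg (phi l) (LL l n) 0" for n k
  proof (induction k)
    case (Suc k)
    have "LL l (n - int k) \<in> supp l" using LL_range[OF assms] by blast
    moreover have "par' (LL l (n - int k)) = LL l (n - int (Suc k))"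
      using Y.isline_anc[OF LL_line[OF assms], of 1 "n - int k"] by (simp add: algebra_simps)
    ultimately show ?case using supp_par(2)[OF assms] Suc by metis
  qed simp
  show ?thesis using 1[of m "nat (m-n)"] 1[of n "nat (n-m)"] by (cases "n \<le> m") auto
qed

text \<open>Lines that agree at \<open>n\<close> agree below it, and the degree at a vertex depends
  only on the cells mapped near it. Far enough below \<open>n\<close> all such cells lie in the
  common half of the two planes.\<close>

lemma supp_common:
  assumes l: "inl l" "inl l'" "l n = l' n"
  obtains u where "u \<in> supp l" "Y.deg (phi l) u 0 = Y.deg (phi l') u 0"
proof -
  define D where "D = K*(6*K+4+RR)+K"
  \<comment> \<open>\<open>D\<close> is the source distance that \<open>phi_far\<close> allows
    between points with images within \<open>6*K+4+RR\<close> of each other.\<close>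
  define j where "j = n - int D"
  have agree: "phi l a = phi l' a" if "fst a \<le> n" for a
    using X.isline_agree[OF inl_line[OF l(1)] inl_line[OF l(2)] l(3) that] by (simp add: phi_def X.emb_def)
  obtain w i where w: "Y.near RR (phi l (j,0)) (w,i)" "Y.deg (phi l) w 0 \<noteq> 0"
    by (rule near_support[OF l(1), of j 0])
  have w': "Y.near RR (phi l' (j,0)) (w,i)" using w(1) agree[of "(j,0)"] by (simp add: j_def)
  let ?y = "Y.yy w i"
  have low: "fst a \<le> n" if "inl m" "Y.near RR (phi m (j,0)) (w,i)"
      "ev (P.cellc c) (\<lambda>a b. Y.II w ?y (phi m a) (phi m b)) \<noteq> 0" "a \<in> pts (P.cellc c)" for m a c
  proof -
    have "Y.near (6*K+3) (phi m a) (w,i)"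
      using Y.cell_near[OF pmap_phi[OF that(1)] Y.inband_yy that(3,4)] by simp
    from Y.near_trans[OF this Y.near_sym[OF that(2)] order_refl]
    have "Y.near (6*K+4+RR) (phi m a) (phi m (j,0))" by (rule Y.near_mono) simp
    from phi_far[OF that(1) this] have "\<bar>fst a - j\<bar> \<le> int D" unfolding P_near D_def by simp
    then show ?thesis by (simp add: j_def)
  qed
  have "ev (P.cellc c) (\<lambda>a b. Y.II w ?y (phi l a) (phi l b)) = ev (P.cellc c) (\<lambda>a b. Y.II w ?y (phi l' a) (phi l' b))" for c
  proof (cases "\<forall>a\<in>pts (P.cellc c). fst a \<le> n")
    case True
    then show ?thesis using agree by (intro ev_cong_pts) simp
  next
    case False
    then have "ev (P.cellc c) (\<lambda>a b. Y.II w ?y (phi l a) (phi l b)) = 0"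
      "ev (P.cellc c) (\<lambda>a b. Y.II w ?y (phi l' a) (phi l' b)) = 0"
      using low[OF l(1) w(1), of c] low[OF l(2) w', of c] by blast+
    then show ?thesis by simp
  qed
  then have "Y.deg (phi l) w ?y = Y.deg (phi l') w ?y" by (simp add: Y.deg_def)
  then have "Y.deg (phi l) w 0 = Y.deg (phi l') w 0"
    using Y.deg_y[OF pmap_phi[OF l(1)], of w ?y 0] Y.deg_y[OF pmap_phi[OF l(2)], of w ?y 0] by simp
  then show ?thesis using that[of w] w(2) by (simp add: supp_def)
qed

definition R5 :: nat where "R5 = 3*RR+2*K+2"

text \<open>Near the image of every point in the first row where the lines differ, duality finds a
  vertex in exactly one of the two supports, while the other support also passes nearby; so the
  supports part close to that level. As \<open>m\<close> does not depend on \<open>k\<close>, image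
  levels also vary little along the row.\<close>

lemma branch_level:
  assumes l: "inl l" "inl l'" and br: "l n = l' n" "l (n+1) \<noteq> l' (n+1)"
  obtains m where "\<And>i. LL l i = LL l' i \<longleftrightarrow> i \<le> m"
    "\<And>k. \<bar>lev' (fst (phi l (n+1,k))) - m\<bar> \<le> int R5"
proof -
  note L1 = LL_line[OF l(1)] and L2 = LL_line[OF l(2)]
  have nr: "l (n+1) \<notin> range l'"
  proof
    assume "l (n+1) \<in> range l'"
    then obtain i where "l (n+1) = l' i" by blast
    moreover from arg_cong[OF this, of lev] have "i = n+1"
      using X.isline_lev[OF inl_line] l by simp
    ultimately show False using br(2) by simp
  qed
  obtain u0 where u0: "u0 \<in> supp l" "Y.deg (phi l) u0 0 = Y.deg (phi l') u0 0"
    by (rule supp_common[OF l br(1)])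
  then have "u0 \<in> supp l'" by (simp add: supp_def)
  then obtain j j' where j: "u0 = LL l j" "u0 = LL l' j'" using u0(1) LL_range l by blast
  then have jj: "j = j'" using Y.isline_lev[OF L1] Y.isline_lev[OF L2] by metis
  \<comment> \<open>Both degrees are constant along their supports and agree at \<open>u0\<close>,
    so they differ only where exactly one of them vanishes.\<close>
  have one: "(u \<in> supp l \<and> u \<notin> supp l') \<or> (u \<in> supp l' \<and> u \<notin> supp l)"
    if "Y.deg (phi l) u 0 \<noteq> Y.deg (phi l') u 0" for u
  proof (rule ccontr)
    assume *: "\<not> ?thesis"
    show False
    proof (cases "u \<in> supp l")
      case True
      then have "u \<in> supp l'" using * by blast
      then obtain i i' where "u = LL l i" "u = LL l' i'" using True LL_range l by blast
      then show False using that LL_deg[OF l(1), of i j] LL_deg[OF l(2), of i' j'] u0 j by simp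
    next
      case False
      then show False using * that by (simp add: supp_def)
    qed
  qed
  have "\<exists>e. LL l e \<noteq> LL l' e"
  proof -
    obtain u i where "Y.deg (phi l) u 0 \<noteq> Y.deg (phi l') u 0"
      by (rule near_support_diff[OF l nr, of 0])
    from one[OF this] show ?thesis using LL_range l by (metis rangeE rangeI)
  qed
  then obtain e0 where e0: "LL l e0 \<noteq> LL l' e0" by blast
  have "LL l j = LL l' j" using j jj by simp
  then obtain m where m: "\<And>i. LL l i = LL l' i \<longleftrightarrow> i \<le> m"
    using Y.isline_branch[OF L1 L2 _ e0] by blast
  have "\<bar>lev' (fst (phi l (n+1,k))) - m\<bar> \<le> int R5" for k
  proof -
    define C where "C = 2*RR+2*K+2"
    obtain u i where u: "Y.near RR (phi l (n+1,k)) (u,i)" "Y.deg (phi l) u 0 \<noteq> Y.deg (phi l') u 0"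
      by (rule near_support_diff[OF l nr, of k])
    obtain w1 i1 where w1: "Y.near RR (phi l (n+1,k)) (w1,i1)" "Y.deg (phi l) w1 0 \<noteq> 0"
      by (rule near_support[OF l(1), of "n+1" k])
    \<comment> \<open>The point below \<open>(n+1,k)\<close> is still common to both lines, which
      gives access to the support of \<open>l'\<close>.\<close>
    obtain w2 i2 where w2: "Y.near RR (phi l' (n,2*k)) (w2,i2)" "Y.deg (phi l') w2 0 \<noteq> 0"
      by (rule near_support[OF l(2), of n "2*k"])
    have "phi l' (n,2*k) = phi l (n,2*k)" using br by (simp add: phi_def X.emb_def)
    moreover have "Y.near (2*K) (phi l (n,2*k)) (phi l (n+1,k))"
      using Y.pmap_near[OF pmap_phi[OF l(1)] P.near_edges(1)[of "n+1" k]] by simp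
    ultimately have w2': "Y.near (RR+2*K+1) (phi l (n+1,k)) (w2,i2)"
      using Y.near_trans[OF Y.near_sym w2(1)] by simp
    have n1: "Y.near C (u,i) (w1,i1)" using Y.near_trans[OF Y.near_sym[OF u(1)] w1(1)] by (simp add: C_def)
    have n2: "Y.near C (u,i) (w2,i2)" using Y.near_trans[OF Y.near_sym[OF u(1)] w2'] by (simp add: C_def)
    have key: "\<bar>lev' u - m\<bar> \<le> int C"
      if A: "Y.isline A" "Y.isline B" "\<And>i. A i = B i \<longleftrightarrow> i \<le> m" "u = A e" "u \<notin> range B" "w = B e'" "Y.near C (u,i) (w,i')" for A B e w e' i'
    proof -
      obtain s t where st: "s \<le> C" "t \<le> C" "(par' ^^ s) u = (par' ^^ t) w" using A(7) by (auto simp: Y.near_def)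
      then have "A (e - int s) = B (e' - int t)" using A by (simp add: Y.isline_anc)
      moreover from arg_cong[OF this, of lev'] have "e - int s = e' - int t" using A by (simp add: Y.isline_lev)
      ultimately have "e - int s \<le> m" using A(3) by metis
      moreover have "\<not> e \<le> m" using A(3)[of e] A(4,5) by auto
      ultimately show ?thesis using A st by (simp add: Y.isline_lev)
    qed
    have "\<bar>lev' u - m\<bar> \<le> int C"
      using one[OF u(2)]
    proof
      assume a: "u \<in> supp l \<and> u \<notin> supp l'"
      obtain e where "u = LL l e" using a LL_range[OF l(1)] by blast
      moreover obtain e' where "w2 = LL l' e'" using w2(2) LL_range[OF l(2)] by (force simp: supp_def)
      ultimately show ?thesis using key[OF L1 L2 m _ _ _ n2] a LL_range[OF l(2)] by blast
    next
      assume a: "u \<in> supp l' \<and> u \<notin> supp l"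
      obtain e where "u = LL l' e" using a LL_range[OF l(2)] by blast
      moreover obtain e' where "w1 = LL l e'" using w1(2) LL_range[OF l(1)] by (force simp: supp_def)
      moreover have "LL l' i = LL l i \<longleftrightarrow> i \<le> m" for i using m[of i] by metis
      ultimately show ?thesis using key[OF L2 L1 _ _ _ _ n1] a LL_range[OF l(1)] by blast
    qed
    moreover have "\<bar>lev' (fst (phi l (n+1,k))) - lev' u\<bar> \<le> int RR" using Y.near_lev[OF u(1)] by simp
    ultimately show ?thesis by (simp add: R5_def C_def)
  qed
  then show ?thesis using that[OF m] by blast
qed

end

section \<open>Image levels rise at unit rate\<close>

locale rigid_branching = rigid par lev par' lev' V f K
  for par :: "'v \<Rightarrow> 'v" and lev and par' :: "'w \<Rightarrow> 'w" and lev' and V f K +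
  fixes B0 :: nat
  assumes branching: "inl l \<Longrightarrow> \<exists>n'\<ge>n. n' \<le> n + int B0 \<and> (\<exists>l'. inl l' \<and> l' n' = l n' \<and> l' (n'+1) \<noteq> l (n'+1))"
begin

definition hh :: "(int \<Rightarrow> 'v) \<Rightarrow> int \<Rightarrow> int" where "hh l n = lev' (fst (phi l (n,0)))"

definition R6 :: nat where "R6 = 2*(K*(B0+1)+K) + 2*R5"

text \<open>The next branching above \<open>n\<close> has one level \<open>m\<close> for the images
  of a whole row, and that row is at most \<open>B0+1\<close> steps above row
  \<open>n\<close>.\<close>

lemma level_const: assumes l: "inl l" shows "\<bar>lev' (fst (phi l (n,k))) - hh l n\<bar> \<le> int R6"
proof -
  obtain n' l' where n': "n \<le> n'" "n' \<le> n + int B0" "inl l'" "l' n' = l n'" "l' (n'+1) \<noteq> l (n'+1)"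
    using branching[OF l, of n] by blast
  obtain m where m: "\<And>k. \<bar>lev' (fst (phi l (n'+1,k))) - m\<bar> \<le> int R5"
    by (rule branch_level[OF l n'(3) n'(4)[symmetric] n'(5)[symmetric]]) blast
  define d where "d = nat (n'+1-n)"
  have d: "n'+1 = n + int d" "d \<le> B0+1" using n' by (auto simp: d_def)
  have "\<bar>lev' (fst (phi l (n,k))) - m\<bar> \<le> int (K*(B0+1)+K) + int R5" for k
  proof -
    have "Y.near (K*(B0+1)+K) (phi l (n,k)) (phi l (n'+1, k div 2^d))"
      using phi_near[OF l P.near_mono[OF P_near_up d(2)]] d(1) by simp
    from Y.near_lev[OF this] m[of "k div 2^d"] show ?thesis by linarith
  qed
  moreover define M0 where "M0 = int (K*(B0+1)+K)"
  moreover have "int R6 = 2 * M0 + 2 * int R5" by (simp add: R6_def M0_def)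
  ultimately have "\<bar>lev' (fst (phi l (n,q))) - m\<bar> \<le> M0 + int R5" and R: "int R6 = 2 * M0 + 2 * int R5" for q by auto
  from this(1)[of k] this(1)[of 0] show ?thesis unfolding hh_def R by linarith
qed

definition cc :: nat where "cc = 2*K+R6"
definition T :: nat where "T = 4*RR + 2*R6"

abbreviation xx :: "(int \<Rightarrow> 'v) \<Rightarrow> int \<Rightarrow> int \<Rightarrow> real" where "xx l n k \<equiv> Y.xc (phi l (n,k))"

lemma xx_horizontal: assumes l: "inl l" shows "\<bar>xx l n k - xx l n (k+1)\<bar> \<le> dy (int cc + hh l n)"
proof -
  have "\<bar>xx l n k - xx l n (k+1)\<bar> \<le> dy (int (2*K) + lev' (fst (phi l (n,k))))"
    using Y.pmap_near[OF pmap_phi[OF l] P.near_edges(2)] by (simp add: Y.near_def)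
  also have "\<dots> \<le> dy (int cc + hh l n)" using level_const[OF l, of n k] by (simp add: cc_def)
  finally show ?thesis .
qed

lemma xx_horizontal_sum: assumes l: "inl l" shows "\<bar>xx l n 0 - xx l n (int k)\<bar> \<le> real k * dy (int cc + hh l n)"
proof (induction k)
  case (Suc k)
  then show ?case using xx_horizontal[OF l, of n "int k"] by (simp add: algebra_simps)
qed simp

lemma xx_vertical: assumes l: "inl l" shows "\<bar>xx l n k - xx l (n+1) (k div 2)\<bar> \<le> dy (int cc + hh l (n+1))"
proof -
  have "P.near 1 (n,k) (n+1, k div 2)" using P_near_up[of 1 n k] by simp
  then have "\<bar>xx l n k - xx l (n+1) (k div 2)\<bar> \<le> dy (int (2*K) + lev' (fst (phi l (n+1,k div 2))))"
    using Y.pmap_near[OF pmap_phi[OF l]] by (simp add: Y.near_def)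
  also have "\<dots> \<le> dy (int cc + hh l (n+1))" using level_const[OF l, of "n+1" "k div 2"] by (simp add: cc_def)
  finally show ?thesis .
qed

lemma xx_climb: assumes l: "inl l"
  shows "\<bar>xx l n k - xx l (n + int j) (k div 2^j)\<bar> \<le> (\<Sum>i<j. dy (int cc + hh l (n + int i + 1)))"
proof (induction j)
  case (Suc j)
  have "\<bar>xx l (n + int j) (k div 2^j) - xx l (n + int (Suc j)) (k div 2^Suc j)\<bar> \<le> dy (int cc + hh l (n + int j + 1))"
  proof -
    have "k div 2^Suc j = k div (2^j * 2)" by (simp add: mult.commute)
    also have "\<dots> = k div 2^j div 2" by (rule zdiv_zmult2_eq) simp
    finally show ?thesis using xx_vertical[OF l, of "n + int j" "k div 2^j"] by (simp add: algebra_simps)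
  qed
  then show ?case using Suc by simp
qed simp

lemma hh_step: assumes l: "inl l" shows "\<bar>hh l (n + int j) - hh l n\<bar> \<le> 2 * int K * int j"
proof (induction j)
  case (Suc j)
  have "P.near 1 (n + int j, 0) (n + int j + 1, 0)" using P_near_up[of 1 "n + int j" 0] by simp
  then have "\<bar>hh l (n + int j) - hh l (n + int j + 1)\<bar> \<le> int (2*K)"
    using Y.near_lev[OF Y.pmap_near[OF pmap_phi[OF l]]] by (simp add: hh_def)
  then show ?case using Suc by (simp add: algebra_simps)
qed simp

text \<open>The tree parts of the two images are within \<open>T\<close> of meeting, both being
  close to one line and at nearly equal levels. With close horizontal coordinates the images would
  be near each other although the points are not.\<close>

lemma xx_separated:
  assumes l: "inl l" and far: "2^(K*A+K) < \<bar>k - k'\<bar>" and A: "T \<le> A"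
  shows "dy (int A - int R6 + hh l n) < \<bar>xx l n k - xx l n k'\<bar>"
proof (rule ccontr)
  assume "\<not> ?thesis"
  then have x: "\<bar>xx l n k - xx l n k'\<bar> \<le> dy (int A - int R6 + hh l n)" by simp
  have lv: "\<bar>lev' (fst (phi l (n,q))) - hh l n\<bar> \<le> int R6" for q by (rule level_const[OF l])
  obtain w1 i1 where w1: "Y.near RR (phi l (n,k)) (w1,i1)" "Y.deg (phi l) w1 0 \<noteq> 0"
    by (rule near_support[OF l, of n k])
  obtain w2 i2 where w2: "Y.near RR (phi l (n,k')) (w2,i2)" "Y.deg (phi l) w2 0 \<noteq> 0"
    by (rule near_support[OF l, of n k'])
  obtain e1 where e1: "w1 = LL l e1" using LL_range[OF l] w1(2) by (force simp: supp_def)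
  obtain e2 where e2: "w2 = LL l e2" using LL_range[OF l] w2(2) by (force simp: supp_def)
  note line = LL_line[OF l]
  have ee: "\<bar>e1 - e2\<bar> \<le> int (2*RR + 2*R6)"
    using Y.near_lev[OF w1(1)] Y.near_lev[OF w2(1)] lv[of k] lv[of k'] by (simp add: e1 e2 Y.isline_lev[OF line])
  obtain s1 t1 where st1: "s1 \<le> RR" "t1 \<le> RR" "(par' ^^ s1) (fst (phi l (n,k))) = (par' ^^ t1) w1"
    using w1(1) by (auto simp: Y.near_def)
  obtain s2 t2 where st2: "s2 \<le> RR" "t2 \<le> RR" "(par' ^^ s2) w2 = (par' ^^ t2) (fst (phi l (n,k')))"
    using w2(1) by (auto simp: Y.near_def dest: sym)
  have "(par' ^^ nat (e1-e2)) w1 = (par' ^^ nat (e2-e1)) w2"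
    unfolding e1 e2 Y.isline_anc[OF line] by (rule arg_cong[of _ _ "LL l"]) simp
  moreover have "nat (e1-e2) \<le> 2*RR+2*R6" "nat (e2-e1) \<le> 2*RR+2*R6" using ee by auto
  ultimately obtain s3 t3 where st3: "s3 \<le> RR+(2*RR+2*R6)" "t3 \<le> RR+(2*RR+2*R6)"
     "(par' ^^ s3) (fst (phi l (n,k))) = (par' ^^ t3) w2"
    using Y.anc_meet_trans[OF st1(3) _ st1(1,2)] by blast
  obtain s t where st: "s \<le> RR+(2*RR+2*R6)+RR" "t \<le> RR+(2*RR+2*R6)+RR"
     "(par' ^^ s) (fst (phi l (n,k))) = (par' ^^ t) (fst (phi l (n,k')))"
    using Y.anc_meet_trans[OF st3(3) st2(3) st3(1,2) st2(1,2)] by blast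
  have "Y.near A (phi l (n,k)) (phi l (n,k'))"
  proof (rule Y.nearI[OF _ _ st(3)])
    show "s \<le> A" "t \<le> A" using st A by (auto simp: T_def)
    show "\<bar>xx l n k - xx l n k'\<bar> \<le> dy (int A + lev' (fst (phi l (n,k))))"
      using lv[of k] by (intro order_trans[OF x]) simp
    show "\<bar>xx l n k - xx l n k'\<bar> \<le> dy (int A + lev' (fst (phi l (n,k'))))"
      using lv[of k'] by (intro order_trans[OF x]) simp
  qed
  from phi_far[OF l this] have "\<bar>P.xc (n,k) - P.xc (n,k')\<bar> \<le> dy (int (K*A+K) + n)" by (simp add: P_near)
  moreover have "\<bar>P.xc (n,k) - P.xc (n,k')\<bar> = \<bar>real_of_int (k - k')\<bar> * dy n"
    by (simp add: P.xc_def abs_mult left_diff_distrib[symmetric])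
  ultimately have "\<bar>real_of_int (k - k')\<bar> \<le> 2^(K*A+K)" by (simp only: dy_add dy_nat) simp
  then have "real_of_int \<bar>k - k'\<bar> \<le> real_of_int (2^(K*A+K))" by simp
  then have "\<bar>k - k'\<bar> \<le> 2^(K*A+K)" by (simp only: of_int_le_iff)
  then show False using far by simp
qed

text \<open>Solves a self-referential requirement: \<open>2 ^ EE\<close> has to exceed a multiple of
  \<open>JJ\<close>, which is itself linear in \<open>EE\<close>.\<close>

definition EE :: nat where
  "EE = (SOME E. (2*K*2^(cc+R6)) * E + ((2*K+3)*2^(cc+R6) + 2^T) < 2 ^ E)"
definition JJ :: nat where "JJ = K*EE+K+1"

lemma EE: "(2*JJ+1) * 2^(cc+R6) < 2 ^ EE" "T \<le> EE"
proof -
  have 1: "(2*K*2^(cc+R6)) * EE + ((2*K+3)*2^(cc+R6) + 2^T) < 2 ^ EE"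
    unfolding EE_def by (rule someI_ex[OF exp_beats_linear])
  then show "(2*JJ+1) * 2^(cc+R6) < 2 ^ EE" by (simp add: JJ_def algebra_simps)
  have "(2::nat) ^ T < 2 ^ EE" using 1 by linarith
  then show "T \<le> EE" by simp
qed

text \<open>The points 0 and \<open>2 ^ JJ\<close> of row \<open>n\<close> become adjacent after
  \<open>JJ\<close> steps up. Had the image level not risen meanwhile, their images would have moved
  by at most \<open>2*JJ+1\<close> units of a fixed scale, too little to close the gap between
  them.\<close>

lemma hh_grows: assumes l: "inl l" shows "\<exists>i\<in>{1..JJ}. hh l n + 1 \<le> hh l (n + int i)"
proof (rule ccontr)
  assume "\<not> ?thesis"
  then have le: "hh l (n + int i) \<le> hh l n" if "1 \<le> i" "i \<le> JJ" for i using that by force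
  have "(\<Sum>i<JJ. dy (int cc + hh l (n + int i + 1))) \<le> (\<Sum>i<JJ. dy (int cc + hh l n))"
  proof (rule sum_mono)
    fix i assume "i \<in> {..<JJ}"
    then show "dy (int cc + hh l (n + int i + 1)) \<le> dy (int cc + hh l n)" using le[of "Suc i"] by (simp add: algebra_simps)
  qed
  also have "\<dots> = real JJ * dy (int cc + hh l n)" by simp
  finally have sum: "(\<Sum>i<JJ. dy (int cc + hh l (n + int i + 1))) \<le> real JJ * dy (int cc + hh l n)" .
  have 1: "\<bar>xx l n 0 - xx l (n + int JJ) 0\<bar> \<le> real JJ * dy (int cc + hh l n)"
    using xx_climb[OF l, of n 0 JJ] sum by simp
  have 2: "\<bar>xx l n (2^JJ) - xx l (n + int JJ) 1\<bar> \<le> real JJ * dy (int cc + hh l n)"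
    using xx_climb[OF l, of n "2^JJ" JJ] sum by simp
  have "dy (int cc + hh l (n + int JJ)) \<le> dy (int cc + hh l n)" using le[of JJ] by (simp add: JJ_def)
  then have 3: "\<bar>xx l (n + int JJ) 0 - xx l (n + int JJ) 1\<bar> \<le> dy (int cc + hh l n)"
    using order_trans[OF xx_horizontal[OF l, of "n + int JJ" 0]] by simp
  have "dy (int EE - int R6 + hh l n) < \<bar>xx l n 0 - xx l n (2^JJ)\<bar>"
    by (rule xx_separated[OF l _ EE(2)]) (simp add: JJ_def)
  also have "\<dots> \<le> 2 * (real JJ * dy (int cc + hh l n)) + dy (int cc + hh l n)" using 1 2 3 by linarith
  also have "\<dots> = real (2*JJ+1) * dy (int cc + hh l n)" by (simp add: algebra_simps)
  also have "dy (int cc + hh l n) = dy (int (cc+R6)) * dy (- int R6 + hh l n)" by (simp flip: dy_add)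
  also have "dy (int EE - int R6 + hh l n) = dy (int EE) * dy (- int R6 + hh l n)"
    unfolding dy_add[symmetric] by (rule arg_cong[of _ _ dy]) simp
  finally have "dy (int EE) < real (2*JJ+1) * dy (int (cc+R6))" by (simp add: mult.assoc[symmetric])
  then have "real (2^EE) < real ((2*JJ+1) * 2^(cc+R6))" unfolding dy_nat of_nat_mult by simp
  then show False using EE(1) by (simp only: of_nat_less_iff)
qed

text \<open>Successive stretches of at most \<open>JJ\<close> steps each gain one level; the
  incomplete last one loses at most \<open>2*K*JJ\<close>.\<close>

lemma hh_mono: assumes l: "inl l" shows "hh l n + int (j div JJ) - 2 * int K * int JJ \<le> hh l (n + int j)"
proof (induction j arbitrary: n rule: less_induct)
  case (less j)
  have JJ: "0 < JJ" by (simp add: JJ_def)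
  show ?case
  proof (cases "j < JJ")
    case True
    have "2 * int K * int j \<le> 2 * int K * int JJ" using True by (intro mult_left_mono) auto
    then show ?thesis using hh_step[OF l, of n j] True by simp
  next
    case False
    obtain i where i: "1 \<le> i" "i \<le> JJ" "hh l n + 1 \<le> hh l (n + int i)" using hh_grows[OF l] by force
    have "hh l (n + int i) + int ((j - i) div JJ) - 2 * int K * int JJ \<le> hh l (n + int i + int (j - i))"
      using i False by (intro less) auto
    moreover have "n + int i + int (j - i) = n + int j" using i False by simp
    moreover have "(j - JJ) div JJ \<le> (j - i) div JJ" using i by (intro div_le_mono) auto
    moreover have "j div JJ = Suc ((j - JJ) div JJ)" using False JJ by (simp add: le_div_geq)
    ultimately show ?thesis using i(3) by simp
  qed
qed

text \<open>A geometric series in which every term occurs \<open>J\<close> times.\<close>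

lemma sum_dy_div: assumes "0 < J" shows "(\<Sum>i<j. dy (- int (i div J))) \<le> 2 * real J"
proof (induction j rule: less_induct)
  case (less j)
  show ?case
  proof (cases "j \<le> J")
    case True
    have "(\<Sum>i<j. dy (- int (i div J))) \<le> (\<Sum>i<j. 1)" using True by (intro sum_mono) simp
    then show ?thesis using True by simp
  next
    case False
    then have j: "j = J + (j - J)" by simp
    have "(\<Sum>i<j. dy (- int (i div J))) = (\<Sum>i<J. dy (- int (i div J))) + (\<Sum>i<j - J. dy (- int ((i + J) div J)))"
    proof -
      have "{..<j} = {..<J} \<union> {J..<j}" using False by auto
      then have "(\<Sum>i<j. dy (- int (i div J))) = (\<Sum>i<J. dy (- int (i div J))) + (\<Sum>i\<in>{J..<j}. dy (- int (i div J)))"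
        by (simp add: sum.union_disjoint ivl_disj_int)
      also have "(\<Sum>i\<in>{J..<j}. dy (- int (i div J))) = (\<Sum>i<j - J. dy (- int ((i + J) div J)))"
        by (rule sum.reindex_bij_witness[of _ "\<lambda>i. i + J" "\<lambda>i. i - J"]) auto
      finally show ?thesis .
    qed
    also have "(\<Sum>i<j - J. dy (- int ((i + J) div J))) = (\<Sum>i<j - J. dy (- int (i div J))) / 2"
      unfolding sum_divide_distrib
    proof (rule sum.cong[OF refl])
      fix i
      show "dy (- int ((i + J) div J)) = dy (- int (i div J)) / 2"
      proof -
        have "- int ((i + J) div J) = - int (i div J) - 1" using assms by simp
        then show ?thesis using dy_pred[of "- int (i div J)"] by (simp only:)
      qed
    qed
    also have "(\<Sum>i<J. dy (- int (i div J))) = real J" by simp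
    finally show ?thesis using less[of "j - J"] False assms by simp
  qed
qed

definition c7 :: nat where "c7 = cc + 2*K*JJ + JJ + 1"

text \<open>The bounds on the horizontal steps grow geometrically on the way up, so the total drift
  is controlled by the scale at the top and not by the number of steps.\<close>

lemma xx_climb': assumes l: "inl l"
  shows "\<bar>xx l n k - xx l (n + int j) (k div 2^j)\<bar> \<le> dy (int c7 + hh l (n + int j))"
proof -
  let ?m = "n + int j"
  have "(\<Sum>i<j. dy (int cc + hh l (n + int i + 1))) = (\<Sum>i<j. dy (int cc + hh l (n + int (j - Suc i) + 1)))"
    by (rule sum.nat_diff_reindex[symmetric])
  also have "\<dots> \<le> (\<Sum>i<j. dy (int cc + 2*int K*int JJ + hh l ?m) * dy (- int (i div JJ)))"
  proof (rule sum_mono)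
    fix i assume i: "i \<in> {..<j}"
    then have e: "n + int (j - Suc i) + 1 = ?m - int i" by auto
    have "hh l (?m - int i) + int (i div JJ) - 2 * int K * int JJ \<le> hh l ?m"
      using hh_mono[OF l, of "?m - int i" i] by simp
    then show "dy (int cc + hh l (n + int (j - Suc i) + 1)) \<le> dy (int cc + 2*int K*int JJ + hh l ?m) * dy (- int (i div JJ))"
      unfolding e dy_add[symmetric] by simp
  qed
  also have "\<dots> \<le> dy (int cc + 2*int K*int JJ + hh l ?m) * (2 * real JJ)"
    unfolding sum_distrib_left[symmetric] by (intro mult_left_mono sum_dy_div) (auto simp: JJ_def)
  also have "\<dots> \<le> dy (int cc + 2*int K*int JJ + hh l ?m) * dy (int (JJ+1))"
  proof (rule mult_left_mono)
    have "real JJ \<le> real (2^JJ)" by (simp only: of_nat_le_iff less_imp_le[OF less_exp])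
    then show "2 * real JJ \<le> dy (int (JJ+1))" unfolding dy_nat by simp
  qed simp
  also have "\<dots> = dy (int c7 + hh l ?m)" unfolding dy_add[symmetric] by (rule arg_cong[of _ _ dy]) (simp add: c7_def)
  finally show ?thesis using xx_climb[OF l, of n k j] by linarith
qed

lemma packing:
  fixes x :: "nat \<Rightarrow> real"
  assumes "0 < \<delta>" and N: "0 < N" and b: "\<And>t. t < N \<Longrightarrow> \<bar>x t - c\<bar> \<le> S" and sep: "\<And>t t'. t < N \<Longrightarrow> t' < N \<Longrightarrow> t \<noteq> t' \<Longrightarrow> \<delta> < \<bar>x t - x t'\<bar>"
  shows "(real N - 1) * \<delta> \<le> 2 * S"
proof -
  define h where "h t = \<lfloor>(x t - (c - S)) / \<delta>\<rfloor>" for t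
  have "inj_on h {..<N}"
  proof (rule inj_onI, rule ccontr)
    fix t t' assume t: "t \<in> {..<N}" "t' \<in> {..<N}" "h t = h t'" "t \<noteq> t'"
    have "\<bar>(x t - (c - S)) / \<delta> - (x t' - (c - S)) / \<delta>\<bar> < 1" using t(3) unfolding h_def by linarith
    then have "\<bar>x t - x t'\<bar> < \<delta>" using assms(1) by (simp add: diff_divide_distrib[symmetric] abs_divide)
    then show False using sep[of t t'] t by simp
  qed
  moreover have "h ` {..<N} \<subseteq> {0..\<lfloor>2 * S / \<delta>\<rfloor>}"
  proof safe
    fix t assume t: "t < N"
    have "0 \<le> (x t - (c - S)) / \<delta>" "(x t - (c - S)) / \<delta> \<le> 2 * S / \<delta>"
      using b[OF t] assms(1) by (auto intro!: divide_right_mono divide_nonneg_pos)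
    then show "h t \<in> {0..\<lfloor>2 * S / \<delta>\<rfloor>}" by (auto simp: h_def floor_mono)
  qed
  ultimately have "card {..<N} \<le> card {0..\<lfloor>2 * S / \<delta>\<rfloor>}" by (intro card_inj_on_le) auto
  then have "int N \<le> \<lfloor>2 * S / \<delta>\<rfloor> + 1" using N by simp
  then have "real N - 1 \<le> 2 * S / \<delta>" by linarith
  then show ?thesis using assms(1) by (simp add: field_simps)
qed

definition dd :: nat where "dd = K*T+K+1"
definition A8 :: nat where "A8 = T+R6+c7+2"
definition R8 :: nat where "R8 = dd + c7 + 2 + K*A8+K+cc"

text \<open>Horizontal lengths are compared at the two levels. Growth that is too slow violates
  packing in the upper row; growth that is too fast makes the images of upper points too far apart
  to be joined through the lower row.\<close>

lemma hh_exact: assumes l: "inl l" shows "\<bar>hh l (n + int j) - hh l n - int j\<bar> \<le> int R8"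
proof -
  let ?m = "n + int j"
  have c7: "2 * int K * int JJ \<le> int c7" by (simp add: c7_def)
  have e0: "0 \<le> int c7 + hh l ?m - hh l n" using hh_mono[OF l, of n j] c7 by linarith
  have lower: "int j - (hh l ?m - hh l n) \<le> int (dd + c7 + 2)"
  proof (cases "j \<le> dd")
    case True
    then show ?thesis using e0 by simp
  next
    case False
    \<comment> \<open>\<open>N\<close> points of row \<open>n\<close> at spacing
      \<open>2 ^ dd\<close> all climb to index 0 of the upper row. Their images are separated at the
      lower scale and confined at the upper scale.\<close>
    define N where "N = (2::nat)^(j - dd)"
    have "(real N - 1) * dy (hh l n) \<le> 2 * dy (int c7 + hh l ?m)"
    proof (rule packing[where x = "\<lambda>t. xx l n (int t * 2^dd)" and c = "xx l ?m 0"])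
      fix t assume t: "t < N"
      have "t * 2^dd < 2^(j-dd) * 2^dd" using t by (simp add: N_def)
      also have "\<dots> = (2::nat)^j" using False by (simp flip: power_add)
      finally have "int (t * 2^dd) < int (2^j)" by (simp only: of_nat_less_iff)
      then have "(int t * 2^dd) div 2^j = 0" by (intro div_pos_pos_trivial) auto
      then show "\<bar>xx l n (int t * 2^dd) - xx l ?m 0\<bar> \<le> dy (int c7 + hh l ?m)"
        using xx_climb'[OF l, of n "int t * 2^dd" j] by simp
    next
      fix t t' assume "t < N" "t' < N" "t \<noteq> t'"
      then have "1 \<le> \<bar>int t - int t'\<bar>" by auto
      then have "1 * 2^dd \<le> \<bar>int t - int t'\<bar> * 2^dd" by (rule mult_right_mono) simp
      also have "\<dots> = \<bar>int t * 2^dd - int t' * 2^dd\<bar>" by (simp add: abs_mult left_diff_distrib[symmetric])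
      finally have "2^(K*T+K) < \<bar>int t * 2^dd - int t' * 2^dd\<bar>" by (rule order_less_le_trans[rotated]) (simp add: dd_def)
      from xx_separated[OF l this order_refl, of n]
      have "dy (int T - int R6 + hh l n) < \<bar>xx l n (int t * 2^dd) - xx l n (int t' * 2^dd)\<bar>" .
      moreover have "dy (hh l n) \<le> dy (int T - int R6 + hh l n)" by (simp add: T_def)
      ultimately show "dy (hh l n) < \<bar>xx l n (int t * 2^dd) - xx l n (int t' * 2^dd)\<bar>" by linarith
    qed (simp_all add: N_def)
    also have "dy (int c7 + hh l ?m) = dy (int c7 + hh l ?m - hh l n) * dy (hh l n)" by (simp flip: dy_add)
    finally have "real N - 1 \<le> 2 * dy (int c7 + hh l ?m - hh l n)" by (simp add: mult.assoc[symmetric])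
    moreover have "1 \<le> dy (int c7 + hh l ?m - hh l n)" using e0 dy_mono[of 0] by simp
    ultimately have "real N \<le> 3 * dy (int c7 + hh l ?m - hh l n)" by simp
    also have "\<dots> < 4 * dy (int c7 + hh l ?m - hh l n)" by simp
    also have "\<dots> = dy (int c7 + hh l ?m - hh l n + 1 + 1)" by (simp only: dy_Suc)
    also have "real N = dy (int (j - dd))" by (simp add: N_def dy_nat)
    finally have "int (j - dd) < int c7 + hh l ?m - hh l n + 1 + 1" by (simp only: dy_less_iff)
    then show ?thesis using False by simp
  qed
  \<comment> \<open>Two points of the upper row with well separated images are joined along row
    \<open>n\<close> by \<open>2 ^ j * k0\<close> steps, each of bounded size at the lower
    scale.\<close>
  have upper: "hh l ?m - hh l n - int j \<le> int (K*A8+K+cc)"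
  proof -
    define k0 where "k0 = (2::nat)^(K*A8+K+1)"
    have "2^(K*A8+K) < \<bar>0 - int k0\<bar>" by (simp add: k0_def)
    from xx_separated[OF l this, of ?m] have 1: "dy (int A8 - int R6 + hh l ?m) < \<bar>xx l ?m 0 - xx l ?m (int k0)\<bar>"
      by (simp add: A8_def)
    have 2: "\<bar>xx l n 0 - xx l ?m 0\<bar> \<le> dy (int c7 + hh l ?m)" using xx_climb'[OF l, of n 0 j] by simp
    have 3: "\<bar>xx l n (int (2^j*k0)) - xx l ?m (int k0)\<bar> \<le> dy (int c7 + hh l ?m)"
      using xx_climb'[OF l, of n "int (2^j*k0)" j] by simp
    have 4: "\<bar>xx l n 0 - xx l n (int (2^j*k0))\<bar> \<le> dy (int (j+(K*A8+K+1)) + (int cc + hh l n))"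
      using xx_horizontal_sum[OF l, of n "2^j*k0"] unfolding dy_add[of "int (j+(K*A8+K+1))"] dy_nat
      by (simp add: k0_def power_add)
    have "4 * dy (int c7 + hh l ?m) = dy (int c7 + hh l ?m + 1 + 1)" by (simp only: dy_Suc)
    also have "\<dots> \<le> dy (int A8 - int R6 + hh l ?m)" by (simp add: A8_def)
    finally have "dy (int c7 + hh l ?m) < dy (int (j+(K*A8+K+1)) + (int cc + hh l n))"
      using 1 2 3 4 dy_pos[of "int c7 + hh l ?m"] by linarith
    then have "int c7 + hh l ?m < int (j+(K*A8+K+1)) + (int cc + hh l n)" by (simp only: dy_less_iff)
    moreover have "1 \<le> c7" by (simp add: c7_def)
    ultimately show ?thesis by simp
  qed
  have "int R8 = int (dd + c7 + 2) + int (K*A8+K+cc)" by (simp add: R8_def)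
  then show ?thesis using lower upper of_nat_0_le_iff[of "K*A8+K+cc"] of_nat_0_le_iff[of "dd+c7+2"] by linarith
qed

text \<open>Through the common vertex \<open>l 0\<close> both lines share the additive normalization
  \<open>hh l 0\<close>; the level at which their supports part is then the source level shifted by
  it, up to \<open>R\<close>.\<close>

theorem branch_heights:
  obtains R :: nat where "\<And>l l' n. inl l \<Longrightarrow> inl l' \<Longrightarrow> l 0 = l' 0 \<Longrightarrow> 0 \<le> n \<Longrightarrow>
    (l n = l' n \<longrightarrow> LL l (n + hh l 0 - int R) = LL l' (n + hh l 0 - int R)) \<and>
    (LL l (n + hh l 0 + int R) = LL l' (n + hh l 0 + int R) \<longrightarrow> l n = l' n)"
proof -
  define R where "R = R5 + 2*K + R8 + 1"
  have "(l n = l' n \<longrightarrow> LL l (n + hh l 0 - int R) = LL l' (n + hh l 0 - int R)) \<and>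
    (LL l (n + hh l 0 + int R) = LL l' (n + hh l 0 + int R) \<longrightarrow> l n = l' n)"
    if l: "inl l" "inl l'" "l 0 = l' 0" "0 \<le> n" for l l' n
  proof (cases "l = l'")
    case False
    then obtain e where "l e \<noteq> l' e" by blast
    then obtain N where N: "\<And>i. l i = l' i \<longleftrightarrow> i \<le> N"
      using X.isline_branch[OF inl_line[OF l(1)] inl_line[OF l(2)] l(3)] by blast
    have N0: "0 \<le> N" using N[of 0] l(3) by simp
    obtain m where m: "\<And>i. LL l i = LL l' i \<longleftrightarrow> i \<le> m" "\<And>k. \<bar>lev' (fst (phi l (N+1,k))) - m\<bar> \<le> int R5"
      using branch_level[OF l(1,2), of N] N[of N] N[of "N+1"] by auto
    have "\<bar>hh l (N+1) - m\<bar> \<le> int R5" using m(2)[of 0] by (simp add: hh_def)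
    moreover have "\<bar>hh l (N+1) - hh l N\<bar> \<le> 2 * int K" using hh_step[OF l(1), of N 1] by simp
    moreover have "\<bar>hh l N - hh l 0 - N\<bar> \<le> int R8" using hh_exact[OF l(1), of 0 "nat N"] N0 by simp
    ultimately have "\<bar>m - hh l 0 - N\<bar> \<le> int R" by (simp add: R_def)
    then show ?thesis unfolding N m(1) by linarith
  qed simp
  then show ?thesis using that by blast
qed

end

subsection \<open>The levels\<close>

declare level.simps [simp del] \<X>.simps [simp del]

text \<open>\<open>LEAST\<close> on the reals has a meaning only for sets that attain their minimum;
  here finiteness below every bound supplies it.\<close>

lemma real_Least:
  fixes A :: "real set"
  assumes "\<And>M. finite {h \<in> A. h \<le> M}" "x \<in> A"
  shows "(LEAST h. h \<in> A) \<in> A" "y \<in> A \<Longrightarrow> (LEAST h. h \<in> A) \<le> y"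
proof -
  let ?B = "{h \<in> A. h \<le> x}"
  have B: "finite ?B" "?B \<noteq> {}" using assms by auto
  have m: "Min ?B \<in> A" "Min ?B \<le> x" using Min_in[OF B] by auto
  have le: "Min ?B \<le> z" if "z \<in> A" for z
  proof (cases "z \<le> x")
    case True then show ?thesis using that B by (intro Min_le) auto
  next
    case False then show ?thesis using m by simp
  qed
  have "(LEAST h. h \<in> A) = Min ?B" by (rule Least_equality) (use m le in auto)
  then show "(LEAST h. h \<in> A) \<in> A" "y \<in> A \<Longrightarrow> (LEAST h. h \<in> A) \<le> y" using m le by auto
qed

text \<open>For positive \<open>l\<close> and nonnegative \<open>h\<close>, the number of multiples
  \<open>0, l, 2*l, ...\<close> strictly below \<open>h\<close>. At \<open>level q q' n\<close> it
  counts the factors \<open>p\<close>, respectively \<open>p'\<close>, applied before index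
  \<open>n\<close> of the sequence \<open>\<X>\<close>.\<close>

definition cnt :: "real \<Rightarrow> real \<Rightarrow> nat" where "cnt l h = nat \<lceil>h / l\<rceil>"

lemma cnt_bounds:
  assumes "0 < l" "0 \<le> h" shows "h \<le> real (cnt l h) * l" "real (cnt l h) * l < h + l"
proof -
  have "0 \<le> \<lceil>h / l\<rceil>" using assms by (simp add: less_le_trans[of "-1" 0])
  then have "h / l \<le> real (cnt l h)" "real (cnt l h) < h / l + 1" unfolding cnt_def by linarith+
  then show "h \<le> real (cnt l h) * l" "real (cnt l h) * l < h + l" using assms by (simp_all add: field_simps)
qed

context
  fixes q q' :: real
  assumes q: "q > 1" and q': "q' > 1"
begin

lemma ln_pos: "0 < ln q" "0 < ln q'" using q q' by simp_all

abbreviation SS :: "real set" where "SS \<equiv> log_multiples q \<union> log_multiples q'"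

lemma finite_multiples: assumes "0 < ln r" shows "finite {h \<in> log_multiples r. h \<le> M}"
proof -
  have "{h \<in> log_multiples r. h \<le> M} \<subseteq> (\<lambda>a. real a * ln r) ` {..nat \<lceil>M / ln r\<rceil>}"
  proof
    fix h assume "h \<in> {h \<in> log_multiples r. h \<le> M}"
    then obtain a where a: "h = real a * ln r" "real a * ln r \<le> M" by (auto simp: log_multiples_def)
    then have "real a \<le> M / ln r" using assms by (simp add: field_simps)
    then have "a \<le> nat \<lceil>M / ln r\<rceil>" by linarith
    then show "h \<in> (\<lambda>a. real a * ln r) ` {..nat \<lceil>M / ln r\<rceil>}" using a by auto
  qed
  then show ?thesis using finite_subset by blast
qed

lemma finite_SS: "finite {h \<in> SS. P h \<and> h \<le> M}"
proof -
  have "{h \<in> SS. P h \<and> h \<le> M} \<subseteq> {h \<in> log_multiples q. h \<le> M} \<union> {h \<in> log_multiples q'. h \<le> M}" by auto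
  then show ?thesis using finite_multiples[OF ln_pos(1)] finite_multiples[OF ln_pos(2)] finite_subset by blast
qed

lemma SS_nonneg: "h \<in> SS \<Longrightarrow> 0 \<le> h"
  using ln_pos by (auto simp: log_multiples_def)

lemma multiple_in: "real a * ln q \<in> SS" "real a * ln q' \<in> SS"
  by (auto simp: log_multiples_def)

lemma level_0: "level q q' 0 = 0"
proof -
  have f: "finite {h \<in> SS. h \<le> M}" for M using finite_SS[of "\<lambda>_. True"] by simp
  have z: "0 \<in> SS" using multiple_in(1)[of 0] by simp
  have "0 \<le> (LEAST h. h \<in> SS)" by (rule SS_nonneg[OF real_Least(1)[OF f z]])
  moreover have "(LEAST h. h \<in> SS) \<le> 0" by (rule real_Least(2)[OF f z z])
  ultimately show ?thesis by (simp only: level.simps)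
qed

lemma level_Suc:
  "level q q' (Suc n) \<in> SS" "level q q' n < level q q' (Suc n)"
  "h \<in> SS \<Longrightarrow> level q q' n < h \<Longrightarrow> level q q' (Suc n) \<le> h"
proof -
  let ?A = "{h. h \<in> SS \<and> level q q' n < h}"
  have f: "finite {h \<in> ?A. h \<le> M}" for M
    using finite_SS[of "\<lambda>h. level q q' n < h" M] by (rule rev_finite_subset) auto
  obtain a :: nat where "level q q' n / ln q < real a" using reals_Archimedean2 by blast
  then have x: "real a * ln q \<in> ?A" using ln_pos multiple_in by (simp add: field_simps)
  have e: "level q q' (Suc n) = (LEAST h. h \<in> ?A)" by (simp add: level.simps)
  show "level q q' (Suc n) \<in> SS" "level q q' n < level q q' (Suc n)"
    using real_Least(1)[OF f x] unfolding e by auto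
  show "level q q' (Suc n) \<le> h" if "h \<in> SS" "level q q' n < h"
    using real_Least(2)[OF f x, of h] that unfolding e by auto
qed

lemma level_in: "level q q' n \<in> SS"
proof (cases n)
  case 0
  then show ?thesis using multiple_in(1)[of 0] by (simp only: level_0) simp
qed (use level_Suc in blast)

lemma level_nonneg: "0 \<le> level q q' n" using SS_nonneg[OF level_in] .

lemma cnt_Suc:
  assumes r: "r = q \<or> r = q'"
  shows "cnt (ln r) (level q q' (Suc n)) = cnt (ln r) (level q q' n) + of_bool (level q q' n \<in> log_multiples r)"
proof -
  let ?h = "level q q' n" and ?h' = "level q q' (Suc n)" and ?l = "ln r"
  have l: "0 < ?l" using r ln_pos by auto
  have m: "real a * ?l \<in> SS" for a using r multiple_in by auto
  have h0: "0 \<le> ?h" by (rule level_nonneg)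
  have up: "?h' \<le> real a * ?l" if "?h < real a * ?l" for a using level_Suc(3)[OF m that] .
  have lt: "?h < ?h'" by (rule level_Suc(2))
  show ?thesis
  proof (cases "?h \<in> log_multiples r")
    case True
    then obtain a where a: "?h = real a * ?l" by (auto simp: log_multiples_def)
    have "?h' \<le> real (a+1) * ?l" using a l by (intro up) simp
    then have "?h' / ?l \<le> real (a+1)" "real a < ?h' / ?l" using a l lt by (simp_all add: field_simps)
    then have "\<lceil>?h' / ?l\<rceil> = int a + 1" by linarith
    moreover have "?h / ?l = real a" using a l by simp
    ultimately show ?thesis using True by (simp only: cnt_def) simp
  next
    case False
    let ?c = "cnt ?l ?h"
    have c: "?h \<le> real ?c * ?l" "real ?c * ?l < ?h + ?l" using cnt_bounds[OF l h0] by auto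
    moreover have "?h \<noteq> real ?c * ?l"
    proof
      assume "?h = real ?c * ?l"
      then have "?h \<in> log_multiples r" unfolding log_multiples_def by blast
      then show False using False by simp
    qed
    ultimately have "?h < real ?c * ?l" by linarith
    then have "?h' \<le> real ?c * ?l" by (rule up)
    then have "?h' / ?l \<le> real ?c" "real ?c - 1 < ?h' / ?l" using c(2) lt l by (simp_all add: field_simps)
    then have "\<lceil>?h' / ?l\<rceil> = int ?c" by linarith
    then show ?thesis using False by (simp only: cnt_def[of ?l ?h']) simp
  qed
qed

lemma cnt_0: "cnt l (level q q' 0) = 0" unfolding level_0 by (simp add: cnt_def)

lemma cnt_sum: "n \<le> cnt (ln q) (level q q' n) + cnt (ln q') (level q q' n)"
proof (induction n)
  case (Suc n)
  have "level q q' n \<in> log_multiples q \<or> level q q' n \<in> log_multiples q'" using level_in by auto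
  then show ?case using Suc cnt_Suc[of q n] cnt_Suc[of q' n] by auto
qed simp

lemma level_unbounded: "\<exists>n. M < level q q' n"
proof (rule ccontr)
  assume "\<not> ?thesis"
  then have le: "level q q' n \<le> M" for n by (simp add: not_less)
  obtain n :: nat where n: "(M + ln q) / ln q + (M + ln q') / ln q' < real n" using reals_Archimedean2 by blast
  have "real (cnt (ln r) (level q q' n)) \<le> (M + ln r) / ln r" if "0 < ln r" for r
    using cnt_bounds(2)[OF that level_nonneg, of n] le[of n] that by (simp add: field_simps)
  from this[OF ln_pos(1)] this[OF ln_pos(2)] cnt_sum[of n] n show False by linarith
qed

context
  fixes p p' :: nat
  assumes p: "p \<ge> 2" and p': "p' \<ge> 2"
begin

abbreviation Xn where "Xn n \<equiv> \<X> p q p' q' n"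
abbreviation an where "an n \<equiv> cnt (ln q) (level q q' n)"
abbreviation bn where "bn n \<equiv> cnt (ln q') (level q q' n)"
abbreviation al :: "nat \<Rightarrow> nat" where "al n \<equiv> of_bool (level q q' n \<in> log_multiples q)"
abbreviation be :: "nat \<Rightarrow> nat" where "be n \<equiv> of_bool (level q q' n \<in> log_multiples q')"

lemma X_Suc: "Xn (Suc n) = \<lceil>real p ^ al n * real_of_int (Xn n) / real p' ^ be n\<rceil>"
proof -
  have "\<lceil>real p * real_of_int (Xn n)\<rceil> = int p * Xn n"
    by (metis ceiling_of_int of_int_mult of_int_of_nat_eq)
  then show ?thesis using level_in[of n] by (auto simp: \<X>.simps)
qed

lemma an_Suc: "an (Suc n) = an n + al n" and bn_Suc: "bn (Suc n) = bn n + be n"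
  using cnt_Suc[of q n] cnt_Suc[of q' n] by simp_all

lemma X_nonneg: "1 \<le> Xn n"
proof (induction n)
  case (Suc n)
  have "0 < real p ^ al n * real_of_int (Xn n) / real p' ^ be n" using Suc p p' by simp
  then show ?case unfolding X_Suc by linarith
qed (simp add: \<X>.simps)

subsection \<open>Boundedness from tree maps\<close>

definition wds :: "nat \<Rightarrow> nat list set" where "wds n = {w. set w \<subseteq> {..<p} \<and> length w = n}"

lemma wds: "finite (wds n)" "card (wds n) = p ^ n"
  unfolding wds_def using card_lists_length_eq[of "{..<p}" n] finite_lists_length_eq[of "{..<p}" n] by auto

text \<open>\<open>F w\<close> is an infinite digit sequence attached to a finite word. Digits up to
  the height of \<open>w\<close>, less \<open>c\<close>, are settled when letters are appended;
  conversely, digits agreeing up to some height force the letters to agree up to that height, less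
  \<open>c\<close>.\<close>

context
  fixes F :: "nat list \<Rightarrow> nat \<Rightarrow> nat" and c :: real
  assumes c: "0 \<le> c"
    and F_range: "\<And>w m. set w \<subseteq> {..<p} \<Longrightarrow> F w m < p'"
    and F_lip: "\<And>w d m j. set (w @ [d]) \<subseteq> {..<p} \<Longrightarrow> real m * ln q' \<le> real (length w) * ln q - c \<Longrightarrow> j < m \<Longrightarrow> F (w @ [d]) j = F w j"
    and F_inj: "\<And>w w' m n. set w \<subseteq> {..<p} \<Longrightarrow> set w' \<subseteq> {..<p} \<Longrightarrow> length w = length w' \<Longrightarrow> (\<And>j. j < m \<Longrightarrow> F w j = F w' j) \<Longrightarrow>
      real n * ln q \<le> real m * ln q' - c \<Longrightarrow> real n * ln q \<le> real (length w) * ln q - c \<Longrightarrow> take n w = take n w'"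
begin

text \<open>A delay that makes the first \<open>bn n - kk\<close> digits of words of length
  \<open>an n\<close> stable: \<open>c\<close> for the map, and \<open>ln q'\<close> because
  \<open>bn\<close> rounds up.\<close>

definition kk :: nat where "kk = nat \<lceil>(c + ln q') / ln q'\<rceil>"

lemma kk: "c + ln q' \<le> real kk * ln q'"
proof -
  have "(c + ln q') / ln q' \<le> real kk" unfolding kk_def by linarith
  then show ?thesis using ln_pos by (simp add: field_simps)
qed

text \<open>The recursion of \<open>\<X>\<close> is a pigeonhole count: a new source letter
  multiplies a fibre by \<open>p\<close>, a new target digit splits it into \<open>p'\<close>
  classes, and the largest class has at least the rounded-up quotient.\<close>

lemma fibre_lower: "\<exists>t. Xn n \<le> int (card {w \<in> wds (an n). \<forall>j < bn n - kk. F w j = t j})"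
proof (induction n)
  case 0
  have "{w \<in> wds (an 0). \<forall>j < bn 0 - kk. F w j = 0} = {[]}" unfolding cnt_0 by (auto simp: wds_def)
  then show ?case by (intro exI[of _ "\<lambda>_. 0"]) (simp add: \<X>.simps)
next
  case (Suc n)
  then obtain t where t: "Xn n \<le> int (card {w \<in> wds (an n). \<forall>j < bn n - kk. F w j = t j})" by blast
  define W where "W = {w \<in> wds (an n). \<forall>j < bn n - kk. F w j = t j}"
  define W' where "W' = {w \<in> wds (an (Suc n)). \<forall>j < bn n - kk. F w j = t j}"
  have fW: "finite W" "finite W'" unfolding W_def W'_def using wds by auto
  have "card W * p ^ al n \<le> card W'"
  proof (cases "al n = 0")
    case True
    then have "W' = W" unfolding W_def W'_def an_Suc by simp
    then show ?thesis using True by simp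
  next
    case False
    then have a1: "al n = 1" by (simp split: if_splits)
    have "(\<lambda>(w,d). w @ [d]) ` (W \<times> {..<p}) \<subseteq> W'"
    proof (rule image_subsetI)
      fix x assume "x \<in> W \<times> {..<p}"
      then obtain w d where x: "x = (w,d)" and w: "w \<in> W" and d: "d \<in> {..<p}" by blast
      have wl: "set (w @ [d]) \<subseteq> {..<p}" "length w = an n" using w d by (auto simp: W_def wds_def)
      have "F (w @ [d]) j = t j" if j: "j < bn n - kk" for j
      proof -
        have "real (bn n - kk) * ln q' \<le> real (length w) * ln q - c"
        proof -
          have "real (bn n) * ln q' < level q q' n + ln q'" by (rule cnt_bounds(2)[OF ln_pos(2) level_nonneg])
          moreover have "level q q' n \<le> real (an n) * ln q" by (rule cnt_bounds(1)[OF ln_pos(1) level_nonneg])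
          moreover have "real (bn n - kk) * ln q' = real (bn n) * ln q' - real kk * ln q'"
            using j by (simp add: of_nat_diff left_diff_distrib)
          ultimately show ?thesis using kk wl(2) by simp
        qed
        from F_lip[OF wl(1) this j] show ?thesis using w j by (simp add: W_def)
      qed
      then have "w @ [d] \<in> W'" using wl unfolding W'_def an_Suc a1 by (auto simp: wds_def)
      then show "(\<lambda>(w,d). w @ [d]) x \<in> W'" by (simp add: x)
    qed
    then have "card ((\<lambda>(w,d). w @ [d]) ` (W \<times> {..<p})) \<le> card W'" by (rule card_mono[OF fW(2)])
    moreover have "card ((\<lambda>(w,d). w @ [d]) ` (W \<times> {..<p})) = card W * p"
      by (subst card_image) (auto simp: inj_on_def card_cartesian_product)
    ultimately show ?thesis unfolding a1 by simp
  qed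
  moreover have "real_of_int (Xn n) \<le> real (card W)" using t unfolding W_def by linarith
  ultimately have W': "real p ^ al n * real_of_int (Xn n) \<le> real (card W')"
  proof -
    assume 1: "card W * p ^ al n \<le> card W'" and 2: "real_of_int (Xn n) \<le> real (card W)"
    have "real p ^ al n * real_of_int (Xn n) \<le> real p ^ al n * real (card W)" by (rule mult_left_mono[OF 2]) simp
    also have "\<dots> = real (card W * p ^ al n)" by simp
    also have "\<dots> \<le> real (card W')" using 1 by (simp only: of_nat_le_iff)
    finally show ?thesis .
  qed
  show ?case
  proof (cases "bn (Suc n) - kk = bn n - kk")
    \<comment> \<open>Either no digit is due or the truncated difference is still 0. No split takes
      place, and a division by \<open>p'\<close> only lowers the number to be reached.\<close>
    case True
    have "real p ^ al n * real_of_int (Xn n) / real p' ^ be n \<le> real p ^ al n * real_of_int (Xn n)"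
    proof -
      have "1 \<le> real p' ^ be n" using p' by simp
      moreover have "0 \<le> real p ^ al n * real_of_int (Xn n)" using X_nonneg[of n] by simp
      moreover have "x / r \<le> x" if "1 \<le> r" "0 \<le> x" for x r :: real
        using mult_left_mono[OF that] that by (simp add: divide_le_eq)
      ultimately show ?thesis by blast
    qed
    then have "real p ^ al n * real_of_int (Xn n) / real p' ^ be n \<le> real_of_int (int (card W'))" using W' by simp
    then have "Xn (Suc n) \<le> int (card W')" unfolding X_Suc by (rule ceiling_le)
    then show ?thesis unfolding True W'_def by blast
  next
    case False
    have "be n \<noteq> 0"
    proof
      assume "be n = 0"
      then show False using False unfolding bn_Suc by simp
    qed
    then have be1: "be n = 1" by (simp split: if_splits)
    then have b1: "be n = 1" "bn (Suc n) - kk = Suc (bn n - kk)" using False unfolding bn_Suc be1 by simp_all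
    let ?m = "bn n - kk"
    have "\<exists>d<p'. card W' \<le> p' * card {w \<in> W'. F w ?m = d}"
    proof (rule ccontr)
      assume "\<not> ?thesis"
      then have lt: "p' * card {w \<in> W'. F w ?m = d} < card W'" if "d < p'" for d using that by auto
      have "W' \<subseteq> (\<Union>d<p'. {w \<in> W'. F w ?m = d})"
        using F_range by (auto simp: W'_def wds_def)
      then have "card W' \<le> card (\<Union>d<p'. {w \<in> W'. F w ?m = d})" by (rule card_mono[rotated]) (use fW in auto)
      also have "\<dots> \<le> (\<Sum>d<p'. card {w \<in> W'. F w ?m = d})" by (rule card_UN_le) simp
      finally have "p' * card W' \<le> (\<Sum>d<p'. p' * card {w \<in> W'. F w ?m = d})" by (simp flip: sum_distrib_left)
      also have "\<dots> < (\<Sum>d<p'. card W')" using p' by (intro sum_strict_mono lt) (auto simp: lessThan_empty_iff)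
      finally show False by simp
    qed
    then obtain d where d: "card W' \<le> p' * card {w \<in> W'. F w ?m = d}" by blast
    have e: "{w \<in> wds (an (Suc n)). \<forall>j<bn (Suc n) - kk. F w j = (t(?m := d)) j} = {w \<in> W'. F w ?m = d}"
      unfolding b1(2) W'_def by (auto simp: less_Suc_eq)
    have "real (card W') \<le> real (p' * card {w \<in> W'. F w ?m = d})" using d by (simp only: of_nat_le_iff)
    then have "real p ^ al n * real_of_int (Xn n) / real p' ^ be n \<le> real_of_int (int (card {w \<in> W'. F w ?m = d}))"
      using W' p' unfolding b1(1) by (simp add: divide_le_eq mult.commute)
    then have "Xn (Suc n) \<le> int (card {w \<in> W'. F w ?m = d})" unfolding X_Suc by (rule ceiling_le)
    then show ?thesis using e by (intro exI[of _ "t(?m := d)"]) simp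
  qed
qed

text \<open>Words in one fibre share all but their last \<open>D\<close> letters, so a fibre has at
  most \<open>p ^ D\<close> elements.\<close>

lemma X_bounded_of_map: "\<exists>B. \<forall>n. \<bar>Xn n\<bar> \<le> B"
proof -
  define D where "D = nat \<lceil>(real kk * ln q' + c) / ln q\<rceil> + 2"
  have "\<bar>Xn n\<bar> \<le> int (p ^ D)" for n
  proof -
    obtain t where t: "Xn n \<le> int (card {w \<in> wds (an n). \<forall>j < bn n - kk. F w j = t j})" using fibre_lower by blast
    define W where "W = {w \<in> wds (an n). \<forall>j < bn n - kk. F w j = t j}"
    define h where "h = level q q' n"
    define n0 where "n0 = nat \<lfloor>(h - real kk * ln q' - c) / ln q\<rfloor>"
    have h: "0 \<le> h" by (simp add: h_def level_nonneg)
    have ab: "h \<le> real (an n) * ln q" "real (an n) * ln q < h + ln q" "h \<le> real (bn n) * ln q'"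
      using cnt_bounds[OF ln_pos(1) h] cnt_bounds[OF ln_pos(2) h] by (auto simp: h_def)
    have diff: "an n - n0 \<le> D"
    proof -
      have "real (an n) < h / ln q + 1" using ab(2) ln_pos by (simp add: field_simps)
      moreover have "(h - real kk * ln q' - c) / ln q - 1 \<le> real n0" unfolding n0_def by linarith
      moreover have "(h - real kk * ln q' - c) / ln q = h / ln q - (real kk * ln q' + c) / ln q"
        by (simp add: diff_divide_distrib add_divide_distrib)
      moreover have "(real kk * ln q' + c) / ln q \<le> real (D - 2)" unfolding D_def by linarith
      ultimately have "real (an n) < real n0 + real (D - 2) + 2" by linarith
      then show ?thesis by (simp add: D_def)
    qed
    have tk: "take n0 w = take n0 w'" if w: "w \<in> W" "w' \<in> W" for w w'
    proof (cases "n0 = 0")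
      case False
      have n0: "real n0 * ln q \<le> h - real kk * ln q' - c"
      proof -
        have "real n0 \<le> (h - real kk * ln q' - c) / ln q" using False unfolding n0_def by linarith
        then show ?thesis using ln_pos by (simp add: field_simps)
      qed
      have k0: "0 \<le> real kk * ln q'" using ln_pos by simp
      show ?thesis
      proof (rule F_inj[of w w' "bn n - kk"])
        show "set w \<subseteq> {..<p}" "set w' \<subseteq> {..<p}" "length w = length w'" using w by (auto simp: W_def wds_def)
        show "F w j = F w' j" if "j < bn n - kk" for j using w that by (simp add: W_def)
        have "real (bn n) - real kk \<le> real (bn n - kk)" by linarith
        then have "(real (bn n) - real kk) * ln q' \<le> real (bn n - kk) * ln q'" using ln_pos by (intro mult_right_mono) auto
        then show "real n0 * ln q \<le> real (bn n - kk) * ln q' - c" using n0 ab(3) by (simp add: left_diff_distrib)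
        have "length w = an n" using w by (simp add: W_def wds_def)
        then show "real n0 * ln q \<le> real (length w) * ln q - c" using n0 ab(1) k0 by simp
      qed
    qed simp
    have "inj_on (drop n0) W"
    proof (rule inj_onI)
      fix w w' assume "w \<in> W" "w' \<in> W" "drop n0 w = drop n0 w'"
      then show "w = w'" using tk by (metis append_take_drop_id)
    qed
    moreover have "drop n0 ` W \<subseteq> wds (an n - n0)"
      by (auto simp: W_def wds_def dest: in_set_dropD)
    ultimately have "card W \<le> card (wds (an n - n0))" using wds by (intro card_inj_on_le) auto
    also have "\<dots> = p ^ (an n - n0)" by (rule wds)
    also have "\<dots> \<le> p ^ D" using diff p by (intro power_increasing) auto
    finally have "int (card W) \<le> int (p ^ D)" by (simp only: of_nat_le_iff)
    then show ?thesis using t X_nonneg[of n] unfolding W_def by linarith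
  qed
  then show ?thesis by blast
qed

end

subsection \<open>Boundedness forces commensurability\<close>

text \<open>Euclid's algorithm in multiplicative form: the smaller base divides the larger one, and
  the quotient satisfies a relation of the same shape with the smaller base.\<close>

lemma power_eq_imp_common:
  assumes "x ^ a = y ^ b" "0 < a" "0 < b" "2 \<le> x" "2 \<le> (y::nat)"
  shows "\<exists>r s t. r > 0 \<and> s > 0 \<and> t > 0 \<and> x = r ^ s \<and> y = r ^ t"
  using assms
proof (induction "x + y" arbitrary: x y a b rule: less_induct)
  case less
  have step: "\<exists>r s t. r > 0 \<and> s > 0 \<and> t > 0 \<and> u = r ^ s \<and> v = r ^ t"
    if uv: "u < v" "u ^ i = v ^ j" "0 < i" "0 < j" "2 \<le> u" "u + v = x + y" for u v i j
  proof -
    have ji: "j < i"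
    proof (rule ccontr)
      assume "\<not> j < i"
      then have "v ^ i \<le> v ^ j" using uv by (intro power_increasing) auto
      moreover have "u ^ i < v ^ i" using uv by (intro power_strict_mono) auto
      ultimately show False using uv(2) by simp
    qed
    then have "u ^ j dvd v ^ j" using uv(2) by (metis le_imp_power_dvd less_imp_le)
    then have "u dvd v" using uv(4) by (simp add: pow_divides_pow_iff)
    then obtain w where w: "v = u * w" by blast
    have "u ^ j * w ^ j = u ^ j * u ^ (i - j)" using uv(2) ji by (simp add: w power_mult_distrib power_add[symmetric])
    then have e: "u ^ (i - j) = w ^ j" using uv(5) by simp
    have w2: "2 \<le> w"
    proof (rule ccontr)
      assume "\<not> 2 \<le> w"
      then have "w = 0 \<or> w = 1" by auto
      then show False using w uv by auto
    qed
    have "u + w < x + y" using uv(1,5,6) w w2 by (metis add_strict_left_mono mult_le_mono1 less_le_trans mult_2 add.commute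
       le_add1 nat_less_le mult.commute n_less_m_mult_n order_less_le_trans zero_less_numeral)
    then obtain r s t where "r > 0" "s > 0" "t > 0" "u = r ^ s" "w = r ^ t"
      using less(1)[of u w "i - j" j] e ji uv(4,5) w2 by auto
    then show ?thesis using w by (intro exI[of _ r] exI[of _ s] exI[of _ "s + t"]) (auto simp: power_add)
  qed
  consider "x = y" | "x < y" | "y < x" by linarith
  then show ?case
  proof cases
    case 1 then show ?thesis using less(5) by (intro exI[of _ x] exI[of _ 1]) auto
  next
    case 2 then show ?thesis using step[of x y a b] less by auto
  next
    case 3 then show ?thesis using step[of y x b a] less by (metis add.commute)
  qed
qed

lemma commensurable_of_X_bounded:
  assumes bounded: "\<And>n. Xn n \<le> B"
  shows "ln p / ln q < ln p' / ln q' \<or> (ln p / ln q = ln p' / ln q' \<and> powers_of_common_integer p p')"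
proof -
  define s s' where "s = ln p / ln q" and "s' = ln p' / ln q'"
  \<comment> \<open>Without rounding \<open>Z\<close> would stay 1, so it records the accumulated
    effect of the roundings; \<open>W\<close> is the exact product of the factors applied so
    far.\<close>
  define Z where "Z n = real_of_int (Xn n) * real p' ^ bn n / real p ^ an n" for n
  define W where "W n = real p ^ an n / real p' ^ bn n" for n
  have pos: "0 < real p" "0 < real p'" using p p' by auto
  have W0: "0 < W n" for n using pos by (simp add: W_def)
  have XZ: "real_of_int (Xn n) = Z n * W n" for n using pos by (simp add: Z_def W_def)
  have Z_Suc: "Z (Suc n) = Z n + (real_of_int (Xn (Suc n)) - real p ^ al n * real_of_int (Xn n) / real p' ^ be n) / W (Suc n)" for n
    using pos unfolding Z_def W_def an_Suc bn_Suc by (simp add: power_add field_simps)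
  have exact_le: "real p ^ al n * real_of_int (Xn n) / real p' ^ be n \<le> real_of_int (Xn (Suc n))" for n
    unfolding X_Suc by (rule le_of_int_ceiling)
  have Z_mono: "Z n \<le> Z (Suc n)" for n using Z_Suc[of n] exact_le[of n] W0[of "Suc n"] by simp
  have Z1: "1 \<le> Z n" for n
  proof (induction n)
    case 0 show ?case by (simp add: Z_def cnt_0 \<X>.simps)
  next
    case (Suc n) then show ?case using Z_mono[of n] by linarith
  qed
  have W_le: "W n \<le> real_of_int B" for n
  proof -
    have "1 * W n \<le> Z n * W n" using Z1[of n] W0[of n] by (intro mult_right_mono) auto
    then show ?thesis using XZ[of n] bounded[of n] by (metis mult_1 of_int_le_iff order_trans)
  qed
  have B0: "0 < real_of_int B" using W_le[of 0] W0[of 0] by linarith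
  \<comment> \<open>Both counts follow the same height; \<open>bn n\<close> overshoots its share by
    less than one step, which costs \<open>ln p'\<close>.\<close>
  have lnW: "level q q' n * (s - s') - ln p' \<le> ln (W n)" for n
  proof -
    have "ln (W n) = real (an n) * ln p - real (bn n) * ln p'"
      using pos by (simp add: W_def ln_div ln_realpow)
    moreover have "level q q' n * s \<le> real (an n) * ln p"
    proof -
      have "level q q' n * s \<le> (real (an n) * ln q) * s"
        using cnt_bounds(1)[OF ln_pos(1) level_nonneg] p ln_pos by (intro mult_right_mono) (auto simp: s_def)
      then show ?thesis using ln_pos by (simp add: s_def)
    qed
    moreover have "real (bn n) * ln p' \<le> level q q' n * s' + ln p'"
    proof -
      have "(real (bn n) * ln q') * s' \<le> (level q q' n + ln q') * s'"
        using cnt_bounds(2)[OF ln_pos(2) level_nonneg, of n] p' ln_pos by (intro mult_right_mono) (auto simp: s'_def)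
      then show ?thesis using ln_pos by (simp add: s'_def field_simps)
    qed
    ultimately show ?thesis by (simp add: algebra_simps)
  qed
  have le: "s \<le> s'"
  proof (rule ccontr)
    assume "\<not> s \<le> s'"
    then have ss: "0 < s - s'" by simp
    obtain n where n: "(ln (real_of_int B) + ln p') / (s - s') < level q q' n" using level_unbounded by blast
    then have "ln (real_of_int B) + ln p' < level q q' n * (s - s')" using ss by (simp add: field_simps)
    then have "ln (real_of_int B) < ln (W n)" using lnW[of n] by linarith
    then show False using W_le[of n] W0[of n] B0 by (simp add: not_less)
  qed
  show ?thesis
  proof (cases "s < s'")
    case True
    then show ?thesis by (simp add: s_def s'_def)
  next
    case False
    then have eq: "s = s'" using le by simp
    have W_ge: "1 / real p' \<le> W n" for n
    proof -
      have "ln (1 / real p') \<le> ln (W n)" using lnW[of n] eq pos by (simp add: ln_div)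
      then show ?thesis using W0[of n] pos by simp
    qed
    have Z_le: "Z n \<le> real_of_int B * real p'" for n
    proof -
      have "Z n * (1 / real p') \<le> Z n * W n" using W_ge[of n] Z1[of n] by (intro mult_left_mono) auto
      also have "\<dots> \<le> real_of_int B" using XZ[of n] bounded[of n] by simp
      finally show ?thesis using pos by (simp add: field_simps)
    qed
    define bad where "bad n \<longleftrightarrow> real p ^ al n * real_of_int (Xn n) / real p' ^ be n \<noteq> real_of_int (Xn (Suc n))" for n
    \<comment> \<open>Rounding up a non-integral fraction with denominator at most \<open>p'\<close>
      adds at least \<open>1 / p'\<close>; dividing by \<open>W\<close>, which is at most
      \<open>B\<close>, leaves at least \<open>eps\<close>.\<close>
    define eps where "eps = 1 / (real p' * real_of_int B)"
    have eps: "0 < eps" using pos B0 by (simp add: eps_def)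
    have gain: "Z n + eps \<le> Z (Suc n)" if "bad n" for n
    proof -
      have "real p ^ al n * real_of_int (Xn n) < real_of_int (Xn (Suc n)) * real p' ^ be n"
        using exact_le[of n] that pos unfolding bad_def by (simp add: divide_le_eq le_less divide_less_eq)
      then have "real_of_int (int p ^ al n * Xn n) < real_of_int (Xn (Suc n) * int p' ^ be n)" by simp
      then have "int p ^ al n * Xn n + 1 \<le> Xn (Suc n) * int p' ^ be n" by linarith
      then have "real_of_int (int p ^ al n * Xn n + 1) \<le> real_of_int (Xn (Suc n) * int p' ^ be n)" by (simp only: of_int_le_iff)
      then have "1 \<le> (real_of_int (Xn (Suc n)) - real p ^ al n * real_of_int (Xn n) / real p' ^ be n) * real p' ^ be n"
      proof -
        have "(x - y / r) * r = x * r - y" if "0 < r" for x y r :: real using that by (simp add: field_simps)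
        from this[of "real p' ^ be n"] show ?thesis
          using \<open>real_of_int (int p ^ al n * Xn n + 1) \<le> _\<close> pos by simp
      qed
      moreover have "real p' ^ be n \<le> real p'" using p' by auto
      moreover have "0 \<le> real_of_int (Xn (Suc n)) - real p ^ al n * real_of_int (Xn n) / real p' ^ be n"
        using exact_le[of n] by simp
      ultimately have "1 \<le> (real_of_int (Xn (Suc n)) - real p ^ al n * real_of_int (Xn n) / real p' ^ be n) * real p'"
        by (meson mult_left_mono order_trans)
      then have 1: "1 / real p' \<le> real_of_int (Xn (Suc n)) - real p ^ al n * real_of_int (Xn n) / real p' ^ be n"
        using pos by (simp add: field_simps)
      have "eps = 1 / real p' / real_of_int B" by (simp add: eps_def)
      also have "\<dots> \<le> 1 / real p' / W (Suc n)" using W_le W0 pos B0 by (intro divide_left_mono) auto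
      also have "\<dots> \<le> (real_of_int (Xn (Suc n)) - real p ^ al n * real_of_int (Xn n) / real p' ^ be n) / W (Suc n)"
        using W0[of "Suc n"] by (intro divide_right_mono[OF 1]) simp
      finally show ?thesis using Z_Suc[of n] by linarith
    qed
    have count: "1 + eps * real (card {i. i < n \<and> bad i}) \<le> Z n" for n
    proof (induction n)
      case 0 show ?case using Z1[of 0] by simp
    next
      case (Suc n)
      have "{i. i < Suc n \<and> bad i} = (if bad n then insert n {i. i < n \<and> bad i} else {i. i < n \<and> bad i})"
        by (auto simp: less_Suc_eq)
      then have "card {i. i < Suc n \<and> bad i} = card {i. i < n \<and> bad i} + of_bool (bad n)" by auto
      then show ?case using Suc gain[of n] Z_mono[of n] by (cases "bad n") (auto simp: algebra_simps)
    qed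
    have "finite {i. bad i}"
    proof (rule ccontr)
      assume inf: "infinite {i. bad i}"
      obtain M :: nat where M: "real_of_int B * real p' / eps < real M" using reals_Archimedean2 by blast
      obtain C where C: "C \<subseteq> {i. bad i}" "finite C" "card C = M" using inf infinite_arbitrarily_large by blast
      have "\<exists>n. \<forall>i\<in>C. i < n" using C(2) by (simp only: finite_nat_set_iff_bounded)
      then obtain n where n: "\<And>i. i \<in> C \<Longrightarrow> i < n" by blast
      have "C \<subseteq> {i. i < n \<and> bad i}" using C n by auto
      then have "M \<le> card {i. i < n \<and> bad i}" using C by (metis card_mono finite_Collect_conjI finite_Collect_less_nat)
      then have "eps * real M \<le> eps * real (card {i. i < n \<and> bad i})" using eps by simp
      moreover have "real_of_int B * real p' < eps * real M" using M eps by (simp add: field_simps)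
      ultimately show False using count[of n] Z_le[of n] by linarith
    qed
    then have "\<exists>n. \<forall>i\<in>{i. bad i}. i < n" by (simp only: finite_nat_set_iff_bounded)
    then obtain n0 where "\<And>i. bad i \<Longrightarrow> i < n0" by blast
    then have good: "\<not> bad i" if "n0 \<le> i" for i using that by (meson not_le)
    have Zc: "Z i = Z n0" if "n0 \<le> i" for i using that
    proof (induction i rule: dec_induct)
      case (step i)
      then show ?case using good[of i] Z_Suc[of i] by (simp add: bad_def)
    qed simp
    have "Xn ` {n0..} \<subseteq> {1..B}" using bounded X_nonneg by fastforce
    then have "finite (Xn ` {n0..})" by (rule finite_subset) simp
    \<comment> \<open>From \<open>n0\<close> on \<open>Z\<close> is constant while the sequence
      takes finitely many values, so a value recurs and \<open>W\<close> recurs with it; cancelling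
      gives a relation between powers of \<open>p\<close> and \<open>p'\<close>.\<close>
    then have "\<not> inj_on Xn {n0..}" using finite_imageD infinite_Ici by blast
    then obtain i' j' where "i' \<in> {n0..}" "j' \<in> {n0..}" "i' \<noteq> j'" "Xn i' = Xn j'"
      unfolding inj_on_def by blast
    then obtain i j where ij: "n0 \<le> i" "i < j" "Xn i = Xn j"
      by (metis atLeast_iff linorder_neqE_nat)
    have "W i = W j"
    proof -
      have "Z i * W i = Z j * W j" using XZ[of i] XZ[of j] ij by simp
      then show ?thesis using Zc[of i] Zc[of j] ij Z1[of n0] by simp
    qed
    define da db where "da = an j - an i" and "db = bn j - bn i"
    have ab: "an i \<le> an j" "bn i \<le> bn j" "an i + bn i < an j + bn j"
    proof -
      have sa: "an n \<le> an (Suc n)" and sb: "bn n \<le> bn (Suc n)" for n unfolding an_Suc bn_Suc by (rule le_add1)+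
      show "an i \<le> an j" by (rule lift_Suc_mono_le[of an, OF sa less_imp_le[OF ij(2)]])
      show "bn i \<le> bn j" by (rule lift_Suc_mono_le[of bn, OF sb less_imp_le[OF ij(2)]])
      have st: "an n + bn n < an (Suc n) + bn (Suc n)" for n
        using level_in[of n] unfolding an_Suc bn_Suc by auto
      show "an i + bn i < an j + bn j" by (rule lift_Suc_mono_less[of "\<lambda>n. an n + bn n", OF st ij(2)])
    qed
    have "real p ^ da = real p' ^ db"
    proof -
      have "an j = an i + da" "bn j = bn i + db" using ab by (auto simp: da_def db_def)
      then show ?thesis using \<open>W i = W j\<close> pos unfolding W_def by (simp add: power_add field_simps)
    qed
    then have pe: "p ^ da = p' ^ db" by (metis of_nat_eq_iff of_nat_power)
    have "da \<noteq> 0 \<or> db \<noteq> 0" using ab by (auto simp: da_def db_def)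
    moreover have "da = 0 \<longleftrightarrow> db = 0"
    proof
      assume "da = 0"
      then have "p' ^ db = 1" using pe by simp
      then show "db = 0" using p' by (simp add: power_eq_1_iff)
    next
      assume "db = 0"
      then have "p ^ da = 1" using pe by simp
      then show "da = 0" using p by (simp add: power_eq_1_iff)
    qed
    ultimately have "0 < da" "0 < db" by auto
    from power_eq_imp_common[OF pe this p p'] have "powers_of_common_integer p p'"
      unfolding powers_of_common_integer_def .
    then show ?thesis using eq by (simp add: s_def s'_def)
  qed
qed

end

end

subsection \<open>Digit expansions\<close>

lemma digits_eq:
  fixes x y b :: nat
  assumes "\<And>t. t < M \<Longrightarrow> x div b^t mod b = y div b^t mod b" "x < b^M" "y < b^M"
  shows "x = y"
  using assms
proof (induction M arbitrary: x y)
  case (Suc M)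
  have b: "0 < b" using Suc.prems(2) by (cases "b = 0") auto
  have "x div b = y div b"
  proof (rule Suc.IH)
    show "x div b div b^t mod b = y div b div b^t mod b" if "t < M" for t
      using Suc.prems(1)[of "Suc t"] that by (simp add: div_mult2_eq)
    show "x div b < b^M" "y div b < b^M" using Suc.prems(2,3) b by (simp_all add: div_less_iff_less_mult mult.commute)
  qed
  moreover have "x mod b = y mod b" using Suc.prems(1)[of 0] by simp
  ultimately show ?case by (metis div_mult_mod_eq)
qed simp

lemma expansion_less:
  fixes f :: "nat \<Rightarrow> nat"
  assumes "\<And>j. j < N \<Longrightarrow> f j < p" shows "(\<Sum>j<N. f j * p^j) < p^N"
  using assms
proof (induction N)
  case (Suc N)
  have "(\<Sum>j<Suc N. f j * p^j) < p^N + f N * p^N" using Suc by simp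
  also have "\<dots> = (f N + 1) * p^N" by simp
  also have "\<dots> \<le> p * p^N" using Suc.prems[of N] by (intro mult_right_mono) auto
  finally show ?case by simp
qed simp

lemma expansion_eq:
  fixes f g :: "nat \<Rightarrow> nat"
  assumes "\<And>j. j < N \<Longrightarrow> f j < p" "\<And>j. j < N \<Longrightarrow> g j < p"
    and "(\<Sum>j<N. f j * p^j) = (\<Sum>j<N. g j * p^j)" "j < N"
  shows "f j = g j"
  using assms
proof (induction N arbitrary: f g j)
  case (Suc N)
  have sh: "(\<Sum>j<Suc N. h j * p^j) = h 0 + p * (\<Sum>j<N. h (Suc j) * p^j)" for h :: "nat \<Rightarrow> nat"
    by (simp only: sum.lessThan_Suc_shift) (simp add: sum_distrib_left mult.commute mult.left_commute)
  have e: "f 0 + p * (\<Sum>j<N. f (Suc j) * p^j) = g 0 + p * (\<Sum>j<N. g (Suc j) * p^j)"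
    using Suc.prems(3) unfolding sh .
  have p: "f 0 < p" "g 0 < p" using Suc.prems by auto
  have 0: "f 0 = g 0" using arg_cong[OF e, of "\<lambda>x. x mod p"] p by simp
  then have 1: "(\<Sum>j<N. f (Suc j) * p^j) = (\<Sum>j<N. g (Suc j) * p^j)" using e p by simp
  show ?case
  proof (cases j)
    case (Suc i)
    then show ?thesis using Suc.IH[of "\<lambda>j. f (Suc j)" "\<lambda>j. g (Suc j)" i] Suc.prems 1 by auto
  qed (use 0 in simp)
qed simp

subsection \<open>Block codes\<close>

text \<open>Block \<open>i\<close> of \<open>N\<close> source letters spans the heights from
  \<open>i * N * l\<close> to \<open>(i+1) * N * l\<close>, and the exponent counts the target
  indices allotted to it. All integers \<open>i\<close> occur because addresses in treebolic spaces
  extend below height 0.\<close>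

locale block_code =
  fixes p p' N :: nat and l l' :: real
  assumes p: "p \<ge> 2" and p': "p' \<ge> 2" and N: "N \<ge> 1" and l: "0 < l" and l': "0 < l'"
    and block: "\<And>i::int. p ^ N \<le> p' ^ nat (\<lfloor>of_int (i+1) * (real N * l / l')\<rfloor> - \<lfloor>of_int i * (real N * l / l')\<rfloor>)"
begin

definition rt :: real where "rt = real N * l / l'"
text \<open>\<open>mm i\<close> is the first target index of block \<open>i\<close>, and
  \<open>blk\<close> is adjoint to it: the block that contains a given target index.\<close>

definition mm :: "int \<Rightarrow> int" where "mm i = \<lfloor>of_int i * rt\<rfloor>"
definition blk :: "int \<Rightarrow> int" where "blk J = \<lceil>of_int (J + 1) / rt\<rceil> - 1"

lemma rt: "0 < rt" using N l l' by (simp add: rt_def)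

lemma mm_le_iff: "mm i \<le> J \<longleftrightarrow> i \<le> blk J"
proof -
  have "mm i \<le> J \<longleftrightarrow> of_int i * rt < of_int (J + 1)" unfolding mm_def by linarith
  also have "\<dots> \<longleftrightarrow> of_int i < of_int (J+1) / rt" using rt by (simp add: field_simps)
  also have "\<dots> \<longleftrightarrow> i \<le> blk J" unfolding blk_def by linarith
  finally show ?thesis .
qed

lemma mm_0 [simp]: "mm 0 = 0" by (simp add: mm_def)

lemma mm_mono: "i \<le> j \<Longrightarrow> mm i \<le> mm j"
  unfolding mm_def using rt by (intro floor_mono mult_right_mono) auto

lemma blk_mm: "blk J = i" if "mm i \<le> J" "J < mm (i+1)"
  using mm_le_iff[of i J] mm_le_iff[of "i+1" J] that by linarith

definition val :: "(int \<Rightarrow> nat) \<Rightarrow> int \<Rightarrow> nat" where "val a i = (\<Sum>j<N. a (i * int N + int j) * p^j)"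

text \<open>The letters of a block, read as a number in base \<open>p\<close>, are rewritten in base
  \<open>p'\<close>; the block condition leaves room for all digits. Blocks of zeros become zeros,
  so a sequence that vanishes far to the left is coded by another such sequence.\<close>

definition enc :: "(int \<Rightarrow> nat) \<Rightarrow> int \<Rightarrow> nat" where
  "enc a J = val a (blk J) div p' ^ nat (J - mm (blk J)) mod p'"

lemma enc_less: "enc a J < p'" using p' by (simp add: enc_def)

lemma enc_agree:
  assumes "\<And>j. j < n \<Longrightarrow> a j = b j" "J < mm (n div int N)" shows "enc a J = enc b J"
proof -
  have i: "blk J < n div int N" using assms(2) mm_le_iff[of "n div int N" J] by linarith
  have "val a (blk J) = val b (blk J)" unfolding val_def
  proof (rule sum.cong[OF refl])
    fix j assume "j \<in> {..<N}"
    then have "blk J * int N + int j < (blk J + 1) * int N" by (simp add: algebra_simps)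
    also have "\<dots> \<le> (n div int N) * int N" using i by (intro mult_right_mono) auto
    also have "\<dots> \<le> n" using N by (simp add: minus_mod_eq_div_mult[symmetric])
    finally show "a (blk J * int N + int j) * p^j = b (blk J * int N + int j) * p^j" using assms(1) by simp
  qed
  then show ?thesis by (simp add: enc_def)
qed

text \<open>A block whose digits all lie below \<open>m\<close> is recovered as a number from its
  base \<open>p'\<close> digits, and then letter by letter in base \<open>p\<close>.\<close>

lemma enc_reflect:
  assumes a: "\<And>j. a j < p" and b: "\<And>j. b j < p" and e: "\<And>J. J < m \<Longrightarrow> enc a J = enc b J"
    and j: "j < int N * blk m"
  shows "a j = b j"
proof -
  define i where "i = j div int N"
  have N0: "0 < int N" using N by simp
  have i: "i < blk m"
  proof (rule ccontr)
    assume "\<not> i < blk m"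
    then have "int N * blk m \<le> int N * i" using N0 by (intro mult_left_mono) auto
    also have "\<dots> \<le> j" using N0 by (simp add: i_def minus_mod_eq_mult_div[symmetric])
    finally show False using j by simp
  qed
  then have mi: "mm (i+1) \<le> m" using mm_le_iff[of "i+1" m] by simp
  let ?M = "nat (mm (i+1) - mm i)"
  have "val a i = val b i"
  proof (rule digits_eq[of ?M _ p'])
    show "val a i < p' ^ ?M" "val b i < p' ^ ?M"
      using expansion_less[of N "\<lambda>j. a (i * int N + int j)" p] expansion_less[of N "\<lambda>j. b (i * int N + int j)" p]
        a b block[of i] by (auto simp: val_def mm_def rt_def intro: less_le_trans)
    fix t assume t: "t < ?M"
    have "blk (mm i + int t) = i" using t by (intro blk_mm) auto
    then show "val a i div p'^t mod p' = val b i div p'^t mod p'"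
      using e[of "mm i + int t"] t mi by (simp add: enc_def)
  qed
  moreover define t where "t = nat (j mod int N)"
  have t: "t < N" using N0 by (simp add: t_def nat_less_iff)
  ultimately have "a (i * int N + int t) = b (i * int N + int t)"
    using expansion_eq[of N "\<lambda>j. a (i * int N + int j)" p "\<lambda>j. b (i * int N + int j)" t] a b by (simp add: val_def)
  moreover have "i * int N + int t = j" using N0 by (simp add: i_def t_def)
  ultimately show ?thesis by simp
qed

lemma enc_zero:
  assumes "\<And>j. j < n \<Longrightarrow> a j = 0" "J < mm (n div int N)" shows "enc a J = 0"
proof -
  have "enc a J = enc (\<lambda>_. 0) J" by (rule enc_agree[OF _ assms(2)]) (use assms(1) in auto)
  then show ?thesis by (simp add: enc_def val_def)
qed

text \<open>One block of source letters plus one target letter: the cost of rounding to block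
  boundaries and of the floor.\<close>

definition CC :: real where "CC = real N * l + l'"

lemma CC: "0 \<le> CC" "l' \<le> CC" "real N * l \<le> CC" using N l l' by (auto simp: CC_def)

lemma mm_upper: "of_int (mm (n div int N)) * l' \<le> of_int n * l"
proof -
  have "of_int (mm (n div int N)) \<le> of_int (n div int N) * rt" unfolding mm_def by linarith
  then have "of_int (mm (n div int N)) * l' \<le> of_int (n div int N) * rt * l'" using l' by (intro mult_right_mono) auto
  also have "\<dots> = of_int (n div int N * int N) * l" using l' by (simp add: rt_def)
  also have "\<dots> \<le> of_int n * l" using N l by (intro mult_right_mono) (auto simp: minus_mod_eq_div_mult[symmetric])
  finally show ?thesis .
qed

lemma mm_lower: "of_int n * l - CC \<le> of_int (mm (n div int N)) * l'"
proof -
  have "of_int (n div int N) * rt - 1 \<le> of_int (mm (n div int N))" unfolding mm_def by linarith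
  then have "(of_int (n div int N) * rt - 1) * l' \<le> of_int (mm (n div int N)) * l'" using l' by (intro mult_right_mono) auto
  moreover have "(of_int (n div int N) * rt - 1) * l' = of_int (n div int N * int N) * l - l'"
  proof -
    have e: "rt * l' = real N * l" using l' by (simp add: rt_def)
    have "(of_int (n div int N) * rt - 1) * l' = of_int (n div int N) * (rt * l') - l'" by (simp add: algebra_simps)
    then show ?thesis unfolding e by simp
  qed
  moreover have "n - int N \<le> n div int N * int N" using N pos_mod_bound[of "int N" n] by (simp add: minus_mod_eq_div_mult[symmetric] del: pos_mod_bound)
  then have "of_int (n - int N) * l \<le> of_int (n div int N * int N) * l" using l by (intro mult_right_mono) linarith+
  moreover have "of_int (n - int N) * l = of_int n * l - real N * l" by (simp add: left_diff_distrib)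
  ultimately show ?thesis unfolding CC_def by linarith
qed

lemma blk_lower: "of_int m * l' - CC \<le> of_int (int N * blk m) * l"
proof -
  have "of_int (m + 1) / rt - 1 \<le> of_int (blk m)" unfolding blk_def by linarith
  then have "(of_int (m + 1) / rt - 1) * (real N * l) \<le> of_int (blk m) * (real N * l)" using N l by (intro mult_right_mono) auto
  moreover have "(of_int (m + 1) / rt - 1) * (real N * l) = of_int (m + 1) * l' - real N * l"
    using N l l' by (simp add: rt_def field_simps)
  ultimately show ?thesis using l' by (simp add: CC_def algebra_simps)
qed

end

lemma block_code_exists:
  fixes p p' :: nat and q q' :: real
  assumes p: "p \<ge> 2" and p': "p' \<ge> 2" and q: "q > 1" and q': "q' > 1"
    and A1: "ln p / ln q < ln p' / ln q' \<or> (ln p / ln q = ln p' / ln q' \<and> powers_of_common_integer p p')"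
  shows "\<exists>N. block_code p p' N (ln q) (ln q')"
proof -
  define l l' where "l = ln q" and "l' = ln q'"
  have l: "0 < l" "0 < l'" using q q' by (auto simp: l_def l'_def)
  have lp: "0 < ln (real p)" "0 < ln (real p')" using p p' by auto
  have "\<exists>N\<ge>1. \<forall>i::int. p ^ N \<le> p' ^ nat (\<lfloor>of_int (i+1) * (real N * l / l')\<rfloor> - \<lfloor>of_int i * (real N * l / l')\<rfloor>)"
    using A1
  proof
    assume lt: "ln p / ln q < ln p' / ln q'"
    define e where "e = l * ln p' / l' - ln p"
    have e: "0 < e" using lt l unfolding e_def l_def[symmetric] l'_def[symmetric] by (simp add: field_simps)
    \<comment> \<open>Per source letter the target offers a surplus \<open>e\<close> of logarithmic
      room. Once \<open>N * e\<close> exceeds \<open>ln p'\<close>, one digit lost to rounding is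
      affordable at every position \<open>i\<close>.\<close>
    obtain N :: nat where N: "ln p' / e < real N" using reals_Archimedean2 by blast
    then have N': "ln p' < real N * e" using e by (simp add: field_simps)
    have N0: "1 \<le> N" using N' lp by (cases N) auto
    have "p ^ N \<le> p' ^ nat (\<lfloor>of_int (i+1) * (real N * l / l')\<rfloor> - \<lfloor>of_int i * (real N * l / l')\<rfloor>)" for i :: int
    proof -
      let ?M = "nat (\<lfloor>of_int (i+1) * (real N * l / l')\<rfloor> - \<lfloor>of_int i * (real N * l / l')\<rfloor>)"
      have "of_int (i+1) * (real N * l / l') = of_int i * (real N * l / l') + real N * l / l'" by (simp add: algebra_simps add_divide_distrib)
      then have "real N * l / l' - 1 \<le> real ?M" by linarith
      then have "(real N * l / l' - 1) * ln p' \<le> real ?M * ln p'" using lp by (intro mult_right_mono) auto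
      moreover have "(real N * l / l' - 1) * ln p' = real N * e + real N * ln p - ln p'"
        by (simp add: e_def algebra_simps)
      ultimately have "real N * ln p \<le> real ?M * ln p'" using N' by linarith
      then have "ln (real p ^ N) \<le> ln (real p' ^ ?M)" using p p' by (simp add: ln_realpow)
      then have "real p ^ N \<le> real p' ^ ?M" using p p' by simp
      then show ?thesis by (metis of_nat_le_iff of_nat_power)
    qed
    then show ?thesis using N0 by blast
  next
    assume eq: "ln p / ln q = ln p' / ln q' \<and> powers_of_common_integer p p'"
    then obtain r s t where rst: "r > 0" "s > 0" "t > 0" "p = r ^ s" "p' = r ^ t"
      unfolding powers_of_common_integer_def by blast
    have r: "2 \<le> r" using rst p by (cases "r = 1") auto
    have lr: "0 < ln (real r)" using r by simp
    have "real s * ln r / l = real t * ln r / l'" using eq rst r unfolding l_def l'_def by (simp add: ln_realpow)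
    \<comment> \<open>With blocks of length \<open>t\<close> the boundaries fall on integers, so
      nothing is rounded, and \<open>p ^ t = p' ^ s\<close> holds exactly.\<close>
    then have "real t * l / l' = real s" using l lr by (simp add: field_simps)
    then have "p ^ t \<le> p' ^ nat (\<lfloor>of_int (i+1) * (real t * l / l')\<rfloor> - \<lfloor>of_int i * (real t * l / l')\<rfloor>)" for i :: int
    proof -
      assume e: "real t * l / l' = real s"
      have "\<lfloor>of_int (i+1) * (real t * l / l')\<rfloor> = (i+1) * int s" unfolding e by (metis floor_of_int of_int_mult of_int_of_nat_eq)
      moreover have "\<lfloor>of_int i * (real t * l / l')\<rfloor> = i * int s" unfolding e by (metis floor_of_int of_int_mult of_int_of_nat_eq)
      ultimately have "nat (\<lfloor>of_int (i+1) * (real t * l / l')\<rfloor> - \<lfloor>of_int i * (real t * l / l')\<rfloor>) = s" by (simp add: algebra_simps)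
      then show ?thesis unfolding rst(4,5) by (simp add: power_mult[symmetric] mult.commute)
    qed
    then show ?thesis using rst(3) by (intro exI[of _ t]) auto
  qed
  then obtain N where N: "1 \<le> N" "\<And>i::int. p ^ N \<le> p' ^ nat (\<lfloor>of_int (i+1) * (real N * l / l')\<rfloor> - \<lfloor>of_int i * (real N * l / l')\<rfloor>)" by blast
  have "block_code p p' N l l'" by unfold_locales (use p p' l N in auto)
  then show ?thesis unfolding l_def l'_def by blast
qed

subsection \<open>Longest common prefixes\<close>

abbreviation lcp :: "'a list \<Rightarrow> 'a list \<Rightarrow> nat" where "lcp xs ys \<equiv> length (longest_common_prefix xs ys)"

lemma lcp_le: "lcp xs ys \<le> length xs" "lcp xs ys \<le> length ys"
  by (auto intro: prefix_length_le longest_common_prefix_prefix1 longest_common_prefix_prefix2)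

lemma lcp_nth: "j < lcp xs ys \<Longrightarrow> xs ! j = ys ! j"
  by (metis longest_common_prefix_prefix1 longest_common_prefix_prefix2 prefix_def nth_append)

lemma lcp_ge: "m \<le> length xs \<Longrightarrow> m \<le> length ys \<Longrightarrow> (\<And>j. j < m \<Longrightarrow> xs ! j = ys ! j) \<Longrightarrow> m \<le> lcp xs ys"
proof -
  assume m: "m \<le> length xs" "m \<le> length ys" "\<And>j. j < m \<Longrightarrow> xs ! j = ys ! j"
  have "take m xs = take m ys" using m by (intro nth_equalityI) auto
  then have "prefix (take m xs) (longest_common_prefix xs ys)"
    by (metis longest_common_prefix_max_prefix take_is_prefix)
  then show ?thesis using m prefix_length_le by fastforce
qed

lemma depth_nonneg:
  assumes "x \<in> tree_points L W" "0 < L" shows "0 \<le> depth L x"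
proof (cases "fst x")
  case Nil
  then show ?thesis using assms by (auto simp: tree_points_def depth_def)
next
  case (Cons a w)
  have "0 \<le> L * real (length w)" using assms(2) by simp
  moreover have "depth L x = L + L * real (length w) - snd x" using Cons by (simp add: depth_def algebra_simps)
  moreover have "snd x < L" using assms(1) by (auto simp: tree_points_def)
  ultimately show ?thesis by linarith
qed

lemma branch_depth_near:
  assumes "x \<in> tree_points L W" "y \<in> tree_points L W" "0 < L"
  shows "real (lcp (fst x) (fst y)) * L - L \<le> branch_depth L x y" "branch_depth L x y \<le> real (lcp (fst x) (fst y)) * L"
    and "real (length (fst x)) * L - L \<le> depth L x" "depth L x \<le> real (length (fst x)) * L"
proof -
  have d: "real (length (fst z)) * L - L \<le> depth L z" "depth L z \<le> real (length (fst z)) * L" if "z \<in> tree_points L W" for z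
    using that by (auto simp: tree_points_def depth_def)
  have "real (lcp (fst x) (fst y)) * L \<le> real (length (fst x)) * L" "real (lcp (fst x) (fst y)) * L \<le> real (length (fst y)) * L"
    using lcp_le[of "fst x" "fst y"] assms(3) by (auto intro!: mult_right_mono)
  then show "real (lcp (fst x) (fst y)) * L - L \<le> branch_depth L x y" "branch_depth L x y \<le> real (lcp (fst x) (fst y)) * L"
    using d[OF assms(1)] d[OF assms(2)] assms(3) unfolding branch_depth_def by linarith+
  show "real (length (fst x)) * L - L \<le> depth L x" "depth L x \<le> real (length (fst x)) * L" using d[OF assms(1)] by auto
qed

subsection \<open>Embeddings from block codes\<close>

definition zpad :: "nat list \<Rightarrow> nat \<Rightarrow> nat" where "zpad w j = (if j < length w then w ! j else 0)"

context block_code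
begin

definition ext :: "(nat \<Rightarrow> nat) \<Rightarrow> int \<Rightarrow> nat" where "ext a j = (if 0 \<le> j then a (nat j) else 0)"

lemma ext_less: "(\<And>n. a n < p) \<Longrightarrow> ext a j < p" using p by (simp add: ext_def)

lemma enc_ext_neg: "J < 0 \<Longrightarrow> enc (ext a) J = 0"
  by (rule enc_zero[of 0]) (auto simp: ext_def)

lemma enc_ext_agree:
  assumes "\<And>j. j < n \<Longrightarrow> a j = b j" "J < mm (int n div int N)"
  shows "enc (ext a) J = enc (ext b) J"
  by (rule enc_agree[OF _ assms(2)]) (use assms(1) in \<open>auto simp: ext_def\<close>)

lemma enc_ext_reflect:
  assumes "\<And>j. a j < p" "\<And>j. b j < p" "\<And>J. J < m \<Longrightarrow> enc (ext a) (int J) = enc (ext b) (int J)"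
    and "real j * l < real m * l' - CC"
  shows "a j = b j"
proof -
  have "real_of_int (int j) * l < of_int (int N * blk (int m)) * l" using blk_lower[of "int m"] assms(4) by simp
  then have "real_of_int (int j) < of_int (int N * blk (int m))" using l by (metis mult_less_cancel_right_pos)
  then have j: "int j < int N * blk (int m)" by (simp only: of_int_less_iff)
  have "ext a (int j) = ext b (int j)"
  proof (rule enc_reflect[OF ext_less ext_less _ j])
    fix J assume J: "J < int m"
    show "enc (ext a) J = enc (ext b) J"
    proof (cases "0 \<le> J")
      case True then show ?thesis using assms(3)[of "nat J"] J by simp
    qed (simp add: enc_ext_neg)
  qed (use assms in auto)
  then show ?thesis by (simp add: ext_def)
qed

lemma mm_nonneg: "0 \<le> mm (int n div int N)"
proof -
  have "0 \<le> int n div int N" by (metis of_nat_0_le_iff zdiv_int)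
  then show ?thesis using mm_mono[of 0 "int n div int N"] by simp
qed

lemma cantor_embedding:
  assumes q: "l = ln q" "l' = ln q'" "1 < q" "1 < q'"
  shows "\<exists>f. bilipschitz_embedding (cantor_set p) (cantor_dist q) (cantor_set p') (cantor_dist q') f"
proof -
  define f where "f a J = enc (ext a) (int J)" for a J
  have pw: "1 / q ^ n = exp (- (real n * l))" "1 / q' ^ n = exp (- (real n * l'))" for n
    using q by (simp_all add: exp_minus exp_of_nat_mult inverse_eq_divide)
  have "1 / exp CC * cantor_dist q a b \<le> cantor_dist q' (f a) (f b) \<and> cantor_dist q' (f a) (f b) \<le> exp CC * cantor_dist q a b"
    if ab: "a \<in> cantor_set p" "b \<in> cantor_set p" for a b
  proof (cases "a = b")
    case True then show ?thesis by (simp add: cantor_dist_def)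
  next
    case False
    have dig: "a j < p" "b j < p" for j using ab by (auto simp: cantor_set_def)
    define n where "n = (LEAST n. a n \<noteq> b n)"
    have n: "a n \<noteq> b n" unfolding n_def by (rule LeastI_ex) (use False in auto)
    have n': "a j = b j" if "j < n" for j using not_less_Least[of j "\<lambda>n. a n \<noteq> b n"] that by (simp add: n_def)
    have refl: "a j = b j" if "\<And>J. J < m \<Longrightarrow> f a J = f b J" "real j * l < real m * l' - CC" for m j
      using enc_ext_reflect[of a b m j] dig that by (simp add: f_def)
    have "f a \<noteq> f b"
    proof
      assume e: "f a = f b"
      obtain m :: nat where "(real n * l + CC) / l' < real m" using reals_Archimedean2 by blast
      then have "real n * l < real m * l' - CC" using l' by (simp add: field_simps)
      then have "a n = b n" using refl[of m n] e by simp
      then show False using n by simp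
    qed
    then have ex: "\<exists>m. f a m \<noteq> f b m" by auto
    define m where "m = (LEAST m. f a m \<noteq> f b m)"
    have m: "f a m \<noteq> f b m" unfolding m_def by (rule LeastI_ex[OF ex])
    have m': "f a j = f b j" if "j < m" for j using not_less_Least[of j "\<lambda>m. f a m \<noteq> f b m"] that by (simp add: m_def)
    have 1: "real m * l' - CC \<le> real n * l"
      using refl[of m n] m' n by force
    have 2: "real n * l - CC \<le> real m * l'"
    proof -
      have "mm (int n div int N) \<le> int m"
        using enc_ext_agree[of n a b "int m"] n' m by (force simp: f_def)
      then have "of_int (mm (int n div int N)) * l' \<le> real m * l'" using l' by (intro mult_right_mono) auto
      then show ?thesis using mm_lower[of "int n"] by simp
    qed
    have "cantor_dist q a b = exp (- (real n * l))" "cantor_dist q' (f a) (f b) = exp (- (real m * l'))"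
      using False \<open>f a \<noteq> f b\<close> by (simp_all add: cantor_dist_def n_def m_def pw)
    then show ?thesis using 1 2 by (simp add: exp_minus[symmetric] inverse_eq_divide[symmetric] exp_add[symmetric])
  qed
  moreover have "f ` cantor_set p \<subseteq> cantor_set p'" by (auto simp: cantor_set_def f_def enc_less)
  ultimately have "qi_embedding (exp CC) 0 (cantor_set p) (cantor_dist q) (cantor_set p') (cantor_dist q') f"
    by (simp add: qi_embedding_def)
  then show ?thesis unfolding bilipschitz_embedding_def using CC(1) by (intro exI[of _ f] exI[of _ "exp CC"]) simp
qed

lemma zpad_less: "set w \<subseteq> {..<p} \<Longrightarrow> zpad w j < p"
  using p by (auto simp: zpad_def subset_eq)

text \<open>Only complete blocks are coded, so that lengthening a word lengthens its code without
  changing it.\<close>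

definition tcode :: "nat list \<Rightarrow> nat list" where
  "tcode w = map (\<lambda>J. enc (ext (zpad w)) (int J)) [0..<nat (mm (int (length w) div int N))]"

lemma tcode_length:
  "real (length (tcode w)) * l' \<le> real (length w) * l" "real (length w) * l - CC \<le> real (length (tcode w)) * l'"
  using mm_upper[of "int (length w)"] mm_lower[of "int (length w)"] mm_nonneg[of "length w"] by (simp_all add: tcode_def)

lemma tcode_lcp:
  assumes w: "set w \<subseteq> {..<p}" "set w' \<subseteq> {..<p}"
  shows "\<bar>real (lcp (tcode w) (tcode w')) * l' - real (lcp w w') * l\<bar> \<le> CC"
proof -
  define n m where "n = lcp w w'" and "m = lcp (tcode w) (tcode w')"
  have ag: "zpad w j = zpad w' j" if "j < n" for j
    using that lcp_nth[of j w w'] lcp_le[of w w'] by (simp add: zpad_def n_def)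
  let ?m = "nat (mm (int n div int N))"
  have le: "?m \<le> length (tcode w)" "?m \<le> length (tcode w')"
    unfolding tcode_def length_map length_upt using lcp_le[of w w']
    by (auto simp: n_def intro!: nat_mono mm_mono zdiv_mono1) (use N in simp_all)
  have "?m \<le> m" unfolding m_def
  proof (rule lcp_ge[OF le])
    fix j assume j: "j < ?m"
    then have "enc (ext (zpad w)) (int j) = enc (ext (zpad w')) (int j)" by (intro enc_ext_agree[OF ag]) auto
    then show "tcode w ! j = tcode w' ! j" using j le by (simp add: tcode_def)
  qed
  then have "of_int (mm (int n div int N)) * l' \<le> real m * l'" using l' by (intro mult_right_mono) auto
  then have 1: "real n * l - CC \<le> real m * l'" using mm_lower[of "int n"] by simp
  have 2: "real m * l' - CC \<le> real n * l"
  proof (cases "n < length w \<and> n < length w'")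
    case True
    have "w ! n \<noteq> w' ! n"
    proof
      assume "w ! n = w' ! n"
      then have "Suc n \<le> lcp w w'" using True lcp_nth[of _ w w'] by (intro lcp_ge) (auto simp: n_def less_Suc_eq)
      then show False by (simp add: n_def)
    qed
    then have "zpad w n \<noteq> zpad w' n" using True by (simp add: zpad_def)
    moreover have "enc (ext (zpad w)) (int J) = enc (ext (zpad w')) (int J)" if "J < m" for J
      using lcp_nth[of J "tcode w" "tcode w'"] that lcp_le[of "tcode w" "tcode w'"] by (simp add: m_def tcode_def)
    ultimately show ?thesis using enc_ext_reflect[where a = "zpad w" and b = "zpad w'" and m = m and j = n] zpad_less w by (force simp: not_less[symmetric])
  next
    case False
    then have "n = length w \<or> n = length w'" using lcp_le[of w w'] by (auto simp: n_def)
    moreover have "real m * l' \<le> real (length (tcode w)) * l'" "real m * l' \<le> real (length (tcode w')) * l'"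
      using lcp_le[of "tcode w" "tcode w'"] l' by (auto simp: m_def intro!: mult_right_mono)
    ultimately show ?thesis using tcode_length(1)[of w] tcode_length(1)[of w'] CC(1) by auto
  qed
  show ?thesis using 1 2 by (simp add: n_def m_def abs_le_iff)
qed

lemma tree_embedding:
  assumes q: "l = ln q" "l' = ln q'"
  shows "\<exists>f. rough_isometric_embedding (R_tree p q) (R_dist p q) (R_tree p' q') (R_dist p' q') f"
proof -
  define f :: "point \<Rightarrow> point" where "f x = (tcode (fst x), 0)" for x
  have fr: "f x \<in> R_tree p' q'" if "x \<in> R_tree p q" for x
  proof -
    have "set (tcode w) \<subseteq> {..<p'}" for w using enc_less by (auto simp: tcode_def)
    then show ?thesis using l' q by (simp add: f_def R_tree_def tree_points_def R_words_def)
  qed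
  have D: "\<bar>R_dist p q x y - R_dist p' q' (f x) (f y)\<bar> \<le> 4 * CC + 4 * l + 4 * l'"
    if xy: "x \<in> R_tree p q" "y \<in> R_tree p q" for x y
  proof -
    have x: "x \<in> tree_points l (R_words p)" "y \<in> tree_points l (R_words p)" using xy by (auto simp: R_tree_def q)
    have y: "f x \<in> tree_points l' (R_words p')" "f y \<in> tree_points l' (R_words p')" using fr xy by (auto simp: R_tree_def q)
    have w: "set (fst x) \<subseteq> {..<p}" "set (fst y) \<subseteq> {..<p}" using x by (auto simp: tree_points_def R_words_def)
    note b = branch_depth_near[OF x l] branch_depth_near(3,4)[OF x(2) x(2) l] branch_depth_near[OF y l'] branch_depth_near(3,4)[OF y(2) y(2) l']
    have "fst (f z) = tcode (fst z)" for z by (simp add: f_def)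
    then show ?thesis
      using b tcode_lcp[OF w] tcode_length[of "fst x"] tcode_length[of "fst y"] CC(1) l l'
      unfolding R_dist_def tree_dist_def q[symmetric] abs_le_iff by (simp; linarith)
  qed
  have "1 / 1 * R_dist p q x y - (4 * CC + 4 * l + 4 * l') \<le> R_dist p' q' (f x) (f y) \<and>
    R_dist p' q' (f x) (f y) \<le> 1 * R_dist p q x y + (4 * CC + 4 * l + 4 * l')"
    if "x \<in> R_tree p q" "y \<in> R_tree p q" for x y using D[OF that] by (simp; linarith)
  then have "qi_embedding 1 (4 * CC + 4 * l + 4 * l') (R_tree p q) (R_dist p q) (R_tree p' q') (R_dist p' q') f"
    using fr unfolding qi_embedding_def by blast
  then show ?thesis unfolding rough_isometric_embedding_def using CC(1) l l'
    by (intro exI[of _ f] exI[of _ "4 * CC + 4 * l + 4 * l'"]) auto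
qed

end

subsection \<open>Tree maps from embeddings\<close>

text \<open>The common denominator of the three embeddings. Infinite digit sequences as values avoid
  all questions about the lengths of image words; the last premise, on the length of
  \<open>w\<close>, excludes letters too close to the end of the word.\<close>

definition tree_map :: "nat \<Rightarrow> real \<Rightarrow> nat \<Rightarrow> real \<Rightarrow> (nat list \<Rightarrow> nat \<Rightarrow> nat) \<Rightarrow> real \<Rightarrow> bool" where
  "tree_map p l p' l' F c \<longleftrightarrow> 0 \<le> c \<and> (\<forall>w m. set w \<subseteq> {..<p} \<longrightarrow> F w m < p') \<and>
    (\<forall>w d m j. set (w @ [d]) \<subseteq> {..<p} \<longrightarrow> real m * l' \<le> real (length w) * l - c \<longrightarrow> j < m \<longrightarrow> F (w @ [d]) j = F w j) \<and>
    (\<forall>w w' m n. set w \<subseteq> {..<p} \<longrightarrow> set w' \<subseteq> {..<p} \<longrightarrow> length w = length w' \<longrightarrow> (\<forall>j<m. F w j = F w' j) \<longrightarrow>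
      real n * l \<le> real m * l' - c \<longrightarrow> real n * l \<le> real (length w) * l - c \<longrightarrow> take n w = take n w')"

lemma X_bounded_of_tree_map:
  assumes "q > 1" "q' > 1" "p \<ge> 2" "p' \<ge> 2" "tree_map p (ln q) p' (ln q') F c"
  shows "\<exists>B. \<forall>n. \<bar>\<X> p q p' q' n\<bar> \<le> B"
  by (rule X_bounded_of_map[OF assms(1-4), of c F]) (use assms(5) in \<open>unfold tree_map_def, blast+\<close>)

lemma take_eq_zpad:
  assumes "length w = length w'" "n \<le> length w" "\<And>j. j < n \<Longrightarrow> zpad w j = zpad w' j"
  shows "take n w = take n w'"
proof (rule nth_equalityI)
  fix i assume "i < length (take n w)"
  then show "take n w ! i = take n w' ! i" using assms(1,2) assms(3)[of i] by (simp add: zpad_def)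
qed (use assms in simp)

text \<open>A word is represented by the point of its cylinder that continues with zeros. Logarithms
  of distances are heights of branching, so the factor \<open>K\<close> becomes an additive error
  \<open>ln K\<close>.\<close>

lemma tree_map_of_cantor:
  assumes q: "q > 1" "q' > 1" and p: "p \<ge> 2" "p' \<ge> 2"
    and f: "bilipschitz_embedding (cantor_set p) (cantor_dist q) (cantor_set p') (cantor_dist q') f"
  shows "\<exists>F c. tree_map p (ln q) p' (ln q') F c"
proof -
  obtain K where K: "K \<ge> 1" "qi_embedding K 0 (cantor_set p) (cantor_dist q) (cantor_set p') (cantor_dist q') f"
    using f unfolding bilipschitz_embedding_def by blast
  have fr: "f a \<in> cantor_set p'" if "a \<in> cantor_set p" for a using K(2) that by (auto simp: qi_embedding_def)
  have up: "cantor_dist q' (f a) (f b) \<le> K * cantor_dist q a b" if "a \<in> cantor_set p" "b \<in> cantor_set p" for a b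
    using K(2) that unfolding qi_embedding_def by fastforce
  have lo: "cantor_dist q a b \<le> K * cantor_dist q' (f a) (f b)" if "a \<in> cantor_set p" "b \<in> cantor_set p" for a b
  proof -
    have "1 / K * cantor_dist q a b \<le> cantor_dist q' (f a) (f b)" using K(2) that unfolding qi_embedding_def by fastforce
    then show ?thesis using K(1) by (simp add: field_simps)
  qed
  have agree: "cantor_dist r a b \<le> exp (- (real n * ln r))" if "\<forall>j<n. a j = b j" "r > 1" for r n a b
  proof (cases "a = b")
    case False
    have ex: "\<exists>j. a j \<noteq> b j" using False by auto
    have "n \<le> (LEAST j. a j \<noteq> b j)" using LeastI_ex[OF ex] that(1) by (meson not_le)
    then have "1 / r ^ (LEAST j. a j \<noteq> b j) \<le> 1 / r ^ n" using that(2) by (intro divide_left_mono power_increasing) auto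
    then show ?thesis using False that(2) by (simp add: cantor_dist_def exp_minus exp_of_nat_mult inverse_eq_divide)
  qed (simp add: cantor_dist_def)
  have differ: "exp (- (real j * ln r)) \<le> cantor_dist r a b" if "a j \<noteq> b j" "r > 1" for r j a b
  proof -
    have "(LEAST j. a j \<noteq> b j) \<le> j" using that(1) by (rule Least_le)
    then have "1 / r ^ j \<le> 1 / r ^ (LEAST j. a j \<noteq> b j)" using that(2) by (intro divide_left_mono power_increasing) auto
    then show ?thesis using that by (auto simp: cantor_dist_def exp_minus exp_of_nat_mult inverse_eq_divide)
  qed
  have Kexp: "K = exp (ln K)" using K(1) by simp
  define F where "F w = f (zpad w)" for w
  have zp: "zpad w \<in> cantor_set p" if "set w \<subseteq> {..<p}" for w
    using that p by (auto simp: cantor_set_def zpad_def subset_eq)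
  have lq: "0 < ln q" "0 < ln q'" using q by auto
  have "tree_map p (ln q) p' (ln q') F (ln K)"
    unfolding tree_map_def
  proof (intro conjI allI impI)
    show "0 \<le> ln K" using K(1) by simp
    show "F w m < p'" if "set w \<subseteq> {..<p}" for w m using fr[OF zp[OF that]] by (simp add: cantor_set_def F_def)
  next
    fix w d m j assume w: "set (w @ [d]) \<subseteq> {..<p}" and m: "real m * ln q' \<le> real (length w) * ln q - ln K" and j: "j < m"
    show "F (w @ [d]) j = F w j"
    proof (rule ccontr)
      assume ne: "F (w @ [d]) j \<noteq> F w j"
      have w': "set w \<subseteq> {..<p}" using w by simp
      have "exp (- (real j * ln q')) \<le> cantor_dist q' (F (w @ [d])) (F w)" using differ[where a = "F (w @ [d])" and b = "F w" and j = j and r = q', OF ne q(2)] .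
      also have "\<dots> \<le> K * cantor_dist q (zpad (w @ [d])) (zpad w)" unfolding F_def by (rule up[OF zp[OF w] zp[OF w']])
      also have "\<dots> \<le> K * exp (- (real (length w) * ln q))"
        using agree[of "length w" "zpad (w @ [d])" "zpad w" q] q K(1) by (intro mult_left_mono) (auto simp: zpad_def nth_append)
      also have "\<dots> = exp (ln K - real (length w) * ln q)" using K(1) by (simp add: exp_diff exp_minus field_simps)
      finally have "real (length w) * ln q - ln K \<le> real j * ln q'" by simp
      moreover have "real j * ln q' < real m * ln q'" using j lq by simp
      ultimately show False using m by linarith
    qed
  next
    fix w w' m n assume w: "set w \<subseteq> {..<p}" "set w' \<subseteq> {..<p}" "length w = length w'" and ag: "\<forall>j<m. F w j = F w' j"
      and n: "real n * ln q \<le> real m * ln q' - ln K" and n': "real n * ln q \<le> real (length w) * ln q - ln K"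
    have "real n * ln q \<le> real (length w) * ln q" using n' K(1) by (smt (verit) ln_ge_zero)
    then have nl: "n \<le> length w" using lq by (simp add: mult_le_cancel_right_pos)
    show "take n w = take n w'"
    proof (rule take_eq_zpad[OF w(3) nl], rule ccontr)
      fix j assume j: "j < n" and ne: "zpad w j \<noteq> zpad w' j"
      have "exp (- (real j * ln q)) \<le> cantor_dist q (zpad w) (zpad w')" using differ[where a = "zpad w" and b = "zpad w'" and j = j and r = q, OF ne q(1)] .
      also have "\<dots> \<le> K * cantor_dist q' (F w) (F w')" unfolding F_def by (rule lo[OF zp[OF w(1)] zp[OF w(2)]])
      also have "\<dots> \<le> K * exp (- (real m * ln q'))" using agree[OF ag q(2)] K(1) by (intro mult_left_mono) auto
      also have "\<dots> = exp (ln K - real m * ln q')" using K(1) by (simp add: exp_diff exp_minus field_simps)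
      finally have "real m * ln q' - ln K \<le> real j * ln q" by simp
      moreover have "real j * ln q < real n * ln q" using j lq by simp
      ultimately show False using n by linarith
    qed
  qed
  then show ?thesis by blast
qed

text \<open>Branch depths are Gromov products at the root, combinations of three distances, and
  therefore survive with an additive error. A multiplicative constant would not allow this.\<close>

lemma tree_map_of_tree:
  assumes q: "q > 1" "q' > 1" and p: "p \<ge> 2" "p' \<ge> 2"
    and f: "rough_isometric_embedding (R_tree p q) (R_dist p q) (R_tree p' q') (R_dist p' q') f"
  shows "\<exists>F c. tree_map p (ln q) p' (ln q') F c"
proof -
  obtain C where C: "C \<ge> 0" "qi_embedding 1 C (R_tree p q) (R_dist p q) (R_tree p' q') (R_dist p' q') f"
    using f unfolding rough_isometric_embedding_def by blast
  define l l' where "l = ln q" and "l' = ln q'"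
  have l: "0 < l" "0 < l'" using q by (auto simp: l_def l'_def)
  have fr: "f x \<in> R_tree p' q'" if "x \<in> R_tree p q" for x using C(2) that by (auto simp: qi_embedding_def)
  have fd: "\<bar>tree_dist l' (f x) (f y) - tree_dist l x y\<bar> \<le> C" if "x \<in> R_tree p q" "y \<in> R_tree p q" for x y
    using C(2) that unfolding qi_embedding_def R_dist_def l_def l'_def by (force simp: abs_le_iff)
  define g where "g w = f (w, 0)" for w
  define F where "F w = zpad (fst (g w))" for w
  \<comment> \<open>The root need not be sent to the root; its depth in the target enters every
    estimate.\<close>
  define D where "D = depth l' (g [])"
  define c where "c = 3 * C + 2 * \<bar>D\<bar>"
  have W: "(w, 0) \<in> R_tree p q" if "set w \<subseteq> {..<p}" for w
    using that l by (auto simp: R_tree_def tree_points_def R_words_def l_def)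
  have gW: "g w \<in> tree_points l' (R_words p')" if "set w \<subseteq> {..<p}" for w
    using fr[OF W[OF that]] by (simp add: g_def R_tree_def l'_def)
  have dd: "\<bar>tree_dist l' (g w) (g w') - (real (length w) + real (length w') - 2 * real (lcp w w')) * l\<bar> \<le> C"
    if "set w \<subseteq> {..<p}" "set w' \<subseteq> {..<p}" for w w'
  proof -
    have "tree_dist l (w,0) (w',0) = (real (length w) + real (length w') - 2 * real (lcp w w')) * l"
      unfolding dist_vertices[OF l(1)] using lcp_le[of w w'] by (simp add: of_nat_diff)
    then show ?thesis using fd[OF W W, of w w'] that by (simp add: g_def)
  qed
  have dep: "\<bar>depth l' (g w) - real (length w) * l\<bar> \<le> C + \<bar>D\<bar>" if "set w \<subseteq> {..<p}" for w
  proof -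
    have "\<bar>tree_dist l' (g w) (g []) - real (length w) * l\<bar> \<le> C" using dd[OF that, of "[]"] by simp
    moreover have "0 \<le> branch_depth l' (g w) (g [])" "branch_depth l' (g w) (g []) \<le> D"
      using depth_nonneg[OF gW[OF that] l(2)] depth_nonneg[OF gW[of "[]"] l(2)] l(2)
      unfolding branch_depth_def D_def by auto
    ultimately show ?thesis unfolding tree_dist_def D_def by linarith
  qed
  have bd: "\<bar>branch_depth l' (g w) (g w') - real (lcp w w') * l\<bar> \<le> (3 * C + 2 * \<bar>D\<bar>) / 2"
    if "set w \<subseteq> {..<p}" "set w' \<subseteq> {..<p}" for w w'
  proof -
    have "\<bar>c - z\<bar> \<le> (A + 2 * E) / 2" if "\<bar>a + b - 2 * c - (x + y - 2 * z)\<bar> \<le> A" "\<bar>a - x\<bar> \<le> E" "\<bar>b - y\<bar> \<le> E"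
      for a b c x y z A E :: real
    proof -
      have "2 * (c - z) \<le> A + 2 * E" "- (2 * (c - z)) \<le> A + 2 * E"
        using that[THEN abs_le_D1] that[THEN abs_le_D2] by (simp_all add: algebra_simps)
      then show ?thesis by (intro abs_leI) (simp_all add: field_simps)
    qed
    from this[OF _ dep[OF that(1)] dep[OF that(2)], where A = C and c = "branch_depth l' (g w) (g w')" and z = "real (lcp w w') * l"]
    show ?thesis using dd[OF that] by (simp add: tree_dist_def algebra_simps)
  qed
  have c0: "0 \<le> c" "(3 * C + 2 * \<bar>D\<bar>) / 2 \<le> c" using C(1) by (auto simp: c_def)
  have bdc: "real (lcp w w') * l - c \<le> branch_depth l' (g w) (g w')" "branch_depth l' (g w) (g w') \<le> real (lcp w w') * l + c"
    if "set w \<subseteq> {..<p}" "set w' \<subseteq> {..<p}" for w w'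
    using abs_le_D1[OF bd[OF that]] abs_le_D2[OF bd[OF that]] c0 by linarith+
  have digit: "F w m < p'" if "set w \<subseteq> {..<p}" for w m
    using gW[OF that] p by (auto simp: F_def zpad_def tree_points_def R_words_def subset_eq)
  have "tree_map p l p' l' F (2*c)"
    unfolding tree_map_def
  proof (intro conjI allI impI digit)
    show "0 \<le> 2*c" using c0 by simp
  next
    fix w d m j assume w: "set (w @ [d]) \<subseteq> {..<p}" and m: "real m * l' \<le> real (length w) * l - 2*c" and j: "j < m"
    have w': "set w \<subseteq> {..<p}" using w by simp
    have "lcp (w @ [d]) w = length w"
      using lcp_ge[of "length w" "w @ [d]" w] lcp_le[of "w @ [d]" w] by (simp add: nth_append)
    then have "real (length w) * l - c \<le> branch_depth l' (g (w @ [d])) (g w)" using bdc(1)[OF w w'] by simp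
    also have "\<dots> \<le> real (lcp (fst (g (w @ [d]))) (fst (g w))) * l'" by (simp add: branch_depth_def)
    finally have "real m * l' \<le> real (lcp (fst (g (w @ [d]))) (fst (g w))) * l'" using m c0 by simp
    then have "m \<le> lcp (fst (g (w @ [d]))) (fst (g w))" using l by simp
    then have "j < lcp (fst (g (w @ [d]))) (fst (g w))" using j by simp
    then show "F (w @ [d]) j = F w j"
      using lcp_nth[of j "fst (g (w @ [d]))" "fst (g w)"] lcp_le[of "fst (g (w @ [d]))" "fst (g w)"] by (simp add: F_def zpad_def)
  next
    fix w w' m n assume w: "set w \<subseteq> {..<p}" "set w' \<subseteq> {..<p}" "length w = length w'" and ag: "\<forall>j<m. F w j = F w' j"
      and n: "real n * l \<le> real m * l' - 2*c" and n': "real n * l \<le> real (length w) * l - 2*c"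
    let ?u = "fst (g w)" and ?u' = "fst (g w')"
    have lens: "depth l' (g w) \<le> real (length ?u) * l'" "depth l' (g w') \<le> real (length ?u') * l'"
      using gW[OF w(1)] gW[OF w(2)] by (auto simp: depth_def tree_points_def)
    \<comment> \<open>Padding by zeros can make digits agree beyond the end of an image word, so the
      common prefix is cut at both lengths.\<close>
    define k where "k = min m (min (length ?u) (length ?u'))"
    have "k \<le> lcp ?u ?u'" using ag by (intro lcp_ge) (auto simp: k_def F_def zpad_def)
    then have kl: "real k * l' \<le> real (lcp ?u ?u') * l'" using l by simp
    have cc: "C + \<bar>D\<bar> \<le> c" using C(1) by (simp add: c_def)
    have dw: "real (length w) * l - c \<le> depth l' (g w)" "real (length w) * l - c \<le> depth l' (g w')"
      using dep[OF w(1)] dep[OF w(2)] cc w(3) by (auto simp: abs_le_iff)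
    have kk: "real n * l + c \<le> real k * l'"
    proof -
      have "k = m \<or> k = length ?u \<or> k = length ?u'" by (auto simp: k_def min_def)
      then show ?thesis using n n' dw lens c0 by auto
    qed
    have "real n * l + c \<le> branch_depth l' (g w) (g w')"
      unfolding branch_depth_def using kk kl dw n' c0 by auto
    also have "\<dots> \<le> real (lcp w w') * l + c" by (rule bdc(2)[OF w(1,2)])
    finally have "n \<le> lcp w w'" using l by simp
    then show "take n w = take n w'" using lcp_nth[of _ w w'] lcp_le[of w w'] by (intro nth_equalityI) auto
  qed
  then show ?thesis unfolding l_def l'_def by blast
qed

subsection \<open>Gromov products in trees\<close>

lemma branch_depth_commute: "branch_depth l x y = branch_depth l y x"
  by (simp add: branch_depth_def lcp_commute min.commute)

lemma ultrametric_four_point: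
  fixes ab :: real
  assumes "ac \<le> ab" "min bc bu \<le> cu" "min au bu \<le> ab" "min ac au \<le> cu"
  shows "min (ac + bu) (bc + au) \<le> ab + cu"
proof (rule ccontr)
  assume "\<not> ?thesis"
  then have n: "ab + cu < ac + bu" "ab + cu < bc + au" by auto
  have "cu < bu" using n assms(1) by linarith
  then have "bc \<le> cu" using assms(2) by linarith
  then have au: "ab < au" using n by linarith
  then have "bu \<le> ab" using assms(3) by linarith
  then have "cu < ac" using n by linarith
  then show False using assms(1,4) au by linarith
qed

lemma branch_depth_four_point:
  assumes "l > 0"
  shows "min (branch_depth l a c + branch_depth l b u) (branch_depth l b c + branch_depth l a u) \<le> branch_depth l a b + branch_depth l c u"
proof -
  note B = branch_depth_ultrametric[OF assms]
  define ab ac au bc bu cu where "ab = branch_depth l a b" and "ac = branch_depth l a c" and "au = branch_depth l a u"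
    and "bc = branch_depth l b c" and "bu = branch_depth l b u" and "cu = branch_depth l c u"
  note defs = ab_def ac_def au_def bc_def bu_def cu_def
  have c: "branch_depth l c b = bc" "branch_depth l u b = bu" "branch_depth l c a = ac"
    by (simp_all only: defs branch_depth_commute[of l c b] branch_depth_commute[of l u b] branch_depth_commute[of l c a])
  have 1: "min ac bc \<le> ab" using B[of a c b] by (simp only: c defs[symmetric])
  have 2: "min bc bu \<le> cu" using B[of c b u] by (simp only: c defs[symmetric])
  have 3: "min au bu \<le> ab" using B[of a u b] by (simp only: c defs[symmetric])
  have 4: "min ac au \<le> cu" using B[of c a u] by (simp only: c defs[symmetric])
  have "min (ac + bu) (bc + au) \<le> ab + cu"
  proof (cases "ac \<le> ab")
    case True
    from ultrametric_four_point[OF this 2 3 4] show ?thesis .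
  next
    case False
    then have 5: "bc \<le> ab" using 1 by linarith
    have 6: "min bu au \<le> ab" using 3 by (simp only: min.commute)
    from ultrametric_four_point[OF 5 4 6 2] show ?thesis by (simp only: min.commute)
  qed
  then show ?thesis by (simp add: defs)
qed

text \<open>The Gromov product of \<open>a\<close> and \<open>b\<close> at \<open>u\<close>, which
  unlike \<open>branch_depth\<close> may be based at any point; its ultrametric inequality is the
  four-point condition.\<close>

definition gprod :: "real \<Rightarrow> point \<Rightarrow> point \<Rightarrow> point \<Rightarrow> real" where
  "gprod l u a b = (tree_dist l u a + tree_dist l u b - tree_dist l a b) / 2"

lemma gprod_ultra: assumes "l > 0" shows "min (gprod l u a c) (gprod l u c b) \<le> gprod l u a b"
  using branch_depth_four_point[OF assms, of a c b u] branch_depth_commute[of l u a] branch_depth_commute[of l u b] branch_depth_commute[of l u c]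
    branch_depth_commute[of l c b]
  unfolding gprod_def tree_dist_def by (auto simp: min_def field_simps split: if_splits)

lemma tree_dist_commute: "tree_dist l x y = tree_dist l y x"
  by (simp add: tree_dist_def branch_depth_commute)

lemma tree_dist_triangle: "0 < l \<Longrightarrow> tree_dist l x z \<le> tree_dist l x y + tree_dist l y z"
proof -
  assume "0 < l"
  have "branch_depth l x y \<le> depth l y" "branch_depth l y z \<le> depth l y" by (auto simp: branch_depth_def)
  with branch_depth_ultrametric[OF \<open>0 < l\<close>, of x y z] show ?thesis unfolding tree_dist_def by linarith
qed

lemma tree_dist_nonneg: "0 \<le> tree_dist l x y"
  by (auto simp: tree_dist_def branch_depth_def)

lemma lcp_refl [simp]: "longest_common_prefix xs xs = xs" by (induction xs) auto

lemma tree_dist_refl: "x \<in> tree_points l W \<Longrightarrow> tree_dist l x x = 0"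
  by (auto simp: tree_dist_def branch_depth_def depth_def tree_points_def)

subsection \<open>Word distance\<close>

definition dw :: "nat list \<Rightarrow> nat list \<Rightarrow> nat" where "dw v w = length v + length w - 2 * lcp v w"

lemma tree_dist_dw: "0 < l \<Longrightarrow> tree_dist l (v,0) (w,0) = real (dw v w) * l"
  by (simp add: dist_vertices dw_def)

lemma dw_commute: "dw v w = dw w v" by (simp add: dw_def lcp_commute add.commute)

lemma dw_triangle: "dw u w \<le> dw u v + dw v w"
  using tree_dist_triangle[of 1 "(u,0)" "(w,0)" "(v,0)"] by (simp add: tree_dist_dw)

lemma dw_0 [simp]: "dw v v = 0" by (simp add: dw_def)

definition adj :: "nat list \<Rightarrow> nat list \<Rightarrow> bool" where "adj v w \<longleftrightarrow> (\<exists>a. w = v @ [a] \<or> v = w @ [a])"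

lemma adj_commute: "adj v w \<longleftrightarrow> adj w v" by (auto simp: adj_def)

lemma adj_iff: "adj v w \<longleftrightarrow> dw v w = 1"
  using adjacent_vertices[of 1 v w] by (simp add: tree_dist_dw adj_def)

text \<open>The neighbour of \<open>w\<close> on the geodesic to \<open>c\<close>.\<close>

definition toward :: "nat list \<Rightarrow> nat list \<Rightarrow> nat list" where
  "toward w c = (if strict_prefix w c then take (Suc (length w)) c else butlast w)"

lemma lcp_append: "lcp (w @ [a]) c = (if lcp w c = length w \<and> length w < length c \<and> c ! length w = a then Suc (length w) else lcp w c)"
proof (induction w arbitrary: c)
  case Nil
  then show ?case by (cases c) auto
next
  case (Cons b w)
  then show ?case by (cases c) auto
qed

lemma lcp_prefix: "lcp w c = length w \<longleftrightarrow> prefix w c"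
  by (metis longest_common_prefix_prefix1 longest_common_prefix_prefix2 prefix_def append_eq_append_conv
     longest_common_prefix_max_prefix prefix_length_le le_antisym prefix_order.refl append.right_neutral same_length_different)

lemma toward:
  assumes "w \<noteq> c"
  shows "adj w (toward w c)" "Suc (dw (toward w c) c) = dw w c"
    "adj w y \<Longrightarrow> y \<noteq> toward w c \<Longrightarrow> dw y c = Suc (dw w c)"
proof -
  have len: "lcp w c \<le> length w" "lcp w c \<le> length c" using lcp_le by auto
  have all: "adj w (toward w c) \<and> Suc (dw (toward w c) c) = dw w c \<and> (adj w y \<longrightarrow> y \<noteq> toward w c \<longrightarrow> dw y c = Suc (dw w c))" for y
  proof (cases "strict_prefix w c")
    case True
    then obtain a r where c: "c = w @ a # r" by (auto simp: strict_prefix_def prefix_def) (metis neq_Nil_conv)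
    have l: "lcp w c = length w" using True lcp_prefix by (auto simp: strict_prefix_def)
    have t: "toward w c = w @ [a]" using True by (simp add: toward_def c)
    have 1: "dw (w @ [b]) c = (if b = a then dw w c - 1 else Suc (dw w c))" for b
      using l by (auto simp: dw_def lcp_append c)
    have d: "0 < dw w c" using l by (simp add: dw_def c)
    have 2: "dw y c = Suc (dw w c)" if y: "w = y @ [b]" for b
    proof -
      have "prefix y c" using c y by simp
      then have "lcp y c = length y" using lcp_prefix by blast
      then show ?thesis using l y c by (simp add: dw_def)
    qed
    show ?thesis unfolding t
    proof (intro conjI impI)
      show "adj w (w @ [a])" by (simp add: adj_def)
      show "Suc (dw (w @ [a]) c) = dw w c" using 1[of a] d by simp
      assume "adj w y" "y \<noteq> w @ [a]"
      then consider b where "y = w @ [b]" "b \<noteq> a" | b where "w = y @ [b]" by (auto simp: adj_def)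
      then show "dw y c = Suc (dw w c)" by cases (use 1 2 in auto)
    qed
  next
    case False
    then have np: "\<not> prefix w c" using assms by (auto simp: strict_prefix_def)
    then have l: "lcp w c < length w" using lcp_prefix len by (metis le_neq_implies_less)
    then have ne: "w \<noteq> []" by auto
    then obtain u b where w: "w = u @ [b]" by (metis rev_exhaust)
    have t: "toward w c = u" using False by (simp add: toward_def w)
    have lu: "lcp u c = lcp w c" using l lcp_append[of u b c] by (auto simp: w split: if_splits)
    have 1: "dw (w @ [a]) c = Suc (dw w c)" for a
      using l len by (auto simp: dw_def lcp_append)
    have 2: "Suc (dw u c) = dw w c" using lu l len by (simp add: dw_def w)
    show ?thesis unfolding t
    proof (intro conjI impI)
      show "adj w u" by (simp add: adj_def w)
      show "Suc (dw u c) = dw w c" by (rule 2)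
      assume "adj w y" "y \<noteq> u"
      then obtain a where "y = w @ [a]" by (auto simp: adj_def w)
      then show "dw y c = Suc (dw w c)" using 1 by simp
    qed
  qed
  show "adj w (toward w c)" "Suc (dw (toward w c) c) = dw w c"
    "adj w y \<Longrightarrow> y \<noteq> toward w c \<Longrightarrow> dw y c = Suc (dw w c)" using all by auto
qed

lemma toward_in: assumes "w \<in> T_words p" "c \<in> T_words p" "w \<noteq> c" shows "toward w c \<in> T_words p"
proof -
  have tk: "take n u \<in> T_words p" if "u \<in> T_words p" for n u
    using that by (cases u; cases n) (auto simp: T_words_def dest: in_set_takeD)
  show ?thesis using tk[OF assms(2)] tk[OF assms(1)] by (simp add: toward_def butlast_conv_take)
qed

subsection \<open>Heights\<close>

locale tree_ray =
  fixes p :: nat and q :: real and \<gamma> :: "real \<Rightarrow> point"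
  assumes p: "p \<ge> 2" and q: "q > 1" and ray: "geodesic_ray p q \<gamma>"
begin

definition l :: real where "l = ln q"
abbreviation td where "td \<equiv> tree_dist l"
abbreviation TT where "TT \<equiv> T_tree p q"
abbreviation hgt where "hgt \<equiv> height p q \<gamma>"

lemma l: "0 < l" using q by (simp add: l_def)

lemma TT: "TT = tree_points l (T_words p)" by (simp add: T_tree_def l_def)

lemma gam: "0 \<le> s \<Longrightarrow> \<gamma> s \<in> TT" "0 \<le> s \<Longrightarrow> 0 \<le> t \<Longrightarrow> td (\<gamma> s) (\<gamma> t) = \<bar>s - t\<bar>"
  using ray by (auto simp: geodesic_ray_def T_dist_def l_def)

lemma T_dist_td: "T_dist p q x y = td x y" by (simp add: T_dist_def l_def)

text \<open>The height is the Busemann function of the ray, already attained at any finite time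
  beyond the distance of \<open>x\<close> from the base point.\<close>

lemma height_eq:
  assumes x: "x \<in> TT" and s0: "td (\<gamma> 0) x < s0"
  shows "hgt x = td x (\<gamma> s0) - s0"
proof -
  define d where "d = td (\<gamma> 0) x"
  have d: "0 \<le> d" "d < s0" using s0 tree_dist_nonneg by (auto simp: d_def)
  define P where "P s = gprod l (\<gamma> 0) (\<gamma> s) x" for s
  have P: "P s = (s + d - td (\<gamma> s) x) / 2" if "0 \<le> s" for s
    using gam(2)[of 0 s] that by (simp add: P_def gprod_def d_def)
  have gp: "gprod l (\<gamma> 0) (\<gamma> s) (\<gamma> t) = s" if "0 \<le> s" "s \<le> t" for s t
    using gam(2)[of 0 s] gam(2)[of 0 t] gam(2)[of s t] that by (simp add: gprod_def)
  have gp': "gprod l (\<gamma> 0) (\<gamma> t) (\<gamma> s) = s" if "0 \<le> s" "s \<le> t" for s t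
    using gp[OF that] by (simp add: gprod_def tree_dist_commute[of l "\<gamma> t"] add.commute)
  have P_le: "P s \<le> s" if "0 \<le> s" for s
    using P[OF that] tree_dist_triangle[OF l, of "\<gamma> 0" x "\<gamma> s"] gam(2)[of 0 s] that by (simp add: d_def)
  have P_d: "P s \<le> d" if "0 \<le> s" for s
    using P[OF that] tree_dist_triangle[OF l, of "\<gamma> 0" "\<gamma> s" x] gam(2)[of 0 s] that by (simp add: d_def tree_dist_commute)
  have P0: "0 \<le> P s" if "0 \<le> s" for s
    using P[OF that] tree_dist_triangle[OF l, of "\<gamma> s" x "\<gamma> 0"] gam(2)[of s 0] that by (simp add: d_def tree_dist_commute)
  have m1: "min s (P t) \<le> P s" if "0 \<le> s" "s \<le> t" for s t
    using gprod_ultra[OF l, of "\<gamma> 0" "\<gamma> s" "\<gamma> t" x] gp[OF that] by (simp add: P_def)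
  have m2: "min s (P s) \<le> P t" if "0 \<le> s" "s \<le> t" for s t
    using gprod_ultra[OF l, of "\<gamma> 0" "\<gamma> t" "\<gamma> s" x] gp'[OF that] by (simp add: P_def)
  have s00: "0 \<le> s0" using d by simp
  \<comment> \<open>A time \<open>t\<close> belongs to the set iff the Gromov product
    \<open>P t\<close> equals \<open>t\<close>; the ultrametric inequality shows that this happens
    exactly until the geodesic to \<open>x\<close> leaves the ray.\<close>
  have "{t. 0 \<le> t \<and> \<gamma> t \<in> T_segment p q (\<gamma> 0) x} = {0..P s0}"
  proof (rule set_eqI)
    fix t
    have "t \<in> {t. 0 \<le> t \<and> \<gamma> t \<in> T_segment p q (\<gamma> 0) x} \<longleftrightarrow> 0 \<le> t \<and> P t = t"
    proof (cases "0 \<le> t")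
      case True
      then show ?thesis using gam(1)[OF True] gam(2)[of 0 t] P[OF True]
        by (auto simp: T_segment_def T_dist_td d_def)
    qed simp
    also have "\<dots> \<longleftrightarrow> t \<in> {0..P s0}"
    proof
      assume t: "0 \<le> t \<and> P t = t"
      show "t \<in> {0..P s0}"
      proof (cases "t \<le> s0")
        case True
        then show ?thesis using m2[of t s0] t by simp
      next
        case False
        then show ?thesis using P_d[of t] t d by simp
      qed
    next
      assume "t \<in> {0..P s0}"
      then have t: "0 \<le> t" "t \<le> P s0" by auto
      then have "t \<le> s0" using P_le[OF s00] by simp
      then have "t \<le> P t" using m1[of t s0] t by simp
      then show "0 \<le> t \<and> P t = t" using P_le[of t] t by simp
    qed
    finally show "t \<in> {t. 0 \<le> t \<and> \<gamma> t \<in> T_segment p q (\<gamma> 0) x} \<longleftrightarrow> t \<in> {0..P s0}" .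
  qed
  then have "hgt x = d - 2 * P s0" using P0[OF s00] by (simp add: height_def T_dist_td d_def)
  moreover have "2 * P s0 = s0 + d - td x (\<gamma> s0)" using P[OF s00] by (simp add: tree_dist_commute)
  ultimately show ?thesis by linarith
qed

lemma height_lipschitz: assumes "x \<in> TT" "y \<in> TT" shows "\<bar>hgt x - hgt y\<bar> \<le> td x y"
proof -
  define s where "s = td (\<gamma> 0) x + td (\<gamma> 0) y + 1"
  have "td (\<gamma> 0) x < s" "td (\<gamma> 0) y < s"
    using tree_dist_nonneg[of l "\<gamma> 0" x] tree_dist_nonneg[of l "\<gamma> 0" y] by (auto simp: s_def)
  then show ?thesis using height_eq assms tree_dist_triangle[OF l, of x "\<gamma> s" y] tree_dist_triangle[OF l, of y "\<gamma> s" x]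
    by (simp add: tree_dist_commute abs_le_iff)
qed

text \<open>The distance from a vertex to a point at offset \<open>s\<close> on an edge is a
  multiple of \<open>l\<close> plus or minus \<open>s\<close>, so at times that are multiples of
  \<open>l\<close> the offset vanishes.\<close>

lemma ray_vertex: "\<exists>u. \<gamma> (real n * l) = (u, 0) \<and> u \<in> T_words p"
proof -
  obtain u s where us: "\<gamma> (real n * l) = (u,s)" by force
  have u: "u \<in> T_words p" "0 \<le> s" "s < l" "u = [] \<Longrightarrow> s = 0"
    using gam(1)[of "real n * l"] l us by (auto simp: TT tree_points_def)
  obtain b where b: "\<gamma> 0 = (b,0)" using ray by (auto simp: geodesic_ray_def T_vertices_def tree_vertices_def)
  have d: "td (b,0) (u,s) = real n * l" using gam(2)[of 0 "real n * l"] l by (simp add: us b)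
  have "s = 0"
  proof (rule ccontr)
    assume "s \<noteq> 0"
    then have s: "0 < s" "u \<noteq> []" using u by auto
    have "\<exists>k::int. s = of_int k * l"
    proof (cases "lcp b u = length u")
      case True
      then have "length u \<le> length b" using lcp_le[of b u] by simp
      then have "real (length u) * l \<le> real (length b) * l" using l by simp
      then have "branch_depth l (b,0) (u,s) = real (length u) * l - s"
        using True s by (simp add: branch_depth_def depth_def)
      then have "s = of_int (int n + int (length u) - int (length b)) * l"
        using d by (simp add: tree_dist_def depth_def algebra_simps)
      then show ?thesis by blast
    next
      case False
      then have 1: "real (lcp b u) + 1 \<le> real (length u)" using lcp_le[of b u] by simp
      have "(real (lcp b u) + 1) * l \<le> real (length u) * l" using 1 l by (intro mult_right_mono) auto
      then have 2: "real (lcp b u) * l \<le> real (length u) * l - s" using u(3) by (simp add: algebra_simps)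
      have 3: "real (lcp b u) * l \<le> real (length b) * l" using lcp_le[of b u] l by simp
      have "branch_depth l (b,0) (u,s) = real (lcp b u) * l" using 2 3 by (simp add: branch_depth_def depth_def)
      then have "s = of_int (int (length b) + int (length u) - 2 * int (lcp b u) - int n) * l"
        using d by (simp add: tree_dist_def depth_def algebra_simps)
      then show ?thesis by blast
    qed
    then obtain k :: int where k: "s = of_int k * l" by blast
    then have "0 < of_int k * l" "of_int k * l < 1 * l" using s u by auto
    then have "0 < k" "real_of_int k < 1" using l by (simp add: zero_less_mult_iff, metis mult_less_cancel_right_pos)
    then show False by simp
  qed
  then show ?thesis using us u by simp
qed

definition G :: "nat \<Rightarrow> nat list" where "G n = fst (\<gamma> (real n * l))"

lemma G: "\<gamma> (real n * l) = (G n, 0)" "G n \<in> T_words p"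
  using ray_vertex[of n] by (auto simp: G_def)

lemma dw_G: "int (dw (G m) (G n)) = \<bar>int m - int n\<bar>"
proof -
  have "td (G m,0) (G n,0) = \<bar>real m * l - real n * l\<bar>" using gam(2)[of "real m * l" "real n * l"] l by (simp add: G)
  also have "\<dots> = \<bar>real m - real n\<bar> * l" using l by (simp add: left_diff_distrib[symmetric] abs_mult)
  finally have "real (dw (G m) (G n)) = \<bar>real m - real n\<bar>" using l by (simp add: tree_dist_dw)
  then show ?thesis by linarith
qed

text \<open>The height of a vertex in units of \<open>l\<close>, read off at the first ray vertex
  that \<open>height_eq\<close> admits.\<close>

definition lvl :: "nat list \<Rightarrow> int" where
  "lvl w = int (dw w (G (dw (G 0) w + 1))) - int (dw (G 0) w + 1)"

lemma vertex_in: "w \<in> T_words p \<Longrightarrow> (w,0) \<in> TT" using l by (auto simp: TT tree_points_def)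

lemma height_vertex_n:
  assumes "w \<in> T_words p" "dw (G 0) w < n" shows "hgt (w,0) = real_of_int (int (dw w (G n)) - int n) * l"
proof -
  have "\<gamma> 0 = (G 0, 0)" using G(1)[of 0] by simp
  then have "td (\<gamma> 0) (w,0) < real n * l" using assms l by (simp add: tree_dist_dw)
  from height_eq[OF vertex_in[OF assms(1)] this] show ?thesis
    unfolding G tree_dist_dw[OF l] by (simp add: left_diff_distrib)
qed

lemma height_vertex: "w \<in> T_words p \<Longrightarrow> hgt (w,0) = real_of_int (lvl w) * l"
  using height_vertex_n[of w "dw (G 0) w + 1"] by (simp add: lvl_def)

lemma lvl_n: assumes "w \<in> T_words p" "dw (G 0) w < n" shows "lvl w = int (dw w (G n)) - int n"
  using height_vertex[OF assms(1)] height_vertex_n[OF assms] l by (metis mult_right_cancel of_int_eq_iff less_irrefl)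

lemma lvl_G: "lvl (G n) = - int n"
proof -
  have "dw (G 0) (G n) < n + 1" using dw_G[of 0 n] by simp
  from lvl_n[OF G(2) this] show ?thesis using dw_G[of n "n+1"] by simp
qed

text \<open>Words are rooted at the empty word, but the treebolic space is oriented from the end of
  the ray, and \<open>pw\<close> is the parent in that orientation. The offset 3 leaves room to
  compute the levels of \<open>w\<close> and of its neighbours with one ray vertex.\<close>

definition pw :: "nat list \<Rightarrow> nat list" where "pw w = toward w (G (dw (G 0) w + 3))"

lemma pw:
  assumes w: "w \<in> T_words p"
  shows "pw w \<in> T_words p" "adj w (pw w)" "lvl (pw w) = lvl w - 1"
    "y \<in> T_words p \<Longrightarrow> adj w y \<Longrightarrow> y \<noteq> pw w \<Longrightarrow> lvl y = lvl w + 1"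
proof -
  define N where "N = dw (G 0) w + 3"
  have ne: "w \<noteq> G N"
  proof
    assume "w = G N"
    then show False using dw_G[of 0 N] by (simp add: N_def)
  qed
  note t = toward[OF ne]
  have pwt: "pw w = toward w (G N)" by (simp add: pw_def N_def)
  show in1: "pw w \<in> T_words p" unfolding pwt by (rule toward_in[OF w G(2) ne])
  show a: "adj w (pw w)" unfolding pwt by (rule t(1))
  have lv: "lvl y = int (dw y (G N)) - int N" if "y \<in> T_words p" "adj w y \<or> y = w" for y
  proof (rule lvl_n[OF that(1)])
    have "dw w y \<le> 1" using that(2) adj_iff by auto
    then show "dw (G 0) y < N" using dw_triangle[of "G 0" y w] by (simp add: N_def)
  qed
  show "lvl (pw w) = lvl w - 1" using lv[OF in1] lv[OF w] a t(2) unfolding pwt by simp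
  show "lvl y = lvl w + 1" if "y \<in> T_words p" "adj w y" "y \<noteq> pw w"
    using lv[of y] lv[of w] that w t(3)[of y] unfolding pwt by simp
qed

lemma pw_G: "pw (G n) = G (Suc n)"
proof (rule ccontr)
  assume "pw (G n) \<noteq> G (Suc n)"
  moreover have "adj (G n) (G (Suc n))" using dw_G[of n "Suc n"] by (simp add: adj_iff)
  ultimately show False using pw(4)[OF G(2) G(2), of n "Suc n"] lvl_G by simp
qed

lemma children:
  assumes u: "u \<in> T_words p"
  shows "{y \<in> T_words p. pw y = u} = {y \<in> T_words p. adj u y} - {pw u}" "card {y \<in> T_words p. pw y = u} = p"
    "finite {y \<in> T_words p. pw y = u}"
proof -
  show e: "{y \<in> T_words p. pw y = u} = {y \<in> T_words p. adj u y} - {pw u}"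
  proof (intro set_eqI iffI)
    fix y assume "y \<in> {y \<in> T_words p. pw y = u}"
    then have y: "y \<in> T_words p" "pw y = u" by auto
    then have "lvl u = lvl y - 1" "adj u y" using pw(2,3)[OF y(1)] adj_commute by auto
    moreover have "y \<noteq> pw u" using pw(3)[OF u] calculation by auto
    ultimately show "y \<in> {y \<in> T_words p. adj u y} - {pw u}" using y by simp
  next
    fix y assume "y \<in> {y \<in> T_words p. adj u y} - {pw u}"
    then have y: "y \<in> T_words p" "adj u y" "y \<noteq> pw u" by auto
    then have "lvl y = lvl u + 1" using pw(4)[OF u] by blast
    moreover have "adj y u" using y adj_commute by blast
    ultimately have "pw y = u" using pw(4)[OF y(1) u] by fastforce
    then show "y \<in> {y \<in> T_words p. pw y = u}" using y by simp
  qed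
  have "{v \<in> T_vertices p q. T_dist p q (u,0) v = ln q} = (\<lambda>y. (y,0)) ` {y \<in> T_words p. adj u y}"
    using l by (auto simp: T_vertices_def tree_vertices_def T_dist_td tree_dist_dw adj_iff l_def[symmetric])
  moreover have "card {v \<in> T_vertices p q. T_dist p q (u,0) v = ln q} = p + 1"
    by (rule valency_T[OF q]) (use u in \<open>auto simp: T_vertices_def tree_vertices_def\<close>)
  ultimately have c: "card {y \<in> T_words p. adj u y} = p + 1"
    by (simp add: card_image inj_on_def)
  then have f: "finite {y \<in> T_words p. adj u y}"
    using card.infinite[of "{y \<in> T_words p. adj u y}"] by (metis add_is_0 zero_neq_one)
  show "finite {y \<in> T_words p. pw y = u}" unfolding e using f by simp
  show "card {y \<in> T_words p. pw y = u} = p" unfolding e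
    using c f pw(1,2)[OF u] by (simp add: card_Diff_singleton)
qed

lemma pw_pow: "w \<in> T_words p \<Longrightarrow> (pw ^^ i) w \<in> T_words p" "w \<in> T_words p \<Longrightarrow> lvl ((pw ^^ i) w) = lvl w - int i"
proof (induction i)
  case (Suc i)
  { case 1 then show ?case using Suc pw by simp }
  { case 2 then show ?case using Suc pw(3)[of "(pw ^^ i) w"] by simp }
qed auto

lemma dw_pw_pow: "w \<in> T_words p \<Longrightarrow> dw w ((pw ^^ i) w) \<le> i"
proof (induction i)
  case (Suc i)
  have "dw ((pw ^^ i) w) ((pw ^^ Suc i) w) = 1" using pw(2)[OF pw_pow(1)[OF Suc(2)], of i] by (simp add: adj_iff)
  then show ?case using Suc dw_triangle[of w "(pw ^^ Suc i) w" "(pw ^^ i) w"] by simp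
qed simp

lemma dw_le_meet:
  assumes "w \<in> T_words p" "w' \<in> T_words p" "(pw ^^ i) w = (pw ^^ j) w'" shows "dw w w' \<le> i + j"
  using dw_triangle[of w w' "(pw ^^ i) w"] dw_pw_pow[OF assms(1), of i] dw_pw_pow[OF assms(2), of j] assms(3)
  by (simp add: dw_commute)

text \<open>A vertex has a single neighbour of lower level, so a geodesic cannot turn down after
  going up: it is a descent followed by an ascent.\<close>

lemma meet_exists:
  assumes "w \<in> T_words p" "w' \<in> T_words p"
  shows "\<exists>i j. (pw ^^ i) w = (pw ^^ j) w' \<and> i + j = dw w w'"
  using assms
proof (induction "dw w w'" arbitrary: w)
  case 0
  then have "w = w'" using toward(2)[of w w'] by fastforce
  then show ?case by (intro exI[of _ 0]) simp
next
  case (Suc d)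
  have ne: "w \<noteq> w'" using Suc(2) by auto
  define y where "y = toward w w'"
  have y: "y \<in> T_words p" "adj w y" "dw y w' = d" using toward_in[OF Suc(3,4) ne] toward(1,2)[OF ne] Suc(2) by (auto simp: y_def)
  obtain i j where ij: "(pw ^^ i) y = (pw ^^ j) w'" "i + j = d" using Suc(1)[OF _ y(1) Suc(4)] y(3) by auto
  show ?case
  proof (cases "y = pw w")
    case True
    have "(pw ^^ Suc i) w = (pw ^^ j) w'" using ij True by (simp add: funpow_swap1)
    then show ?thesis using ij(2) Suc(2) by (intro exI[of _ "Suc i"] exI[of _ j]) auto
  next
    case False
    then have py: "pw y = w" using children(1)[OF Suc(3)] y by blast
    have "i = 0"
    proof (rule ccontr)
      assume "i \<noteq> 0"
      then obtain i' where i': "i = Suc i'" by (cases i) auto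
      have "(pw ^^ i') w = (pw ^^ j) w'" using ij(1) py by (simp add: i' funpow_swap1)
      from dw_le_meet[OF Suc(3,4) this] show False using ij(2) Suc(2) i' by simp
    qed
    then have "(pw ^^ 0) w = (pw ^^ Suc j) w'" using ij py by simp
    moreover have "0 + Suc j = dw w w'" using ij(2) Suc(2) \<open>i = 0\<close> by simp
    ultimately show ?thesis by blast
  qed
qed

end

subsection \<open>Paths in horostrips\<close>

lemma valid_path_of_derivative:
  fixes g :: "real \<Rightarrow> complex"
  assumes "\<And>t. (g has_vector_derivative D t) (at t)" "continuous_on {0..1} D"
  shows "valid_path g"
  unfolding valid_path_def
  by (rule C1_differentiable_imp_piecewise) (use assms in \<open>auto simp: C1_differentiable_on_def\<close>)

lemma vertical_path:
  assumes "a \<le> h0" "h0 \<le> b" "a \<le> h1" "h1 \<le> b"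
  shows "\<exists>g. valid_path g \<and> pathstart g = Complex x (exp h0) \<and> pathfinish g = Complex x (exp h1) \<and>
    path_image g \<subseteq> horostrip a b \<and> ((\<lambda>t. norm (vector_derivative g (at t)) / Im (g t)) has_integral \<bar>h1 - h0\<bar>) {0..1}"
proof -
  define g where "g t = Complex x (exp (h0 + t * (h1 - h0)))" for t
  define D where "D t = Complex 0 ((h1 - h0) * exp (h0 + t * (h1 - h0)))" for t
  have gD: "(g has_vector_derivative D t) (at t)" for t
    unfolding g_def D_def has_vector_derivative_complex_iff by (auto intro!: derivative_eq_intros)
  have "D = (\<lambda>t. \<i> * of_real ((h1 - h0) * exp (h0 + t * (h1 - h0))))"
    by (auto simp: D_def fun_eq_iff complex_eq_iff)
  then have "continuous_on {0..1} D" by (auto intro!: continuous_intros)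
  then have v: "valid_path g" using valid_path_of_derivative[OF gD] by blast
  have i: "norm (vector_derivative g (at t)) / Im (g t) = \<bar>h1 - h0\<bar>" for t
    unfolding vector_derivative_at[OF gD] by (simp add: D_def g_def cmod_def abs_mult)
  have bt: "a \<le> h0 + t * (h1 - h0) \<and> h0 + t * (h1 - h0) \<le> b" if "0 \<le> t" "t \<le> 1" for t
  proof -
    have e: "h0 + t * (h1 - h0) = (1 - t) * h0 + t * h1" by (simp add: algebra_simps)
    have "(1 - t) * a \<le> (1 - t) * h0" "t * a \<le> t * h1" "(1 - t) * h0 \<le> (1 - t) * b" "t * h1 \<le> t * b"
      using that assms by (auto intro!: mult_left_mono)
    then show ?thesis unfolding e by (simp add: algebra_simps)
  qed
  have "path_image g \<subseteq> horostrip a b"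
    using bt by (auto simp: path_image_def horostrip_def g_def)
  moreover have "((\<lambda>t. norm (vector_derivative g (at t)) / Im (g t)) has_integral \<bar>h1 - h0\<bar>) {0..1}"
    unfolding i using has_integral_const_real[of "\<bar>h1 - h0\<bar>" 0 1] by simp
  ultimately show ?thesis using v by (intro exI[of _ g]) (simp add: pathstart_def pathfinish_def g_def)
qed

lemma horizontal_path:
  assumes "a \<le> h" "h \<le> b"
  shows "\<exists>g. valid_path g \<and> pathstart g = Complex x (exp h) \<and> pathfinish g = Complex x' (exp h) \<and>
    path_image g \<subseteq> horostrip a b \<and> ((\<lambda>t. norm (vector_derivative g (at t)) / Im (g t)) has_integral \<bar>x - x'\<bar> / exp h) {0..1}"
proof -
  define g where "g t = Complex (x + t * (x' - x)) (exp h)" for t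
  define D where "D = (\<lambda>t::real. Complex (x' - x) 0)"
  have gD: "(g has_vector_derivative D t) (at t)" for t
    unfolding g_def D_def has_vector_derivative_complex_iff by (auto intro!: derivative_eq_intros)
  have "continuous_on {0..1} D" by (simp add: D_def)
  then have v: "valid_path g" using valid_path_of_derivative[OF gD] by blast
  have i: "norm (vector_derivative g (at t)) / Im (g t) = \<bar>x - x'\<bar> / exp h" for t
    unfolding vector_derivative_at[OF gD] by (simp add: D_def g_def cmod_def abs_minus_commute)
  have "path_image g \<subseteq> horostrip a b"
    using assms by (auto simp: path_image_def horostrip_def g_def)
  moreover have "((\<lambda>t. norm (vector_derivative g (at t)) / Im (g t)) has_integral \<bar>x - x'\<bar> / exp h) {0..1}"
    unfolding i using has_integral_const_real[of "\<bar>x - x'\<bar> / exp h" 0 1] by simp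
  ultimately show ?thesis using v by (intro exI[of _ g]) (simp add: pathstart_def pathfinish_def g_def)
qed

text \<open>Domination of integrands: \<open>Im g' / Im g\<close> is the derivative of
  \<open>ln (Im g)\<close>, and \<open>Re g'\<close> is at most the hyperbolic speed times the
  largest ordinate \<open>exp b\<close>.\<close>

lemma horostrip_length:
  assumes v: "valid_path g" and s: "path_image g \<subseteq> horostrip a b"
    and L: "((\<lambda>t. norm (vector_derivative g (at t)) / Im (g t)) has_integral L) {0..1}"
  shows "\<bar>ln (Im (pathfinish g)) - ln (Im (pathstart g))\<bar> \<le> L" "\<bar>Re (pathfinish g) - Re (pathstart g)\<bar> \<le> L * exp b"
proof -
  have im: "0 < Im (g t)" "Im (g t) \<le> exp b" if "t \<in> {0..1}" for t
  proof -
    have "g t \<in> horostrip a b" using s that by (auto simp: path_image_def)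
    then have "0 < Im (g t)" "ln (Im (g t)) \<le> b" by (auto simp: horostrip_def)
    moreover from this have "exp (ln (Im (g t))) \<le> exp b" by (simp only: exp_le_cancel_iff)
    ultimately show "0 < Im (g t)" "Im (g t) \<le> exp b" by simp_all
  qed
  obtain S where S: "finite S" "continuous_on {0..1} g" "\<And>t. t \<in> {0..1} - S \<Longrightarrow> g differentiable at t"
    using v unfolding valid_path_def piecewise_C1_differentiable_on_def C1_differentiable_on_eq by blast
  let ?D = "\<lambda>t. vector_derivative g (at t)"
  have D: "(g has_vector_derivative ?D t) (at t)" if "t \<in> {0<..<1} - S" for t
    using S(3)[of t] that vector_derivative_works by auto
  have D': "((\<lambda>t. Re (g t)) has_field_derivative Re (?D t)) (at t)" "((\<lambda>t. Im (g t)) has_field_derivative Im (?D t)) (at t)"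
    if "t \<in> {0<..<1} - S" for t using D[OF that] by (auto simp: has_vector_derivative_complex_iff)
  have R: "((\<lambda>t. Re (?D t)) has_integral Re (g 1) - Re (g 0)) {0..1}"
    using D'(1) S(1,2) by (intro fundamental_theorem_of_calculus_interior_strong[of S])
      (auto simp: has_real_derivative_iff_has_vector_derivative intro!: continuous_intros)
  have I: "((\<lambda>t. Im (?D t) / Im (g t)) has_integral ln (Im (g 1)) - ln (Im (g 0))) {0..1}"
  proof (rule fundamental_theorem_of_calculus_interior_strong[of S])
    show "continuous_on {0..1} (\<lambda>t. ln (Im (g t)))"
      using S(2) im(1) by (intro continuous_intros) (auto simp: less_imp_neq[symmetric])
    fix t assume t: "t \<in> {0<..<1} - S"
    then have "0 < Im (g t)" using im(1)[of t] by auto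
    then have "((\<lambda>t. ln (Im (g t))) has_field_derivative (Im (?D t) / Im (g t))) (at t)"
      using DERIV_chain2[OF DERIV_ln_divide D'(2)[OF t]] by simp
    then show "((\<lambda>t. ln (Im (g t))) has_vector_derivative (Im (?D t) / Im (g t))) (at t)"
      by (simp add: has_real_derivative_iff_has_vector_derivative)
  qed (use S in auto)
  have b1: "\<bar>Im (?D t) / Im (g t)\<bar> \<le> norm (?D t) / Im (g t)" if "t \<in> {0..1}" for t
    using im(1)[OF that] abs_Im_le_cmod[of "?D t"] by (simp add: abs_divide divide_right_mono)
  have b2: "\<bar>Re (?D t)\<bar> \<le> norm (?D t) / Im (g t) * exp b" if "t \<in> {0..1}" for t
  proof -
    have "norm (?D t) / Im (g t) * Im (g t) \<le> norm (?D t) / Im (g t) * exp b"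
      using im[OF that] by (intro mult_left_mono) auto
    then show ?thesis using im(1)[OF that] abs_Re_le_cmod[of "?D t"] by simp
  qed
  have L': "((\<lambda>t. norm (?D t) / Im (g t) * exp b) has_integral L * exp b) {0..1}"
    by (rule has_integral_mult_left[OF L])
  have "ln (Im (g 1)) - ln (Im (g 0)) \<le> L" by (rule has_integral_le[OF I L]) (rule abs_le_D1[OF b1])
  moreover have "- (ln (Im (g 1)) - ln (Im (g 0))) \<le> L"
    by (rule has_integral_le[OF has_integral_neg[OF I] L]) (rule abs_le_D2[OF b1])
  ultimately show "\<bar>ln (Im (pathfinish g)) - ln (Im (pathstart g))\<bar> \<le> L"
    by (simp add: pathfinish_def pathstart_def abs_le_iff)
  have "Re (g 1) - Re (g 0) \<le> L * exp b" by (rule has_integral_le[OF R L']) (rule abs_le_D1[OF b2])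
  moreover have "- (Re (g 1) - Re (g 0)) \<le> L * exp b"
    by (rule has_integral_le[OF has_integral_neg[OF R] L']) (rule abs_le_D2[OF b2])
  ultimately show "\<bar>Re (pathfinish g) - Re (pathstart g)\<bar> \<le> L * exp b"
    by (simp add: pathfinish_def pathstart_def abs_le_iff)
qed

subsection \<open>The metric of a treebolic space\<close>

context tree_ray
begin

abbreviation HP where "HP \<equiv> HT_path p q \<gamma>"
abbreviation HD where "HD \<equiv> HT_dist p q \<gamma>"
abbreviation coord where "coord \<equiv> horostrip_coord p q \<gamma>"

lemma td_down: "(w,s) \<in> TT \<Longrightarrow> td (w,s) (w,0) = s"
  by (auto simp: TT tree_points_def tree_dist_def branch_depth_def depth_def)

lemma td_butlast:
  assumes "(w,s) \<in> TT" "w \<noteq> []" shows "td (butlast w,0) (w,s) = l - s"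
proof -
  obtain u a where w: "w = u @ [a]" using assms(2) by (metis rev_exhaust)
  have "prefix u w" by (simp add: w)
  then have "lcp u w = length u" using lcp_prefix by blast
  moreover have "0 \<le> s" "s < l" using assms(1) by (auto simp: TT tree_points_def)
  ultimately have "branch_depth l (u,0) (w,s) = real (length u) * l"
    by (simp add: branch_depth_def depth_def w algebra_simps)
  then show ?thesis by (simp add: tree_dist_def depth_def w algebra_simps)
qed

lemma edge_heights:
  assumes v: "v \<in> T_vertices p q" "w \<in> T_vertices p q" "T_dist p q v w = ln q" "hgt v < hgt w"
  shows "hgt w = hgt v + l"
    and "x \<in> T_segment p q v w \<Longrightarrow> hgt x = hgt v + td v x \<and> 0 \<le> td v x \<and> td v x \<le> l"
    and "x \<in> T_segment p q v w \<Longrightarrow> y \<in> T_segment p q v w \<Longrightarrow> td x y \<le> \<bar>hgt x - hgt y\<bar>"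
proof -
  obtain a b where ab: "v = (a,0)" "w = (b,0)" "a \<in> T_words p" "b \<in> T_words p"
    using v(1,2) by (auto simp: T_vertices_def tree_vertices_def)
  have vw: "v \<in> TT" "w \<in> TT" using ab vertex_in by auto
  have d: "td v w = l" using v(3) by (simp add: T_dist_td l_def)
  then have ad: "adj a b" using l by (simp add: ab tree_dist_dw adj_iff)
  have lv: "hgt v = real_of_int (lvl a) * l" "hgt w = real_of_int (lvl b) * l" using height_vertex ab by auto
  have "lvl b = lvl a + 1"
  proof (rule ccontr)
    assume "lvl b \<noteq> lvl a + 1"
    then have "b = pw a" using pw(4)[OF ab(3,4) ad] by blast
    then have "lvl b = lvl a - 1" using pw(3)[OF ab(3)] by simp
    then show False using v(4) lv l by simp
  qed
  then show hw: "hgt w = hgt v + l" unfolding lv by (simp add: algebra_simps)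
  show hx: "hgt x = hgt v + td v x \<and> 0 \<le> td v x \<and> td v x \<le> l" if "x \<in> T_segment p q v w" for x
  proof -
    have x: "x \<in> TT" "td v x + td x w = l" using that d by (auto simp: T_segment_def T_dist_td)
    show ?thesis using height_lipschitz[OF vw(1) x(1)] height_lipschitz[OF x(1) vw(2)] x(2) hw
        tree_dist_nonneg[of l v x] tree_dist_nonneg[of l x w] by linarith
  qed
  show "td x y \<le> \<bar>hgt x - hgt y\<bar>" if xy: "x \<in> T_segment p q v w" "y \<in> T_segment p q v w"
  proof -
    have x: "td v x + td x w = l" "td v y + td y w = l" using xy d by (auto simp: T_segment_def T_dist_td)
    have "min (branch_depth l x v + branch_depth l y w) (branch_depth l y v + branch_depth l x w) \<le> branch_depth l x y + branch_depth l v w"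
      by (rule branch_depth_four_point[OF l])
    then have "td x y + td v w \<le> max (td v x + td y w) (td v y + td x w)"
      using branch_depth_commute[of l v x] branch_depth_commute[of l v y] unfolding tree_dist_def by linarith
    then show ?thesis using hx[OF xy(1)] hx[OF xy(2)] x d by linarith
  qed
qed

lemma strip_bounds:
  assumes "strip_path p q \<gamma> u u' L"
  shows "fst u \<in> TT" "fst u' \<in> TT" "td (fst u) (fst u') \<le> L" "\<bar>snd u - snd u'\<bar> \<le> L * exp (hgt (fst u) + l)"
proof -
  obtain v w g where v: "v \<in> T_vertices p q" "w \<in> T_vertices p q" "T_dist p q v w = ln q" "hgt v < hgt w"
    and s: "fst u \<in> T_segment p q v w" "fst u' \<in> T_segment p q v w"
    and g: "valid_path g" "pathstart g = coord u" "pathfinish g = coord u'" "path_image g \<subseteq> horostrip (hgt v) (hgt w)"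
      "((\<lambda>t. norm (vector_derivative g (at t)) / Im (g t)) has_integral L) {0..1}"
    using assms unfolding strip_path_def by blast
  show "fst u \<in> TT" "fst u' \<in> TT" using s by (auto simp: T_segment_def)
  note b = horostrip_length[OF g(1,4,5)]
  have "\<bar>hgt (fst u') - hgt (fst u)\<bar> \<le> L" using b(1) by (simp add: g horostrip_coord_def)
  then show td: "td (fst u) (fst u') \<le> L" using edge_heights(3)[OF v s] by linarith
  have L0: "0 \<le> L" using td tree_dist_nonneg[of l "fst u" "fst u'"] by linarith
  have "\<bar>snd u - snd u'\<bar> \<le> L * exp (hgt w)" using b(2) by (simp add: g horostrip_coord_def abs_minus_commute)
  also have "\<dots> \<le> L * exp (hgt (fst u) + l)"
    using edge_heights(1)[OF v] edge_heights(2)[OF v s(1)] L0 by (intro mult_left_mono) auto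
  finally show "\<bar>snd u - snd u'\<bar> \<le> L * exp (hgt (fst u) + l)" .
qed

text \<open>A path of length \<open>L\<close> rises by at most \<open>L\<close>, and
  \<open>l\<close> accounts for the top of the current strip; this limits the horizontal reach of a
  unit of length.\<close>

lemma path_bounds:
  assumes "HP u u' L"
  shows "fst u \<in> TT \<and> fst u' \<in> TT \<and> td (fst u) (fst u') \<le> L \<and> \<bar>snd u - snd u'\<bar> \<le> L * exp (hgt (fst u) + L + l)"
  using assms
proof (induction rule: HT_path.induct)
  case (HT_path_refl u)
  then show ?case by (auto simp: HT_space_def tree_dist_refl TT)
next
  case (HT_path_step u v L w L')
  note s = strip_bounds[OF HT_path_step(2)]
  have td: "td (fst u) (fst w) \<le> L + L'" using HT_path_step(3) s tree_dist_triangle[OF l, of "fst u" "fst w" "fst v"] by linarith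
  have nn: "0 \<le> L" "0 \<le> L'" using HT_path_step(3) s(3) tree_dist_nonneg[of l "fst u" "fst v"] tree_dist_nonneg[of l "fst v" "fst w"] by linarith+
  have h: "hgt (fst v) \<le> hgt (fst u) + L" using height_lipschitz[of "fst u" "fst v"] HT_path_step(3) by linarith
  have "\<bar>snd u - snd w\<bar> \<le> L * exp (hgt (fst u) + L + l) + L' * exp (hgt (fst v) + l)" using HT_path_step(3) s(4) by linarith
  also have "\<dots> \<le> L * exp (hgt (fst u) + (L + L') + l) + L' * exp (hgt (fst u) + (L + L') + l)"
    using nn h by (intro add_mono mult_left_mono) auto
  finally have "\<bar>snd u - snd w\<bar> \<le> (L + L') * exp (hgt (fst u) + (L + L') + l)" by (simp add: distrib_right)
  then show ?case using td s HT_path_step(3) by blast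
qed

lemma HP_trans: assumes "HP u v L1" "HP v w L2" shows "HP u w (L1 + L2)"
  using assms(2,1)
proof (induction rule: HT_path.induct)
  case (HT_path_step v a L b L')
  from HT_path.HT_path_step[OF HT_path_step(3)[OF HT_path_step(4)] HT_path_step(2)] show ?case by (simp add: add.assoc)
qed simp

lemma HP_strip: assumes "strip_path p q \<gamma> u v L" shows "HP u v L"
proof -
  have "u \<in> HT_space p q" using strip_bounds(1)[OF assms] by (auto simp: HT_space_def mem_Times_iff)
  from HT_path_step[OF HT_path_refl[OF this] assms] show ?thesis by simp
qed

lemma edge_strip:
  assumes y: "y \<in> T_words p" and s: "t \<in> T_segment p q (pw y,0) (y,0)" "t' \<in> T_segment p q (pw y,0) (y,0)"
  shows "HP (t,x) (t',x) \<bar>hgt t' - hgt t\<bar>" "HP (t,x) (t,x') (\<bar>x - x'\<bar> / exp (hgt t))"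
proof -
  let ?v = "(pw y, 0::real)" and ?w = "(y, 0::real)"
  have v: "?v \<in> T_vertices p q" "?w \<in> T_vertices p q" using y pw(1)[OF y] by (auto simp: T_vertices_def tree_vertices_def)
  have d: "T_dist p q ?v ?w = ln q" using pw(2)[OF y] adj_iff adj_commute by (simp add: T_dist_td tree_dist_dw l) (simp add: l_def)
  have h: "hgt ?v < hgt ?w" using pw(1,3)[OF y] y l by (simp add: height_vertex)
  note e = edge_heights(1)[OF v d h] edge_heights(2)[OF v d h s(1)] edge_heights(2)[OF v d h s(2)]
  have b: "hgt ?v \<le> hgt t" "hgt t \<le> hgt ?w" "hgt ?v \<le> hgt t'" "hgt t' \<le> hgt ?w" using e by auto
  show "HP (t,x) (t',x) \<bar>hgt t' - hgt t\<bar>"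
    using vertical_path[OF b, of x] v d h s by (intro HP_strip) (auto simp: strip_path_def horostrip_coord_def)
  show "HP (t,x) (t,x') (\<bar>x - x'\<bar> / exp (hgt t))"
    using horizontal_path[OF b(1,2), of x x'] v d h s by (intro HP_strip) (auto simp: strip_path_def horostrip_coord_def)
qed

lemma vertex_segment:
  assumes "y \<in> T_words p" shows "(y,0) \<in> T_segment p q (pw y,0) (y,0)" "(pw y,0) \<in> T_segment p q (pw y,0) (y,0)"
  using vertex_in[OF assms] vertex_in[OF pw(1)[OF assms]] by (auto simp: T_segment_def T_dist_td tree_dist_refl TT)

lemma HP_parent:
  assumes "y \<in> T_words p" shows "HP ((y,0),x) ((pw y,0),x) l" "HP ((pw y,0),x) ((y,0),x) l"
proof -
  have "hgt (y,0) - hgt (pw y,0) = l"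
    using assms pw(1)[OF assms] unfolding height_vertex[OF assms] height_vertex[OF pw(1)[OF assms]] pw(3)[OF assms]
    by (simp add: left_diff_distrib)
  then show "HP ((y,0),x) ((pw y,0),x) l" "HP ((pw y,0),x) ((y,0),x) l"
    using edge_strip(1)[OF assms vertex_segment(1)[OF assms] vertex_segment(2)[OF assms], of x]
      edge_strip(1)[OF assms vertex_segment(2)[OF assms] vertex_segment(1)[OF assms], of x] l by simp_all
qed

lemma HP_horizontal: "y \<in> T_words p \<Longrightarrow> HP ((y,0),x) ((y,0),x') (\<bar>x - x'\<bar> / exp (hgt (y,0)))"
  using edge_strip(2)[OF _ vertex_segment(1) vertex_segment(1)] by blast

lemma HP_pow:
  assumes "y \<in> T_words p" shows "HP ((y,0),x) (((pw ^^ i) y,0),x) (real i * l)" "HP (((pw ^^ i) y,0),x) ((y,0),x) (real i * l)"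
proof (induction i)
  case 0
  { case 1 show ?case using HT_path_refl[of "((y,0),x)" p q \<gamma>] vertex_in[OF assms] by (simp add: HT_space_def) }
  { case 2 show ?case using HT_path_refl[of "((y,0),x)" p q \<gamma>] vertex_in[OF assms] by (simp add: HT_space_def) }
next
  case (Suc i)
  note s = HP_parent[OF pw_pow(1)[OF assms, of i], of x]
  { case 1 show ?case using HP_trans[OF Suc(1) s(1)] by (simp add: algebra_simps) }
  { case 2 show ?case using HP_trans[OF s(2) Suc(2)] by (simp add: algebra_simps) }
qed

lemma HP_vertices:
  assumes "w \<in> T_words p" "w' \<in> T_words p" shows "HP ((w,0),x) ((w',0),x) (real (dw w w') * l)"
proof -
  obtain i j where ij: "(pw ^^ i) w = (pw ^^ j) w'" "i + j = dw w w'" using meet_exists[OF assms] by blast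
  have "HP ((w,0),x) ((w',0),x) (real i * l + real j * l)"
    using HP_trans[OF HP_pow(1)[OF assms(1), where x = x and i = i]] HP_pow(2)[OF assms(2), where x = x and i = j] ij(1) by simp
  then show ?thesis by (simp add: ij(2)[symmetric] algebra_simps)
qed

text \<open>Points are parametrized along edges oriented by words, horostrips along edges oriented
  by height. The edge between \<open>w\<close> and \<open>butlast w\<close> has either of the two as
  its upper end \<open>y\<close>.\<close>

lemma point_vertex:
  assumes "(w,s) \<in> TT"
  shows "\<exists>y\<in>T_words p. (w,s) \<in> T_segment p q (pw y,0) (y,0) \<and> (w,0) \<in> T_segment p q (pw y,0) (y,0)"
proof -
  have w: "w \<in> T_words p" "0 \<le> s" "s < l" "w = [] \<Longrightarrow> s = 0" using assms by (auto simp: TT tree_points_def)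
  show ?thesis
  proof (cases "w = []")
    case True
    then show ?thesis using w vertex_segment[OF w(1)] by auto
  next
    case False
    have a: "adj (butlast w) w" using False by (auto simp: adj_def intro: exI[of _ "last w"])
    have bw: "butlast w \<in> T_words p"
      using toward_in[of w p "[]"] w False by (simp add: toward_def T_words_def)
    have d: "td (butlast w,0) (w,s) = l - s" "td (w,s) (w,0) = s" "td (butlast w,0) (w,0) = l" "td (w,0) (w,0) = 0"
      using td_butlast[OF assms False] td_down[OF assms] td_butlast[OF vertex_in[OF w(1)] False] tree_dist_refl vertex_in[OF w(1)] TT by auto
    have d': "td (w,s) (butlast w,0) = l - s" "td (w,0) (w,s) = s" "td (w,0) (butlast w,0) = l"
      using d tree_dist_commute by metis+
    have in12: "(w,s) \<in> T_segment p q (butlast w,0) (w,0)" "(w,0) \<in> T_segment p q (butlast w,0) (w,0)"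
      "(w,s) \<in> T_segment p q (w,0) (butlast w,0)" "(w,0) \<in> T_segment p q (w,0) (butlast w,0)"
      using assms vertex_in[OF w(1)] d d' by (auto simp: T_segment_def T_dist_td)
    show ?thesis
    proof (cases "pw w = butlast w")
      case True
      then show ?thesis using in12 w(1) by (intro bexI[of _ w]) auto
    next
      case False
      then have "butlast w \<in> {y \<in> T_words p. adj w y} - {pw w}" using bw a adj_commute by auto
      then have "pw (butlast w) = w" using children(1)[OF w(1)] by blast
      then show ?thesis using in12 bw by (intro bexI[of _ "butlast w"]) auto
    qed
  qed
qed

lemma HP_point:
  assumes "(w,s) \<in> TT"
  shows "\<exists>L\<le>l. HP ((w,s),x) ((w,0),x) L" "\<exists>L\<le>l. HP ((w,0),x) ((w,s),x) L"
proof -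
  obtain y where y: "y \<in> T_words p" "(w,s) \<in> T_segment p q (pw y,0) (y,0)" "(w,0) \<in> T_segment p q (pw y,0) (y,0)"
    using point_vertex[OF assms] by blast
  have w: "w \<in> T_words p" "s < l" using assms by (auto simp: TT tree_points_def)
  have "\<bar>hgt (w,s) - hgt (w,0)\<bar> \<le> l"
    using height_lipschitz[OF assms vertex_in[OF w(1)]] td_down[OF assms] w by simp
  then show "\<exists>L\<le>l. HP ((w,s),x) ((w,0),x) L" "\<exists>L\<le>l. HP ((w,0),x) ((w,s),x) L"
    using edge_strip(1)[OF y(1,2,3), of x] edge_strip(1)[OF y(1,3,2), of x] by (auto simp: abs_minus_commute)
qed

lemma descendant_exists: assumes "w \<in> T_words p" shows "\<exists>u\<in>T_words p. (pw ^^ n) u = w"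
proof (induction n)
  case (Suc n)
  then obtain u where u: "u \<in> T_words p" "(pw ^^ n) u = w" by blast
  have "{y \<in> T_words p. pw y = u} \<noteq> {}" using children(2)[OF u(1)] p by (metis card.empty not_numeral_le_zero)
  then obtain y where "y \<in> T_words p" "pw y = u" by blast
  then show ?case using u by (intro bexI[of _ y]) (auto simp: funpow_swap1)
qed (use assms in auto)

text \<open>Climb until the displacement is at most one unit, cross, and descend again; any
  descendant of \<open>w\<close> of the right level serves.\<close>

lemma HP_raised:
  assumes "w \<in> T_words p" shows "\<exists>L. HP ((w,0),x) ((w,0),x') L \<and> L \<le> 2 * ln (1 + \<bar>x - x'\<bar> / exp (hgt (w,0))) + 2 * l + 1"
proof -
  define R where "R = \<bar>x - x'\<bar> / exp (hgt (w,0))"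
  have R: "0 \<le> R" by (simp add: R_def)
  define n where "n = nat \<lceil>ln (1 + R) / l\<rceil>"
  have "0 \<le> ln (1 + R) / l" using R l by simp
  then have "ln (1 + R) / l \<le> real n" "real n \<le> ln (1 + R) / l + 1" unfolding n_def by linarith+
  then have n: "ln (1 + R) \<le> real n * l" "real n * l \<le> ln (1 + R) + l" using l by (simp_all add: field_simps)
  obtain u where u: "u \<in> T_words p" "(pw ^^ n) u = w" using descendant_exists[OF assms] by blast
  have "lvl w = lvl u - int n" using pw_pow(2)[OF u(1), of n] u(2) by simp
  then have "real_of_int (lvl u) = real_of_int (lvl w) + real n" by simp
  then have hu: "hgt (u,0) = hgt (w,0) + real n * l" unfolding height_vertex[OF u(1)] height_vertex[OF assms]
    by (simp add: distrib_right)
  have "HP ((w,0),x) ((w,0),x') (real n * l + \<bar>x - x'\<bar> / exp (hgt (u,0)) + real n * l)"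
    using HP_trans[OF HP_trans[OF HP_pow(2)[OF u(1), where i = n and x = x] HP_horizontal[OF u(1)]] HP_pow(1)[OF u(1), where i = n and x = x']] u(2) by simp
  moreover have "\<bar>x - x'\<bar> / exp (hgt (u,0)) \<le> 1"
  proof -
    have "\<bar>x - x'\<bar> / exp (hgt (u,0)) = R / exp (real n * l)" by (simp add: hu R_def exp_add)
    moreover have "exp (ln (1 + R)) \<le> exp (real n * l)" using n(1) by simp
    ultimately show ?thesis using R by (simp add: divide_le_eq)
  qed
  ultimately have "HP ((w,0),x) ((w,0),x') (real n * l + \<bar>x - x'\<bar> / exp (hgt (u,0)) + real n * l) \<and>
    real n * l + \<bar>x - x'\<bar> / exp (hgt (u,0)) + real n * l \<le> 2 * ln (1 + R) + 2 * l + 1"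
    using n(2) by linarith
  then show ?thesis unfolding R_def by blast
qed

text \<open>The treebolic distance up to multiplicative and additive constants, in closed form. The
  displacement is measured at the height of the first point, so this is only a quasi-metric:
  symmetry and the triangle inequality hold with a factor 2.\<close>

definition rho :: "point \<times> real \<Rightarrow> point \<times> real \<Rightarrow> real" where
  "rho u u' = td (fst u) (fst u') + ln (1 + \<bar>snd u - snd u'\<bar> * exp (- hgt (fst u)))"

lemma HP_upper:
  assumes "fst u \<in> TT" "fst u' \<in> TT" shows "\<exists>L. HP u u' L \<and> L \<le> 2 * rho u u' + 8 * l + 1"
proof -
  obtain w s x w' s' x' where u: "u = ((w,s),x)" "u' = ((w',s'),x')" by (metis prod.collapse)
  have t: "(w,s) \<in> TT" "(w',s') \<in> TT" using assms u by auto
  have w: "w \<in> T_words p" "w' \<in> T_words p" "s < l" "s' < l" using t by (auto simp: TT tree_points_def)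
  obtain L1 where L1: "L1 \<le> l" "HP ((w,s),x) ((w,0),x) L1" using HP_point(1)[OF t(1)] by blast
  obtain L2 where L2: "HP ((w,0),x) ((w,0),x') L2" "L2 \<le> 2 * ln (1 + \<bar>x - x'\<bar> / exp (hgt (w,0))) + 2 * l + 1"
    using HP_raised[OF w(1)] by blast
  have L3: "HP ((w,0),x') ((w',0),x') (real (dw w w') * l)" by (rule HP_vertices[OF w(1,2)])
  obtain L4 where L4: "L4 \<le> l" "HP ((w',0),x') ((w',s'),x') L4" using HP_point(2)[OF t(2)] by blast
  have path: "HP u u' (L1 + L2 + real (dw w w') * l + L4)"
    unfolding u by (rule HP_trans[OF HP_trans[OF HP_trans[OF L1(2) L2(1)] L3] L4(2)])
  have d: "real (dw w w') * l \<le> td (w,s) (w',s') + 2 * l"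
    using tree_dist_triangle[OF l, of "(w,0)" "(w',0)" "(w,s)"] tree_dist_triangle[OF l, of "(w,s)" "(w',0)" "(w',s')"]
      td_down[OF t(1)] td_down[OF t(2)] w(3,4) tree_dist_commute[of l "(w,0)" "(w,s)"] by (simp add: tree_dist_dw l)
  define r where "r = \<bar>x - x'\<bar> * exp (- hgt (w,s))"
  have r: "0 \<le> r" by (simp add: r_def)
  have "hgt (w,s) - l \<le> hgt (w,0)" using height_lipschitz[OF t(1) vertex_in[OF w(1)]] td_down[OF t(1)] w(3) by linarith
  then have "\<bar>x - x'\<bar> / exp (hgt (w,0)) \<le> \<bar>x - x'\<bar> * exp (l - hgt (w,s))"
    by (simp add: divide_inverse exp_minus[symmetric] mult_left_mono)
  also have "\<dots> = exp l * r" by (simp add: r_def exp_diff exp_minus divide_inverse)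
  finally have "1 + \<bar>x - x'\<bar> / exp (hgt (w,0)) \<le> 1 + exp l * r" by simp
  also have "\<dots> \<le> exp l * (1 + r)" using l by (simp add: algebra_simps)
  finally have "ln (1 + \<bar>x - x'\<bar> / exp (hgt (w,0))) \<le> ln (exp l * (1 + r))"
    by (intro ln_mono) (auto simp: add_pos_nonneg)
  also have "\<dots> = l + ln (1 + r)" using r by (simp add: ln_mult)
  finally have "L1 + L2 + real (dw w w') * l + L4 \<le> td (w,s) (w',s') + 2 * ln (1 + r) + 8 * l + 1"
    using L1(1) L2(2) L4(1) d by linarith
  also have "\<dots> \<le> 2 * rho u u' + 8 * l + 1"
    using tree_dist_nonneg[of l "(w,s)" "(w',s')"] by (simp add: rho_def u r_def)
  finally show ?thesis using path by blast
qed

lemma HD_upper: assumes "fst u \<in> TT" "fst u' \<in> TT" shows "HD u u' \<le> 2 * rho u u' + 8 * l + 1"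
proof -
  obtain L where L: "HP u u' L" "L \<le> 2 * rho u u' + 8 * l + 1" using HP_upper[OF assms] by blast
  have "0 \<le> L" if "HP u u' L" for L using path_bounds[OF that] tree_dist_nonneg[of l "fst u" "fst u'"] by linarith
  then have "bdd_below {L. HP u u' L}" by (auto simp: bdd_below_def)
  then have "HD u u' \<le> L" unfolding HT_dist_def using L(1) by (intro cInf_lower) auto
  then show ?thesis using L(2) by simp
qed

text \<open>The logarithm of \<open>1 + L * exp (L + l)\<close> is at most \<open>2*L + l\<close>,
  which turns the exponential reach of a path into a linear bound.\<close>

lemma HD_lower: assumes "fst u \<in> TT" "fst u' \<in> TT" shows "rho u u' \<le> 3 * HD u u' + 3 + l"
proof -
  have ne: "{L. HP u u' L} \<noteq> {}" using HP_upper[OF assms] by blast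
  obtain L where L: "HP u u' L" "L < HD u u' + 1"
    using cInf_lessD[OF ne, of "HD u u' + 1"] by (auto simp: HT_dist_def)
  note b = path_bounds[OF L(1)]
  have L0: "0 \<le> L" using b tree_dist_nonneg[of l "fst u" "fst u'"] by linarith
  have "\<bar>snd u - snd u'\<bar> * exp (- hgt (fst u)) \<le> (L * exp (hgt (fst u) + L + l)) * exp (- hgt (fst u))"
    using b by (intro mult_right_mono) auto
  also have "\<dots> = L * exp (L + l)" by (simp add: exp_add exp_minus field_simps)
  finally have "1 + \<bar>snd u - snd u'\<bar> * exp (- hgt (fst u)) \<le> 1 + L * exp (L + l)" by simp
  also have "\<dots> \<le> (1 + L) * exp (L + l)" using L0 l by (simp add: algebra_simps)
  also have "\<dots> \<le> exp L * exp (L + l)" using exp_ge_add_one_self[of L] by (intro mult_right_mono) auto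
  finally have "ln (1 + \<bar>snd u - snd u'\<bar> * exp (- hgt (fst u))) \<le> ln (exp (L + (L + l)))"
    by (intro ln_mono) (simp_all only: exp_add[of L "L + l"], auto simp: add_pos_nonneg)
  then have "rho u u' \<le> 3 * L + l" using b by (simp add: rho_def)
  then show ?thesis using L(2) by linarith
qed

end

subsection \<open>Addresses of vertices\<close>

context tree_ray
begin

lemma G_pow: "(pw ^^ i) (G n) = G (n + i)"
  by (induction i) (auto simp: pw_G)

text \<open>With the ray labelled by zeros every address vanishes far below, because each descent
  eventually joins the ray. A transposition of labels at each ray vertex achieves this.\<close>

lemma labelling_exists:
  "\<exists>lab. (\<forall>u\<in>T_words p. bij_betw lab {y \<in> T_words p. pw y = u} {..<p}) \<and> (\<forall>n. lab (G n) = 0)"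
proof -
  have "\<exists>g. bij_betw g {y \<in> T_words p. pw y = u} {..<p} \<and> (\<forall>n. pw (G n) = u \<longrightarrow> g (G n) = 0)"
    if u: "u \<in> T_words p" for u
  proof -
    obtain g where g: "bij_betw g {y \<in> T_words p. pw y = u} {..<p}"
      using finite_same_card_bij[OF children(3)[OF u], of "{..<p}"] children(2)[OF u] by auto
    show ?thesis
    proof (cases "\<exists>n. pw (G n) = u")
      case False
      then show ?thesis using g by blast
    next
      case True
      then obtain n where n: "pw (G n) = u" by blast
      have un: "m = n" if "pw (G m) = u" for m
        using that n lvl_G[of "Suc m"] lvl_G[of "Suc n"] by (simp add: pw_G)
      have gn: "g (G n) \<in> {..<p}" using bij_betwE[OF g] G(2)[of n] n by blast
      have t: "bij_betw (Transposition.transpose (g (G n)) 0) {..<p} {..<p}"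
        using gn p by (intro bij_betw_transpose_iff) auto
      have "bij_betw (Transposition.transpose (g (G n)) 0 \<circ> g) {y \<in> T_words p. pw y = u} {..<p}"
        by (rule bij_betw_trans[OF g t])
      moreover have "\<forall>m. pw (G m) = u \<longrightarrow> (Transposition.transpose (g (G n)) 0 \<circ> g) (G m) = 0" using un by auto
      ultimately show ?thesis by blast
    qed
  qed
  then obtain g where g: "\<And>u. u \<in> T_words p \<Longrightarrow> bij_betw (g u) {y \<in> T_words p. pw y = u} {..<p}"
    "\<And>u n. u \<in> T_words p \<Longrightarrow> pw (G n) = u \<Longrightarrow> g u (G n) = 0" by metis
  have "bij_betw (\<lambda>y. g (pw y) y) {y \<in> T_words p. pw y = u} {..<p}" if "u \<in> T_words p" for u
    using g(1)[OF that] by (rule bij_betw_cong[THEN iffD1, rotated]) auto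
  moreover have "g (pw (G n)) (G n) = 0" for n using g(2)[OF pw(1)[OF G(2)] refl] by blast
  ultimately show ?thesis by (intro exI[of _ "\<lambda>y. g (pw y) y"]) blast
qed

definition lab :: "nat list \<Rightarrow> nat" where
  "lab = (SOME lab. (\<forall>u\<in>T_words p. bij_betw lab {y \<in> T_words p. pw y = u} {..<p}) \<and> (\<forall>n. lab (G n) = 0))"

lemma lab_bij: "u \<in> T_words p \<Longrightarrow> bij_betw lab {y \<in> T_words p. pw y = u} {..<p}" and lab_G: "lab (G n) = 0"
  unfolding lab_def using someI_ex[OF labelling_exists] by blast+

lemma lab_less: "w \<in> T_words p \<Longrightarrow> lab w < p"
  using bij_betwE[OF lab_bij[OF pw(1)], of w] by auto

lemma lab_inj: "w \<in> T_words p \<Longrightarrow> w' \<in> T_words p \<Longrightarrow> pw w = pw w' \<Longrightarrow> lab w = lab w' \<Longrightarrow> w = w'"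
  using bij_betw_imp_inj_on[OF lab_bij[OF pw(1)], of w'] by (auto simp: inj_on_def)

lemma lab_surj: "u \<in> T_words p \<Longrightarrow> d < p \<Longrightarrow> \<exists>y\<in>T_words p. pw y = u \<and> lab y = d"
proof -
  assume "u \<in> T_words p" "d < p"
  then have "d \<in> lab ` {y \<in> T_words p. pw y = u}" using bij_betw_imp_surj_on[OF lab_bij, of u] by simp
  then show ?thesis by blast
qed

text \<open>The digit at index \<open>j\<close> labels the edge between levels \<open>j\<close> and \<open>j + 1\<close>.\<close>

definition addr :: "nat list \<Rightarrow> int \<Rightarrow> nat" where
  "addr w j = (if j < lvl w then lab ((pw ^^ nat (lvl w - (j+1))) w) else 0)"

lemma addr_less: "w \<in> T_words p \<Longrightarrow> addr w j < p"
  using p lab_less[OF pw_pow(1)] by (simp add: addr_def)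

lemma addr_pw: "w \<in> T_words p \<Longrightarrow> j < lvl w - 1 \<Longrightarrow> addr (pw w) j = addr w j"
proof -
  assume w: "w \<in> T_words p" "j < lvl w - 1"
  have "nat (lvl w - (j+1)) = Suc (nat (lvl w - 1 - (j+1)))" using w(2) by simp
  then show ?thesis using w by (simp add: addr_def pw(3) funpow_swap1)
qed

lemma addr_pow: "w \<in> T_words p \<Longrightarrow> j < lvl w - int i \<Longrightarrow> addr ((pw ^^ i) w) j = addr w j"
proof (induction i)
  case (Suc i)
  then show ?case using addr_pw[OF pw_pow(1), of w j i] pw_pow(2)[of w i] by simp
qed simp

lemma ray_below: assumes "w \<in> T_words p" shows "\<exists>i n. (pw ^^ i) w = G n"
  using meet_exists[OF assms G(2), of 0] by (metis G_pow)

definition address :: "(int \<Rightarrow> nat) \<Rightarrow> bool" where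
  "address a \<longleftrightarrow> (\<forall>j. a j < p) \<and> (\<exists>j0. \<forall>j<j0. a j = 0)"

lemma address_addr: assumes w: "w \<in> T_words p" shows "address (addr w)"
proof -
  obtain i n where i: "(pw ^^ i) w = G n" using ray_below[OF w] by blast
  have "addr w j = 0" if j: "j < lvl w - int i" for j
  proof -
    define t where "t = nat (lvl w - int i - (j + 1))"
    have "nat (lvl w - (j+1)) = t + i" using j by (simp add: t_def)
    then show ?thesis using j by (simp add: addr_def funpow_add i G_pow lab_G)
  qed
  then show ?thesis using addr_less[OF w] by (auto simp: address_def)
qed

text \<open>Both descents reach the ray, after equally many steps at equal levels and hence at one
  vertex; equal labels then carry the equality back up.\<close>

lemma addr_inject:
  assumes "w \<in> T_words p" "w' \<in> T_words p" "lvl w = lvl w'" "\<And>j. j < lvl w \<Longrightarrow> addr w j = addr w' j"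
  shows "w = w'"
proof -
  obtain i n where i: "(pw ^^ i) w = G n" using ray_below[OF assms(1)] by blast
  obtain i' n' where i': "(pw ^^ i') w' = G n'" using ray_below[OF assms(2)] by blast
  have g: "(pw ^^ (i' + i)) w = G (n + i')" "(pw ^^ (i + i')) w' = G (n' + i)"
    by (simp_all add: funpow_add i i' G_pow)
  have "lvl (G (n + i')) = lvl (G (n' + i))"
    unfolding g[symmetric] using pw_pow(2)[OF assms(1)] pw_pow(2)[OF assms(2)] assms(3) by simp
  then have "n + i' = n' + i" by (simp add: lvl_G)
  then have "(pw ^^ (i + i')) w = (pw ^^ (i + i')) w'" using g by (simp only: add.commute[of i i'])
  moreover have "w = w'" if "(pw ^^ k) w = (pw ^^ k) w'" for k
    using assms that
  proof (induction k arbitrary: w w')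
    case (Suc k)
    have "pw w = pw w'"
    proof (rule Suc.IH)
      show "pw w \<in> T_words p" "pw w' \<in> T_words p" "lvl (pw w) = lvl (pw w')" using Suc.prems pw by auto
      show "addr (pw w) j = addr (pw w') j" if "j < lvl (pw w)" for j
        using that Suc.prems(1-4) addr_pw[of w j] addr_pw[of w' j] pw(3)[of w] by simp
      show "(pw ^^ k) (pw w) = (pw ^^ k) (pw w')" using Suc.prems(5) by (simp add: funpow_swap1)
    qed
    moreover have "lab w = lab w'" using Suc.prems(3) Suc.prems(4)[of "lvl w - 1"] by (simp add: addr_def)
    ultimately show ?case using lab_inj Suc.prems by blast
  qed simp
  ultimately show ?thesis by blast
qed

text \<open>Start on the ray so far down that all lower digits vanish, and follow the prescribed
  digits upward.\<close>

lemma addr_surj: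
  assumes "address a" shows "\<exists>w\<in>T_words p. lvl w = n \<and> (\<forall>j<n. addr w j = a j)"
proof -
  obtain j0 where j0: "\<And>j. j < j0 \<Longrightarrow> a j = 0" using assms by (auto simp: address_def)
  define M where "M = nat (- j0)"
  have z: "a j = 0" if "j < - int M" for j
    using that by (intro j0) (simp add: M_def split: if_splits)
  have base: "\<exists>w\<in>T_words p. lvl w = - int m \<and> (\<forall>j<(- int m). addr w j = a j)" if "M \<le> m" for m
    using z that by (intro bexI[of _ "G m"]) (auto simp: addr_def lvl_G G_pow lab_G G)
  have up: "\<exists>w\<in>T_words p. lvl w = - int M + int k \<and> (\<forall>j<(- int M + int k). addr w j = a j)" for k
  proof (induction k)
    case 0
    then show ?case using base[of M] by simp
  next
    case (Suc k)
    then obtain w where w: "w \<in> T_words p" "lvl w = - int M + int k" "\<And>j. j < lvl w \<Longrightarrow> addr w j = a j" by auto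
    have "a (lvl w) < p" using assms by (simp add: address_def)
    then obtain y where y: "y \<in> T_words p" "pw y = w" "lab y = a (lvl w)" using lab_surj[OF w(1)] by blast
    have l: "lvl y = lvl w + 1" using pw(3)[OF y(1)] y(2) by simp
    have "addr y j = a j" if "j < lvl y" for j
    proof (cases "j = lvl w")
      case True
      then show ?thesis using l y(3) by (simp add: addr_def)
    next
      case False
      then show ?thesis using that l w(3)[of j] addr_pw[OF y(1), of j] y(2) by simp
    qed
    then show ?case using y(1) l w(2) by (intro bexI[of _ y]) auto
  qed
  show ?thesis
  proof (cases "- int M \<le> n")
    case True
    then show ?thesis using up[of "nat (n + int M)"] by simp
  next
    case False
    then show ?thesis using base[of "nat (- n)"] by simp
  qed
qed

text \<open>An address without a level describes a whole vertical line; \<open>dec n\<close> is its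
  vertex at level \<open>n\<close>.\<close>

definition dec :: "int \<Rightarrow> (int \<Rightarrow> nat) \<Rightarrow> nat list" where
  "dec n a = (SOME w. w \<in> T_words p \<and> lvl w = n \<and> (\<forall>j<n. addr w j = a j))"

lemma dec:
  assumes "address a" shows "dec n a \<in> T_words p" "lvl (dec n a) = n" "j < n \<Longrightarrow> addr (dec n a) j = a j"
proof -
  have "dec n a \<in> T_words p \<and> lvl (dec n a) = n \<and> (\<forall>j<n. addr (dec n a) j = a j)"
    unfolding dec_def by (rule someI_ex) (use addr_surj[OF assms, of n] in blast)
  then show "dec n a \<in> T_words p" "lvl (dec n a) = n" "j < n \<Longrightarrow> addr (dec n a) j = a j" by auto
qed

lemma dec_eqI:
  assumes "address a" "w \<in> T_words p" "lvl w = n" "\<And>j. j < n \<Longrightarrow> addr w j = a j" shows "dec n a = w"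
  by (rule addr_inject) (simp_all add: dec[OF assms(1)] assms)

lemma dec_addr: "w \<in> T_words p \<Longrightarrow> dec (lvl w) (addr w) = w"
  by (rule dec_eqI) (auto simp: address_addr)

lemma dec_eq_iff: "address a \<Longrightarrow> address b \<Longrightarrow> dec n a = dec n b \<longleftrightarrow> (\<forall>j<n. a j = b j)"
  using dec[of a] dec[of b] dec_eqI[of a "dec n b" n] by metis

lemma dec_pow: "address a \<Longrightarrow> (pw ^^ i) (dec n a) = dec (n - int i) a"
proof (rule dec_eqI[symmetric])
  assume a: "address a"
  show "(pw ^^ i) (dec n a) \<in> T_words p" "lvl ((pw ^^ i) (dec n a)) = n - int i"
    using pw_pow[OF dec(1)[OF a]] dec(2)[OF a] by auto
  show "addr ((pw ^^ i) (dec n a)) j = a j" if "j < n - int i" for j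
    using addr_pow[OF dec(1)[OF a], of j n i] dec(2)[OF a, of n] dec(3)[OF a, of j n] that by simp
qed auto

lemma dw_dec_le:
  assumes "address a" "address b" "k \<le> n" "k \<le> m" "\<And>j. j < k \<Longrightarrow> a j = b j"
  shows "int (dw (dec n a) (dec m b)) \<le> n + m - 2 * k"
proof -
  have "(pw ^^ nat (n - k)) (dec n a) = (pw ^^ nat (m - k)) (dec m b)"
    using assms by (simp add: dec_pow dec_eq_iff)
  from dw_le_meet[OF dec(1)[OF assms(1)] dec(1)[OF assms(2)] this] show ?thesis using assms(3,4) by linarith
qed

lemma dw_dec_meet:
  assumes "address a" "address b"
  shows "\<exists>k. k \<le> n \<and> k \<le> m \<and> (\<forall>j<k. a j = b j) \<and> int (dw (dec n a) (dec m b)) = n + m - 2 * k"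
proof -
  obtain i j where ij: "(pw ^^ i) (dec n a) = (pw ^^ j) (dec m b)" "i + j = dw (dec n a) (dec m b)"
    using meet_exists[OF dec(1)[OF assms(1)] dec(1)[OF assms(2)]] by blast
  have e: "dec (n - int i) a = dec (m - int j) b" using ij(1) assms by (simp add: dec_pow)
  then have "n - int i = m - int j" using dec(2)[OF assms(1)] dec(2)[OF assms(2)] by metis
  moreover from this e have "\<forall>j<n - int i. a j = b j" using dec_eq_iff[OF assms] by metis
  ultimately show ?thesis using ij(2) by (intro exI[of _ "n - int i"]) auto
qed

end

subsection \<open>Quasi-metric estimates\<close>

context tree_ray
begin

lemma ln_shift:
  fixes r h h' d :: real
  assumes "0 \<le> r" "h' - h \<le> d" "0 \<le> d" shows "ln (1 + r * exp (- h)) \<le> ln (1 + r * exp (- h')) + d"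
proof -
  have "r * exp (- h) \<le> r * exp (d - h')" using assms by (intro mult_left_mono) auto
  also have "\<dots> = exp d * (r * exp (- h'))" by (simp add: exp_diff exp_minus divide_inverse)
  finally have "1 + r * exp (- h) \<le> exp d * (1 + r * exp (- h'))" using assms by (simp add: distrib_left add_mono)
  then have "ln (1 + r * exp (- h)) \<le> ln (exp d * (1 + r * exp (- h')))"
    using assms by (intro ln_mono) (auto simp: add_pos_nonneg)
  also have "\<dots> = d + ln (1 + r * exp (- h'))"
    using ln_mult_pos[of "exp d" "1 + r * exp (- h')"] assms by (simp add: add_pos_nonneg)
  finally show ?thesis by simp
qed

lemma rho_commute_le: assumes "fst u \<in> TT" "fst v \<in> TT" shows "rho v u \<le> 2 * rho u v"
proof -
  define a b where "a = ln (1 + \<bar>snd u - snd v\<bar> * exp (- hgt (fst u)))" and "b = ln (1 + \<bar>snd u - snd v\<bar> * exp (- hgt (fst v)))"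
  have "hgt (fst u) - hgt (fst v) \<le> td (fst u) (fst v)" using height_lipschitz[OF assms] by linarith
  then have "b \<le> a + td (fst u) (fst v)" unfolding a_def b_def by (intro ln_shift) (auto simp: tree_dist_nonneg)
  moreover have "0 \<le> a" by (simp add: a_def)
  moreover have "rho v u = td (fst u) (fst v) + b" "2 * rho u v = 2 * td (fst u) (fst v) + 2 * a"
    by (simp_all add: rho_def a_def b_def tree_dist_commute[of l "fst v"] abs_minus_commute[of "snd v"])
  ultimately show ?thesis using tree_dist_nonneg[of l "fst u" "fst v"] by linarith
qed

lemma rho_triangle: assumes "fst u \<in> TT" "fst v \<in> TT" shows "rho u w \<le> 2 * rho u v + rho v w"
proof -
  define a b b' c where "a = \<bar>snd u - snd v\<bar> * exp (- hgt (fst u))" and "b = \<bar>snd v - snd w\<bar> * exp (- hgt (fst u))"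
    and "b' = \<bar>snd v - snd w\<bar> * exp (- hgt (fst v))" and "c = \<bar>snd u - snd w\<bar> * exp (- hgt (fst u))"
  have ab: "0 \<le> a" "0 \<le> b" "0 \<le> c" by (auto simp: a_def b_def c_def)
  have "c \<le> (\<bar>snd u - snd v\<bar> + \<bar>snd v - snd w\<bar>) * exp (- hgt (fst u))"
    unfolding c_def by (intro mult_right_mono) auto
  then have "1 + c \<le> 1 + (a + b)" by (simp add: a_def b_def distrib_right)
  also have "\<dots> \<le> (1 + a) * (1 + b)" using ab by (simp add: algebra_simps)
  finally have "ln (1 + c) \<le> ln ((1 + a) * (1 + b))" using ab by (intro ln_mono) auto
  also have "\<dots> = ln (1 + a) + ln (1 + b)" using ab by (simp add: ln_mult)
  also have "ln (1 + b) \<le> ln (1 + b') + td (fst u) (fst v)"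
    unfolding b_def b'_def using height_lipschitz[OF assms] by (intro ln_shift) (auto simp: tree_dist_nonneg)
  finally have "ln (1 + c) \<le> ln (1 + a) + (ln (1 + b') + td (fst u) (fst v))" by simp
  moreover have "0 \<le> ln (1 + a)" using ab by simp
  ultimately show ?thesis
    using tree_dist_triangle[OF l, of "fst u" "fst w" "fst v"] unfolding rho_def a_def[symmetric] b'_def[symmetric] c_def[symmetric]
    by (simp add: distrib_left)
qed

end

subsection \<open>From block codes to treebolic spaces\<close>

locale two_trees = X: tree_ray p q \<gamma> + Y: tree_ray p' q' \<gamma>' for p q \<gamma> p' q' \<gamma>'
begin

lemma quasiisometric_embedding_of_rho:
  assumes f: "\<And>u. fst u \<in> X.TT \<Longrightarrow> fst (f u) \<in> Y.TT" and A: "1 \<le> A" and B: "0 \<le> B"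
    and up: "\<And>u v. fst u \<in> X.TT \<Longrightarrow> fst v \<in> X.TT \<Longrightarrow> Y.rho (f u) (f v) \<le> A * X.rho u v + B"
    and lo: "\<And>u v. fst u \<in> X.TT \<Longrightarrow> fst v \<in> X.TT \<Longrightarrow> X.rho u v \<le> A * Y.rho (f u) (f v) + B"
  shows "quasiisometric_embedding (HT_space p q) (HT_dist p q \<gamma>) (HT_space p' q') (HT_dist p' q' \<gamma>') f"
proof -
  define D where "D = 2 * A * (3 + X.l + Y.l) + 2 * B + 8 * X.l + 8 * Y.l + 1"
  have l: "0 < X.l" "0 < Y.l" using X.l Y.l by auto
  have D: "0 \<le> D" unfolding D_def using A B l by (intro add_nonneg_nonneg) auto
  have "1 / (6 * A) * X.HD u v - D \<le> Y.HD (f u) (f v) \<and> Y.HD (f u) (f v) \<le> 6 * A * X.HD u v + D"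
    if uv: "u \<in> HT_space p q" "v \<in> HT_space p q" for u v
  proof -
    have t: "fst u \<in> X.TT" "fst v \<in> X.TT" using uv by (auto simp: HT_space_def)
    have Al: "0 \<le> A * X.l" "0 \<le> A * Y.l" using A l by auto
    have "A * X.rho u v \<le> A * (3 * X.HD u v + 3 + X.l)" using X.HD_lower[OF t] A by (intro mult_left_mono) auto
    then have 1: "Y.HD (f u) (f v) \<le> 6 * A * X.HD u v + D"
      using Y.HD_upper[OF f[OF t(1)] f[OF t(2)]] up[OF t] Al l unfolding D_def by (simp add: distrib_left)
    have "A * Y.rho (f u) (f v) \<le> A * (3 * Y.HD (f u) (f v) + 3 + Y.l)"
      using Y.HD_lower[OF f[OF t(1)] f[OF t(2)]] A by (intro mult_left_mono) auto
    then have "X.HD u v \<le> 6 * A * Y.HD (f u) (f v) + D"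
      using X.HD_upper[OF t] lo[OF t] Al l unfolding D_def by (simp add: distrib_left)
    also have "\<dots> \<le> 6 * A * Y.HD (f u) (f v) + 6 * A * D" using A D by (simp add: mult_le_cancel_right1)
    finally have "1 / (6 * A) * X.HD u v \<le> 1 / (6 * A) * (6 * A * (Y.HD (f u) (f v) + D))"
      using A by (intro mult_left_mono) (auto simp: distrib_left)
    also have "\<dots> = Y.HD (f u) (f v) + D" using A by simp
    finally show ?thesis using 1 by simp
  qed
  moreover have "f ` HT_space p q \<subseteq> HT_space p' q'" using f by (force simp: HT_space_def mem_Times_iff)
  ultimately show ?thesis unfolding quasiisometric_embedding_def qi_embedding_def using A D
    by (intro exI[of _ "6 * A"] exI[of _ D] conjI) auto
qed

lemma rho_of_quasiisometric_embedding:
  assumes "quasiisometric_embedding (HT_space p q) (HT_dist p q \<gamma>) (HT_space p' q') (HT_dist p' q' \<gamma>') f"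
  shows "\<exists>A\<ge>1. \<exists>B\<ge>0. \<forall>u v. fst u \<in> X.TT \<longrightarrow> fst v \<in> X.TT \<longrightarrow> fst (f u) \<in> Y.TT \<and>
    Y.rho (f u) (f v) \<le> A * X.rho u v + B \<and> X.rho u v \<le> A * Y.rho (f u) (f v) + B"
proof -
  obtain K C where K: "1 \<le> K" "0 \<le> C" and f: "f ` HT_space p q \<subseteq> HT_space p' q'"
    and qi: "\<And>u v. u \<in> HT_space p q \<Longrightarrow> v \<in> HT_space p q \<Longrightarrow>
      1 / K * X.HD u v - C \<le> Y.HD (f u) (f v) \<and> Y.HD (f u) (f v) \<le> K * X.HD u v + C"
    using assms unfolding quasiisometric_embedding_def qi_embedding_def by blast
  define D where "D = 3 * K * (8 * X.l + 8 * Y.l + 1 + C) + 3 * C + 3 + X.l + Y.l"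
  have l: "0 < X.l" "0 < Y.l" using X.l Y.l by auto
  have "0 \<le> K * (8 * X.l + 8 * Y.l + 1 + C)" using K l by (intro mult_nonneg_nonneg) auto
  then have D: "0 \<le> D" unfolding D_def using K l by simp
  have "fst (f u) \<in> Y.TT \<and> Y.rho (f u) (f v) \<le> 6 * K * X.rho u v + D \<and> X.rho u v \<le> 6 * K * Y.rho (f u) (f v) + D"
    if t: "fst u \<in> X.TT" "fst v \<in> X.TT" for u v
  proof -
    have uv: "u \<in> HT_space p q" "v \<in> HT_space p q" using t by (auto simp: HT_space_def mem_Times_iff)
    have ft: "fst (f u) \<in> Y.TT" "fst (f v) \<in> Y.TT" using f uv by (force simp: HT_space_def mem_Times_iff)+
    have nn: "0 \<le> K * X.l" "0 \<le> K * Y.l" "0 \<le> K * C" using K l by auto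
    have e: "D = 24 * (K * X.l) + 24 * (K * Y.l) + 3 * K + 3 * (K * C) + 3 * C + 3 + X.l + Y.l"
      by (simp add: D_def algebra_simps)
    have "K * X.HD u v \<le> K * (2 * X.rho u v + 8 * X.l + 1)" using X.HD_upper[OF t] K by (intro mult_left_mono) auto
    also have "\<dots> = 2 * (K * X.rho u v) + 8 * (K * X.l) + K" by (simp add: algebra_simps)
    finally have "Y.rho (f u) (f v) \<le> 6 * (K * X.rho u v) + D"
      using Y.HD_lower[OF ft] qi[OF uv] nn K l unfolding e by linarith
    then have 1: "Y.rho (f u) (f v) \<le> 6 * K * X.rho u v + D" by (simp add: mult.assoc)
    have "K * (1 / K * X.HD u v - C) \<le> K * (2 * Y.rho (f u) (f v) + 8 * Y.l + 1)"
      using Y.HD_upper[OF ft] qi[OF uv] K by (intro mult_left_mono) auto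
    moreover have "K * (1 / K * X.HD u v - C) = X.HD u v - K * C" using K by (simp add: right_diff_distrib)
    moreover have "K * (2 * Y.rho (f u) (f v) + 8 * Y.l + 1) = 2 * (K * Y.rho (f u) (f v)) + 8 * (K * Y.l) + K" by (simp add: algebra_simps)
    ultimately have "X.rho u v \<le> 6 * (K * Y.rho (f u) (f v)) + D"
      using X.HD_lower[OF t] nn K l unfolding e by linarith
    then have "X.rho u v \<le> 6 * K * Y.rho (f u) (f v) + D" by (simp add: mult.assoc)
    then show ?thesis using 1 ft by blast
  qed
  then show ?thesis using K D by (intro exI[of _ "6 * K"] exI[of _ D]) auto
qed

end

context tree_ray
begin

definition ver :: "point \<times> real \<Rightarrow> point \<times> real" where "ver u = ((fst (fst u), 0), snd u)"

lemma word_in: "fst u \<in> TT \<Longrightarrow> fst (fst u) \<in> T_words p"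
  by (auto simp: TT tree_points_def)

lemma ver_in: "fst u \<in> TT \<Longrightarrow> fst (ver u) \<in> TT"
  using vertex_in[OF word_in] by (simp add: ver_def)

lemma rho_ver: assumes "fst u \<in> TT" shows "rho u (ver u) \<le> l"
proof -
  have "td (fst u) (fst (ver u)) = snd (fst u)" using td_down[of "fst (fst u)" "snd (fst u)"] assms by (simp add: ver_def)
  moreover have "snd (fst u) < l" using assms by (auto simp: TT tree_points_def)
  ultimately show ?thesis by (simp add: rho_def ver_def)
qed

lemma rho_ver_bounds:
  assumes "fst u \<in> TT" "fst v \<in> TT"
  shows "rho u v \<le> 2 * rho (ver u) (ver v) + 4 * l" "rho (ver u) (ver v) \<le> 2 * rho u v + 5 * l"
proof -
  note i = assms ver_in[OF assms(1)] ver_in[OF assms(2)]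
  have b: "rho u (ver u) \<le> l" "rho v (ver v) \<le> l" "rho (ver u) u \<le> 2 * l" "rho (ver v) v \<le> 2 * l"
    using rho_ver[OF i(1)] rho_ver[OF i(2)] rho_commute_le[OF i(1,3)] rho_commute_le[OF i(2,4)] by linarith+
  show "rho u v \<le> 2 * rho (ver u) (ver v) + 4 * l"
    using rho_triangle[OF i(1,3), of v] rho_triangle[OF i(3,4), of v] b by linarith
  show "rho (ver u) (ver v) \<le> 2 * rho u v + 5 * l"
    using rho_triangle[OF i(3,1), of "ver v"] rho_triangle[OF i(1,2), of "ver v"] b by linarith
qed

end

context two_trees
begin

context
  fixes N :: nat
  assumes code: "block_code p p' N X.l Y.l"
begin

interpretation C: block_code p p' N X.l Y.l by (rule code)

definition cdig :: "nat list \<Rightarrow> int \<Rightarrow> nat" where "cdig w = C.enc (X.addr w)"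
text \<open>Blocks are counted from level 0 in both trees, so the coded vertex has the height of
  \<open>w\<close> up to a constant. This is why the embedding can leave the horizontal coordinate
  unchanged.\<close>

definition cword :: "nat list \<Rightarrow> nat list" where "cword w = Y.dec (C.mm (X.lvl w div int N)) (cdig w)"

lemma cdig: assumes "w \<in> T_words p" shows "Y.address (cdig w)"
proof -
  obtain j0 where "\<And>j. j < j0 \<Longrightarrow> X.addr w j = 0" using X.address_addr[OF assms] by (auto simp: X.address_def)
  then have "cdig w J = 0" if "J < C.mm (j0 div int N)" for J using C.enc_zero[of j0 "X.addr w" J] that by (simp add: cdig_def)
  then show ?thesis using C.enc_less by (auto simp: Y.address_def cdig_def)
qed

lemma cword: assumes "w \<in> T_words p"
  shows "cword w \<in> T_words p'" "Y.lvl (cword w) = C.mm (X.lvl w div int N)"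
  using Y.dec[OF cdig[OF assms]] by (auto simp: cword_def)

lemma cword_dist:
  assumes w: "w \<in> T_words p" "w' \<in> T_words p"
  shows "\<bar>real (dw (cword w) (cword w')) * Y.l - real (dw w w') * X.l\<bar> \<le> 4 * C.CC"
proof -
  define n m where "n = X.lvl w" and "m = X.lvl w'"
  define n' m' where "n' = C.mm (n div int N)" and "m' = C.mm (m div int N)"
  note a = X.address_addr[OF w(1)] X.address_addr[OF w(2)] and c = cdig[OF w(1)] cdig[OF w(2)]
  have e: "w = X.dec n (X.addr w)" "w' = X.dec m (X.addr w')" "cword w = Y.dec n' (cdig w)" "cword w' = Y.dec m' (cdig w')"
    using w by (simp_all add: n_def m_def n'_def m'_def cword_def X.dec_addr)
  note up = C.mm_upper[of n, folded n'_def] C.mm_upper[of m, folded m'_def]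
  note lo = C.mm_lower[of n, folded n'_def] C.mm_lower[of m, folded m'_def]
  have CC: "0 \<le> C.CC" by (rule C.CC)
  have "real (dw (cword w) (cword w')) * Y.l \<le> real (dw w w') * X.l + 4 * C.CC"
  proof -
    obtain k where k: "k \<le> n" "k \<le> m" "\<forall>j<k. X.addr w j = X.addr w' j" "int (dw w w') = n + m - 2 * k"
      using X.dw_dec_meet[OF a, of n m] e(1,2) by auto
    define M where "M = C.mm (k div int N)"
    have M: "M \<le> n'" "M \<le> m'" unfolding M_def n'_def m'_def using k(1,2) C.N by (auto intro!: C.mm_mono zdiv_mono1)
    have "int (dw (cword w) (cword w')) \<le> n' + m' - 2 * M" unfolding e(3,4)
    proof (rule Y.dw_dec_le[OF c M])
      show "cdig w J = cdig w' J" if "J < M" for J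
        unfolding cdig_def by (rule C.enc_agree[of k]) (use k(3) that in \<open>auto simp: M_def\<close>)
    qed
    then have "real_of_int (int (dw (cword w) (cword w'))) \<le> of_int (n' + m' - 2 * M)" by (simp only: of_int_le_iff)
    then have "real (dw (cword w) (cword w')) * Y.l \<le> of_int (n' + m' - 2 * M) * Y.l"
      using Y.l by (intro mult_right_mono) auto
    also have "\<dots> = of_int n' * Y.l + of_int m' * Y.l - 2 * (of_int M * Y.l)" by (simp add: algebra_simps)
    also have "\<dots> \<le> of_int n * X.l + of_int m * X.l - 2 * (of_int k * X.l - C.CC)"
      using up C.mm_lower[of k, folded M_def] by (simp add: right_diff_distrib)
    also have "\<dots> = of_int (int (dw w w')) * X.l + 2 * C.CC" unfolding k(4) by (simp add: algebra_simps)
    finally show ?thesis using CC by simp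
  qed
  moreover have "real (dw w w') * X.l \<le> real (dw (cword w) (cword w')) * Y.l + 4 * C.CC"
  proof -
    obtain M where M: "M \<le> n'" "M \<le> m'" "\<forall>J<M. cdig w J = cdig w' J" "int (dw (cword w) (cword w')) = n' + m' - 2 * M"
      using Y.dw_dec_meet[OF c, of n' m'] e(3,4) by auto
    define k where "k = min (int N * C.blk M) (min n m)"
    have ag: "X.addr w j = X.addr w' j" if "j < k" for j
      using C.enc_reflect[of "X.addr w" "X.addr w'" M j] X.addr_less w M(3) that by (simp add: cdig_def k_def)
    have "of_int M * Y.l \<le> of_int n' * Y.l" "of_int M * Y.l \<le> of_int m' * Y.l" using M Y.l by auto
    then have kM: "of_int M * Y.l - C.CC \<le> of_int k * X.l"
      using C.blk_lower[of M] up CC unfolding k_def by (simp add: min_def)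
    have "int (dw w w') \<le> n + m - 2 * k" using X.dw_dec_le[OF a, of k n m] ag e(1,2) by (auto simp: k_def)
    then have "real_of_int (int (dw w w')) \<le> of_int (n + m - 2 * k)" by (simp only: of_int_le_iff)
    then have "real (dw w w') * X.l \<le> of_int (n + m - 2 * k) * X.l"
      using X.l by (intro mult_right_mono) auto
    also have "\<dots> = of_int n * X.l + of_int m * X.l - 2 * (of_int k * X.l)" by (simp add: algebra_simps)
    also have "\<dots> \<le> (of_int n' * Y.l + C.CC) + (of_int m' * Y.l + C.CC) - 2 * (of_int M * Y.l - C.CC)"
      using lo kM by (simp add: right_diff_distrib)
    also have "\<dots> = of_int (int (dw (cword w) (cword w'))) * Y.l + 4 * C.CC" unfolding M(4) by (simp add: algebra_simps)
    finally show ?thesis by simp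
  qed
  ultimately show ?thesis by linarith
qed

lemma treebolic_embedding:
  "quasiisometric_embedding (HT_space p q) (HT_dist p q \<gamma>) (HT_space p' q') (HT_dist p' q' \<gamma>')
    (\<lambda>u. ((cword (fst (fst u)), 0), snd u))"
proof (rule quasiisometric_embedding_of_rho)
  let ?f = "\<lambda>u :: point \<times> real. ((cword (fst (fst u)), 0 :: real), snd u)"
  show "fst (?f u) \<in> Y.TT" if "fst u \<in> X.TT" for u using Y.vertex_in[OF cword(1)[OF X.word_in[OF that]]] by simp
  have CC: "0 \<le> C.CC" by (rule C.CC)
  have close: "Y.rho (?f u) (?f v) \<le> X.rho (X.ver u) (X.ver v) + 5 * C.CC"
    "X.rho (X.ver u) (X.ver v) \<le> Y.rho (?f u) (?f v) + 5 * C.CC" if uv: "fst u \<in> X.TT" "fst v \<in> X.TT" for u v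
  proof -
    define w w' where "w = fst (fst u)" and "w' = fst (fst v)"
    have w: "w \<in> T_words p" "w' \<in> T_words p" unfolding w_def w'_def using uv X.word_in by blast+
    define r where "r = \<bar>snd u - snd v\<bar>"
    have r: "0 \<le> r" by (simp add: r_def)
    define h h' where "h = X.hgt (w,0)" and "h' = Y.hgt (cword w,0)"
    have "h' \<le> h" "h - C.CC \<le> h'" unfolding h_def h'_def X.height_vertex[OF w(1)] Y.height_vertex[OF cword(1)[OF w(1)]] cword(2)[OF w(1)]
      using C.mm_upper C.mm_lower by auto
    then have "ln (1 + r * exp (- h')) \<le> ln (1 + r * exp (- h)) + C.CC" "ln (1 + r * exp (- h)) \<le> ln (1 + r * exp (- h')) + C.CC"
      using r CC by (auto intro!: X.ln_shift)
    moreover have "X.rho (X.ver u) (X.ver v) = real (dw w w') * X.l + ln (1 + r * exp (- h))"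
      by (simp add: X.rho_def X.ver_def w_def w'_def tree_dist_dw X.l r_def h_def)
    moreover have "Y.rho (?f u) (?f v) = real (dw (cword w) (cword w')) * Y.l + ln (1 + r * exp (- h'))"
      by (simp add: Y.rho_def w_def w'_def tree_dist_dw Y.l r_def h'_def)
    ultimately show "Y.rho (?f u) (?f v) \<le> X.rho (X.ver u) (X.ver v) + 5 * C.CC"
      "X.rho (X.ver u) (X.ver v) \<le> Y.rho (?f u) (?f v) + 5 * C.CC"
      using abs_le_D1[OF cword_dist[OF w]] abs_le_D2[OF cword_dist[OF w]] by linarith+
  qed
  show "1 \<le> (2::real)" "0 \<le> 5 * X.l + 10 * C.CC" using X.l CC by auto
  fix u v :: "point \<times> real" assume uv: "fst u \<in> X.TT" "fst v \<in> X.TT"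
  show "Y.rho (?f u) (?f v) \<le> 2 * X.rho u v + (5 * X.l + 10 * C.CC)"
    using close(1)[OF uv] X.rho_ver_bounds(2)[OF uv] CC by linarith
  show "X.rho u v \<le> 2 * Y.rho (?f u) (?f v) + (5 * X.l + 10 * C.CC)"
    using close(2)[OF uv] X.rho_ver_bounds(1)[OF uv] X.l by linarith
qed

end

end

subsection \<open>Dyadic models of treebolic spaces\<close>

lemma dy_exp: "dy n = exp (of_int n * ln 2)" by (simp add: dy_def powr_def)

context tree_ray
begin

text \<open>Model vertices of level \<open>n\<close> sit at heights between \<open>n ln 2 - l\<close> and \<open>n ln 2\<close>, where
  horizontal distances scale by \<open>2 ^ n\<close> up to a bounded factor.\<close>

definition tau :: "int \<Rightarrow> int" where "tau n = \<lfloor>of_int n * ln 2 / l\<rfloor>"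

lemma tau_le: "of_int (tau n) * l \<le> of_int n * ln 2"
proof -
  have "of_int (tau n) \<le> of_int n * ln 2 / l" unfolding tau_def by linarith
  then show ?thesis using l by (simp add: field_simps)
qed

lemma tau_gt: "of_int n * ln 2 - l < of_int (tau n) * l"
proof -
  have "of_int n * ln 2 / l < of_int (tau n) + 1" unfolding tau_def by linarith
  then show ?thesis using l by (simp add: field_simps)
qed

lemma le_tau: "of_int k * l \<le> of_int n * ln 2 \<Longrightarrow> k \<le> tau n"
  using l by (simp add: tau_def le_floor_iff field_simps)

lemma tau_mono: "m \<le> n \<Longrightarrow> tau m \<le> tau n"
  unfolding tau_def using l by (intro floor_mono divide_right_mono mult_right_mono) auto

lemma tau_0 [simp]: "tau 0 = 0" by (simp add: tau_def)

text \<open>A model vertex carries its model level explicitly: when edges are long, several model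
  levels share one tree level, and when they are short, one model step skips several.\<close>

definition mpar :: "int \<times> nat list \<Rightarrow> int \<times> nat list" where
  "mpar v = (fst v - 1, (pw ^^ nat (tau (fst v) - tau (fst v - 1))) (snd v))"

definition MV :: "(int \<times> nat list) set" where "MV = {v. snd v \<in> T_words p \<and> lvl (snd v) = tau (fst v)}"

end

sublocale tree_ray \<subseteq> H: horo mpar fst
  by unfold_locales (simp add: mpar_def)

context tree_ray
begin

lemma mpar_pow: "(mpar ^^ i) v = (fst v - int i, (pw ^^ nat (tau (fst v) - tau (fst v - int i))) (snd v))"
proof (induction i)
  case (Suc i)
  have "nat (tau (fst v - int i) - tau (fst v - int i - 1)) + nat (tau (fst v) - tau (fst v - int i))
      = nat (tau (fst v) - tau (fst v - int (Suc i)))"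
    using tau_mono[of "fst v - int i - 1" "fst v - int i"] tau_mono[of "fst v - int i" "fst v"] by (simp add: algebra_simps)
  moreover have "(mpar ^^ Suc i) v = (fst v - int i - 1, (pw ^^ (nat (tau (fst v - int i) - tau (fst v - int i - 1)) + nat (tau (fst v) - tau (fst v - int i)))) (snd v))"
    by (simp only: funpow.simps o_apply Suc mpar_def fst_conv snd_conv funpow_add)
  moreover have "fst v - int i - 1 = fst v - int (Suc i)" by simp
  ultimately show ?case by (simp only:)
qed simp

lemma MV_pow: assumes "v \<in> MV" shows "(mpar ^^ i) v \<in> MV"
  using assms pw_pow[of "snd v"] tau_mono[of "fst v - int i" "fst v"] by (simp add: MV_def mpar_pow)

definition pnt :: "(int \<times> nat list) \<times> int \<Rightarrow> point \<times> real" where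
  "pnt a = ((snd (fst a), 0), real_of_int (snd a) * dy (fst (fst a)))"

lemma pnt_in: "fst a \<in> MV \<Longrightarrow> fst (pnt a) \<in> TT"
  using vertex_in by (simp add: MV_def pnt_def)

lemma hgt_pnt: "fst a \<in> MV \<Longrightarrow> hgt (fst (pnt a)) = of_int (tau (fst (fst a))) * l"
  using height_vertex by (simp add: MV_def pnt_def)

lemma rho_pnt: "rho (pnt a) (pnt b) = real (dw (snd (fst a)) (snd (fst b))) * l + ln (1 + \<bar>H.xc a - H.xc b\<bar> * exp (- hgt (fst (pnt a))))"
  by (simp add: rho_def pnt_def H.xc_def tree_dist_dw l)

lemma ln_bound: assumes "0 \<le> r" "r \<le> exp (d::real)" "0 \<le> d" shows "ln (1 + r) \<le> ln 2 + d"
proof -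
  have "1 + r \<le> 2 * exp d" using assms by (smt (verit) one_le_exp_iff)
  then have "ln (1 + r) \<le> ln (2 * exp d)" using assms(1) by (intro ln_mono) auto
  then show ?thesis by (simp add: ln_mult)
qed

lemma rho_of_near:
  assumes ab: "fst a \<in> MV" "fst b \<in> MV" and near: "H.near A a b"
  shows "rho (pnt a) (pnt b) \<le> 3 * ln 2 * real A + (3 * l + ln 2)"
proof -
  define n m where "n = fst (fst a)" and "m = fst (fst b)"
  obtain i j where ij: "i \<le> A" "j \<le> A" "(mpar ^^ i) (fst a) = (mpar ^^ j) (fst b)"
    and x: "\<bar>H.xc a - H.xc b\<bar> \<le> dy (int A + n)"
    using near unfolding H.near_def n_def by blast
  have w: "snd (fst a) \<in> T_words p" "snd (fst b) \<in> T_words p" using ab by (auto simp: MV_def)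
  define I J where "I = nat (tau n - tau (n - int i))" and "J = nat (tau m - tau (m - int j))"
  have e: "(pw ^^ I) (snd (fst a)) = (pw ^^ J) (snd (fst b))" using arg_cong[OF ij(3), of snd] by (simp only: mpar_pow snd_conv I_def J_def n_def m_def)
  have small: "real (nat (tau k - tau (k - int t))) * l \<le> real A * ln 2 + l" if "t \<le> A" for k t
  proof -
    have "tau (k - int t) \<le> tau k" by (rule tau_mono) simp
    then have "real (nat (tau k - tau (k - int t))) * l = of_int (tau k) * l - of_int (tau (k - int t)) * l"
      by (simp add: left_diff_distrib)
    also have "\<dots> \<le> real t * ln 2 + l" using tau_le[of k] tau_gt[of "k - int t"] by (simp add: left_diff_distrib)
    also have "\<dots> \<le> real A * ln 2 + l" using that by simp
    finally show ?thesis .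
  qed
  have "real (dw (snd (fst a)) (snd (fst b))) * l \<le> real (I + J) * l"
    using dw_le_meet[OF w e] l by (intro mult_right_mono) auto
  also have "\<dots> \<le> 2 * (real A * ln 2) + 2 * l"
    using small[OF ij(1), of n] small[OF ij(2), of m] by (simp add: I_def J_def distrib_right)
  finally have d: "real (dw (snd (fst a)) (snd (fst b))) * l \<le> 2 * (real A * ln 2) + 2 * l" .
  have "\<bar>H.xc a - H.xc b\<bar> * exp (- hgt (fst (pnt a))) \<le> dy (int A + n) * exp (l - of_int n * ln 2)"
    using x tau_gt[of n] hgt_pnt[OF ab(1)] by (intro mult_mono) (auto simp: n_def)
  also have "\<dots> = exp (real A * ln 2 + l)" by (simp add: dy_exp exp_add[symmetric] algebra_simps)
  finally have "ln (1 + \<bar>H.xc a - H.xc b\<bar> * exp (- hgt (fst (pnt a)))) \<le> ln 2 + (real A * ln 2 + l)"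
    using l by (intro ln_bound) auto
  then show ?thesis unfolding rho_pnt using d by (simp add: algebra_simps)
qed

lemma near_of_rho:
  assumes ab: "fst a \<in> MV" "fst b \<in> MV" and S: "rho (pnt a) (pnt b) \<le> S" and A: "(2 * S + l) / ln 2 + 2 \<le> real A"
  shows "H.near A a b"
proof -
  define n m where "n = fst (fst a)" and "m = fst (fst b)"
  define w w' where "w = snd (fst a)" and "w' = snd (fst b)"
  have w: "w \<in> T_words p" "w' \<in> T_words p" "lvl w = tau n" "lvl w' = tau m"
    using ab by (auto simp: MV_def w_def w'_def n_def m_def)
  have l2: "0 < ln (2::real)" by simp
  have A2: "2 * S + l + 2 * ln 2 \<le> real A * ln 2" using A l2 by (simp add: field_simps)
  define r where "r = \<bar>H.xc a - H.xc b\<bar> * exp (- hgt (fst (pnt a)))"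
  have r: "0 \<le> r" by (simp add: r_def)
  have rho: "real (dw w w') * l + ln (1 + r) \<le> S" using S unfolding rho_pnt r_def w_def w'_def .
  have d: "real (dw w w') * l \<le> S" "0 \<le> S" "ln (1 + r) \<le> S" using rho r l by (smt (verit) ln_ge_zero mult_nonneg_nonneg of_nat_0_le_iff)+
  obtain i j where ij: "(pw ^^ i) w = (pw ^^ j) w'" "i + j = dw w w'" using meet_exists[OF w(1,2)] by blast
  have lev: "tau n - int i = tau m - int j" using pw_pow(2)[OF w(1), of i] pw_pow(2)[OF w(2), of j] ij(1) w(3,4) by simp
  have iS: "real i * l \<le> S" "real j * l \<le> S" "\<bar>of_int (tau n) * l - of_int (tau m) * l\<bar> \<le> S"
  proof -
    have "real i * l + real j * l \<le> S" using d(1) by (simp add: ij(2)[symmetric] distrib_right)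
    moreover have "of_int (tau n) * l - of_int (tau m) * l = real i * l - real j * l"
    proof -
      have "of_int (tau n - tau m) = real i - real j" using lev by simp
      then show ?thesis by (simp add: left_diff_distrib[symmetric])
    qed
    moreover have "0 \<le> real i * l" "0 \<le> real j * l" using l by auto
    ultimately show "real i * l \<le> S" "real j * l \<le> S" "\<bar>of_int (tau n) * l - of_int (tau m) * l\<bar> \<le> S" by linarith+
  qed
  have nm: "\<bar>of_int n * ln 2 - of_int m * ln 2\<bar> \<le> S + l"
    using iS(3) tau_le[of n] tau_le[of m] tau_gt[of n] tau_gt[of m] by linarith
  define i1 where "i1 = \<lceil>S / ln 2\<rceil>"
  have i1: "S \<le> of_int i1 * ln 2" "of_int i1 * ln 2 \<le> S + ln 2" "0 \<le> i1"
  proof -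
    have "S / ln 2 \<le> of_int i1" "of_int i1 \<le> S / ln 2 + 1" unfolding i1_def by linarith+
    then show "S \<le> of_int i1 * ln 2" "of_int i1 * ln 2 \<le> S + ln 2" using l2 by (simp_all add: field_simps)
    have "0 \<le> S / ln 2" using d(2) by simp
    then show "0 \<le> i1" unfolding i1_def by linarith
  qed
  \<comment> \<open>The height covered by \<open>i1\<close> model levels is at least
    \<open>S\<close>, which puts level \<open>k\<close> at or below the meet of \<open>w\<close> and
    \<open>w'\<close>; the descents of both points to \<open>k\<close> are the ancestors that
    \<open>near\<close> asks for.\<close>
  define k where "k = min n m - i1"
  have kn: "k \<le> n" "k \<le> m" "n - k \<le> int A" "m - k \<le> int A"
  proof -
    show "k \<le> n" "k \<le> m" using i1 by (auto simp: k_def)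
    have "of_int k * ln (2::real) = of_int n * ln 2 - of_int i1 * ln 2 \<or> of_int k * ln (2::real) = of_int m * ln 2 - of_int i1 * ln 2"
      by (simp add: k_def min_def left_diff_distrib)
    then have "of_int (n - k) * ln 2 \<le> real A * ln 2" "of_int (m - k) * ln 2 \<le> real A * ln 2"
      using nm i1(2) A2 d(2) l l2 unfolding of_int_diff left_diff_distrib by linarith+
    from this[THEN mult_right_le_imp_le[OF _ l2]] show "n - k \<le> int A" "m - k \<le> int A" by linarith+
  qed
  have tk: "tau k \<le> tau n - int i"
  proof -
    have "of_int (tau k) * l \<le> of_int k * ln 2" by (rule tau_le)
    also have "\<dots> \<le> of_int n * ln 2 - S"
    proof -
      have "of_int k * ln 2 \<le> of_int (n - i1) * ln (2::real)" using l2 by (intro mult_right_mono) (auto simp: k_def)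
      then show ?thesis using i1(1) by (simp add: left_diff_distrib)
    qed
    finally have "of_int (tau k + int i) * l \<le> of_int n * ln 2" using iS(1) by (simp add: distrib_right)
    then show ?thesis using le_tau[of "tau k + int i" n] by simp
  qed
  show ?thesis
  proof (rule H.nearI)
    show "nat (n - k) \<le> A" "nat (m - k) \<le> A" using kn by auto
    define t where "t = nat (tau n - int i - tau k)"
    have t: "nat (tau n - tau k) = t + i" "nat (tau m - tau k) = t + j" using tk lev by (auto simp: t_def)
    have "(pw ^^ (t + i)) w = (pw ^^ (t + j)) w'" using ij(1) by (simp add: funpow_add)
    then show "(mpar ^^ nat (n - k)) (fst a) = (mpar ^^ nat (m - k)) (fst b)"
      using kn t by (simp add: mpar_pow n_def m_def w_def w'_def)
    have "1 + r \<le> exp S" using d(3) r by (metis add_pos_nonneg exp_le_cancel_iff exp_ln zero_less_one)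
    then have "r \<le> exp S" by simp
    have "\<bar>H.xc a - H.xc b\<bar> = r * exp (of_int (tau n) * l)" using hgt_pnt[OF ab(1)] by (simp add: r_def n_def exp_minus)
    also have "\<dots> \<le> exp S * exp (of_int n * ln 2)" using \<open>r \<le> exp S\<close> r tau_le[of n] by (intro mult_mono) auto
    finally have x: "\<bar>H.xc a - H.xc b\<bar> \<le> exp (S + of_int n * ln 2)" by (simp add: exp_add)
    have "S + of_int n * ln 2 \<le> of_int (int A + n) * ln (2::real)" unfolding of_int_add distrib_right of_int_of_nat_eq using A2 l d(2) l2 by linarith
    then show "\<bar>H.xc a - H.xc b\<bar> \<le> dy (int A + fst (fst a))"
      using x unfolding dy_exp n_def[symmetric] by (meson exp_le_cancel_iff order_trans)
    have "S + of_int n * ln 2 \<le> of_int (int A + m) * ln 2" unfolding of_int_add distrib_right of_int_of_nat_eq using A2 nm l l2 d(2) by linarith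
    then show "\<bar>H.xc a - H.xc b\<bar> \<le> dy (int A + fst (fst b))"
      using x unfolding dy_exp m_def[symmetric] by (meson exp_le_cancel_iff order_trans)
  qed
qed

definition rlev :: "point \<times> real \<Rightarrow> int" where "rlev u = \<lfloor>of_int (lvl (fst (fst u))) * l / ln 2\<rfloor>"

definition rep :: "point \<times> real \<Rightarrow> (int \<times> nat list) \<times> int" where
  "rep u = ((rlev u, (pw ^^ nat (lvl (fst (fst u)) - tau (rlev u))) (fst (fst u))), \<lfloor>snd u / dy (rlev u)\<rfloor>)"

lemma rlev: "of_int (rlev u) * ln 2 \<le> of_int (lvl (fst (fst u))) * l" "of_int (lvl (fst (fst u))) * l \<le> of_int (rlev u) * ln 2 + ln 2"
  "tau (rlev u) \<le> lvl (fst (fst u))"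
proof -
  have l2: "0 < ln (2::real)" by simp
  have "of_int (rlev u) \<le> of_int (lvl (fst (fst u))) * l / ln 2" "of_int (lvl (fst (fst u))) * l / ln 2 \<le> of_int (rlev u) + 1"
    unfolding rlev_def by linarith+
  then show 1: "of_int (rlev u) * ln 2 \<le> of_int (lvl (fst (fst u))) * l" and "of_int (lvl (fst (fst u))) * l \<le> of_int (rlev u) * ln 2 + ln 2"
    using l2 by (simp_all add: field_simps)
  have "of_int (tau (rlev u)) * l \<le> of_int (lvl (fst (fst u))) * l" using 1 tau_le[of "rlev u"] by linarith
  then show "tau (rlev u) \<le> lvl (fst (fst u))" using l by simp
qed

lemma rep_in: "fst u \<in> TT \<Longrightarrow> fst (rep u) \<in> MV"
  using pw_pow[OF word_in, of u] rlev(3)[of u] by (simp add: rep_def MV_def)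

definition DR :: real where "DR = 3 * l + 2 * ln 2"

lemma rho_rep: assumes u: "fst u \<in> TT" shows "rho u (pnt (rep u)) \<le> DR"
proof -
  define w s n where "w = fst (fst u)" and "s = snd (fst u)" and "n = rlev u"
  have fu: "fst u = (w,s)" by (simp add: w_def s_def)
  have w: "w \<in> T_words p" "s < l" "(w,s) \<in> TT" using u by (auto simp: w_def s_def TT tree_points_def)
  have n: "of_int n * ln 2 \<le> of_int (lvl w) * l" "of_int (lvl w) * l \<le> of_int n * ln 2 + ln 2" "tau n \<le> lvl w"
    using rlev[of u] by (auto simp: n_def w_def)
  define v where "v = (pw ^^ nat (lvl w - tau n)) w"
  have "td (w,s) (v,0) \<le> td (w,s) (w,0) + td (w,0) (v,0)" by (rule tree_dist_triangle[OF l])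
  also have "td (w,s) (w,0) \<le> l" using td_down[OF w(3)] w(2) by simp
  also have "td (w,0) (v,0) \<le> real (nat (lvl w - tau n)) * l"
    using dw_pw_pow[OF w(1)] l unfolding v_def by (simp add: tree_dist_dw)
  also have "real (nat (lvl w - tau n)) * l = of_int (lvl w) * l - of_int (tau n) * l"
    using n(3) by (simp add: left_diff_distrib)
  finally have d: "td (w,s) (v,0) \<le> 2 * l + ln 2" using n(2) tau_gt[of n] by linarith
  have h: "of_int (lvl w) * l - l \<le> hgt (w,s)"
    using height_lipschitz[OF w(3) vertex_in[OF w(1)]] td_down[OF w(3)] w(2) height_vertex[OF w(1)] by linarith
  define k where "k = \<lfloor>snd u / dy n\<rfloor>"
  have "of_int k \<le> snd u / dy n" "snd u / dy n \<le> of_int k + 1" unfolding k_def by linarith+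
  then have "of_int k * dy n \<le> snd u" "snd u \<le> of_int k * dy n + dy n" using dy_pos[of n] by (simp_all add: field_simps)
  then have xb: "\<bar>snd u - of_int \<lfloor>snd u / dy n\<rfloor> * dy n\<bar> \<le> dy n"
    using dy_pos[of n] unfolding k_def[symmetric] by linarith
  have xe: "\<bar>snd u - of_int \<lfloor>snd u / dy n\<rfloor> * dy n\<bar> * exp (- hgt (w,s)) \<le> exp (of_int (lvl w) * l) * exp (l - of_int (lvl w) * l)"
  proof (rule mult_mono)
    show "exp (- hgt (w,s)) \<le> exp (l - of_int (lvl w) * l)" using h by simp
    have "dy n \<le> exp (of_int (lvl w) * l)" using n(1) by (simp add: dy_exp)
    then show "\<bar>snd u - of_int \<lfloor>snd u / dy n\<rfloor> * dy n\<bar> \<le> exp (of_int (lvl w) * l)"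
      using xb by linarith
  qed simp_all
  also have "\<dots> = exp l" by (simp add: exp_diff)
  finally have "ln (1 + \<bar>snd u - of_int \<lfloor>snd u / dy n\<rfloor> * dy n\<bar> * exp (- hgt (w,s))) \<le> ln 2 + l"
    using l by (intro ln_bound) auto
  moreover have "rho u (pnt (rep u)) = td (w,s) (v,0) + ln (1 + \<bar>snd u - of_int \<lfloor>snd u / dy n\<rfloor> * dy n\<bar> * exp (- hgt (w,s)))"
    by (simp add: rho_def fu pnt_def rep_def n_def[symmetric] v_def)
  ultimately show ?thesis using d by (simp add: DR_def)
qed

lemma rho_rep_bounds:
  assumes u: "fst u \<in> TT" and v: "fst v \<in> TT"
  shows "rho u v \<le> 2 * rho (pnt (rep u)) (pnt (rep v)) + 4 * DR" "rho (pnt (rep u)) (pnt (rep v)) \<le> 2 * rho u v + 5 * DR"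
proof -
  note i = pnt_in[OF rep_in[OF u]] pnt_in[OF rep_in[OF v]]
  have b: "rho u (pnt (rep u)) \<le> DR" "rho v (pnt (rep v)) \<le> DR" "rho (pnt (rep u)) u \<le> 2 * DR" "rho (pnt (rep v)) v \<le> 2 * DR"
    using rho_rep[OF u] rho_rep[OF v] rho_commute_le[OF u i(1)] rho_commute_le[OF v i(2)] by linarith+
  show "rho u v \<le> 2 * rho (pnt (rep u)) (pnt (rep v)) + 4 * DR"
    using rho_triangle[OF u i(1), of v] rho_triangle[OF i, of v] b by linarith
  show "rho (pnt (rep u)) (pnt (rep v)) \<le> 2 * rho u v + 5 * DR"
    using rho_triangle[OF i(1) u, of "pnt (rep v)"] rho_triangle[OF u v, of "pnt (rep v)"] b by linarith
qed

definition mline :: "(int \<Rightarrow> nat) \<Rightarrow> int \<Rightarrow> int \<times> nat list" where "mline a n = (n, dec (tau n) a)"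

lemma mline: assumes "address a" shows "H.isline (mline a)" "range (mline a) \<subseteq> MV"
proof -
  have "mpar (mline a (n + 1)) = mline a n" for n
    using tau_mono[of n "n+1"] by (simp add: mline_def mpar_def dec_pow[OF assms])
  then show "H.isline (mline a)" unfolding H.isline_def by (simp add: mline_def)
  show "range (mline a) \<subseteq> MV" using dec[OF assms] by (auto simp: mline_def MV_def)
qed

text \<open>Among any \<open>BB + 1\<close> consecutive model steps at least one enters a new tree
  level, and only there can lines branch.\<close>

definition BB :: nat where "BB = nat \<lceil>l / ln 2\<rceil>"

lemma tau_increase: "\<exists>n'\<ge>n. n' \<le> n + int BB \<and> tau n' < tau (n' + 1)"
proof (rule ccontr)
  assume a: "\<not> ?thesis"
  have c: "tau (n + int k) = tau n" if "k \<le> BB" for k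
    using that
  proof (induction k)
    case (Suc k)
    then have "n \<le> n + int k" "n + int k \<le> n + int BB" by auto
    then have "\<not> tau (n + int k) < tau (n + int k + 1)" using a by blast
    moreover have "tau (n + int k) \<le> tau (n + int k + 1)" by (rule tau_mono) simp
    ultimately have "tau (n + int (Suc k)) = tau (n + int k)" by (simp add: algebra_simps)
    then show ?case using Suc by simp
  qed simp
  have "l / ln 2 \<le> real BB" unfolding BB_def by linarith
  then have "l \<le> real BB * ln 2" by (simp add: field_simps)
  then have "of_int (tau n + 1) * l \<le> of_int (n + int BB) * ln 2" using tau_le[of n] by (simp add: distrib_right)
  then have "tau n + 1 \<le> tau (n + int BB)" by (rule le_tau)
  then show False using c[of BB] by simp
qed

lemma mline_branching:
  assumes li: "H.isline li" "range li \<subseteq> MV"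
  shows "\<exists>n'\<ge>n. n' \<le> n + int BB \<and> (\<exists>l'. (H.isline l' \<and> range l' \<subseteq> MV) \<and> l' n' = li n' \<and> l' (n'+1) \<noteq> li (n'+1))"
proof -
  obtain k where k: "k \<ge> n" "k \<le> n + int BB" "tau k < tau (k + 1)" using tau_increase by blast
  define w where "w = snd (li (k+1))"
  have fst_li: "fst (li (k+1)) = k + 1" using H.isline_lev[OF li(1)] .
  have "li (k+1) \<in> MV" using li(2) by blast
  then have w: "w \<in> T_words p" "lvl w = tau (k+1)" using fst_li by (auto simp: w_def MV_def)
  define a where "a = addr w"
  have a: "address a" unfolding a_def by (rule address_addr[OF w(1)])
  have li1: "li (k+1) = mline a (k+1)" using dec_addr[OF w(1)] fst_li w(2) by (simp add: mline_def a_def w_def prod_eq_iff)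
  have "li k = mpar (li (k+1))" "mline a k = mpar (mline a (k+1))" using li(1) mline(1)[OF a] by (simp_all add: H.isline_def)
  then have li0: "li k = mline a k" using li1 by simp
  \<comment> \<open>The digit at index \<open>tau k\<close> is invisible at model level
    \<open>k\<close> and visible at \<open>k + 1\<close>, so changing it makes the lines part
    exactly there.\<close>
  define b where "b = a(tau k := (if a (tau k) = 0 then 1 else 0))"
  have b: "address b"
  proof -
    obtain j0 where "\<And>j. j < j0 \<Longrightarrow> a j = 0" using a by (auto simp: address_def)
    then have "b j = 0" if "j < min j0 (tau k)" for j using that by (simp add: b_def)
    moreover have "b j < p" for j using a p by (simp add: address_def b_def)
    ultimately show ?thesis unfolding address_def by blast
  qed
  have "mline b k = li k" unfolding li0 mline_def using dec_eq_iff[OF b a] by (simp add: b_def)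
  moreover have "mline b (k+1) \<noteq> li (k+1)" unfolding li1 mline_def using dec_eq_iff[OF b a, of "tau (k+1)"] k(3) by (auto simp: b_def)
  ultimately show ?thesis using k mline[OF b] by blast
qed

end

subsection \<open>Quasi-isometric embeddings induce tree maps\<close>

lemma linear_bound: "\<exists>K::nat. \<forall>A::nat. \<alpha> * real A + \<beta> \<le> real (K * A + K)"
proof (intro exI allI)
  fix A :: nat
  define K where "K = nat \<lceil>max \<alpha> \<beta>\<rceil>"
  have "max \<alpha> \<beta> \<le> real K" unfolding K_def by linarith
  then have "\<alpha> \<le> real K" "\<beta> \<le> real K" by auto
  moreover from this have "\<alpha> * real A \<le> real K * real A" by (intro mult_right_mono) auto
  ultimately show "\<alpha> * real A + \<beta> \<le> real (nat \<lceil>max \<alpha> \<beta>\<rceil> * A + nat \<lceil>max \<alpha> \<beta>\<rceil>)" unfolding K_def[symmetric] by simp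
qed

lemma linear_compose:
  assumes "S \<le> (a::real) * x + b" "0 \<le> c" shows "c * S + d \<le> c * a * x + (c * b + d)"
  using mult_left_mono[OF assms] by (simp add: algebra_simps)

text \<open>The word is written above level 0 of an address that is zero elsewhere. All these lines
  share their vertex at level 0, as \<open>branch_heights\<close> requires.\<close>

definition wadr :: "nat list \<Rightarrow> int \<Rightarrow> nat" where
  "wadr w j = (if 0 \<le> j \<and> nat j < length w then w ! nat j else 0)"

lemma (in tree_ray) address_wadr: "set w \<subseteq> {..<p} \<Longrightarrow> address (wadr w)"
  using p nth_mem[of _ w] by (auto simp: address_def wadr_def subset_iff intro!: exI[of _ 0])

context two_trees
begin

text \<open>\<open>rho\<close> between lattice points and the least index of \<open>near\<close>
  bound each other affinely, so the constants of the embedding merge into a single affine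
  bound.\<close>

lemma model_map:
  assumes "quasiisometric_embedding (HT_space p q) (HT_dist p q \<gamma>) (HT_space p' q') (HT_dist p' q' \<gamma>') f"
  shows "\<exists>g K. rigid X.mpar fst Y.mpar fst X.MV g K \<and> (\<forall>a. fst a \<in> X.MV \<longrightarrow> fst (g a) \<in> Y.MV)"
proof -
  obtain A B where A: "1 \<le> A" "0 \<le> B" and f: "\<And>u v. fst u \<in> X.TT \<Longrightarrow> fst v \<in> X.TT \<Longrightarrow> fst (f u) \<in> Y.TT \<and>
      Y.rho (f u) (f v) \<le> A * X.rho u v + B \<and> X.rho u v \<le> A * Y.rho (f u) (f v) + B"
    using rho_of_quasiisometric_embedding[OF assms] by blast
  define g where "g a = Y.rep (f (X.pnt a))" for a
  have l2: "0 < ln (2::real)" by simp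
  have fin: "fst (f (X.pnt a)) \<in> Y.TT" if "fst a \<in> X.MV" for a using f[OF X.pnt_in X.pnt_in, OF that that] by blast
  have gin: "fst (g a) \<in> Y.MV" if "fst a \<in> X.MV" for a unfolding g_def by (rule Y.rep_in[OF fin[OF that]])
  have up: "Y.rho (Y.pnt (g a)) (Y.pnt (g b)) \<le> 2 * A * X.rho (X.pnt a) (X.pnt b) + (2 * B + 5 * Y.DR)"
    if ab: "fst a \<in> X.MV" "fst b \<in> X.MV" for a b
    using f[OF X.pnt_in[OF ab(1)] X.pnt_in[OF ab(2)]] Y.rho_rep_bounds(2)[OF fin[OF ab(1)] fin[OF ab(2)]] by (simp add: g_def)
  have lo: "X.rho (X.pnt a) (X.pnt b) \<le> 2 * A * Y.rho (Y.pnt (g a)) (Y.pnt (g b)) + (4 * A * Y.DR + B)"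
    if ab: "fst a \<in> X.MV" "fst b \<in> X.MV" for a b
  proof -
    have "A * Y.rho (f (X.pnt a)) (f (X.pnt b)) \<le> A * (2 * Y.rho (Y.pnt (g a)) (Y.pnt (g b)) + 4 * Y.DR)"
      using Y.rho_rep_bounds(1)[OF fin[OF ab(1)] fin[OF ab(2)]] A by (intro mult_left_mono) (auto simp: g_def)
    then show ?thesis using f[OF X.pnt_in[OF ab(1)] X.pnt_in[OF ab(2)]] by (simp add: distrib_left)
  qed
  have c: "0 \<le> 2 / ln (2::real)" using l2 by simp
  have near: "(2 * S + L) / ln 2 + 2 = 2 / ln 2 * S + (L / ln 2 + 2)" for S L :: real by (simp add: add_divide_distrib)
  define a1 b1 where "a1 = 2 / ln 2 * (2 * A * (3 * ln 2))"
    and "b1 = 2 / ln 2 * (2 * A * (3 * X.l + ln 2) + (2 * B + 5 * Y.DR)) + (Y.l / ln 2 + 2)"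
  define a2 b2 where "a2 = 2 / ln 2 * (2 * A * (3 * ln 2))"
    and "b2 = 2 / ln 2 * (2 * A * (3 * Y.l + ln 2) + (4 * A * Y.DR + B)) + (X.l / ln 2 + 2)"
  obtain K1 :: nat where K1: "\<And>x::nat. a1 * real x + b1 \<le> real (K1 * x + K1)" using linear_bound by blast
  obtain K2 :: nat where K2: "\<And>x::nat. a2 * real x + b2 \<le> real (K2 * x + K2)" using linear_bound by blast
  have Kle: "real (K1 * x + K1) \<le> real ((K1 + K2) * x + (K1 + K2))" "real (K2 * x + K2) \<le> real ((K1 + K2) * x + (K1 + K2))" for x
    by (simp_all add: algebra_simps)
  have A0: "0 \<le> 2 * A" using A by simp
  have "rigid X.mpar fst Y.mpar fst X.MV g (K1 + K2)"
  proof unfold_locales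
    fix a b :: "(int \<times> nat list) \<times> int" and x :: nat
    assume ab: "fst a \<in> X.MV" "fst b \<in> X.MV"
    show "Y.H.near ((K1 + K2) * x + (K1 + K2)) (g a) (g b)" if n: "X.H.near x a b"
    proof (rule Y.near_of_rho[OF gin[OF ab(1)] gin[OF ab(2)] order_refl])
      have "Y.rho (Y.pnt (g a)) (Y.pnt (g b)) \<le> 2 * A * (3 * ln 2) * real x + (2 * A * (3 * X.l + ln 2) + (2 * B + 5 * Y.DR))"
        using linear_compose[OF X.rho_of_near[OF ab n] A0, of "2 * B + 5 * Y.DR"] up[OF ab] by linarith
      from linear_compose[OF this c, of "Y.l / ln 2 + 2"]
      show "(2 * Y.rho (Y.pnt (g a)) (Y.pnt (g b)) + Y.l) / ln 2 + 2 \<le> real ((K1 + K2) * x + (K1 + K2))"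
        unfolding near using K1[of x] Kle(1)[of x] unfolding a1_def b1_def by linarith
    qed
    show "X.H.near ((K1 + K2) * x + (K1 + K2)) a b" if n: "Y.H.near x (g a) (g b)"
    proof (rule X.near_of_rho[OF ab order_refl])
      have "X.rho (X.pnt a) (X.pnt b) \<le> 2 * A * (3 * ln 2) * real x + (2 * A * (3 * Y.l + ln 2) + (4 * A * Y.DR + B))"
        using linear_compose[OF Y.rho_of_near[OF gin[OF ab(1)] gin[OF ab(2)] n] A0, of "4 * A * Y.DR + B"] lo[OF ab] by linarith
      from linear_compose[OF this c, of "X.l / ln 2 + 2"]
      show "(2 * X.rho (X.pnt a) (X.pnt b) + X.l) / ln 2 + 2 \<le> real ((K1 + K2) * x + (K1 + K2))"
        unfolding near using K2[of x] Kle(2)[of x] unfolding a2_def b2_def by linarith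
    qed
  qed
  then show ?thesis using gin by blast
qed

section \<open>The map of words obtained from supports of degrees\<close>

context
  fixes g :: "(int \<times> nat list) \<times> int \<Rightarrow> (int \<times> nat list) \<times> int" and K :: nat
  assumes rigid: "rigid X.mpar fst Y.mpar fst X.MV g K" and gin: "\<And>a. fst a \<in> X.MV \<Longrightarrow> fst (g a) \<in> Y.MV"
begin

interpretation R: rigid X.mpar fst Y.mpar fst X.MV g K by (rule rigid)

interpretation R: rigid_branching X.mpar fst Y.mpar fst X.MV g K X.BB
proof unfold_locales
  fix li n assume "R.inl li"
  then show "\<exists>n'\<ge>n. n' \<le> n + int X.BB \<and> (\<exists>l'. R.inl l' \<and> l' n' = li n' \<and> l' (n'+1) \<noteq> li (n'+1))"
    unfolding R.inl_def using X.mline_branching[of li n] by blast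
qed

lemma inl_mline: "X.address a \<Longrightarrow> R.inl (X.mline a)"
  unfolding R.inl_def using X.mline by blast

text \<open>A vertex of nonzero degree has an image point in its branch, and the model vertices are
  closed under parents.\<close>

lemma LL_in: assumes li: "R.inl li" shows "R.LL li n \<in> Y.MV"
proof -
  have "R.LL li n \<in> R.supp li" using R.LL_range[OF li] by blast
  then obtain a where "Y.H.up (R.LL li n) (fst (R.phi li a))" using Y.H.deg_up unfolding R.supp_def by blast
  moreover have "fst (R.phi li a) \<in> Y.MV" unfolding R.phi_def by (rule gin[OF R.inl_V[OF li]])
  moreover obtain i where "(Y.mpar ^^ i) (fst (R.phi li a)) = R.LL li n" using calculation(1) unfolding Y.H.up_def by blast
  ultimately show ?thesis using Y.MV_pow[of "fst (R.phi li a)" i] by simp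
qed

lemma LL_fst: "R.inl li \<Longrightarrow> fst (R.LL li n) = n"
  using Y.H.isline_lev[OF R.LL_line] by blast

lemma LL_word: assumes li: "R.inl li" shows "snd (R.LL li n) \<in> T_words p'" "Y.lvl (snd (R.LL li n)) = Y.tau n"
  using LL_in[OF li, of n] LL_fst[OF li, of n] by (auto simp: Y.MV_def)

lemma LL_addr:
  assumes li: "R.inl li" and J: "J < Y.tau n" "J < Y.tau m"
  shows "Y.addr (snd (R.LL li n)) J = Y.addr (snd (R.LL li m)) J"
proof -
  have le: "Y.addr (snd (R.LL li n)) J = Y.addr (snd (R.LL li m)) J" if nm: "n \<le> m" "J < Y.tau n" for n m
  proof -
    have "R.LL li n = (Y.mpar ^^ nat (m - n)) (R.LL li m)" using Y.H.isline_anc[OF R.LL_line[OF li], of "nat (m - n)" m] nm by simp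
    then have e: "snd (R.LL li n) = (Y.pw ^^ nat (Y.tau m - Y.tau n)) (snd (R.LL li m))"
      using LL_fst[OF li] nm by (simp add: Y.mpar_pow)
    show ?thesis unfolding e
      by (rule Y.addr_pow[OF LL_word(1)[OF li]]) (use LL_word(2)[OF li, of m] nm Y.tau_mono[OF nm(1)] in simp)
  qed
  show ?thesis
  proof (cases "n \<le> m")
    case True
    from le[OF this J(1)] show ?thesis .
  next
    case False
    then have "m \<le> n" by simp
    from le[OF this J(2)] show ?thesis by (rule sym)
  qed
qed

text \<open>A model level at which digit \<open>J\<close> is already visible; by
  \<open>LL_addr\<close> every other such level shows the same digit.\<close>

definition tlev :: "int \<Rightarrow> int" where "tlev J = \<lceil>of_int (J + 1) * Y.l / ln 2\<rceil>"

lemma tlev: "J < Y.tau (tlev J)"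
proof -
  have "of_int (J + 1) * Y.l / ln 2 \<le> of_int (tlev J)" unfolding tlev_def by linarith
  then have "of_int (J + 1) * Y.l \<le> of_int (tlev J) * ln 2" by (simp add: field_simps)
  then show ?thesis using Y.le_tau[of "J + 1" "tlev J"] by simp
qed

definition edig :: "nat list \<Rightarrow> int \<Rightarrow> nat" where
  "edig w J = Y.addr (snd (R.LL (X.mline (wadr w)) (tlev J))) J"

lemma LL_eq_iff:
  assumes "set w \<subseteq> {..<p}" "set w' \<subseteq> {..<p}"
  shows "R.LL (X.mline (wadr w)) n = R.LL (X.mline (wadr w')) n \<longleftrightarrow> (\<forall>J<Y.tau n. edig w J = edig w' J)"
proof -
  note li = inl_mline[OF X.address_wadr[OF assms(1)]] inl_mline[OF X.address_wadr[OF assms(2)]]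
  have d: "edig w J = Y.addr (snd (R.LL (X.mline (wadr w)) n)) J" "edig w' J = Y.addr (snd (R.LL (X.mline (wadr w')) n)) J" if "J < Y.tau n" for J
    unfolding edig_def by (rule LL_addr[OF li(1) tlev that], rule LL_addr[OF li(2) tlev that])
  show ?thesis
  proof
    assume "R.LL (X.mline (wadr w)) n = R.LL (X.mline (wadr w')) n"
    then show "\<forall>J<Y.tau n. edig w J = edig w' J" using d by simp
  next
    assume "\<forall>J<Y.tau n. edig w J = edig w' J"
    then have "snd (R.LL (X.mline (wadr w)) n) = snd (R.LL (X.mline (wadr w')) n)"
      using d LL_word[OF li(1), of n] LL_word[OF li(2), of n] by (intro Y.addr_inject) auto
    then show "R.LL (X.mline (wadr w)) n = R.LL (X.mline (wadr w')) n"
      using LL_fst[OF li(1), of n] LL_fst[OF li(2), of n] by (simp add: prod_eq_iff)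
  qed
qed

text \<open>Words become lines, lines become support lines, and the addresses of the latter are read
  as digits. Agreement up to a level is carried in both directions by \<open>branch_heights\<close>;
  what remains is conversion between edge lengths and \<open>ln 2\<close>.\<close>

lemma tree_map_exists: "\<exists>F c. tree_map p X.l p' Y.l F c"
proof -
  obtain R :: nat where R: "\<And>l l' n. R.inl l \<Longrightarrow> R.inl l' \<Longrightarrow> l 0 = l' 0 \<Longrightarrow> 0 \<le> n \<Longrightarrow>
      (l n = l' n \<longrightarrow> R.LL l (n + R.hh l 0 - int R) = R.LL l' (n + R.hh l 0 - int R)) \<and>
      (R.LL l (n + R.hh l 0 + int R) = R.LL l' (n + R.hh l 0 + int R) \<longrightarrow> l n = l' n)"
    using R.branch_heights by blast
  let ?li = "\<lambda>w. X.mline (wadr w)"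
  have l2: "0 < ln (2::real)" by simp
  have inl: "R.inl (?li w)" if "set w \<subseteq> {..<p}" for w by (rule inl_mline[OF X.address_wadr[OF that]])
  have li_eq: "?li w n = ?li w' n \<longleftrightarrow> (\<forall>j<X.tau n. wadr w j = wadr w' j)" if "set w \<subseteq> {..<p}" "set w' \<subseteq> {..<p}" for w w' n
    by (simp add: X.mline_def X.dec_eq_iff[OF X.address_wadr[OF that(1)] X.address_wadr[OF that(2)]])
  have li0: "?li w 0 = ?li w' 0" if "set w \<subseteq> {..<p}" "set w' \<subseteq> {..<p}" for w w'
    unfolding li_eq[OF that] by (simp add: wadr_def)
  define h where "h = R.hh (?li []) 0"
  have h: "R.hh (?li w) 0 = h" if "set w \<subseteq> {..<p}" for w
    using li0[OF that, of "[]"] by (simp add: h_def R.hh_def R.phi_def X.H.emb_def)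
  \<comment> \<open>All the lines agree at level 0, so their support lines agree up to model level
    \<open>h - R\<close>. Digits below \<open>b\<close> are the same for every word, and
    \<open>F\<close> starts reading at \<open>b\<close>.\<close>
  define b where "b = Y.tau (h - int R)"
  have down: "edig w J = edig w' J"
    if w: "set w \<subseteq> {..<p}" "set w' \<subseteq> {..<p}" and n: "0 \<le> n" "\<And>j. j < X.tau n \<Longrightarrow> wadr w j = wadr w' j"
      and J: "J < Y.tau (n + h - int R)" for w w' n J
  proof -
    have "?li w n = ?li w' n" using li_eq[OF w] n(2) by blast
    then have "R.LL (?li w) (n + h - int R) = R.LL (?li w') (n + h - int R)"
      using R[OF inl[OF w(1)] inl[OF w(2)] li0[OF w] n(1)] h[OF w(1)] by simp
    then show ?thesis using LL_eq_iff[OF w] J by blast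
  qed
  have reflect: "wadr w j = wadr w' j"
    if w: "set w \<subseteq> {..<p}" "set w' \<subseteq> {..<p}" and n: "0 \<le> n" "\<And>J. J < Y.tau (n + h + int R) \<Longrightarrow> edig w J = edig w' J"
      and j: "j < X.tau n" for w w' n j
  proof -
    have "R.LL (?li w) (n + h + int R) = R.LL (?li w') (n + h + int R)" using LL_eq_iff[OF w] n(2) by blast
    then have "?li w n = ?li w' n" using R[OF inl[OF w(1)] inl[OF w(2)] li0[OF w] n(1)] h[OF w(1)] by simp
    then show ?thesis using li_eq[OF w] j by blast
  qed
  \<comment> \<open>\<open>2*R\<close> model levels for the two-sided error of
    \<open>branch_heights\<close>, one level of rounding, and one edge of each tree.\<close>
  define c where "c = (2 * real R + 1) * ln 2 + X.l + Y.l"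
  have c0: "0 \<le> c" using l2 X.l Y.l by (simp add: c_def)
  have c1: "ln 2 + Y.l \<le> c" "2 * (real R * ln 2) + ln 2 + Y.l \<le> c"
    using l2 X.l Y.l mult_nonneg_nonneg[of "real R" "ln 2"] by (simp_all add: c_def algebra_simps)
  define F where "F w j = edig w (b + int j)" for w j
  have "tree_map p X.l p' Y.l F c"
    unfolding tree_map_def
  proof (intro conjI allI impI)
    show "0 \<le> c" by (rule c0)
    show "F w m < p'" if "set w \<subseteq> {..<p}" for w m
      unfolding F_def edig_def by (rule Y.addr_less[OF LL_word(1)[OF inl[OF that]]])
    show "F (w @ [d]) j = F w j"
      if wd: "set (w @ [d]) \<subseteq> {..<p}" and m: "real m * Y.l \<le> real (length w) * X.l - c" and j: "j < m" for w d m j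
      unfolding F_def
    proof (rule down[OF wd])
      show "set w \<subseteq> {..<p}" using wd by simp
      define n where "n = \<lfloor>real (length w) * X.l / ln 2\<rfloor>"
      have n: "of_int n * ln 2 \<le> real (length w) * X.l" "real (length w) * X.l \<le> of_int n * ln 2 + ln 2"
      proof -
        have "of_int n \<le> real (length w) * X.l / ln 2" "real (length w) * X.l / ln 2 \<le> of_int n + 1" unfolding n_def by linarith+
        then show "of_int n * ln 2 \<le> real (length w) * X.l" "real (length w) * X.l \<le> of_int n * ln 2 + ln 2"
          using l2 by (simp_all add: field_simps)
      qed
      show "0 \<le> \<lfloor>real (length w) * X.l / ln 2\<rfloor>" using X.l by simp
      have "of_int (X.tau n) * X.l \<le> of_int (int (length w)) * X.l" using X.tau_le[of n] n(1) by simp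
      then have "X.tau n \<le> int (length w)" using X.l by simp
      then show "wadr (w @ [d]) i = wadr w i" if "i < X.tau \<lfloor>real (length w) * X.l / ln 2\<rfloor>" for i
        using that unfolding n_def[symmetric] by (auto simp: wadr_def nth_append)
      have "of_int (b + int m) * Y.l = of_int b * Y.l + real m * Y.l" by (simp add: distrib_right)
      also have "\<dots> \<le> of_int (h - int R) * ln 2 + real m * Y.l" using Y.tau_le[of "h - int R"] by (simp add: b_def)
      also have "\<dots> \<le> of_int (h - int R) * ln 2 + of_int n * ln 2" using m n(2) c1(1) Y.l by linarith
      also have "\<dots> = of_int (n + h - int R) * ln 2" by (simp add: algebra_simps)
      finally have "b + int m \<le> Y.tau (n + h - int R)" by (rule Y.le_tau)
      then show "b + int j < Y.tau (\<lfloor>real (length w) * X.l / ln 2\<rfloor> + h - int R)" using j unfolding n_def[symmetric] by simp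
    qed
    show "take n w = take n w'"
      if w: "set w \<subseteq> {..<p}" "set w' \<subseteq> {..<p}" "length w = length w'" and ag: "\<forall>j<m. F w j = F w' j"
        and n: "real n * X.l \<le> real m * Y.l - c" "real n * X.l \<le> real (length w) * X.l - c" for w w' m n
    proof -
      have "real n * X.l \<le> real (length w) * X.l" using n(2) c0 by linarith
      then have nw: "n \<le> length w" using X.l by simp
      define k where "k = \<lceil>real n * X.l / ln 2\<rceil>"
      have k: "real n * X.l \<le> of_int k * ln 2" "of_int k * ln 2 \<le> real n * X.l + ln 2"
      proof -
        have "real n * X.l / ln 2 \<le> of_int k" "of_int k \<le> real n * X.l / ln 2 + 1" unfolding k_def by linarith+
        then show "real n * X.l \<le> of_int k * ln 2" "of_int k * ln 2 \<le> real n * X.l + ln 2"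
          using l2 by (simp_all add: field_simps)
      qed
      have "0 \<le> real n * X.l / ln 2" using X.l by simp
      then have k0: "0 \<le> k" unfolding k_def by linarith
      have nk: "int n \<le> X.tau k" using X.le_tau[of "int n" k] k(1) by simp
      have "of_int (Y.tau (k + h + int R)) * Y.l \<le> of_int (k + h + int R) * ln 2" by (rule Y.tau_le)
      also have "\<dots> = of_int k * ln 2 + 2 * (real R * ln 2) + of_int (h - int R) * ln 2" by (simp add: algebra_simps)
      also have "\<dots> \<le> real m * Y.l - Y.l + of_int (h - int R) * ln 2" using k(2) n(1) c1(2) by linarith
      also have "\<dots> \<le> real m * Y.l + of_int b * Y.l" using Y.tau_gt[of "h - int R"] by (simp add: b_def)
      also have "\<dots> = of_int (b + int m) * Y.l" by (simp add: distrib_right)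
      finally have top: "Y.tau (k + h + int R) \<le> b + int m" using Y.l by simp
      have ed: "edig w J = edig w' J" if J: "J < Y.tau (k + h + int R)" for J
      proof (cases "J < b")
        case True
        then show ?thesis using down[OF w(1,2), of 0 J] by (simp add: b_def wadr_def)
      next
        case False
        then have "F w (nat (J - b)) = F w' (nat (J - b))" using ag J top by auto
        then show ?thesis using False by (simp add: F_def)
      qed
      show ?thesis
      proof (rule nth_equalityI)
        show "length (take n w) = length (take n w')" using w(3) by simp
        fix i assume "i < length (take n w)"
        then have i: "i < n" "i < length w" "i < length w'" using w(3) by auto
        then have "wadr w (int i) = wadr w' (int i)" using nk by (intro reflect[OF w(1,2) k0 ed]) auto
        then show "take n w ! i = take n w' ! i" using i by (simp add: wadr_def)
      qed
    qed
  qed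
  then show ?thesis by blast
qed

end

lemma tree_map_of_treebolic:
  assumes "quasiisometric_embedding (HT_space p q) (HT_dist p q \<gamma>) (HT_space p' q') (HT_dist p' q' \<gamma>') f"
  shows "\<exists>F c. tree_map p (ln q) p' (ln q') F c"
proof -
  obtain g K where g: "rigid X.mpar fst Y.mpar fst X.MV g K" "\<And>a. fst a \<in> X.MV \<Longrightarrow> fst (g a) \<in> Y.MV"
    using model_map[OF assms] by blast
  from tree_map_exists[OF g] show ?thesis by (simp only: X.l_def Y.l_def)
qed

end

section \<open>The implications between the five conditions\<close>

theorem theorem1:
  fixes p p' :: nat and q q' :: real and \<gamma> \<gamma>' :: "real \<Rightarrow> point"
  assumes "p \<ge> 2" and "p' \<ge> 2" and "q > 1" and "q' > 1"
    and "geodesic_ray p q \<gamma>" and "geodesic_ray p' q' \<gamma>'"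
  shows
    "let A1 = (ln p / ln q < ln p' / ln q' \<or>
               (ln p / ln q = ln p' / ln q' \<and> powers_of_common_integer p p'));
         A2 = (\<exists>B. \<forall>n. \<bar>\<X> p q p' q' n\<bar> \<le> B);
         A3 = (\<exists>f. rough_isometric_embedding
                 (R_tree p q) (R_dist p q) (R_tree p' q') (R_dist p' q') f);
         A4 = (\<exists>f. bilipschitz_embedding
                 (cantor_set p) (cantor_dist q) (cantor_set p') (cantor_dist q') f);
         A5 = (\<exists>f. quasiisometric_embedding
                 (HT_space p q) (HT_dist p q \<gamma>) (HT_space p' q') (HT_dist p' q' \<gamma>') f)
     in (A1 \<longleftrightarrow> A2) \<and> (A2 \<longleftrightarrow> A3) \<and> (A3 \<longleftrightarrow> A4) \<and> (A4 \<longleftrightarrow> A5)"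
proof -
  interpret T: two_trees p q \<gamma> p' q' \<gamma>' by unfold_locales (use assms in auto)
  define A1 where "A1 \<longleftrightarrow> ln p / ln q < ln p' / ln q' \<or> (ln p / ln q = ln p' / ln q' \<and> powers_of_common_integer p p')"
  define A2 where "A2 \<longleftrightarrow> (\<exists>B. \<forall>n. \<bar>\<X> p q p' q' n\<bar> \<le> B)"
  define A3 where "A3 \<longleftrightarrow> (\<exists>f. rough_isometric_embedding (R_tree p q) (R_dist p q) (R_tree p' q') (R_dist p' q') f)"
  define A4 where "A4 \<longleftrightarrow> (\<exists>f. bilipschitz_embedding (cantor_set p) (cantor_dist q) (cantor_set p') (cantor_dist q') f)"
  define A5 where "A5 \<longleftrightarrow> (\<exists>f. quasiisometric_embedding
    (HT_space p q) (HT_dist p q \<gamma>) (HT_space p' q') (HT_dist p' q' \<gamma>') f)"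
  have q: "q > 1" "q' > 1" and p: "p \<ge> 2" "p' \<ge> 2" using assms by auto
  have 345: "A3 \<and> A4 \<and> A5" if a: A1
  proof -
    obtain N where N: "block_code p p' N (ln q) (ln q')"
      using block_code_exists[OF p q] a unfolding A1_def by blast
    interpret C: block_code p p' N "ln q" "ln q'" by (rule N)
    have "A3" unfolding A3_def using C.tree_embedding[OF refl refl] by blast
    moreover have "A4" unfolding A4_def using C.cantor_embedding[OF refl refl q] by blast
    moreover have "A5" unfolding A5_def using T.treebolic_embedding[of N] N by (auto simp: T.X.l_def T.Y.l_def)
    ultimately show ?thesis by blast
  qed
  have map: "\<exists>F c. tree_map p (ln q) p' (ln q') F c" if "A3 \<or> A4 \<or> A5"
    using that tree_map_of_tree[OF q p] tree_map_of_cantor[OF q p] T.tree_map_of_treebolic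
    unfolding A3_def A4_def A5_def by blast
  have 2: A2 if "\<exists>F c. tree_map p (ln q) p' (ln q') F c"
    using that X_bounded_of_tree_map[OF q p] unfolding A2_def by blast
  have 1: A1 if b: A2
  proof -
    obtain B where "\<And>n. \<bar>\<X> p q p' q' n\<bar> \<le> B" using b unfolding A2_def by blast
    then have "\<X> p q p' q' n \<le> B" for n by (meson abs_le_D1)
    then show ?thesis unfolding A1_def using commensurable_of_X_bounded[OF q p] by blast
  qed
  have "(A1 \<longleftrightarrow> A2) \<and> (A2 \<longleftrightarrow> A3) \<and> (A3 \<longleftrightarrow> A4) \<and> (A4 \<longleftrightarrow> A5)"
    using 345 map 2 1 by blast
  then show ?thesis unfolding Let_def A1_def A2_def A3_def A4_def A5_def .
qed

end
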